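(* Let $k\ge0$ and $\sigma\in[-1,1]$. There exists $\epsilon>0$ such that the following holds. Let $u_0\in\mathcal{X}^{k-1}\cap\mathcal{X}^{-1}\cap\mathcal{Y}^\sigma$ with $\operatorname{div}u_0=0$. If $\|u_0\|_{\mathcal{X}^{-1}}\le\epsilon$, then the incompressible Navier-Stokes equations on $\mathbb{R}^3$ $$u_t+u\cdot\nabla u+\nabla p-\Delta u=0,\qquad \operatorname{div}u=0,$$ with initial datum $u_0$ admit a unique solution $$u\in L^\infty([0,\infty);\mathcal{X}^{k-1}\cap\mathcal{X}^{-1}\cap\mathcal{Y}^\sigma)\cap L^1((0,\infty);\mathcal{X}^{k+1}\cap\mathcal{X}^1).$$ Furthermore, there is a constant $C_k$ independent of time such that $$\|u(t)\|_{\mathcal{X}^{k-1}}\le C_k(1+t)^{-1+\frac\sigma2-\frac k2}\qquad\text{for all }t>0.$$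
   Context: $u(t,x)\in\mathbb{R}^3$ is the velocity and $p$ the pressure (viscosity is set to $1$). $\widehat f$ is the Fourier transform in $x\in\mathbb{R}^3$. For $s\in\mathbb{R}$, the Lei-Lin space $\mathcal{X}^s$ and the space of pseudo-measures $\mathcal{Y}^s$ are $$\mathcal{X}^s=\Big\{f\in\mathcal{S}'(\mathbb{R}^3):\ \|f\|_{\mathcal{X}^s}:=\int_{\mathbb{R}^3}|\xi|^s|\widehat f(\xi)|\,d\xi<\infty\Big\},\qquad \mathcal{Y}^s=\Big\{f\in\mathcal{S}'(\mathbb{R}^3):\ \|f\|_{\mathcal{Y}^s}:=\sup_{\xi\in\mathbb{R}^3}|\xi|^s|\widehat f(\xi)|<\infty\Big\}.$$ For a Banach space $X$, $f\in L^\infty([0,\infty);X)$ means that $\sup_{0\le t<\infty}\|f(t)\|_X$ is finite. The constant $C_k$ may depend on norms of the initial data and on $k,\sigma$, but not on time. A solution is understood through the integral equation $$u(t)=e^{t\Delta}u_0-\int_0^te^{(t-\tau)\Delta}\mathbb{P}\operatorname{div}(u\otimes u)(\tau)\,d\tau,$$ where $\mathbb{P}$ is the Leray projection, with Fourier multiplier $m_{ij}(\xi)=\delta_{ij}-\xi_i\xi_j/|\xi|^2$. *)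

theory Defs
  imports "HOL-Analysis.Analysis" "HOL-Probability.Essential_Supremum"
begin

section \<open>Schwartz functions and tempered distributions on three-dimensional space\<close>

definition pderiv_dir :: "3 \<Rightarrow> (real^3 \<Rightarrow> complex) \<Rightarrow> (real^3 \<Rightarrow> complex)" where
  "pderiv_dir j \<phi> = (\<lambda>x. frechet_derivative \<phi> (at x) (axis j 1))"

text \<open>Multi-indices are replaced by finite lists of directions: the list
  \<open>[j1, ..., jn]\<close> stands for the iterated partial derivative along \<open>j1, ..., jn\<close>.\<close>

definition pderivs :: "3 list \<Rightarrow> (real^3 \<Rightarrow> complex) \<Rightarrow> (real^3 \<Rightarrow> complex)" where
  "pderivs js \<phi> = foldr pderiv_dir js \<phi>"

definition schwartz :: "(real^3 \<Rightarrow> complex) set" where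
  "schwartz = {\<phi>. (\<forall>js x. pderivs js \<phi> differentiable at x) \<and>
     (\<forall>js N. bdd_above (range (\<lambda>x. (1 + norm x) ^ N * norm (pderivs js \<phi> x))))}"

definition schwartz_seminorm :: "nat \<Rightarrow> (real^3 \<Rightarrow> complex) \<Rightarrow> real" where
  "schwartz_seminorm N \<phi> =
     (SUP (js, x) \<in> {js. length js \<le> N} \<times> UNIV. (1 + norm x) ^ N * norm (pderivs js \<phi> x))"

text \<open>A distribution is a functional on test functions; only its values on Schwartz functions
  matter, and two distributions are identified when they agree there.\<close>

type_synonym dist = "(real^3 \<Rightarrow> complex) \<Rightarrow> complex"
type_synonym vdist = "3 \<Rightarrow> dist"

definition tempered :: "dist \<Rightarrow> bool" where
  "tempered T \<longleftrightarrow>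
     (\<forall>\<phi>\<in>schwartz. \<forall>\<psi>\<in>schwartz. \<forall>a b. T (\<lambda>x. a * \<phi> x + b * \<psi> x) = a * T \<phi> + b * T \<psi>) \<and>
     (\<exists>C N. \<forall>\<phi>\<in>schwartz. norm (T \<phi>) \<le> C * schwartz_seminorm N \<phi>)"

definition dist_eq :: "vdist \<Rightarrow> vdist \<Rightarrow> bool" where
  "dist_eq f g \<longleftrightarrow> (\<forall>i. \<forall>\<phi>\<in>schwartz. f i \<phi> = g i \<phi>)"

definition vdist_diff :: "vdist \<Rightarrow> vdist \<Rightarrow> vdist" where
  "vdist_diff f g = (\<lambda>i \<phi>. f i \<phi> - g i \<phi>)"

text \<open>The distribution is that of an \<open>\<real>\<^sup>3\<close>-valued field.\<close>

definition real_field :: "vdist \<Rightarrow> bool" where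
  "real_field f \<longleftrightarrow> (\<forall>i. \<forall>\<phi>\<in>schwartz. f i (\<lambda>x. cnj (\<phi> x)) = cnj (f i \<phi>))"

text \<open>Integrability against the Gaussian already makes \<open>g\<close> locally integrable.\<close>

definition represents :: "(real^3 \<Rightarrow> complex) \<Rightarrow> dist \<Rightarrow> bool" where
  "represents g T \<longleftrightarrow> g \<in> borel_measurable borel \<and>
     (\<forall>\<phi>\<in>schwartz. integrable lborel (\<lambda>x. g x * \<phi> x) \<and> T \<phi> = (LINT x|lborel. g x * \<phi> x))"

text \<open>The function is determined up to null sets, and is only used in ways that do not depend
  on the representative.\<close>

definition dist_fun :: "dist \<Rightarrow> (real^3 \<Rightarrow> complex)" where
  "dist_fun T = (SOME g. represents g T)"

section \<open>Fourier transform\<close>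

definition fourier :: "(real^3 \<Rightarrow> complex) \<Rightarrow> (real^3 \<Rightarrow> complex)" where
  "fourier \<phi> = (\<lambda>\<xi>. LINT x|lborel. cis (- (x \<bullet> \<xi>)) * \<phi> x)"

definition inv_fourier :: "(real^3 \<Rightarrow> complex) \<Rightarrow> (real^3 \<Rightarrow> complex)" where
  "inv_fourier \<phi> = (\<lambda>x. complex_of_real (1 / (2 * pi) ^ 3) * (LINT \<xi>|lborel. cis (x \<bullet> \<xi>) * \<phi> \<xi>))"

definition fourier_dist :: "dist \<Rightarrow> dist" where
  "fourier_dist T = (\<lambda>\<phi>. T (fourier \<phi>))"

definition inv_fourier_dist :: "dist \<Rightarrow> dist" where
  "inv_fourier_dist T = (\<lambda>\<phi>. T (inv_fourier \<phi>))"

definition fourier_is_fun :: "dist \<Rightarrow> bool" where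
  "fourier_is_fun T \<longleftrightarrow> (\<exists>g. represents g (fourier_dist T))"

definition fhat :: "dist \<Rightarrow> (real^3 \<Rightarrow> complex)" where
  "fhat T = dist_fun (fourier_dist T)"

definition vfhat :: "vdist \<Rightarrow> real^3 \<Rightarrow> complex^3" where
  "vfhat f \<xi> = (\<chi> i. fhat (f i) \<xi>)"

section \<open>Lei-Lin spaces and pseudo-measures\<close>

definition X_norm :: "real \<Rightarrow> vdist \<Rightarrow> ennreal" where
  "X_norm s f = (\<integral>\<^sup>+ \<xi>. ennreal (norm \<xi> powr s * norm (vfhat f \<xi>)) \<partial>lborel)"

text \<open>The Fourier transform is a function defined almost everywhere, so the supremum in the
  norm of \<open>\<Y>\<^sup>s\<close> is an essential supremum.\<close>

definition Y_norm :: "real \<Rightarrow> vdist \<Rightarrow> ennreal" where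
  "Y_norm s f = esssup lborel (\<lambda>\<xi>. ennreal (norm \<xi> powr s * norm (vfhat f \<xi>)))"

definition X_space :: "real \<Rightarrow> vdist set" where
  "X_space s = {f. (\<forall>i. tempered (f i) \<and> fourier_is_fun (f i)) \<and> X_norm s f < \<infinity>}"

definition Y_space :: "real \<Rightarrow> vdist set" where
  "Y_space s = {f. (\<forall>i. tempered (f i) \<and> fourier_is_fun (f i)) \<and> Y_norm s f < \<infinity>}"

text \<open>\<open>L\<^sup>\<infinity>([0,\<infinity>);B)\<close> and the Bochner space \<open>L\<^sup>1((0,\<infinity>);B)\<close>, for a space \<open>B\<close>
  of distributions with norm \<open>N\<close>. In the latter, strong measurability is the existence of
  \<open>B\<close>-valued simple functions converging in norm almost everywhere.\<close>

definition Linf_in :: "vdist set \<Rightarrow> (vdist \<Rightarrow> ennreal) \<Rightarrow> (real \<Rightarrow> vdist) \<Rightarrow> bool" where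
  "Linf_in B N u \<longleftrightarrow> (\<forall>t\<ge>0. u t \<in> B) \<and> (SUP t\<in>{0..}. N (u t)) < \<infinity>"

definition L1_in :: "vdist set \<Rightarrow> (vdist \<Rightarrow> ennreal) \<Rightarrow> (real \<Rightarrow> vdist) \<Rightarrow> bool" where
  "L1_in B N u \<longleftrightarrow>
     (AE t in lebesgue_on {0<..}. u t \<in> B) \<and>
     (\<exists>w. (\<forall>n. simple_function (lebesgue_on {0<..}) (w n) \<and> (\<forall>t>0. w n t \<in> B)) \<and>
          (AE t in lebesgue_on {0<..}. (\<lambda>n. N (vdist_diff (w n t) (u t))) \<longlonglongrightarrow> 0)) \<and>
     (\<integral>\<^sup>+ t. N (u t) \<partial>lebesgue_on {0<..}) < \<infinity>"

section \<open>The Navier-Stokes equations\<close>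

definition dist_deriv :: "3 \<Rightarrow> dist \<Rightarrow> dist" where
  "dist_deriv j T = (\<lambda>\<phi>. - T (pderiv_dir j \<phi>))"

definition div_free :: "vdist \<Rightarrow> bool" where
  "div_free f \<longleftrightarrow> (\<forall>\<phi>\<in>schwartz. (\<Sum>j\<in>UNIV. dist_deriv j (f j) \<phi>) = 0)"

text \<open>Pointwise product of distributions that are functions.\<close>

definition dist_mult :: "dist \<Rightarrow> dist \<Rightarrow> dist" where
  "dist_mult S T = (\<lambda>\<phi>. LINT x|lborel. dist_fun S x * dist_fun T x * \<phi> x)"

definition tensor :: "vdist \<Rightarrow> vdist \<Rightarrow> 3 \<Rightarrow> 3 \<Rightarrow> dist" where
  "tensor f g i j = dist_mult (f i) (g j)"

definition tensor_div :: "(3 \<Rightarrow> 3 \<Rightarrow> dist) \<Rightarrow> vdist" where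
  "tensor_div A i = (\<lambda>\<phi>. \<Sum>j\<in>UNIV. dist_deriv j (A i j) \<phi>)"

text \<open>Fourier multipliers, for distributions whose Fourier transform is a function.\<close>

definition fourier_mult :: "(real^3 \<Rightarrow> complex) \<Rightarrow> dist \<Rightarrow> dist" where
  "fourier_mult m T = inv_fourier_dist (\<lambda>\<phi>. LINT \<xi>|lborel. m \<xi> * fhat T \<xi> * \<phi> \<xi>)"

definition heat :: "real \<Rightarrow> vdist \<Rightarrow> vdist" where
  "heat t f i = fourier_mult (\<lambda>\<xi>. complex_of_real (exp (- t * (norm \<xi>)\<^sup>2))) (f i)"

definition leray_symbol :: "3 \<Rightarrow> 3 \<Rightarrow> real^3 \<Rightarrow> real" where
  "leray_symbol i j \<xi> = (if i = j then 1 else 0) - \<xi> $ i * \<xi> $ j / (norm \<xi>)\<^sup>2"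

definition leray :: "vdist \<Rightarrow> vdist" where
  "leray f i = (\<lambda>\<phi>. \<Sum>j\<in>UNIV. fourier_mult (\<lambda>\<xi>. complex_of_real (leray_symbol i j \<xi>)) (f j) \<phi>)"

definition duhamel_integrand :: "(real \<Rightarrow> vdist) \<Rightarrow> real \<Rightarrow> real \<Rightarrow> vdist" where
  "duhamel_integrand u t \<tau> = heat (t - \<tau>) (leray (tensor_div (tensor (u \<tau>) (u \<tau>))))"

text \<open>The time integral of distributions is taken weakly, i.e. against every test function.\<close>

definition mild_solution :: "vdist \<Rightarrow> (real \<Rightarrow> vdist) \<Rightarrow> bool" where
  "mild_solution u0 u \<longleftrightarrow>
     (\<forall>t\<ge>0. real_field (u t) \<and> div_free (u t)) \<and>
     (\<forall>t\<ge>0. \<forall>i. \<forall>\<phi>\<in>schwartz.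
        set_integrable lebesgue {0..t} (\<lambda>\<tau>. duhamel_integrand u t \<tau> i \<phi>) \<and>
        u t i \<phi> = heat t u0 i \<phi> - (LINT \<tau>:{0..t}|lebesgue. duhamel_integrand u t \<tau> i \<phi>))"

definition data_space :: "real \<Rightarrow> real \<Rightarrow> vdist set" where
  "data_space k \<sigma> = X_space (k - 1) \<inter> X_space (-1) \<inter> Y_space \<sigma>"

definition solution_class :: "real \<Rightarrow> real \<Rightarrow> (real \<Rightarrow> vdist) set" where
  "solution_class k \<sigma> = {u.
     Linf_in (data_space k \<sigma>) (\<lambda>f. X_norm (k - 1) f + X_norm (-1) f + Y_norm \<sigma> f) u \<and>
     L1_in (X_space (k + 1) \<inter> X_space 1) (\<lambda>f. X_norm (k + 1) f + X_norm 1 f) u}"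

end

theory Submission
  imports Defs "HOL-Probability.Probability" "HOL-Real_Asymp.Real_Asymp"
begin

text \<open>
  The equation is solved on the Fourier side. The Fourier transform turns the integral equation into a fixed
  point problem \<open>U = duhamel f U\<close> for functions of time and frequency, where \<open>f\<close>
  is the transform of the initial datum. The modulus of the quadratic term is at most the heat kernel
  applied to \<open>|xi|\<close> times the convolution of \<open>|U|\<close> with itself, so that all
  estimates concern nonnegative functions. They are carried out in the norms \<open>evnorm\<close>, which
  combine the supremum in time of the \<open>X\<^sup>\<kappa>\<^sup>-\<^sup>1\<close> norm with the time
  integral of the \<open>X\<^sup>\<kappa>\<^sup>+\<^sup>1\<close> norm.

  Two facts make the quadratic term bounded in these norms (\<open>bilin_evnorm\<close>): integrating the
  heat kernel in time gains the factor \<open>|xi|\<^sup>-\<^sup>2\<close>, and a product of norms of order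
  \<open>\<kappa>\<close> and 0 is interpolated between orders \<open>\<kappa> + 1\<close>, -1 and
  \<open>\<kappa> - 1\<close>, 1 (\<open>wnorm_amgm\<close>). For data that are small in
  \<open>X\<^sup>-\<^sup>1\<close> the Picard iteration converges for \<open>\<kappa> = 0\<close>, and the
  bounds for \<open>\<kappa> = k\<close> and for the pseudo-measure norm are linear in the respective
  quantity and survive in the limit (\<open>picard\<close>, \<open>pseudo_measure_bilin\<close>). The
  difference of two fixed points with finite norm vanishes by Gronwall's lemma (\<open>uniqueness\<close>);
  this also shows that the solution is real valued, by comparison with its reflected conjugate.

  The decay rate comes from a balance of frequencies (\<open>decay\<close>). The flow can be restarted at
  time \<open>t / 2\<close> with a bound that is linear in the norm of order \<open>k - 1\<close> at that
  time, hence at some later time \<open>s \<le> t\<close> the norm of order \<open>k + 1\<close> is at most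
  a multiple of that norm divided by \<open>t\<close>. At time \<open>s\<close> the frequencies above
  \<open>R = sqrt (\<Lambda> / t)\<close> contribute a small multiple of the norm at \<open>t / 2\<close>,
  and those below \<open>R\<close> contribute a multiple of \<open>R powr (k + 2 - \<sigma>)\<close>, since
  the pseudo-measure norm is bounded. Iterating over dyadic times gives the rate \<open>t powr (-(k + 2 -
  \<sigma>) / 2)\<close>.

  The remaining work relates distributions to their Fourier transforms. Fourier inversion on Schwartz
  functions and the uniqueness of representing functions make it possible to evaluate the operators in the
  mild formulation (\<open>mild_formula\<close>). A competing solution is given as a strongly measurable
  curve of distributions; its Fourier transforms first have to be assembled into one function that is
  jointly measurable in time and frequency (\<open>joint_version\<close>). Conversely, the constructed
  solution is strongly measurable because its time slices are uniformly continuous in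
  \<open>X\<^sup>-\<^sup>1\<close> (\<open>fixed_point_L1_in\<close>).
\<close>

section \<open>Schwartz functions\<close>

definition rapid :: "(real^3 \<Rightarrow> complex) \<Rightarrow> bool" where
  "rapid \<phi> \<longleftrightarrow> (\<forall>N. \<exists>C. \<forall>x. (1 + norm x) ^ N * norm (\<phi> x) \<le> C)"

lemma rapidE: assumes "rapid \<phi>" obtains C where "C \<ge> 0" "\<And>x. (1 + norm x) ^ N * norm (\<phi> x) \<le> C"
proof -
  obtain C where C: "\<And>x. (1 + norm x) ^ N * norm (\<phi> x) \<le> C" using assms unfolding rapid_def by blast
  have "0 \<le> (1 + norm (0::real^3)) ^ N * norm (\<phi> 0)" by simp
  also have "... \<le> C" by (rule C)
  finally show thesis using C that by blast
qed

text \<open>A function is Schwartz as soon as it lies in some family that is stable under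
  \<open>pderiv_dir\<close> and whose members are differentiable and rapidly decreasing. Every closure
  property below is obtained by exhibiting such a family, which avoids any product or chain rule for iterated
  derivatives.\<close>
lemma schwartz_coinduct:
  assumes "\<phi> \<in> S" "\<And>f x. f \<in> S \<Longrightarrow> f differentiable at x" "\<And>f. f \<in> S \<Longrightarrow> rapid f"
    and "\<And>f j. f \<in> S \<Longrightarrow> pderiv_dir j f \<in> S"
  shows "\<phi> \<in> schwartz"
proof -
  have *: "pderivs js \<phi> \<in> S" for js
    by (induction js) (auto simp: pderivs_def assms)
  show ?thesis unfolding schwartz_def bdd_above_def
    using assms(2)[OF *] assms(3)[OF *] unfolding rapid_def by auto
qed

lemma schwartz_differentiable: "\<phi> \<in> schwartz \<Longrightarrow> \<phi> differentiable at x"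
  unfolding schwartz_def by (auto dest!: spec[of _ "[]"] simp: pderivs_def)

lemma schwartz_rapid: assumes "\<phi> \<in> schwartz" shows "rapid \<phi>"
proof -
  have "bdd_above (range (\<lambda>x. (1 + norm x) ^ N * norm (pderivs [] \<phi> x)))"
    for N using assms unfolding schwartz_def by simp
  then show ?thesis unfolding rapid_def bdd_above_def pderivs_def by auto
qed

lemma schwartz_pderiv: assumes "\<phi> \<in> schwartz" shows "pderiv_dir j \<phi> \<in> schwartz"
proof -
  have "pderivs js (pderiv_dir j \<phi>) = pderivs (js @ [j]) \<phi>" for js by (simp add: pderivs_def)
  then show ?thesis using assms unfolding schwartz_def by simp
qed

lemma pderiv_dirI:
  assumes "\<And>x. (f has_derivative D x) (at x)" shows "pderiv_dir j f = (\<lambda>x. D x (axis j 1))"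
  unfolding pderiv_dir_def using frechet_derivative_at[OF assms] by metis

lemma schwartz_has_derivative:
  "\<phi> \<in> schwartz \<Longrightarrow> (\<phi> has_derivative frechet_derivative \<phi> (at x)) (at x)"
  using schwartz_differentiable frechet_derivative_works by blast

lemma schwartz_continuous: "\<phi> \<in> schwartz \<Longrightarrow> continuous_on UNIV \<phi>"
  using schwartz_differentiable differentiable_imp_continuous_within
  by (metis continuous_at_imp_continuous_on)

lemma schwartz_measurable[measurable_dest]: "\<phi> \<in> schwartz \<Longrightarrow> \<phi> \<in> borel_measurable borel"
  using schwartz_continuous borel_measurable_continuous_onI by blast

lemma rapid_bound_mult:
  assumes "rapid f" "\<And>x. norm (g x) \<le> C * (1 + norm x) ^ k * norm (f x)"
  shows "rapid g"
  unfolding rapid_def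
proof
  fix N
  obtain D where D: "\<And>x. (1 + norm x) ^ (N + k) * norm (f x) \<le> D" using assms(1) unfolding rapid_def by blast
  have "(1 + norm x) ^ N * norm (g x) \<le> \<bar>C\<bar> * D" for x
  proof -
    have "(1 + norm x) ^ N * norm (g x) \<le> (1 + norm x) ^ N * (\<bar>C\<bar> * (1 + norm x) ^ k * norm (f x))"
      by (intro mult_left_mono order_trans[OF assms(2)] mult_right_mono) auto
    also have "... = \<bar>C\<bar> * ((1 + norm x) ^ (N + k) * norm (f x))" by (simp add: power_add)
    also have "... \<le> \<bar>C\<bar> * D" by (intro mult_left_mono D) auto
    finally show ?thesis .
  qed
  then show "\<exists>C. \<forall>x. (1 + norm x) ^ N * norm (g x) \<le> C" by blast
qed

lemma rapid_add: assumes "rapid f" "rapid g" shows "rapid (\<lambda>x. f x + g x)"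
  unfolding rapid_def
proof
  fix N
  obtain C where C: "\<And>x. (1 + norm x) ^ N * norm (f x) \<le> C" using assms(1) unfolding rapid_def by blast
  obtain D where D: "\<And>x. (1 + norm x) ^ N * norm (g x) \<le> D" using assms(2) unfolding rapid_def by blast
  have "(1 + norm x) ^ N * norm (f x + g x) \<le> C + D" for x
  proof -
    have "(1 + norm x) ^ N * norm (f x + g x) \<le> (1 + norm x) ^ N * (norm (f x) + norm (g x))"
      by (intro mult_left_mono norm_triangle_ineq) auto
    then show ?thesis using C[of x] D[of x] by (simp add: distrib_left)
  qed
  then show "\<exists>C. \<forall>x. (1 + norm x) ^ N * norm (f x + g x) \<le> C" by blast
qed

lemma rapid_cmult: "rapid f \<Longrightarrow> rapid (\<lambda>x. c * f x)"
  by (rule rapid_bound_mult[where f=f and C="norm c" and k=0]) (auto simp: norm_mult)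

lemma rapid_coord: "rapid f \<Longrightarrow> rapid (\<lambda>x. complex_of_real (x $ i) * f x)"
proof (rule rapid_bound_mult[where f=f and C=1 and k=1])
  fix x :: "real^3"
  have "\<bar>x $ i\<bar> \<le> 1 + norm x" using component_le_norm_cart[of x i] by linarith
  then show "norm (complex_of_real (x $ i) * f x) \<le> 1 * (1 + norm x) ^ 1 * norm (f x)"
    by (auto simp: norm_mult intro!: mult_right_mono)
qed

lemma schwartz_add_cmult:
  assumes "\<phi> \<in> schwartz" "\<psi> \<in> schwartz" shows "(\<lambda>x. a * \<phi> x + b * \<psi> x) \<in> schwartz"
proof (rule schwartz_coinduct[where S="{\<lambda>x. a * \<phi> x + b * \<psi> x | \<phi> \<psi>. \<phi> \<in> schwartz \<and> \<psi> \<in> schwartz}"], goal_cases)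
  case 1 then show ?case using assms by blast
next
  case (2 f x) then show ?case using schwartz_differentiable by (auto intro!: derivative_intros)
next
  case (3 f)
  then obtain \<phi> \<psi> where *: "f = (\<lambda>x. a * \<phi> x + b * \<psi> x)" "\<phi> \<in> schwartz" "\<psi> \<in> schwartz" by blast
  then show ?case using rapid_add rapid_cmult schwartz_rapid by metis
next
  case (4 f j)
  then obtain \<phi> \<psi> where *: "f = (\<lambda>x. a * \<phi> x + b * \<psi> x)" "\<phi> \<in> schwartz" "\<psi> \<in> schwartz" by blast
  have "pderiv_dir j f = (\<lambda>x. a * pderiv_dir j \<phi> x + b * pderiv_dir j \<psi> x)"
    unfolding *(1) by (subst pderiv_dirI[where D="\<lambda>x h. a * frechet_derivative \<phi> (at x) h + b * frechet_derivative \<psi> (at x) h"])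
      (auto intro!: derivative_eq_intros schwartz_has_derivative * simp: pderiv_dir_def)
  then show ?case using *(2,3) schwartz_pderiv by blast
qed

lemma schwartz_cmult: "\<phi> \<in> schwartz \<Longrightarrow> (\<lambda>x. a * \<phi> x) \<in> schwartz"
  using schwartz_add_cmult[of \<phi> \<phi> a 0] by simp

lemma schwartz_zero: "(\<lambda>x. 0) \<in> schwartz"
proof (rule schwartz_coinduct[where S="{\<lambda>x. 0}"], goal_cases)
  case (4 f j) then show ?case by (auto simp: pderiv_dir_def)
qed (auto simp: rapid_def)

text \<open>The Leibniz rule leaves the undifferentiated factor behind, so the family has to contain sums with
  a free Schwartz summand.\<close>
lemma schwartz_coord:
  assumes "\<phi> \<in> schwartz" shows "(\<lambda>x. complex_of_real (x $ i) * \<phi> x) \<in> schwartz"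
proof (rule schwartz_coinduct[where S="{\<lambda>x. complex_of_real (x $ i) * \<phi> x + \<psi> x | \<phi> \<psi>. \<phi> \<in> schwartz \<and> \<psi> \<in> schwartz}"], goal_cases)
  case 1 then show ?case using assms schwartz_zero by force
next
  case (2 f x)
  then obtain \<phi> \<psi> where *: "f = (\<lambda>x. complex_of_real (x $ i) * \<phi> x + \<psi> x)" "\<phi> \<in> schwartz" "\<psi> \<in> schwartz" by blast
  have "(f has_derivative (\<lambda>h. complex_of_real (x $ i) * frechet_derivative \<phi> (at x) h + complex_of_real (h $ i) * \<phi> x + frechet_derivative \<psi> (at x) h)) (at x)"
    unfolding *(1) by (auto intro!: derivative_eq_intros schwartz_has_derivative * bounded_linear.has_derivative[OF bounded_linear_of_real] bounded_linear_imp_has_derivative bounded_linear_vec_nth)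
  then show ?case unfolding differentiable_def by blast
next
  case (3 f)
  then obtain \<phi> \<psi> where *: "f = (\<lambda>x. complex_of_real (x $ i) * \<phi> x + \<psi> x)" "\<phi> \<in> schwartz" "\<psi> \<in> schwartz" by blast
  then show ?case using rapid_add rapid_coord schwartz_rapid by metis
next
  case (4 f j)
  then obtain \<phi> \<psi> where *: "f = (\<lambda>x. complex_of_real (x $ i) * \<phi> x + \<psi> x)" "\<phi> \<in> schwartz" "\<psi> \<in> schwartz" by blast
  have "pderiv_dir j f = (\<lambda>x. complex_of_real (x $ i) * pderiv_dir j \<phi> x + ((if i = j then 1 else 0) * \<phi> x + 1 * pderiv_dir j \<psi> x))"
    unfolding *(1) by (subst pderiv_dirI[where D="\<lambda>x h. complex_of_real (x $ i) * frechet_derivative \<phi> (at x) h + complex_of_real (h $ i) * \<phi> x + frechet_derivative \<psi> (at x) h"])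
      (auto intro!: derivative_eq_intros schwartz_has_derivative * bounded_linear.has_derivative[OF bounded_linear_of_real] bounded_linear_imp_has_derivative bounded_linear_vec_nth simp: pderiv_dir_def axis_def)
  then show ?case
    by (intro CollectI exI[of _ "pderiv_dir j \<phi>"] exI[of _ "\<lambda>x. (if i = j then 1 else 0) * \<phi> x + 1 * pderiv_dir j \<psi> x"] conjI
      schwartz_pderiv schwartz_add_cmult *(2,3))
qed

lemma schwartz_cnj:
  assumes "\<phi> \<in> schwartz" shows "(\<lambda>x. cnj (\<phi> x)) \<in> schwartz"
proof (rule schwartz_coinduct[where S="{\<lambda>x. cnj (\<phi> x) | \<phi>. \<phi> \<in> schwartz}"], goal_cases)
  case 1 then show ?case using assms by blast
next
  case (2 f x)
  then obtain \<phi> where *: "f = (\<lambda>x. cnj (\<phi> x))" "\<phi> \<in> schwartz" by blast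
  have "(f has_derivative (\<lambda>h. cnj (frechet_derivative \<phi> (at x) h))) (at x)"
    unfolding *(1) by (intro bounded_linear.has_derivative[OF bounded_linear_cnj] schwartz_has_derivative *)
  then show ?case unfolding differentiable_def by blast
next
  case (3 f) then show ?case by (auto dest!: schwartz_rapid simp: rapid_def)
next
  case (4 f j)
  then obtain \<phi> where *: "f = (\<lambda>x. cnj (\<phi> x))" "\<phi> \<in> schwartz" by blast
  have "pderiv_dir j f = (\<lambda>x. cnj (pderiv_dir j \<phi> x))"
    unfolding *(1) by (subst pderiv_dirI[where D="\<lambda>x h. cnj (frechet_derivative \<phi> (at x) h)"])
      (auto intro!: bounded_linear.has_derivative[OF bounded_linear_cnj] schwartz_has_derivative * simp: pderiv_dir_def)
  then show ?case using *(2) schwartz_pderiv by blast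
qed

lemma schwartz_reflect:
  assumes "\<phi> \<in> schwartz" shows "(\<lambda>x. \<phi> (- x)) \<in> schwartz"
proof (rule schwartz_coinduct[where S="{\<lambda>x. a * \<phi> (-x) | a \<phi>. \<phi> \<in> schwartz}"], goal_cases)
  case 1 have "(\<lambda>x. \<phi> (- x)) = (\<lambda>x. 1 * \<phi> (- x))" by simp
  then show ?case using assms by blast
next
  case (2 f x)
  then obtain a \<phi> where *: "f = (\<lambda>x. a * \<phi> (-x))" "\<phi> \<in> schwartz" by blast
  have "(f has_derivative (\<lambda>h. a * (frechet_derivative \<phi> (at (-x)) (-h)))) (at x)"
    unfolding *(1) by (intro has_derivative_mult_right has_derivative_compose[of uminus uminus, OF _ schwartz_has_derivative[OF *(2)]] derivative_intros)
  then show ?case unfolding differentiable_def by blast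
next
  case (3 f)
  then obtain a \<phi> where *: "f = (\<lambda>x. a * \<phi> (-x))" "\<phi> \<in> schwartz" by blast
  have "rapid (\<lambda>x. \<phi> (-x))" using schwartz_rapid[OF *(2)] unfolding rapid_def by (metis norm_minus_cancel)
  then show ?case unfolding * by (rule rapid_cmult)
next
  case (4 f j)
  then obtain a \<phi> where *: "f = (\<lambda>x. a * \<phi> (-x))" "\<phi> \<in> schwartz" by blast
  have lin: "linear (frechet_derivative \<phi> (at x))" for x
    using schwartz_has_derivative[OF *(2)] has_derivative_linear by blast
  have "pderiv_dir j f = (\<lambda>x. a * frechet_derivative \<phi> (at (-x)) (- axis j 1))"
    unfolding *(1) by (subst pderiv_dirI[where D="\<lambda>x h. a * (frechet_derivative \<phi> (at (-x)) (-h))"])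
     (auto intro!: has_derivative_mult_right has_derivative_compose[of uminus uminus, OF _ schwartz_has_derivative[OF *(2)]] derivative_intros)
  then have "pderiv_dir j f = (\<lambda>x. (- a) * (pderiv_dir j \<phi> (-x)))"
    by (simp add: pderiv_dir_def linear_neg[OF lin])
  then show ?case using *(2) schwartz_pderiv by blast
qed

section \<open>The Fourier transform of Schwartz functions\<close>

text \<open>The affine substitutions \<open>x \<mapsto> t + c x\<close> serve as translations, reflections and
  dilations alike.\<close>
lemma lborel_integral_affine3:
  fixes f :: "real^3 \<Rightarrow> 'b::{banach,second_countable_topology}"
  assumes [measurable]: "f \<in> borel_measurable borel" and c: "c \<noteq> 0"
  shows "(LINT x|lborel. f x) = \<bar>c\<bar>^3 *\<^sub>R (LINT x|lborel. f (t + c *\<^sub>R x))"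
proof -
  have "(LINT x|lborel. f x) = integral\<^sup>L (density (distr lborel borel (\<lambda>x. t + c *\<^sub>R x)) (\<lambda>_. ennreal (\<bar>c\<bar>^DIM(real^3)))) f"
    using lborel_affine[OF c, of t] by simp
  also have "... = (LINT x|lborel. \<bar>c\<bar>^3 *\<^sub>R f (t + c *\<^sub>R x))"
    by (subst integral_density) (auto simp: integral_distr)
  finally show ?thesis by simp
qed

lemma lborel_integrable_affine3:
  fixes f :: "real^3 \<Rightarrow> 'b::{banach,second_countable_topology}"
  assumes c: "c \<noteq> 0" and f: "integrable lborel f"
  shows "integrable lborel (\<lambda>x. f (t + c *\<^sub>R x))"
proof -
  have [measurable]: "f \<in> borel_measurable borel" using f by auto
  have "integrable (density (distr lborel borel (\<lambda>x. t + c *\<^sub>R x)) (\<lambda>_. ennreal (\<bar>c\<bar>^DIM(real^3)))) f"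
    using lborel_affine[OF c, of t] f by simp
  then have "integrable lborel (\<lambda>x. \<bar>c\<bar>^3 *\<^sub>R f (t + c *\<^sub>R x))"
    by (subst (asm) integrable_density) (auto simp: integrable_distr_eq)
  then have "integrable lborel (\<lambda>x. (1 / \<bar>c\<bar>^3) *\<^sub>R (\<bar>c\<bar>^3 *\<^sub>R f (t + c *\<^sub>R x)))" by (rule integrable_scaleR_right)
  then show ?thesis using c by simp
qed

lemma nn_integral_affine3:
  fixes f :: "real^3 \<Rightarrow> ennreal"
  assumes [measurable]: "f \<in> borel_measurable borel" and c: "c \<noteq> 0"
  shows "(\<integral>\<^sup>+x. f x \<partial>lborel) = ennreal (\<bar>c\<bar>^3) * (\<integral>\<^sup>+x. f (t + c *\<^sub>R x) \<partial>lborel)"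
proof -
  have "(\<integral>\<^sup>+x. f x \<partial>lborel) = integral\<^sup>N (density (distr lborel borel (\<lambda>x. t + c *\<^sub>R x)) (\<lambda>_. ennreal (\<bar>c\<bar>^DIM(real^3)))) f"
    using lborel_affine[OF c, of t] by simp
  also have "... = (\<integral>\<^sup>+x. ennreal (\<bar>c\<bar>^3) * f (t + c *\<^sub>R x) \<partial>lborel)"
    by (subst nn_integral_density) (auto simp: nn_integral_distr)
  finally show ?thesis by (simp add: nn_integral_cmult)
qed

lemma AE_affine3:
  fixes P :: "real^3 \<Rightarrow> bool"
  assumes "AE x in lborel. P x" and c: "c \<noteq> 0"
  shows "AE x in lborel. P (t + c *\<^sub>R x)"
proof -
  have "AE x in density (distr lborel borel (\<lambda>x. t + c *\<^sub>R x)) (\<lambda>_. ennreal (\<bar>c\<bar>^DIM(real^3))). P x"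
    unfolding lborel_affine[OF c, of t, symmetric] by (rule assms)
  then have "AE x in distr lborel borel (\<lambda>x. t + c *\<^sub>R x). P x"
    using c by (simp add: AE_density)
  then show ?thesis by (rule AE_distrD[rotated]) simp
qed

lemma lborel_product:
  fixes f :: "'a::euclidean_space \<Rightarrow> real \<Rightarrow> 'b::{real_normed_field,banach,second_countable_topology}"
  assumes f: "\<And>b. b \<in> Basis \<Longrightarrow> integrable lborel (f b)"
  shows integrable_lborel_product: "integrable lborel (\<lambda>x. \<Prod>b\<in>Basis. f b (x \<bullet> b))" (is ?A)
    and integral_lborel_product: "(LINT x|lborel. (\<Prod>b\<in>Basis. f b (x \<bullet> b))) = (\<Prod>b\<in>Basis. LINT x|lborel. f b x)" (is ?B)
proof -
  interpret product_sigma_finite "\<lambda>_::'a. lborel :: real measure" ..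
  have [measurable]: "b \<in> Basis \<Longrightarrow> f b \<in> borel_measurable borel" for b using f by auto
  have *: "(\<Prod>b\<in>Basis. f b ((\<Sum>b\<in>Basis. g b *\<^sub>R b) \<bullet> b)) = (\<Prod>b\<in>Basis. f b (g b))" for g
    by (intro prod.cong) auto
  have i: "integrable (\<Pi>\<^sub>M b\<in>Basis. lborel) (\<lambda>x. \<Prod>b\<in>Basis. f b (x b))"
    using product_integrable_prod[OF finite_Basis f] by simp
  show ?A by (subst lborel_eq, subst integrable_distr_eq) (simp_all add: * i)
  show ?B by (subst lborel_eq, subst integral_distr) (simp_all add: * product_integral_prod f)
qed

lemma integrable_inverse_1_square: "integrable lborel (\<lambda>x::real. inverse (1 + x\<^sup>2))"
  using integrable_inverse_1_plus_square by (simp add: set_integrable_def)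

text \<open>The majorant is integrable because it is dominated by a product of three integrable functions of
  one variable; the power 6 is what the product of three factors \<open>1 + x\<^sub>i\<^sup>2\<close>
  needs.\<close>
lemma integrable_weight: "integrable lborel (\<lambda>x::real^3. 1 / (1 + norm x) ^ 6)"
proof (rule Bochner_Integration.integrable_bound)
  show "integrable lborel (\<lambda>x::real^3. \<Prod>b\<in>Basis. inverse (1 + (x \<bullet> b)\<^sup>2))"
    by (intro integrable_lborel_product integrable_inverse_1_square)
  show "AE x::real^3 in lborel. norm (1 / (1 + norm x) ^ 6) \<le> norm (\<Prod>b\<in>Basis. inverse (1 + (x \<bullet> b)\<^sup>2))"
  proof (intro AE_I2)
    fix x :: "real^3"
    have "(\<Prod>b\<in>Basis. (1 + (x \<bullet> b)\<^sup>2)) \<le> (\<Prod>b\<in>(Basis::(real^3) set). (1 + norm x)\<^sup>2)"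
    proof (rule prod_mono, safe)
      fix b :: "real^3" assume "b \<in> Basis"
      then have "\<bar>x \<bullet> b\<bar> \<le> norm x" by (rule Basis_le_norm)
      then have "(x \<bullet> b)\<^sup>2 \<le> (norm x)\<^sup>2" by (metis abs_ge_zero power2_abs power_mono)
      then show "1 + (x \<bullet> b)\<^sup>2 \<le> (1 + norm x)\<^sup>2" by (simp add: power2_sum add_increasing2)
    qed simp
    also have "... = (1 + norm x) ^ 6" by (simp add: power_mult[symmetric])
    finally have "(\<Prod>b\<in>Basis. (1 + (x \<bullet> b)\<^sup>2)) \<le> (1 + norm x) ^ 6" .
    moreover have "0 < (\<Prod>b\<in>Basis. (1 + (x \<bullet> b)\<^sup>2))" by (intro prod_pos) (simp add: add_pos_nonneg)
    moreover have "(\<Prod>b\<in>Basis. inverse (1 + (x \<bullet> b)\<^sup>2)) = inverse (\<Prod>b\<in>Basis. (1 + (x \<bullet> b)\<^sup>2))"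
      by (simp add: prod_inversef[symmetric] o_def)
    moreover have "norm (1 / (1 + norm x) ^ 6) = inverse ((1 + norm x) ^ 6)"
      unfolding real_norm_def inverse_eq_divide by (rule abs_of_nonneg) simp
    ultimately show "norm (1 / (1 + norm x) ^ 6) \<le> norm (\<Prod>b\<in>Basis. inverse (1 + (x \<bullet> b)\<^sup>2))"
      using le_imp_inverse_le by simp
  qed
qed measurable

lemma rapid_integrable:
  assumes "rapid \<phi>" and [measurable]: "\<phi> \<in> borel_measurable borel"
  shows "integrable lborel \<phi>"
proof -
  obtain C where C: "C \<ge> 0" "\<And>x. (1 + norm x) ^ 6 * norm (\<phi> x) \<le> C" using rapidE[OF assms(1)] by metis
  show ?thesis
  proof (rule Bochner_Integration.integrable_bound[OF integrable_mult_right[OF integrable_weight, of C]])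
    show "AE x in lborel. norm (\<phi> x) \<le> norm (C * (1 / (1 + norm x) ^ 6))"
    proof (intro AE_I2)
      fix x :: "real^3"
      have "(1 + norm x) ^ 6 > 0" by (intro zero_less_power add_pos_nonneg) auto
      then have "norm (\<phi> x) \<le> C / (1 + norm x) ^ 6"
        using C(2)[of x] by (metis pos_le_divide_eq mult.commute)
      then show "norm (\<phi> x) \<le> norm (C * (1 / (1 + norm x) ^ 6))" using C(1) by simp
    qed
  qed measurable
qed

lemma schwartz_integrable: "\<phi> \<in> schwartz \<Longrightarrow> integrable lborel \<phi>"
  by (simp add: rapid_integrable schwartz_rapid schwartz_measurable)

lemma integrable_cis_mult:
  assumes "integrable M f" "g \<in> borel_measurable M"
  shows "integrable M (\<lambda>x. cis (g x) * f x)"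
proof (rule Bochner_Integration.integrable_bound[OF assms(1)])
  have [measurable]: "cis \<in> borel_measurable borel" by (intro borel_measurable_continuous_onI continuous_intros)
  show "(\<lambda>x. cis (g x) * f x) \<in> borel_measurable M" using assms by measurable
qed (simp add: norm_mult)

lemma cis_measurable[measurable]: "cis \<in> borel_measurable borel"
  by (intro borel_measurable_continuous_onI continuous_intros)

lemma fourier_norm_le: assumes "integrable lborel f" shows "norm (fourier f xi) \<le> (LINT x|lborel. norm (f x))"
proof -
  have "norm (fourier f xi) \<le> (LINT x|lborel. norm (cis (- (x \<bullet> xi)) * f x))"
    unfolding fourier_def by (rule integral_norm_bound)
  then show ?thesis by (simp add: norm_mult)
qed

text \<open>The quadratic Taylor remainder is what turns difference quotients of characters into derivatives,
  both in \<open>fourier_has_derivative\<close> and in \<open>fourier_of_pderiv\<close>.\<close>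
lemma cis_approx: "norm (cis \<theta> - 1 - \<i> * complex_of_real \<theta>) \<le> \<theta>\<^sup>2"
proof -
  have "cmod (exp (\<i> * complex_of_real \<theta>) - (\<Sum>k \<le> 1. (\<i> * complex_of_real \<theta>)^k / fact k)) \<le> \<bar>\<theta>\<bar>^(Suc 1) / fact (Suc 1)"
    by (rule iexp_approx1)
  also have "(\<Sum>k \<le> 1. (\<i> * complex_of_real \<theta>)^k / fact k) = 1 + \<i> * complex_of_real \<theta>" by simp
  also have "\<bar>\<theta>\<bar>^(Suc 1) / fact (Suc 1) \<le> \<theta>\<^sup>2" by (simp add: power2_eq_square fact_numeral)
  finally show ?thesis by (simp add: cis_conv_exp diff_diff_eq)
qed

text \<open>Differentiation under the integral sign, with the quantitative remainder \<open>K
  |h|\<^sup>2\<close> where \<open>K\<close> is the second absolute moment of \<open>\<phi>\<close>.\<close>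
lemma fourier_has_derivative:
  assumes "\<phi> \<in> schwartz"
  shows "(fourier \<phi> has_derivative (\<lambda>h. \<Sum>j\<in>UNIV. complex_of_real (h $ j) * fourier (\<lambda>x. - \<i> * (complex_of_real (x $ j) * \<phi> x)) xi)) (at xi)"
    (is "(_ has_derivative ?D) _")
proof -
  note [measurable] = schwartz_measurable[OF assms]
  have xs: "(\<lambda>x. - \<i> * (complex_of_real (x $ j) * \<phi> x)) \<in> schwartz" for j
    by (intro schwartz_cmult schwartz_coord assms)
  have i1: "integrable lborel (\<lambda>x. cis (- (x \<bullet> xi)) * \<phi> x)" for xi
    by (intro integrable_cis_mult schwartz_integrable assms) simp
  have i2: "integrable lborel (\<lambda>x. cis (- (x \<bullet> xi)) * (- \<i> * (complex_of_real (x $ j) * \<phi> x)))" for j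
    by (intro integrable_cis_mult schwartz_integrable xs) simp
  define K where "K = (LINT x|lborel. (norm x)\<^sup>2 * norm (\<phi> x))"
  have r2: "rapid (\<lambda>x. complex_of_real ((norm x)\<^sup>2) * \<phi> x)"
  proof (rule rapid_bound_mult[OF schwartz_rapid[OF assms], of _ 1 2])
    fix x :: "real^3"
    have "(norm x)\<^sup>2 \<le> (1 + norm x)\<^sup>2" by (intro power_mono) auto
    then show "norm (complex_of_real ((norm x)\<^sup>2) * \<phi> x) \<le> 1 * (1 + norm x) ^ 2 * norm (\<phi> x)"
      by (auto simp: norm_mult norm_power intro!: mult_right_mono)
  qed
  have i3: "integrable lborel (\<lambda>x. (norm x)\<^sup>2 * norm (\<phi> x))"
    using integrable_norm[OF rapid_integrable[OF r2]] by (simp add: norm_mult norm_power)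
  have rem: "norm (fourier \<phi> (xi + h) - fourier \<phi> xi - ?D h) \<le> K * (norm h)\<^sup>2" for h
  proof -
    have eq: "fourier \<phi> (xi + h) - fourier \<phi> xi - ?D h =
      (LINT x|lborel. cis (- (x \<bullet> (xi + h))) * \<phi> x - cis (- (x \<bullet> xi)) * \<phi> x
        - (\<Sum>j\<in>UNIV. complex_of_real (h $ j) * (cis (- (x \<bullet> xi)) * (- \<i> * (complex_of_real (x $ j) * \<phi> x)))))"
      unfolding fourier_def using i1 i2
      by (subst Bochner_Integration.integral_diff, (intro Bochner_Integration.integrable_diff i1 Bochner_Integration.integrable_sum integrable_mult_right i2)+,
         subst Bochner_Integration.integral_diff, (intro i1)+, subst Bochner_Integration.integral_sum, (intro integrable_mult_right i2)) simp
    have pt: "cis (- (x \<bullet> (xi + h))) * \<phi> x - cis (- (x \<bullet> xi)) * \<phi> x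
        - (\<Sum>j\<in>UNIV. complex_of_real (h $ j) * (cis (- (x \<bullet> xi)) * (- \<i> * (complex_of_real (x $ j) * \<phi> x))))
        = cis (- (x \<bullet> xi)) * \<phi> x * (cis (- (x \<bullet> h)) - 1 - \<i> * complex_of_real (- (x \<bullet> h)))" for x
    proof -
      have "(\<Sum>j\<in>UNIV. complex_of_real (h $ j) * (cis (- (x \<bullet> xi)) * (- \<i> * (complex_of_real (x $ j) * \<phi> x))))
        = cis (- (x \<bullet> xi)) * \<phi> x * (- \<i>) * complex_of_real (x \<bullet> h)"
        by (simp add: inner_vec_def sum_distrib_left sum_negf[symmetric] mult_ac)
      moreover have "cis (- (x \<bullet> (xi + h))) = cis (- (x \<bullet> xi)) * cis (- (x \<bullet> h))"
        by (simp add: inner_add_right cis_mult)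
      ultimately show ?thesis by (simp add: algebra_simps)
    qed
    have "norm (fourier \<phi> (xi + h) - fourier \<phi> xi - ?D h) \<le> (LINT x|lborel. (norm h)\<^sup>2 * ((norm x)\<^sup>2 * norm (\<phi> x)))"
      unfolding eq pt
    proof (rule Bochner_Integration.integral_norm_bound_integral)
      have "integrable lborel (\<lambda>x. cis (- (x \<bullet> (xi + h))) * \<phi> x - cis (- (x \<bullet> xi)) * \<phi> x
        - (\<Sum>j\<in>UNIV. complex_of_real (h $ j) * (cis (- (x \<bullet> xi)) * (- \<i> * (complex_of_real (x $ j) * \<phi> x)))))"
        by (intro Bochner_Integration.integrable_diff i1 Bochner_Integration.integrable_sum integrable_mult_right i2)
      then show "integrable lborel (\<lambda>x. cis (- (x \<bullet> xi)) * \<phi> x * (cis (- (x \<bullet> h)) - 1 - \<i> * complex_of_real (- (x \<bullet> h))))"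
        unfolding pt .
      show "integrable lborel (\<lambda>x. (norm h)\<^sup>2 * ((norm x)\<^sup>2 * norm (\<phi> x)))" by (intro integrable_mult_right i3)
      fix x
      have "norm (cis (- (x \<bullet> h)) - 1 - \<i> * complex_of_real (- (x \<bullet> h))) \<le> (x \<bullet> h)\<^sup>2"
        using cis_approx[of "- (x \<bullet> h)"] by simp
      also have "... \<le> (norm x * norm h)\<^sup>2" by (metis Cauchy_Schwarz_ineq2 abs_ge_zero power2_abs power_mono)
      finally have "norm (\<phi> x) * norm (cis (- (x \<bullet> h)) - 1 - \<i> * complex_of_real (- (x \<bullet> h))) \<le> norm (\<phi> x) * (norm x * norm h)\<^sup>2"
        by (intro mult_left_mono) auto
      then show "norm (cis (- (x \<bullet> xi)) * \<phi> x * (cis (- (x \<bullet> h)) - 1 - \<i> * complex_of_real (- (x \<bullet> h)))) \<le> (norm h)\<^sup>2 * ((norm x)\<^sup>2 * norm (\<phi> x))"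
        by (simp add: norm_mult power_mult_distrib mult_ac)
    qed
    then show ?thesis by (simp add: K_def mult.commute)
  qed
  show ?thesis unfolding has_derivative_at
  proof
    show "bounded_linear ?D"
      by (intro bounded_linear_sum bounded_linear_mult_const bounded_linear_compose[OF bounded_linear_of_real] bounded_linear_vec_nth)
    show "(\<lambda>h. norm (fourier \<phi> (xi + h) - fourier \<phi> xi - ?D h) / norm h) \<midarrow>0\<rightarrow> 0"
    proof (rule Lim_null_comparison)
      show "\<forall>\<^sub>F h in at 0. norm (norm (fourier \<phi> (xi + h) - fourier \<phi> xi - ?D h) / norm h) \<le> K * norm h"
        unfolding eventually_at using rem by (intro exI[of _ 1]) (auto simp: divide_simps power2_eq_square mult.assoc)
      have "((\<lambda>h::real^3. K * norm h) \<longlongrightarrow> K * norm (0::real^3)) (at 0)" by (intro tendsto_intros)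
      then show "((\<lambda>h::real^3. K * norm h) \<longlongrightarrow> 0) (at 0)" by simp
    qed
  qed
qed

lemma fourier_pderiv:
  assumes "\<phi> \<in> schwartz"
  shows "pderiv_dir j (fourier \<phi>) = fourier (\<lambda>x. - \<i> * (complex_of_real (x $ j) * \<phi> x))"
proof -
  have "pderiv_dir j (fourier \<phi>) = (\<lambda>xi. \<Sum>i\<in>UNIV. complex_of_real (axis j 1 $ i) * fourier (\<lambda>x. - \<i> * (complex_of_real (x $ i) * \<phi> x)) xi)"
    by (rule pderiv_dirI[OF fourier_has_derivative[OF assms]])
  also have "... = fourier (\<lambda>x. - \<i> * (complex_of_real (x $ j) * \<phi> x))"
    by (auto simp: axis_def if_distrib if_distribR cong: if_cong)
  finally show ?thesis .
qed

text \<open>An integrable majorant for the difference quotients of a Schwartz function, uniform in the step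
  size; it follows from the mean value inequality, since moving by at most 1 changes \<open>1 + |x|\<close> by
  a factor of at most 2.\<close>
lemma schwartz_increment_bound:
  assumes "\<phi> \<in> schwartz"
  obtains C where "\<And>x h. 0 < h \<Longrightarrow> h \<le> 1 \<Longrightarrow> norm (\<phi> (x + h *\<^sub>R axis j 1) - \<phi> x) \<le> h * (C * (1 / (1 + norm x) ^ 6))"
proof -
  obtain C where C: "C \<ge> 0" "\<And>x. (1 + norm x) ^ 6 * norm (pderiv_dir j \<phi> x) \<le> C"
    using rapidE[OF schwartz_rapid[OF schwartz_pderiv[OF assms]]] by metis
  have "norm (\<phi> (x + h *\<^sub>R axis j 1) - \<phi> x) \<le> h * ((C * 2^6) * (1 / (1 + norm x) ^ 6))" if h: "0 < h" "h \<le> 1" for x h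
  proof -
    define g where "g s = \<phi> (x + s *\<^sub>R axis j 1)" for s
    have lin: "linear (frechet_derivative \<phi> (at y))" for y
      using schwartz_has_derivative[OF assms] has_derivative_linear by blast
    have der: "(g has_derivative (\<lambda>u. u *\<^sub>R pderiv_dir j \<phi> (x + s *\<^sub>R axis j 1))) (at s)" for s
    proof -
      have "(g has_derivative (\<lambda>u. frechet_derivative \<phi> (at (x + s *\<^sub>R axis j 1)) (u *\<^sub>R axis j 1))) (at s)"
        unfolding g_def by (rule has_derivative_compose[where g=\<phi>, OF _ schwartz_has_derivative[OF assms]]) (auto intro!: derivative_eq_intros)
      then show ?thesis by (simp add: pderiv_dir_def linear_scale[OF lin])
    qed
    have cont: "continuous_on {0..h} g"
      by (intro continuous_at_imp_continuous_on ballI has_derivative_continuous[OF der])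
    have "\<exists>s\<in>{0<..<h}. norm (g h - g 0) \<le> norm ((h - 0) *\<^sub>R pderiv_dir j \<phi> (x + s *\<^sub>R axis j 1))"
      by (rule mvt_general[OF h(1) cont der])
    then obtain s where s: "0 < s" "s < h" "norm (g h - g 0) \<le> h * norm (pderiv_dir j \<phi> (x + s *\<^sub>R axis j 1))" using h by auto
    let ?y = "x + s *\<^sub>R axis j 1"
    have n1: "norm x \<le> norm ?y + norm (s *\<^sub>R (axis j 1 :: real^3))"
      using norm_triangle_ineq4[of ?y "s *\<^sub>R axis j 1"] by simp
    have n2: "norm (s *\<^sub>R (axis j 1 :: real^3)) \<le> 1" using s h by (simp add: norm_axis_1)
    have "1 + norm x \<le> 2 * (1 + norm ?y)" using n1 n2 norm_ge_zero[of ?y] unfolding distrib_left by linarith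
    then have "(1 + norm x) ^ 6 \<le> (2 * (1 + norm ?y)) ^ 6" by (intro power_mono) auto
    then have "(1 + norm x) ^ 6 * norm (pderiv_dir j \<phi> ?y) \<le> (2 * (1 + norm ?y)) ^ 6 * norm (pderiv_dir j \<phi> ?y)"
      by (intro mult_right_mono) auto
    also have "... \<le> 2^6 * C" using C(2)[of ?y] unfolding power_mult_distrib mult.assoc by (intro mult_left_mono) auto
    finally have "norm (pderiv_dir j \<phi> ?y) * (1 + norm x) ^ 6 \<le> C * 2^6" by (simp only: mult.commute)
    moreover have "(1 + norm x) ^ 6 > 0" by (intro zero_less_power add_pos_nonneg) auto
    ultimately have "norm (pderiv_dir j \<phi> ?y) \<le> (C * 2^6) / (1 + norm x) ^ 6" by (metis pos_le_divide_eq)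
    then have "norm (pderiv_dir j \<phi> ?y) \<le> (C * 2^6) * (1 / (1 + norm x) ^ 6)" by simp
    then have "h * norm (pderiv_dir j \<phi> ?y) \<le> h * ((C * 2^6) * (1 / (1 + norm x) ^ 6))" using h by (intro mult_left_mono) auto
    then show ?thesis using s(3) by (simp add: g_def)
  qed
  then show thesis using that by blast
qed

text \<open>Instead of integrating by parts, the translation invariance of Lebesgue measure is differentiated:
  a difference quotient of \<open>\<phi>\<close> has Fourier transform \<open>(cis (h xi\<^sub>j) - 1) /
  h\<close> times that of \<open>\<phi>\<close>, and both sides converge as \<open>h\<close> tends to
  0.\<close>
lemma fourier_of_pderiv:
  assumes "\<phi> \<in> schwartz"
  shows "fourier (pderiv_dir j \<phi>) xi = \<i> * complex_of_real (xi $ j) * fourier \<phi> xi"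
proof -
  note [measurable] = schwartz_measurable[OF assms] schwartz_measurable[OF schwartz_pderiv[OF assms, of j]]
  define h where "h n = inverse (real (Suc n))" for n
  have h: "0 < h n" "h n \<le> 1" for n by (auto simp: h_def inverse_le_1_iff)
  have h0: "h \<longlonglongrightarrow> 0" unfolding h_def by (rule LIMSEQ_inverse_real_of_nat)
  define D where "D n x = complex_of_real (1 / h n) * (\<phi> (x + h n *\<^sub>R axis j 1) - \<phi> x)" for n x
  obtain C where C: "\<And>x h. 0 < h \<Longrightarrow> h \<le> 1 \<Longrightarrow> norm (\<phi> (x + h *\<^sub>R axis j 1) - \<phi> x) \<le> h * (C * (1 / (1 + norm x) ^ 6))"
    using schwartz_increment_bound[OF assms] by metis
  have lim1: "(\<lambda>n. LINT x|lborel. cis (- (x \<bullet> xi)) * D n x) \<longlonglongrightarrow> (LINT x|lborel. cis (- (x \<bullet> xi)) * pderiv_dir j \<phi> x)"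
  proof (rule integral_dominated_convergence)
    show "integrable lborel (\<lambda>x::real^3. C * (1 / (1 + norm x) ^ 6))" by (intro integrable_mult_right integrable_weight)
    show "AE x in lborel. (\<lambda>n. cis (- (x \<bullet> xi)) * D n x) \<longlonglongrightarrow> cis (- (x \<bullet> xi)) * pderiv_dir j \<phi> x"
    proof (intro AE_I2 tendsto_mult_left)
      fix x
      have lin: "linear (frechet_derivative \<phi> (at y))" for y
        using schwartz_has_derivative[OF assms] has_derivative_linear by blast
      have "((\<lambda>s. \<phi> (x + s *\<^sub>R axis j 1)) has_derivative (\<lambda>u. frechet_derivative \<phi> (at (x + 0 *\<^sub>R axis j 1)) (u *\<^sub>R axis j 1))) (at 0)"
        by (rule has_derivative_compose[where g=\<phi>, OF _ schwartz_has_derivative[OF assms]]) (auto intro!: derivative_eq_intros)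
      then have "((\<lambda>s. \<phi> (x + s *\<^sub>R axis j 1)) has_vector_derivative pderiv_dir j \<phi> x) (at 0)"
        unfolding has_vector_derivative_def by (simp add: pderiv_dir_def linear_scale[OF lin])
      note vd = this
      have "((\<lambda>s. (\<phi> (x + s *\<^sub>R axis j 1) - \<phi> x) /\<^sub>R s) \<longlongrightarrow> pderiv_dir j \<phi> x) (at 0)"
      proof -
        from vd have l: "(\<lambda>s. norm (\<phi> (x + s *\<^sub>R axis j 1) - \<phi> x - s *\<^sub>R pderiv_dir j \<phi> x) / norm s) \<midarrow>0\<rightarrow> 0"
          unfolding has_vector_derivative_def has_derivative_at by simp
        show ?thesis
        proof (rule LIM_zero_cancel, rule tendsto_norm_zero_cancel, rule Lim_transform_eventually[OF l])
          show "\<forall>\<^sub>F s in at 0. norm (\<phi> (x + s *\<^sub>R axis j 1) - \<phi> x - s *\<^sub>R pderiv_dir j \<phi> x) / norm s = norm ((\<phi> (x + s *\<^sub>R axis j 1) - \<phi> x) /\<^sub>R s - pderiv_dir j \<phi> x)"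
            unfolding eventually_at
          proof (intro exI[of _ 1] conjI ballI impI)
            fix s :: real assume "s \<noteq> 0 \<and> dist s 0 < 1"
            then have "(\<phi> (x + s *\<^sub>R axis j 1) - \<phi> x) /\<^sub>R s - pderiv_dir j \<phi> x = (\<phi> (x + s *\<^sub>R axis j 1) - \<phi> x - s *\<^sub>R pderiv_dir j \<phi> x) /\<^sub>R s"
              by (simp add: scaleR_right_diff_distrib)
            then show "norm (\<phi> (x + s *\<^sub>R axis j 1) - \<phi> x - s *\<^sub>R pderiv_dir j \<phi> x) / norm s = norm ((\<phi> (x + s *\<^sub>R axis j 1) - \<phi> x) /\<^sub>R s - pderiv_dir j \<phi> x)"
              by (simp add: divide_inverse mult.commute)
          qed simp
        qed
      qed
      moreover have "filterlim h (at 0) sequentially" using h0 h(1) unfolding filterlim_at by (intro conjI always_eventually) (auto simp: less_imp_neq[symmetric] less_imp_neq)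
      ultimately have "(\<lambda>n. (\<phi> (x + h n *\<^sub>R axis j 1) - \<phi> x) /\<^sub>R h n) \<longlonglongrightarrow> pderiv_dir j \<phi> x"
        by (rule filterlim_compose)
      then show "(\<lambda>n. D n x) \<longlonglongrightarrow> pderiv_dir j \<phi> x" unfolding D_def by (simp add: scaleR_conv_of_real inverse_eq_divide)
    qed
    show "AE x in lborel. norm (cis (- (x \<bullet> xi)) * D n x) \<le> C * (1 / (1 + norm x) ^ 6)" for n
    proof (intro AE_I2)
      fix x :: "real^3"
      have "norm (cis (- (x \<bullet> xi)) * D n x) = norm (\<phi> (x + h n *\<^sub>R axis j 1) - \<phi> x) / h n"
        using h(1)[of n] by (simp add: D_def norm_mult norm_divide)
      also have "... \<le> C * (1 / (1 + norm x) ^ 6)" using C[OF h[of n], of x] h(1)[of n] by (simp add: pos_divide_le_eq mult.commute)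
      finally show "norm (cis (- (x \<bullet> xi)) * D n x) \<le> C * (1 / (1 + norm x) ^ 6)" .
    qed
  qed (unfold D_def, measurable)
  have eq: "(LINT x|lborel. cis (- (x \<bullet> xi)) * D n x) = ((cis (h n * xi $ j) - 1) / complex_of_real (h n)) * fourier \<phi> xi" for n
  proof -
    have i0: "integrable lborel (\<lambda>x. cis (- (x \<bullet> xi)) * \<phi> x)" by (intro integrable_cis_mult schwartz_integrable assms) simp
    have i1: "integrable lborel (\<lambda>x. cis (- (x \<bullet> xi)) * \<phi> (x + h n *\<^sub>R axis j 1))"
      using lborel_integrable_affine3[of 1 \<phi> "h n *\<^sub>R axis j 1", OF _ schwartz_integrable[OF assms]]
      by (intro integrable_cis_mult) (auto simp: add.commute)
    have "fourier \<phi> xi = (LINT x|lborel. cis (- ((h n *\<^sub>R axis j 1 + x) \<bullet> xi)) * \<phi> (h n *\<^sub>R axis j 1 + x))"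
      unfolding fourier_def by (subst lborel_integral_affine3[where c=1 and t="h n *\<^sub>R axis j 1"]) auto
    also have "... = (LINT x|lborel. cis (- (h n * xi $ j)) * (cis (- (x \<bullet> xi)) * \<phi> (x + h n *\<^sub>R axis j 1)))"
    proof (intro Bochner_Integration.integral_cong refl)
      fix x
      have "cis (- ((h n *\<^sub>R axis j 1 + x) \<bullet> xi)) = cis (- (h n * xi $ j)) * cis (- (x \<bullet> xi))"
        by (simp add: cis_mult inner_add_left inner_axis')
      then show "cis (- ((h n *\<^sub>R axis j 1 + x) \<bullet> xi)) * \<phi> (h n *\<^sub>R axis j 1 + x) = cis (- (h n * xi $ j)) * (cis (- (x \<bullet> xi)) * \<phi> (x + h n *\<^sub>R axis j 1))"
        by (simp add: add.commute)
    qed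
    also have "... = cis (- (h n * xi $ j)) * (LINT x|lborel. cis (- (x \<bullet> xi)) * \<phi> (x + h n *\<^sub>R axis j 1))" by simp
    finally have s: "(LINT x|lborel. cis (- (x \<bullet> xi)) * \<phi> (x + h n *\<^sub>R axis j 1)) = cis (h n * xi $ j) * fourier \<phi> xi"
      by (simp add: mult.assoc[symmetric] cis_mult)
    have "(LINT x|lborel. cis (- (x \<bullet> xi)) * D n x)
      = (LINT x|lborel. complex_of_real (1 / h n) * (cis (- (x \<bullet> xi)) * \<phi> (x + h n *\<^sub>R axis j 1) - cis (- (x \<bullet> xi)) * \<phi> x))"
      by (intro Bochner_Integration.integral_cong) (auto simp: D_def algebra_simps)
    also have "... = complex_of_real (1 / h n) * ((LINT x|lborel. cis (- (x \<bullet> xi)) * \<phi> (x + h n *\<^sub>R axis j 1)) - (LINT x|lborel. cis (- (x \<bullet> xi)) * \<phi> x))"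
      by (simp only: integral_mult_right_zero Bochner_Integration.integral_diff[OF i1 i0])
    finally have e: "(LINT x|lborel. cis (- (x \<bullet> xi)) * D n x) = complex_of_real (1 / h n) * (cis (h n * xi $ j) * fourier \<phi> xi - fourier \<phi> xi)"
      unfolding s by (simp only: fourier_def)
    show ?thesis unfolding e by (simp add: left_diff_distrib)
  qed
  have lim0: "(\<lambda>n. (cis (h n * xi $ j) - 1) / complex_of_real (h n) - \<i> * complex_of_real (xi $ j)) \<longlonglongrightarrow> 0"
  proof (rule Lim_null_comparison)
    show "\<forall>\<^sub>F n in sequentially. norm ((cis (h n * xi $ j) - 1) / complex_of_real (h n) - \<i> * complex_of_real (xi $ j)) \<le> h n * (xi $ j)\<^sup>2"
    proof (intro always_eventually allI)
      fix n
      have "(cis (h n * xi $ j) - 1) / complex_of_real (h n) - \<i> * complex_of_real (xi $ j) = (cis (h n * xi $ j) - 1 - \<i> * complex_of_real (h n * xi $ j)) / complex_of_real (h n)"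
        using h(1)[of n] by (simp add: field_simps)
      also have "norm ... \<le> (h n * xi $ j)\<^sup>2 / h n"
        using h(1)[of n] cis_approx[of "h n * xi $ j"] by (simp add: norm_divide divide_right_mono)
      also have "... = h n * (xi $ j)\<^sup>2" using h(1)[of n] by (simp add: power2_eq_square)
      finally show "norm ((cis (h n * xi $ j) - 1) / complex_of_real (h n) - \<i> * complex_of_real (xi $ j)) \<le> h n * (xi $ j)\<^sup>2" .
    qed
    show "(\<lambda>n. h n * (xi $ j)\<^sup>2) \<longlonglongrightarrow> 0" using tendsto_mult_right[OF h0, of "(xi $ j)\<^sup>2"] by simp
  qed
  have "(\<lambda>n. ((cis (h n * xi $ j) - 1) / complex_of_real (h n)) * fourier \<phi> xi) \<longlonglongrightarrow> \<i> * complex_of_real (xi $ j) * fourier \<phi> xi"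
    by (intro tendsto_mult_right LIM_zero_cancel[OF lim0])
  from LIMSEQ_unique[OF lim1[unfolded eq] this] show ?thesis unfolding fourier_def[of "pderiv_dir j \<phi>"] .
qed

lemma norm_le_sum_coord3: "norm (x::real^3) \<le> (\<Sum>j\<in>UNIV. \<bar>x $ j\<bar>)"
  by (rule norm_le_l1_cart)

text \<open>Each power of \<open>|xi|\<close> is paid for by one derivative of \<open>\<phi>\<close>, whence
  the induction over all Schwartz functions at once.\<close>
lemma fourier_rapid: "\<phi> \<in> schwartz \<Longrightarrow> rapid (fourier \<phi>)"
  unfolding rapid_def
proof
  fix N show "\<phi> \<in> schwartz \<Longrightarrow> \<exists>C. \<forall>x. (1 + norm x) ^ N * norm (fourier \<phi> x) \<le> C"
  proof (induction N arbitrary: \<phi>)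
    case 0 then show ?case using fourier_norm_le[OF schwartz_integrable] by auto
  next
    case (Suc N)
    obtain C where C: "\<And>x. (1 + norm x) ^ N * norm (fourier \<phi> x) \<le> C" using Suc by blast
    have "\<exists>D. \<forall>x. (1 + norm x) ^ N * norm (fourier (pderiv_dir j \<phi>) x) \<le> D" for j using Suc schwartz_pderiv by blast
    then obtain D where D: "\<And>j x. (1 + norm x) ^ N * norm (fourier (pderiv_dir j \<phi>) x) \<le> D j" by metis
    have "(1 + norm x) ^ Suc N * norm (fourier \<phi> x) \<le> C + (\<Sum>j\<in>UNIV. D j)" for x
    proof -
      have "(1 + norm x) ^ Suc N * norm (fourier \<phi> x) = (1 + norm x) ^ N * norm (fourier \<phi> x) + norm x * ((1 + norm x) ^ N * norm (fourier \<phi> x))"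
        by (simp add: algebra_simps)
      also have "norm x * ((1 + norm x) ^ N * norm (fourier \<phi> x)) \<le> (\<Sum>j\<in>UNIV. \<bar>x $ j\<bar>) * ((1 + norm x) ^ N * norm (fourier \<phi> x))"
        by (intro mult_right_mono norm_le_sum_coord3) auto
      also have "... = (\<Sum>j\<in>UNIV. (1 + norm x) ^ N * norm (fourier (pderiv_dir j \<phi>) x))"
        unfolding fourier_of_pderiv[OF Suc.prems] sum_distrib_right by (intro sum.cong) (auto simp: norm_mult)
      also have "... \<le> (\<Sum>j\<in>UNIV. D j)" by (intro sum_mono D)
      finally show ?thesis using C[of x] by simp
    qed
    then show ?case by blast
  qed
qed

lemma fourier_schwartz: assumes "\<phi> \<in> schwartz" shows "fourier \<phi> \<in> schwartz"
proof (rule schwartz_coinduct[where S="fourier ` schwartz"])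
  fix f x assume "f \<in> fourier ` schwartz"
  then show "f differentiable at x" using fourier_has_derivative unfolding differentiable_def by blast
next
  fix f assume "f \<in> fourier ` schwartz" then show "rapid f" using fourier_rapid by blast
next
  fix f j assume "f \<in> fourier ` schwartz"
  then obtain \<psi> where \<psi>: "\<psi> \<in> schwartz" "f = fourier \<psi>" by blast
  show "pderiv_dir j f \<in> fourier ` schwartz"
    unfolding \<psi>(2) fourier_pderiv[OF \<psi>(1)] by (intro imageI schwartz_cmult[OF schwartz_coord[OF \<psi>(1)]])
qed (use assms in blast)

lemma inv_fourier_conv: "inv_fourier \<phi> = (\<lambda>x. complex_of_real (1 / (2 * pi) ^ 3) * fourier \<phi> (- x))"
  by (simp add: inv_fourier_def fourier_def inner_commute)

lemma inv_fourier_schwartz: "\<phi> \<in> schwartz \<Longrightarrow> inv_fourier \<phi> \<in> schwartz"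
  unfolding inv_fourier_conv by (intro schwartz_cmult schwartz_reflect fourier_schwartz)

section \<open>Fourier inversion\<close>

lemma integrable_nn_norm:
  fixes f :: "'a \<Rightarrow> 'b::{banach,second_countable_topology}"
  shows "integrable M f \<Longrightarrow> (\<integral>\<^sup>+x. ennreal (norm (f x)) \<partial>M) < \<infinity>"
  unfolding integrable_iff_bounded by blast

lemma integrable_pairI:
  fixes f :: "'a::euclidean_space \<times> 'b::euclidean_space \<Rightarrow> 'c::{banach,second_countable_topology}"
  assumes [measurable]: "f \<in> borel_measurable (lborel \<Otimes>\<^sub>M lborel)"
    and "(\<integral>\<^sup>+x. \<integral>\<^sup>+y. ennreal (norm (f (x, y))) \<partial>lborel \<partial>lborel) < \<infinity>"
  shows "integrable (lborel \<Otimes>\<^sub>M lborel) f"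
  by (rule integrableI_bounded) (use assms(2) in \<open>auto simp: lborel.nn_integral_fst[symmetric]\<close>)

lemma integrable_pair_bound:
  fixes f :: "'a::euclidean_space \<times> 'b::euclidean_space \<Rightarrow> 'c::{banach,second_countable_topology}"
    and g :: "'a \<Rightarrow> 'd::{banach,second_countable_topology}" and h :: "'b \<Rightarrow> 'e::{banach,second_countable_topology}"
  assumes [measurable]: "f \<in> borel_measurable (lborel \<Otimes>\<^sub>M lborel)"
    and g: "integrable lborel g" and h: "integrable lborel h"
    and le: "\<And>x y. norm (f (x, y)) \<le> norm (g x) * norm (h y)"
  shows "integrable (lborel \<Otimes>\<^sub>M lborel) f"
proof (rule integrable_pairI)
  have [measurable]: "g \<in> borel_measurable borel" "h \<in> borel_measurable borel" using g h by auto
  have "(\<integral>\<^sup>+x. \<integral>\<^sup>+y. ennreal (norm (f (x, y))) \<partial>lborel \<partial>lborel)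
    \<le> (\<integral>\<^sup>+x. \<integral>\<^sup>+y. ennreal (norm (g x)) * ennreal (norm (h y)) \<partial>lborel \<partial>lborel)"
    using le by (intro nn_integral_mono) (simp add: ennreal_mult[symmetric] ennreal_leI)
  also have "... = (\<integral>\<^sup>+x. ennreal (norm (g x)) \<partial>lborel) * (\<integral>\<^sup>+y. ennreal (norm (h y)) \<partial>lborel)"
    by (simp add: nn_integral_cmult nn_integral_multc)
  also have "... < \<infinity>" using integrable_nn_norm[OF g] integrable_nn_norm[OF h] by (simp add: ennreal_mult_less_top)
  finally show "(\<integral>\<^sup>+x. \<integral>\<^sup>+y. ennreal (norm (f (x, y))) \<partial>lborel \<partial>lborel) < \<infinity>" .
qed measurable

definition gauss :: "real^3 \<Rightarrow> real" where "gauss x = exp (- (norm x)\<^sup>2 / 2)"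
definition gauss_mass :: real where "gauss_mass = sqrt (2 * pi) ^ 3"

lemma gauss_measurable[measurable]: "gauss \<in> borel_measurable borel"
  unfolding gauss_def by measurable

lemma gauss_pos: "gauss x > 0" by (simp add: gauss_def)
lemma gauss_le1: "gauss x \<le> 1" by (simp add: gauss_def)
lemma gauss_0: "gauss 0 = 1" by (simp add: gauss_def)
lemma gauss_mass_pos: "gauss_mass > 0" by (simp add: gauss_mass_def)
lemma gauss_mass_sq: "gauss_mass * gauss_mass = (2 * pi) ^ 3"
  by (simp add: gauss_mass_def power_mult_distrib[symmetric])

text \<open>This is the characteristic function of the standard normal distribution, without its
  normalisation.\<close>
lemma gauss1_fourier:
  "integrable lborel (\<lambda>x::real. complex_of_real (exp (- x\<^sup>2 / 2)) * iexp (t * x))"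
  "(LINT x|lborel. complex_of_real (exp (- x\<^sup>2 / 2)) * iexp (t * x)) = complex_of_real (sqrt (2 * pi) * exp (- t\<^sup>2 / 2))"
proof -
  have e: "complex_of_real (exp (- x\<^sup>2 / 2)) * iexp (t * x) = complex_of_real (sqrt (2 * pi)) * (std_normal_density x *\<^sub>R iexp (t * x))" for x
    by (simp add: std_normal_density_def scaleR_conv_of_real)
  have i: "integrable lborel (\<lambda>x. std_normal_density x *\<^sub>R iexp (t * x))"
    by (rule Bochner_Integration.integrable_bound[OF integrable_normal_density[where \<mu>=0 and \<sigma>=1]]) auto
  show "integrable lborel (\<lambda>x::real. complex_of_real (exp (- x\<^sup>2 / 2)) * iexp (t * x))"
    unfolding e by (intro integrable_mult_right i)
  have "complex_of_real (exp (- (t^2) / 2)) = (LINT x|density lborel std_normal_density. iexp (t * x))"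
    using char_std_normal_distribution unfolding char_def by metis
  also have "... = (LINT x|lborel. std_normal_density x *\<^sub>R iexp (t * x))"
    by (subst integral_density) auto
  finally have "(LINT x|lborel. std_normal_density x *\<^sub>R iexp (t * x)) = complex_of_real (exp (- (t^2) / 2))" by simp
  then show "(LINT x|lborel. complex_of_real (exp (- x\<^sup>2 / 2)) * iexp (t * x)) = complex_of_real (sqrt (2 * pi) * exp (- t\<^sup>2 / 2))"
    unfolding e integral_mult_right_zero by simp
qed

lemma gauss_fourier:
  "integrable lborel (\<lambda>x::real^3. complex_of_real (gauss x) * cis (x \<bullet> xi))"
  "(LINT x::real^3|lborel. complex_of_real (gauss x) * cis (x \<bullet> xi)) = complex_of_real (gauss_mass * gauss xi)"
proof -
  have e: "complex_of_real (gauss x) * cis (x \<bullet> xi) = (\<Prod>b\<in>Basis. complex_of_real (exp (- (x \<bullet> b)\<^sup>2 / 2)) * iexp ((xi \<bullet> b) * (x \<bullet> b)))" for x :: "real^3"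
  proof -
    have g: "gauss y = (\<Prod>b\<in>Basis. exp (- (y \<bullet> b)\<^sup>2 / 2))" for y :: "real^3"
      unfolding gauss_def exp_sum[OF finite_Basis, symmetric] power2_norm_eq_inner
      by (subst euclidean_inner) (simp add: sum_negf sum_divide_distrib power2_eq_square)
    have "cis (x \<bullet> xi) = exp (\<i> * complex_of_real (\<Sum>b\<in>Basis. (x \<bullet> b) * (xi \<bullet> b)))"
      by (simp add: cis_conv_exp euclidean_inner[of x xi])
    also have "... = exp (\<Sum>b\<in>Basis. \<i> * complex_of_real ((xi \<bullet> b) * (x \<bullet> b)))"
      unfolding of_real_sum sum_distrib_left by (simp add: mult.commute)
    also have "... = (\<Prod>b\<in>Basis. iexp ((xi \<bullet> b) * (x \<bullet> b)))" by (rule exp_sum) simp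
    finally show ?thesis unfolding g prod.distrib by simp
  qed
  show "integrable lborel (\<lambda>x::real^3. complex_of_real (gauss x) * cis (x \<bullet> xi))"
    unfolding e using integrable_lborel_product[of "\<lambda>b x. complex_of_real (exp (- x\<^sup>2 / 2)) * iexp ((xi \<bullet> b) * x)", OF gauss1_fourier(1)] .
  have g: "gauss xi = (\<Prod>b\<in>Basis. exp (- (xi \<bullet> b)\<^sup>2 / 2))"
    unfolding gauss_def exp_sum[OF finite_Basis, symmetric] power2_norm_eq_inner
    by (subst euclidean_inner) (simp add: sum_negf sum_divide_distrib power2_eq_square)
  have "(LINT x::real^3|lborel. complex_of_real (gauss x) * cis (x \<bullet> xi)) = (\<Prod>b\<in>(Basis::(real^3) set). complex_of_real (sqrt (2 * pi) * exp (- (xi \<bullet> b)\<^sup>2 / 2)))"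
    unfolding e using integral_lborel_product[of "\<lambda>b x. complex_of_real (exp (- x\<^sup>2 / 2)) * iexp ((xi \<bullet> b) * x)", OF gauss1_fourier(1)]
    unfolding gauss1_fourier(2) .
  also have "... = complex_of_real (gauss_mass * gauss xi)"
    by (simp add: g prod.distrib gauss_mass_def del: of_real_mult add: of_real_mult[symmetric] of_real_prod[symmetric])
  finally show "(LINT x::real^3|lborel. complex_of_real (gauss x) * cis (x \<bullet> xi)) = complex_of_real (gauss_mass * gauss xi)" .
qed

lemma gauss_integral: "integrable lborel gauss" "(LINT x|lborel. gauss x) = gauss_mass"
proof -
  have i: "integrable lborel (\<lambda>x. complex_of_real (gauss x))" using gauss_fourier(1)[of 0] by simp
  then show "integrable lborel gauss" using complex_of_real_integrable_eq by blast
  have "(LINT x|lborel. complex_of_real (gauss x)) = complex_of_real gauss_mass"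
    using gauss_fourier(2)[of 0] by (simp add: gauss_0)
  then show "(LINT x|lborel. gauss x) = gauss_mass" by (simp add: integral_complex_of_real)
qed

text \<open>Gaussians of width \<open>h\<close> form an approximate identity as \<open>h\<close> tends to 0,
  up to the factor \<open>gauss_mass\<close>.\<close>
lemma gauss_approx:
  fixes \<psi> :: "real^3 \<Rightarrow> complex"
  assumes cont: "continuous_on UNIV \<psi>" and bd: "\<And>x. norm (\<psi> x) \<le> B" and h0: "h \<longlonglongrightarrow> 0"
  shows "(\<lambda>n. LINT z|lborel. complex_of_real (gauss z) * \<psi> (x + h n *\<^sub>R z)) \<longlonglongrightarrow> complex_of_real gauss_mass * \<psi> x"
proof -
  have [measurable]: "\<psi> \<in> borel_measurable borel" using cont by (rule borel_measurable_continuous_onI)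
  have "(\<lambda>n. LINT z|lborel. complex_of_real (gauss z) * \<psi> (x + h n *\<^sub>R z)) \<longlonglongrightarrow> (LINT z|lborel. complex_of_real (gauss z) * \<psi> x)"
  proof (rule integral_dominated_convergence)
    show "integrable lborel (\<lambda>x. B * gauss x)" by (intro integrable_mult_right gauss_integral)
    show "AE z in lborel. (\<lambda>n. complex_of_real (gauss z) * \<psi> (x + h n *\<^sub>R z)) \<longlonglongrightarrow> complex_of_real (gauss z) * \<psi> x"
    proof (intro AE_I2 tendsto_mult_left)
      fix z
      have "(\<lambda>n. x + h n *\<^sub>R z) \<longlonglongrightarrow> x + 0 *\<^sub>R z" by (intro tendsto_intros h0)
      then have "(\<lambda>n. x + h n *\<^sub>R z) \<longlonglongrightarrow> x" by simp
      then show "(\<lambda>n. \<psi> (x + h n *\<^sub>R z)) \<longlonglongrightarrow> \<psi> x"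
        using cont continuous_on_eq_continuous_at[OF open_UNIV] by (intro isCont_tendsto_compose[of x \<psi>]) auto
    qed
    show "AE z in lborel. norm (complex_of_real (gauss z) * \<psi> (x + h n *\<^sub>R z)) \<le> B * gauss z" for n
      using bd gauss_pos by (intro AE_I2) (simp add: norm_mult less_imp_le mult.commute mult_right_mono)
  qed measurable
  then show ?thesis by (simp add: gauss_integral integral_complex_of_real)
qed

lemma gauss_scaled_fourier:
  assumes "h > 0"
  shows "(LINT xi|lborel. complex_of_real (gauss (h *\<^sub>R xi)) * cis (xi \<bullet> z)) = complex_of_real (gauss_mass * gauss ((1 / h) *\<^sub>R z) / h ^ 3)"
proof -
  have "(LINT xi|lborel. complex_of_real (gauss (h *\<^sub>R xi)) * cis (xi \<bullet> z))
    = (1/h)^3 *\<^sub>R (LINT xi|lborel. complex_of_real (gauss xi) * cis (xi \<bullet> ((1/h) *\<^sub>R z)))"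
    using assms by (subst lborel_integral_affine3[where c="1/h" and t=0]) auto
  then show ?thesis unfolding gauss_fourier(2) using assms by (simp add: scaleR_conv_of_real power_divide)
qed

text \<open>The inverse transform is regularised by the factor \<open>gauss (h xi)\<close>. After exchanging
  the integrals the inner one is again a Gaussian, of width \<open>h\<close>, so that the regularised integral
  is an average of \<open>\<phi>\<close> near \<open>x\<close>; then \<open>h\<close> tends to 0 on both
  sides.\<close>
lemma fourier_inversion:
  assumes "\<phi> \<in> schwartz" shows "inv_fourier (fourier \<phi>) = \<phi>"
proof
  fix x
  note [measurable] = schwartz_measurable[OF assms] schwartz_measurable[OF fourier_schwartz[OF assms]]
  define h where "h n = inverse (real (Suc n))" for n
  have h: "0 < h n" for n by (auto simp: h_def)
  have h0: "h \<longlonglongrightarrow> 0" unfolding h_def by (rule LIMSEQ_inverse_real_of_nat)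
  obtain B where B: "\<And>x. norm (\<phi> x) \<le> B" using rapidE[OF schwartz_rapid[OF assms], of 0] by auto
  have lim1: "(\<lambda>n. LINT xi|lborel. complex_of_real (gauss (h n *\<^sub>R xi)) * (cis (x \<bullet> xi) * fourier \<phi> xi)) \<longlonglongrightarrow> (LINT xi|lborel. cis (x \<bullet> xi) * fourier \<phi> xi)"
  proof (rule integral_dominated_convergence)
    show "integrable lborel (\<lambda>xi. norm (fourier \<phi> xi))" by (intro integrable_norm schwartz_integrable fourier_schwartz assms)
    show "AE xi in lborel. (\<lambda>n. complex_of_real (gauss (h n *\<^sub>R xi)) * (cis (x \<bullet> xi) * fourier \<phi> xi)) \<longlonglongrightarrow> cis (x \<bullet> xi) * fourier \<phi> xi"
    proof (intro AE_I2)
      fix xi :: "real^3"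
      have "isCont (\<lambda>s. gauss (s *\<^sub>R xi)) 0" unfolding gauss_def by (intro continuous_intros) auto
      from isCont_tendsto_compose[OF this h0] have "(\<lambda>n. gauss (h n *\<^sub>R xi)) \<longlonglongrightarrow> 1" by (simp add: gauss_0)
      then have "(\<lambda>n. complex_of_real (gauss (h n *\<^sub>R xi)) * (cis (x \<bullet> xi) * fourier \<phi> xi)) \<longlonglongrightarrow> complex_of_real 1 * (cis (x \<bullet> xi) * fourier \<phi> xi)"
        by (intro tendsto_mult_right tendsto_of_real)
      then show "(\<lambda>n. complex_of_real (gauss (h n *\<^sub>R xi)) * (cis (x \<bullet> xi) * fourier \<phi> xi)) \<longlonglongrightarrow> cis (x \<bullet> xi) * fourier \<phi> xi" by simp
    qed
    show "AE xi in lborel. norm (complex_of_real (gauss (h n *\<^sub>R xi)) * (cis (x \<bullet> xi) * fourier \<phi> xi)) \<le> norm (fourier \<phi> xi)" for n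
      using gauss_pos gauss_le1 by (intro AE_I2) (simp add: norm_mult less_imp_le mult_left_le_one_le)
  qed measurable
  have eq: "(LINT xi|lborel. complex_of_real (gauss (h n *\<^sub>R xi)) * (cis (x \<bullet> xi) * fourier \<phi> xi))
     = complex_of_real gauss_mass * (LINT z|lborel. complex_of_real (gauss z) * \<phi> (x + h n *\<^sub>R z))" for n
  proof -
    define F where "F = (\<lambda>(xi, y). complex_of_real (gauss (h n *\<^sub>R xi)) * (cis (xi \<bullet> (x - y)) * \<phi> y))"
    have gi: "integrable lborel (\<lambda>xi. gauss (h n *\<^sub>R xi))"
      using lborel_integrable_affine3[of "h n" gauss 0] h[of n] gauss_integral(1) by simp
    have Fi: "integrable (lborel \<Otimes>\<^sub>M lborel) F"
    proof (rule integrable_pair_bound[OF _ gi schwartz_integrable[OF assms]])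
      show "F \<in> borel_measurable (lborel \<Otimes>\<^sub>M lborel)" unfolding F_def by measurable
    qed (simp add: F_def norm_mult)
    have "(LINT xi|lborel. complex_of_real (gauss (h n *\<^sub>R xi)) * (cis (x \<bullet> xi) * fourier \<phi> xi)) = (LINT xi|lborel. LINT y|lborel. F (xi, y))"
    proof (intro Bochner_Integration.integral_cong refl)
      fix xi
      have "(LINT y|lborel. F (xi, y)) = (LINT y|lborel. complex_of_real (gauss (h n *\<^sub>R xi)) * cis (x \<bullet> xi) * (cis (- (y \<bullet> xi)) * \<phi> y))"
      proof (intro Bochner_Integration.integral_cong refl)
        fix y
        have "cis (xi \<bullet> (x - y)) = cis (x \<bullet> xi) * cis (- (y \<bullet> xi))" by (simp add: cis_mult inner_diff_right inner_commute)
        then show "F (xi, y) = complex_of_real (gauss (h n *\<^sub>R xi)) * cis (x \<bullet> xi) * (cis (- (y \<bullet> xi)) * \<phi> y)" by (simp add: F_def)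
      qed
      then show "complex_of_real (gauss (h n *\<^sub>R xi)) * (cis (x \<bullet> xi) * fourier \<phi> xi) = (LINT y|lborel. F (xi, y))"
        by (simp add: fourier_def)
    qed
    also have "... = (LINT y|lborel. LINT xi|lborel. F (xi, y))"
      using lborel_pair.Fubini_integral[of "\<lambda>x y. F (x, y)"] Fi by simp
    also have "... = (LINT y|lborel. complex_of_real (gauss_mass * gauss ((1 / h n) *\<^sub>R (x - y)) / h n ^ 3) * \<phi> y)"
    proof (intro Bochner_Integration.integral_cong refl)
      fix y
      have "(LINT xi|lborel. F (xi, y)) = (LINT xi|lborel. complex_of_real (gauss (h n *\<^sub>R xi)) * cis (xi \<bullet> (x - y)) * \<phi> y)"
        by (simp add: F_def mult.assoc)
      then show "(LINT xi|lborel. F (xi, y)) = complex_of_real (gauss_mass * gauss ((1 / h n) *\<^sub>R (x - y)) / h n ^ 3) * \<phi> y"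
        using gauss_scaled_fourier[OF h[of n], of "x - y"] by simp
    qed
    also have "... = \<bar>h n\<bar>^3 *\<^sub>R (LINT z|lborel. complex_of_real (gauss_mass * gauss ((1 / h n) *\<^sub>R (x - (x + h n *\<^sub>R z))) / h n ^ 3) * \<phi> (x + h n *\<^sub>R z))"
      using h[of n] by (subst lborel_integral_affine3[where c="h n" and t=x]) auto
    also have "... = \<bar>h n\<bar>^3 *\<^sub>R (LINT z|lborel. complex_of_real (gauss_mass / h n ^ 3) * (complex_of_real (gauss z) * \<phi> (x + h n *\<^sub>R z)))"
      using h[of n] by (intro arg_cong2[where f="(*\<^sub>R)"] Bochner_Integration.integral_cong refl) (simp add: gauss_def)
    also have "... = complex_of_real gauss_mass * (LINT z|lborel. complex_of_real (gauss z) * \<phi> (x + h n *\<^sub>R z))"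
      using h[of n] by (simp add: scaleR_conv_of_real)
    finally show ?thesis .
  qed
  have "(\<lambda>n. complex_of_real gauss_mass * (LINT z|lborel. complex_of_real (gauss z) * \<phi> (x + h n *\<^sub>R z))) \<longlonglongrightarrow> complex_of_real gauss_mass * (complex_of_real gauss_mass * \<phi> x)"
    by (intro tendsto_mult_left gauss_approx[OF schwartz_continuous[OF assms] B h0])
  from LIMSEQ_unique[OF lim1[unfolded eq] this]
  have "(LINT xi|lborel. cis (x \<bullet> xi) * fourier \<phi> xi) = complex_of_real ((2 * pi) ^ 3) * \<phi> x"
    by (simp only: mult.assoc[symmetric] of_real_mult[symmetric] gauss_mass_sq)
  then show "inv_fourier (fourier \<phi>) x = \<phi> x" by (simp add: inv_fourier_def)
qed

lemma fourier_reflect: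
  assumes [measurable]: "f \<in> borel_measurable borel"
  shows "fourier (\<lambda>x. f (- x)) xi = fourier f (- xi)"
  unfolding fourier_def by (subst lborel_integral_affine3[where c="-1" and t=0]) auto

lemma fourier_inversion':
  assumes "\<phi> \<in> schwartz" shows "fourier (inv_fourier \<phi>) = \<phi>"
proof
  fix x
  note [measurable] = schwartz_measurable[OF fourier_schwartz[OF assms]]
  have "fourier (inv_fourier \<phi>) x = complex_of_real (1 / (2 * pi) ^ 3) * fourier (\<lambda>x. fourier \<phi> (- x)) x"
    unfolding inv_fourier_conv by (simp add: fourier_def mult.left_commute)
  also have "... = inv_fourier (fourier \<phi>) x"
    unfolding inv_fourier_conv[of "fourier \<phi>"] by (subst fourier_reflect) auto
  finally show "fourier (inv_fourier \<phi>) x = \<phi> x" by (simp add: fourier_inversion[OF assms])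
qed

section \<open>Uniqueness of the function representing a distribution\<close>

lemma gauss_pow_bound: "\<exists>C. \<forall>x. (1 + norm x) ^ N * gauss x \<le> C"
proof -
  have "((\<lambda>r::real. (1 + r) ^ N * exp (- r\<^sup>2 / 2)) \<longlongrightarrow> 0) at_top" by real_asymp
  then have "eventually (\<lambda>r::real. (1 + r) ^ N * exp (- r\<^sup>2 / 2) < 1) at_top" by (rule order_tendstoD) simp
  then obtain R where R: "\<And>r::real. r \<ge> R \<Longrightarrow> (1 + r) ^ N * exp (- r\<^sup>2 / 2) < 1" by (auto simp: eventually_at_top_linorder)
  have "(1 + norm x) ^ N * gauss x \<le> (1 + \<bar>R\<bar>) ^ N + 1" for x :: "real^3"
  proof (cases "norm x \<ge> R")
    case True then show ?thesis using R[of "norm x"] by (simp add: gauss_def add.commute add_increasing2)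
  next
    case False
    then have "(1 + norm x) ^ N \<le> (1 + \<bar>R\<bar>) ^ N" by (intro power_mono) auto
    moreover have "(1 + norm x) ^ N * gauss x \<le> (1 + norm x) ^ N" using gauss_le1[of x] by (simp add: mult_left_le)
    ultimately show ?thesis by simp
  qed
  then show ?thesis by blast
qed

text \<open>Products of a polynomial with two Gaussians, one centred at the origin and one at
  \<open>y\<close>. The set is closed under derivatives, which makes its members Schwartz functions. The
  second Gaussian is the test function; the first one will make an arbitrary representing function
  integrable.\<close>
inductive_set gauss_poly :: "real \<Rightarrow> real^3 \<Rightarrow> (real^3 \<Rightarrow> complex) set" for a y where
  gp_base: "(\<lambda>x. complex_of_real (gauss x * gauss (a *\<^sub>R (x - y)))) \<in> gauss_poly a y"
| gp_coord: "f \<in> gauss_poly a y \<Longrightarrow> (\<lambda>x. complex_of_real (x $ i) * f x) \<in> gauss_poly a y"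
| gp_lin: "f \<in> gauss_poly a y \<Longrightarrow> g \<in> gauss_poly a y \<Longrightarrow> (\<lambda>x. c * f x + d * g x) \<in> gauss_poly a y"

lemma gauss_has_derivative: "(gauss has_derivative (\<lambda>h. - (x \<bullet> h) * gauss x)) (at x)"
proof -
  have "((\<lambda>x. exp (- (x \<bullet> x) / 2)) has_derivative (\<lambda>h. - (x \<bullet> h) * exp (- (x \<bullet> x) / 2))) (at x)"
    by (auto intro!: derivative_eq_intros simp: inner_commute)
  then show ?thesis unfolding gauss_def[abs_def] power2_norm_eq_inner .
qed

lemma gauss_poly_derivative:
  assumes "f \<in> gauss_poly a y"
  shows "\<exists>D. (\<forall>x. (f has_derivative (\<lambda>h. D x h)) (at x)) \<and> (\<forall>j. (\<lambda>x. D x (axis j 1)) \<in> gauss_poly a y)"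
  using assms
proof induction
  case gp_base
  let ?E = "\<lambda>x. complex_of_real (gauss x * gauss (a *\<^sub>R (x - y)))"
  \<comment> \<open>The factor of \<open>?E x\<close> is the logarithmic derivative of the product of the two Gaussians.\<close>
  let ?D = "\<lambda>x h. complex_of_real (- (x \<bullet> h) - a\<^sup>2 * ((x - y) \<bullet> h)) * ?E x"
  have "(?E has_derivative ?D x) (at x)" for x
  proof -
    have "((\<lambda>x. gauss (a *\<^sub>R (x - y))) has_derivative (\<lambda>h. - ((a *\<^sub>R (x - y)) \<bullet> (a *\<^sub>R h)) * gauss (a *\<^sub>R (x - y)))) (at x)"
      by (rule has_derivative_compose[where g=gauss, OF _ gauss_has_derivative]) (auto intro!: derivative_eq_intros)
    from has_derivative_mult[OF gauss_has_derivative this]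
    have "((\<lambda>x. gauss x * gauss (a *\<^sub>R (x - y))) has_derivative (\<lambda>h. (- (x \<bullet> h) - a\<^sup>2 * ((x - y) \<bullet> h)) * (gauss x * gauss (a *\<^sub>R (x - y))))) (at x)"
      by (rule has_derivative_eq_rhs) (simp add: fun_eq_iff algebra_simps power2_eq_square)
    from bounded_linear.has_derivative[OF bounded_linear_of_real[where 'a=complex] this] show ?thesis by simp
  qed
  moreover have "(\<lambda>x. ?D x (axis j 1)) \<in> gauss_poly a y" for j
  proof -
    have "(\<lambda>x. ?D x (axis j 1)) = (\<lambda>x. complex_of_real (-1 - a\<^sup>2) * (complex_of_real (x $ j) * ?E x) + complex_of_real (a\<^sup>2 * y $ j) * ?E x)"
      by (simp add: fun_eq_iff inner_axis algebra_simps)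
    also have "... \<in> gauss_poly a y" by (intro gauss_poly.intros)
    finally show ?thesis .
  qed
  ultimately show ?case by (intro exI[of _ ?D]) blast
next
  case (gp_coord f i)
  then obtain D where D: "\<And>x. (f has_derivative (\<lambda>h. D x h)) (at x)" "\<And>j. (\<lambda>x. D x (axis j 1)) \<in> gauss_poly a y" by blast
  let ?D = "\<lambda>x h. complex_of_real (x $ i) * D x h + complex_of_real (h $ i) * f x"
  have "((\<lambda>x. complex_of_real (x $ i) * f x) has_derivative ?D x) (at x)" for x
    by (auto intro!: derivative_eq_intros D(1) bounded_linear.has_derivative[OF bounded_linear_of_real] bounded_linear_imp_has_derivative bounded_linear_vec_nth)
  moreover have "(\<lambda>x. ?D x (axis j 1)) \<in> gauss_poly a y" for j
  proof -
    have "(\<lambda>x. ?D x (axis j 1)) = (\<lambda>x. 1 * (complex_of_real (x $ i) * D x (axis j 1)) + (if i = j then 1 else 0) * f x)"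
      by (auto simp: fun_eq_iff axis_def)
    also have "... \<in> gauss_poly a y" by (intro gauss_poly.intros D(2) gp_coord.hyps)
    finally show ?thesis .
  qed
  ultimately show ?case by (intro exI[of _ ?D]) blast
next
  case (gp_lin f g c d)
  then obtain D1 D2 where D1: "\<And>x. (f has_derivative (\<lambda>h. D1 x h)) (at x)" "\<And>j. (\<lambda>x. D1 x (axis j 1)) \<in> gauss_poly a y"
    and D2: "\<And>x. (g has_derivative (\<lambda>h. D2 x h)) (at x)" "\<And>j. (\<lambda>x. D2 x (axis j 1)) \<in> gauss_poly a y" by blast
  let ?D = "\<lambda>x h. c * D1 x h + d * D2 x h"
  have "((\<lambda>x. c * f x + d * g x) has_derivative ?D x) (at x)" for x
    by (intro has_derivative_add has_derivative_mult_right D1 D2)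
  moreover have "(\<lambda>x. ?D x (axis j 1)) \<in> gauss_poly a y" for j
    by (intro gauss_poly.intros D1(2) D2(2))
  ultimately show ?case by (intro exI[of _ ?D]) blast
qed

lemma gauss_poly_rapid: "f \<in> gauss_poly a y \<Longrightarrow> rapid f"
proof (induction rule: gauss_poly.induct)
  case gp_base
  have "rapid (\<lambda>x. complex_of_real (gauss x))" using gauss_pow_bound gauss_pos by (auto simp: rapid_def less_imp_le)
  then show ?case
    by (rule rapid_bound_mult[where C=1 and k=0]) (use gauss_pos gauss_le1 in \<open>auto simp: norm_mult less_imp_le intro!: mult_right_le_one_le\<close>)
qed (auto intro: rapid_coord rapid_add rapid_cmult)

lemma gauss_schwartz: "(\<lambda>x. complex_of_real (gauss x * gauss (a *\<^sub>R (x - y)))) \<in> schwartz"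
proof (rule schwartz_coinduct[where S="gauss_poly a y"])
  fix f x assume "f \<in> gauss_poly a y"
  then show "f differentiable at x" using gauss_poly_derivative unfolding differentiable_def by blast
next
  fix f j assume "f \<in> gauss_poly a y"
  then obtain D where D: "\<And>x. (f has_derivative (\<lambda>h. D x h)) (at x)" "\<And>j. (\<lambda>x. D x (axis j 1)) \<in> gauss_poly a y"
    using gauss_poly_derivative by blast
  show "pderiv_dir j f \<in> gauss_poly a y" using D(2)[of j] by (simp add: pderiv_dirI[OF D(1)])
qed (rule gp_base, rule gauss_poly_rapid)

lemma integrable_bounded_mult:
  fixes f g :: "'a \<Rightarrow> complex"
  assumes "integrable M f" "g \<in> borel_measurable M" "\<And>x. norm (g x) \<le> B"
  shows "integrable M (\<lambda>x. f x * g x)"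
proof (rule Bochner_Integration.integrable_bound[OF integrable_mult_right[OF integrable_norm[OF assms(1)], of B]])
  show "(\<lambda>x. f x * g x) \<in> borel_measurable M" using assms by measurable
  show "AE x in M. norm (f x * g x) \<le> norm (B * norm (f x))"
  proof (intro AE_I2)
    fix x
    have "norm (f x * g x) \<le> norm (f x) * B" unfolding norm_mult by (intro mult_left_mono assms) auto
    also have "... \<le> norm (B * norm (f x))" by (simp add: mult.commute)
    finally show "norm (f x * g x) \<le> norm (B * norm (f x))" .
  qed
qed

text \<open>A bounded continuous \<open>\<psi>\<close> is the limit of its Gaussian averages, and these are
  superpositions of translated Gaussians, against which \<open>H\<close> integrates to 0.\<close>
lemma integral_continuous_zero:
  fixes H :: "real^3 \<Rightarrow> complex"
  assumes H: "integrable lborel H"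
    and z: "\<And>a y. a > 0 \<Longrightarrow> (LINT x|lborel. H x * complex_of_real (gauss (a *\<^sub>R (x - y)))) = 0"
    and cont: "continuous_on UNIV \<psi>" and bd: "\<And>x. norm (\<psi> x) \<le> B"
  shows "(LINT x|lborel. H x * \<psi> x) = 0"
proof -
  have [measurable]: "\<psi> \<in> borel_measurable borel" using cont by (rule borel_measurable_continuous_onI)
  have [measurable]: "H \<in> borel_measurable borel" using H by auto
  define h where "h n = inverse (real (Suc n))" for n
  have h: "0 < h n" for n by (auto simp: h_def)
  have h0: "h \<longlonglongrightarrow> 0" unfolding h_def by (rule LIMSEQ_inverse_real_of_nat)
  define J where "J n x = (LINT z|lborel. complex_of_real (gauss z) * \<psi> (x + h n *\<^sub>R z))" for n x
  have B0: "0 \<le> B" using bd[of 0] norm_ge_zero order_trans by blast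
  have Jb: "norm (J n x) \<le> B * gauss_mass" for n x
  proof -
    have "norm (J n x) \<le> (LINT z|lborel. B * gauss z)" unfolding J_def
    proof (rule Bochner_Integration.integral_norm_bound_integral)
      show "integrable lborel (\<lambda>z. complex_of_real (gauss z) * \<psi> (x + h n *\<^sub>R z))"
        by (rule integrable_bounded_mult[where B=B]) (use gauss_integral(1) bd in auto)
      show "integrable lborel (\<lambda>z. B * gauss z)" by (intro integrable_mult_right gauss_integral)
      show "norm (complex_of_real (gauss z) * \<psi> (x + h n *\<^sub>R z)) \<le> B * gauss z" for z
        using bd[of "x + h n *\<^sub>R z"] gauss_pos[of z] by (simp add: norm_mult mult.commute mult_right_mono)
    qed
    then show ?thesis by (simp add: gauss_integral)
  qed
  have [measurable]: "J n \<in> borel_measurable borel" for n unfolding J_def by measurable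
  have "(\<lambda>n. LINT x|lborel. H x * J n x) \<longlonglongrightarrow> (LINT x|lborel. H x * (complex_of_real gauss_mass * \<psi> x))"
  proof (rule integral_dominated_convergence)
    show "integrable lborel (\<lambda>x. (B * gauss_mass) * norm (H x))" by (intro integrable_mult_right integrable_norm H)
    show "AE x in lborel. (\<lambda>n. H x * J n x) \<longlonglongrightarrow> H x * (complex_of_real gauss_mass * \<psi> x)"
      unfolding J_def by (intro AE_I2 tendsto_mult_left gauss_approx[OF cont bd h0])
    show "AE x in lborel. norm (H x * J n x) \<le> (B * gauss_mass) * norm (H x)" for n
    proof (intro AE_I2)
      fix x show "norm (H x * J n x) \<le> (B * gauss_mass) * norm (H x)"
        using mult_left_mono[OF Jb[of n x], of "norm (H x)"] by (simp add: norm_mult mult.commute)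
    qed
  qed measurable
  moreover have "(LINT x|lborel. H x * J n x) = 0" for n
  proof -
    have hn: "h n > 0" by (rule h)
    define G where "G = (\<lambda>(x, z). H x * (complex_of_real (gauss z) * \<psi> (x + h n *\<^sub>R z)))"
    define G' where "G' = (\<lambda>(x, y). H x * (complex_of_real (gauss ((1 / h n) *\<^sub>R (x - y))) * \<psi> y))"
    have inner: "J n x = (1 / h n)^3 *\<^sub>R (LINT y|lborel. complex_of_real (gauss ((1 / h n) *\<^sub>R (x - y))) * \<psi> y)" for x
    proof -
      have "(LINT y|lborel. complex_of_real (gauss ((1 / h n) *\<^sub>R (x - y))) * \<psi> y)
        = \<bar>h n\<bar>^3 *\<^sub>R (LINT z|lborel. complex_of_real (gauss ((1 / h n) *\<^sub>R (x - (x + h n *\<^sub>R z)))) * \<psi> (x + h n *\<^sub>R z))"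
        using hn by (subst lborel_integral_affine3[where c="h n" and t=x]) auto
      also have "... = \<bar>h n\<bar>^3 *\<^sub>R J n x"
        unfolding J_def using hn by (intro arg_cong2[where f="(*\<^sub>R)"] Bochner_Integration.integral_cong refl) (simp add: gauss_def)
      finally show ?thesis using hn by (simp add: power_divide)
    qed
    have G'i: "integrable (lborel \<Otimes>\<^sub>M lborel) G'"
    proof (rule integrable_pairI)
      show "G' \<in> borel_measurable (lborel \<Otimes>\<^sub>M lborel)" unfolding G'_def by measurable
      have gm: "(\<integral>\<^sup>+y. ennreal (gauss ((1 / h n) *\<^sub>R (x - y))) \<partial>lborel) = ennreal (h n ^ 3) * (\<integral>\<^sup>+y. ennreal (gauss y) \<partial>lborel)" for x
        using hn by (subst nn_integral_affine3[where c="h n" and t=x]) (auto simp: gauss_def)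
      have "(\<integral>\<^sup>+x. \<integral>\<^sup>+y. ennreal (norm (G' (x, y))) \<partial>lborel \<partial>lborel)
        \<le> (\<integral>\<^sup>+x. \<integral>\<^sup>+y. ennreal (B * norm (H x)) * ennreal (gauss ((1 / h n) *\<^sub>R (x - y))) \<partial>lborel \<partial>lborel)"
      proof (intro nn_integral_mono)
        fix x y
        have "norm (G' (x, y)) \<le> (B * norm (H x)) * gauss ((1 / h n) *\<^sub>R (x - y))"
          using mult_left_mono[OF bd[of y], of "norm (H x) * gauss ((1 / h n) *\<^sub>R (x - y))"] gauss_pos[of "(1 / h n) *\<^sub>R (x - y)"]
          by (simp add: G'_def norm_mult mult_ac)
        then show "ennreal (norm (G' (x, y))) \<le> ennreal (B * norm (H x)) * ennreal (gauss ((1 / h n) *\<^sub>R (x - y)))"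
          using gauss_pos B0 by (simp add: ennreal_mult[symmetric] less_imp_le ennreal_leI)
      qed
      also have "... = (\<integral>\<^sup>+x. ennreal (B * norm (H x)) \<partial>lborel) * (ennreal (h n ^ 3) * (\<integral>\<^sup>+y. ennreal (gauss y) \<partial>lborel))"
        by (simp add: nn_integral_cmult nn_integral_multc gm)
      also have "... < \<infinity>"
      proof -
        have "(\<integral>\<^sup>+y. ennreal (gauss y) \<partial>lborel) < \<infinity>"
          using integrable_nn_norm[OF gauss_integral(1)] gauss_pos by (simp add: less_imp_le)
        moreover have "(\<integral>\<^sup>+x. ennreal (B * norm (H x)) \<partial>lborel) < \<infinity>"
          using integrable_nn_norm[OF integrable_mult_right[OF integrable_norm[OF H], of B]] B0 by (simp add: abs_mult)
        ultimately show ?thesis by (simp add: ennreal_mult_less_top)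
      qed
      finally show "(\<integral>\<^sup>+x. \<integral>\<^sup>+y. ennreal (norm (G' (x, y))) \<partial>lborel \<partial>lborel) < \<infinity>" .
    qed
    have z0: "(LINT x|lborel. G' (x, y)) = 0" for y
    proof -
      have "(LINT x|lborel. G' (x, y)) = (LINT x|lborel. (H x * complex_of_real (gauss ((1 / h n) *\<^sub>R (x - y)))) * \<psi> y)"
        by (simp add: G'_def mult.assoc)
      then show ?thesis using z[of "1 / h n" y] hn by simp
    qed
    have "(LINT x|lborel. LINT y|lborel. G' (x, y)) = (LINT y|lborel. LINT x|lborel. G' (x, y))"
      using lborel_pair.Fubini_integral[of "\<lambda>x y. G' (x, y)"] G'i by simp
    then have "(LINT x|lborel. LINT y|lborel. G' (x, y)) = 0" by (simp add: z0)
    moreover have "(LINT x|lborel. H x * J n x) = (LINT x|lborel. (1 / h n)^3 *\<^sub>R (LINT y|lborel. G' (x, y)))"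
      by (intro Bochner_Integration.integral_cong refl) (simp add: G'_def inner)
    ultimately show ?thesis by simp
  qed
  ultimately have "(\<lambda>n. 0::complex) \<longlonglongrightarrow> (LINT x|lborel. H x * (complex_of_real gauss_mass * \<psi> x))" by simp
  then have "0 = (LINT x|lborel. H x * (complex_of_real gauss_mass * \<psi> x))" by (rule LIMSEQ_unique[OF tendsto_const])
  also have "... = (LINT x|lborel. complex_of_real gauss_mass * (H x * \<psi> x))"
    by (intro Bochner_Integration.integral_cong refl mult.left_commute)
  also have "... = complex_of_real gauss_mass * (LINT x|lborel. H x * \<psi> x)" by (rule integral_mult_right_zero)
  finally show ?thesis using gauss_mass_pos by simp
qed

text \<open>Testing with \<open>cnj (sgn H)\<close> would give \<open>\<integral>|H| = 0\<close>; this
  function is measurable, hence almost everywhere a limit of continuous functions, which are truncated to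
  modulus at most 1.\<close>
lemma AE_zero_of_gauss:
  fixes H :: "real^3 \<Rightarrow> complex"
  assumes H: "integrable lborel H"
    and z: "\<And>a y. a > 0 \<Longrightarrow> (LINT x|lborel. H x * complex_of_real (gauss (a *\<^sub>R (x - y)))) = 0"
  shows "AE x in lborel. H x = 0"
proof -
  have [measurable]: "H \<in> borel_measurable borel" using H by auto
  define \<psi> where "\<psi> x = cnj (sgn (H x))" for x
  have [measurable]: "\<psi> \<in> borel_measurable borel" unfolding \<psi>_def by (intro borel_measurable_continuous_on[OF continuous_on_cnj[OF continuous_on_id]]) (auto simp: sgn_div_norm)
  have p: "\<psi> \<in> borel_measurable lebesgue" by (rule measurable_completion) simp
  have "\<psi> measurable_on UNIV" by (rule lebesgue_measurable_imp_measurable_on[OF p]) simp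
  then obtain N g where N: "negligible N" and gc: "\<And>n::nat. continuous_on UNIV (g n)" and gl: "\<And>x. x \<notin> N \<Longrightarrow> (\<lambda>n. g n x) \<longlonglongrightarrow> \<psi> x"
    unfolding measurable_on_def by auto
  \<comment> \<open>Dividing by \<open>max 1 |g|\<close> truncates without destroying continuity.\<close>
  define k where "k n x = g n x / complex_of_real (max 1 (norm (g n x)))" for n x
  have kc: "continuous_on UNIV (k n)" for n unfolding k_def
    by (intro continuous_intros gc continuous_on_of_real) (auto simp: max_def)
  have kb: "norm (k n x) \<le> 1" for n x by (simp add: k_def norm_divide)
  have \<psi>b: "norm (\<psi> x) \<le> 1" for x by (simp add: \<psi>_def norm_sgn)
  have kl: "(\<lambda>n. k n x) \<longlonglongrightarrow> \<psi> x" if "x \<notin> N" for x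
  proof -
    have "(\<lambda>n. k n x) \<longlonglongrightarrow> \<psi> x / complex_of_real (max 1 (norm (\<psi> x)))"
      unfolding k_def by (intro tendsto_intros gl that) (auto simp: max_def)
    then show ?thesis using \<psi>b[of x] by (simp add: max_def split: if_splits)
  qed
  have [measurable]: "k n \<in> borel_measurable borel" for n using kc by (rule borel_measurable_continuous_onI)
  have "AE x in lebesgue. x \<notin> N" using N by (auto simp: negligible_iff_null_sets intro: AE_not_in)
  then have AEN: "AE x in lborel. x \<notin> N" by (simp add: AE_completion_iff)
  have "(\<lambda>n. LINT x|lborel. H x * k n x) \<longlonglongrightarrow> (LINT x|lborel. H x * \<psi> x)"
  proof (rule integral_dominated_convergence)
    show "integrable lborel (\<lambda>x. norm (H x))" by (intro integrable_norm H)
    show "AE x in lborel. (\<lambda>n. H x * k n x) \<longlonglongrightarrow> H x * \<psi> x"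
      using AEN by eventually_elim (intro tendsto_mult_left kl)
    show "AE x in lborel. norm (H x * k n x) \<le> norm (H x)" for n
      using kb by (intro AE_I2) (simp add: norm_mult mult_left_le)
  qed measurable
  moreover have "(LINT x|lborel. H x * k n x) = 0" for n
    by (rule integral_continuous_zero[OF H z kc kb])
  ultimately have "(\<lambda>n. 0::complex) \<longlonglongrightarrow> (LINT x|lborel. H x * \<psi> x)" by simp
  then have "0 = (LINT x|lborel. H x * \<psi> x)" by (rule LIMSEQ_unique[OF tendsto_const])
  also have "... = (LINT x|lborel. complex_of_real (norm (H x)))"
  proof (intro Bochner_Integration.integral_cong refl)
    fix x
    have "H x * cnj (H x) = complex_of_real ((norm (H x))\<^sup>2)" by (metis complex_norm_square)
    then show "H x * \<psi> x = complex_of_real (norm (H x))"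
      by (cases "H x = 0") (simp_all add: \<psi>_def sgn_div_norm scaleR_conv_of_real power2_eq_square field_simps)
  qed
  finally have "(LINT x|lborel. norm (H x)) = 0" by (simp add: integral_complex_of_real)
  then show ?thesis using integral_nonneg_eq_0_iff_AE[OF integrable_norm[OF H]] by simp
qed

text \<open>Multiplying the difference by a Gaussian makes it integrable, and the product with a further
  Gaussian is still a legitimate test function.\<close>
lemma represents_unique:
  assumes "represents g T" "represents g' T"
  shows "AE x in lborel. g x = g' x"
proof -
  have [measurable]: "g \<in> borel_measurable borel" "g' \<in> borel_measurable borel"
    using assms by (auto simp: represents_def)
  define H where "H x = (g x - g' x) * complex_of_real (gauss x)" for x
  have *: "integrable lborel (\<lambda>x. (g x - g' x) * \<phi> x)" "(LINT x|lborel. (g x - g' x) * \<phi> x) = 0" if "\<phi> \<in> schwartz" for \<phi>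
  proof -
    have i: "integrable lborel (\<lambda>x. g x * \<phi> x)" "integrable lborel (\<lambda>x. g' x * \<phi> x)"
      and e: "(LINT x|lborel. g x * \<phi> x) = (LINT x|lborel. g' x * \<phi> x)"
      using assms that unfolding represents_def by auto
    show "integrable lborel (\<lambda>x. (g x - g' x) * \<phi> x)" unfolding left_diff_distrib by (intro Bochner_Integration.integrable_diff i)
    show "(LINT x|lborel. (g x - g' x) * \<phi> x) = 0" unfolding left_diff_distrib Bochner_Integration.integral_diff[OF i] e by simp
  qed
  have gs: "(\<lambda>x. complex_of_real (gauss x)) \<in> schwartz" using gauss_schwartz[of 0 0] by (simp add: gauss_0)
  have "AE x in lborel. H x = 0"
  proof (rule AE_zero_of_gauss)
    show "integrable lborel H" unfolding H_def by (rule *(1)[OF gs])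
    show "(LINT x|lborel. H x * complex_of_real (gauss (a *\<^sub>R (x - y)))) = 0" for a y
      using *(2)[OF gauss_schwartz[of a y]] by (simp add: H_def mult.assoc)
  qed
  then show ?thesis by eventually_elim (use gauss_pos in \<open>auto simp: H_def less_imp_neq[symmetric]\<close>)
qed

lemma dist_fun_AE: "represents g T \<Longrightarrow> AE x in lborel. dist_fun T x = g x"
  by (rule represents_unique[of _ T]) (simp_all add: dist_fun_def someI[of "\<lambda>g. represents g T"])

lemma represents_dist_fun: "represents g T \<Longrightarrow> represents (dist_fun T) T"
  unfolding dist_fun_def by (rule someI[of "\<lambda>g. represents g T"])

section \<open>Weighted norms, convolution and the heat semigroup\<close>

text \<open>Registering this rule for a given \<open>f\<close> lets the measurability prover use the joint
  measurability of \<open>f\<close> under arbitrary substitutions.\<close>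
lemma measurable_curried:
  assumes "case_prod f \<in> measurable (borel \<Otimes>\<^sub>M borel) N" "g \<in> measurable M borel" "h \<in> measurable M borel"
  shows "(\<lambda>x. f (g x) (h x)) \<in> measurable M N"
proof -
  have "(\<lambda>x. case_prod f (g x, h x)) \<in> measurable M N"
    by (rule measurable_compose[OF measurable_Pair[OF assms(2,3)] assms(1)])
  then show ?thesis by simp
qed

abbreviation heat_ker :: "real \<Rightarrow> real^3 \<Rightarrow> real" where
  "heat_ker t xi \<equiv> exp (- t * (norm xi)\<^sup>2)"

text \<open>Note that \<open>wt a 0 = 0\<close> for every \<open>a\<close>, also for \<open>a = 0\<close>;
  this is harmless since the origin is a null set.\<close>
definition wt :: "real \<Rightarrow> real^3 \<Rightarrow> ennreal" where "wt a xi = ennreal (norm xi powr a)"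
text \<open>The Lei-Lin norm of order \<open>a\<close>, as a function of the modulus of the Fourier
  transform.\<close>
definition wnorm :: "real \<Rightarrow> (real^3 \<Rightarrow> ennreal) \<Rightarrow> ennreal" where "wnorm a f = (\<integral>\<^sup>+xi. wt a xi * f xi \<partial>lborel)"
definition convol :: "(real^3 \<Rightarrow> ennreal) \<Rightarrow> (real^3 \<Rightarrow> ennreal) \<Rightarrow> real^3 \<Rightarrow> ennreal" where
  "convol f g xi = (\<integral>\<^sup>+\<eta>. f (xi - \<eta>) * g \<eta> \<partial>lborel)"
text \<open>The Duhamel integral of a source \<open>F\<close> for the heat equation, on the Fourier side. It
  takes values in \<open>ennreal\<close>, so that no integrability has to be known beforehand.\<close>
definition heat_duhamel :: "(real \<Rightarrow> real^3 \<Rightarrow> ennreal) \<Rightarrow> real \<Rightarrow> real^3 \<Rightarrow> ennreal" where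
  "heat_duhamel F t xi = (\<integral>\<^sup>+tau. indicator {0..t} tau * ennreal (heat_ker (t - tau) xi) * F tau xi \<partial>lborel)"
text \<open>The pointwise majorant of the bilinear term of the integral equation: the derivative and the Leray
  projection contribute the factor \<open>|xi|\<close>, and the product of functions a convolution.\<close>
definition bilin :: "(real \<Rightarrow> real^3 \<Rightarrow> ennreal) \<Rightarrow> (real \<Rightarrow> real^3 \<Rightarrow> ennreal) \<Rightarrow> real \<Rightarrow> real^3 \<Rightarrow> ennreal" where
  "bilin f g = heat_duhamel (\<lambda>tau xi. wt 1 xi * convol (f tau) (g tau) xi)"
text \<open>The norm of \<open>L\<^sup>\<infinity>(S; X\<^sup>\<kappa>\<^sup>-\<^sup>1) \<inter> L\<^sup>1(S;
  X\<^sup>\<kappa>\<^sup>+\<^sup>1)\<close>, on the Fourier side. The heat semigroup maps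
  \<open>X\<^sup>\<kappa>\<^sup>-\<^sup>1\<close> boundedly into this space, and \<open>\<kappa> = 0\<close>
  is the scaling invariant case.\<close>
definition evnorm :: "real set \<Rightarrow> real \<Rightarrow> (real \<Rightarrow> real^3 \<Rightarrow> ennreal) \<Rightarrow> ennreal" where
  "evnorm S \<kappa> f = (SUP t\<in>S. wnorm (\<kappa> - 1) (f t)) + (\<integral>\<^sup>+t. indicator S t * wnorm (\<kappa> + 1) (f t) \<partial>lborel)"
text \<open>The time sets on which the Duhamel integral only refers to times in the set.\<close>
definition down_closed :: "real set \<Rightarrow> bool" where
  "down_closed S \<longleftrightarrow> S \<in> sets borel \<and> S \<subseteq> {0..} \<and> (\<forall>t\<in>S. {0..t} \<subseteq> S)"
abbreviation jmeas :: "(real \<Rightarrow> real^3 \<Rightarrow> 'a::topological_space) \<Rightarrow> bool" where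
  "jmeas f \<equiv> case_prod f \<in> borel_measurable (borel \<Otimes>\<^sub>M borel)"

lemma wt_measurable[measurable]: "wt a \<in> borel_measurable borel" unfolding wt_def by measurable

lemma wt_zero[simp]: "wt a 0 = 0" by (simp add: wt_def)
lemma wt_0: "xi \<noteq> 0 \<Longrightarrow> wt 0 xi = 1" by (simp add: wt_def)
lemma wt_mult: "wt a xi * wt b xi = wt (a + b) xi"
  by (simp add: wt_def ennreal_mult[symmetric] powr_add)
lemma wt_minus[simp]: "wt a (- xi) = wt a xi" by (simp add: wt_def)

lemma AE_nonzero3: "AE xi::real^3 in lborel. xi \<noteq> 0" using AE_lborel_singleton .

lemma convol_measurable[measurable]:
  assumes [measurable]: "f \<in> borel_measurable borel" "g \<in> borel_measurable borel"
  shows "convol f g \<in> borel_measurable borel"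
  unfolding convol_def[abs_def] by measurable

lemma convol_jmeas:
  assumes f: "jmeas f" and g: "jmeas g"
  shows "jmeas (\<lambda>tau. convol (f tau) (g tau))"
proof -
  note [measurable (raw)] = measurable_curried[OF f] measurable_curried[OF g]
  show ?thesis unfolding convol_def by measurable
qed

lemma jmeas_slice: "jmeas f \<Longrightarrow> f t \<in> borel_measurable borel"
  using measurable_curried[of f borel "\<lambda>_. t" borel "\<lambda>x. x"] by simp

lemma wnorm_jmeas:
  assumes f: "jmeas f" shows "(\<lambda>t. wnorm a (f t)) \<in> borel_measurable borel"
proof -
  note [measurable (raw)] = measurable_curried[OF f]
  show ?thesis unfolding wnorm_def by measurable
qed

lemma heat_duhamel_jmeas:
  assumes f: "jmeas F" shows "jmeas (heat_duhamel F)"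
proof -
  note [measurable (raw)] = measurable_curried[OF f]
  have "(\<lambda>x. \<integral>\<^sup>+tau. indicator {p. 0 \<le> snd p \<and> snd p \<le> fst p} (fst x, tau) * ennreal (exp (- (fst x - tau) * (norm (snd x))\<^sup>2)) * F tau (snd x) \<partial>lborel) \<in> borel_measurable (borel \<Otimes>\<^sub>M borel)"
    by measurable
  also have "(\<lambda>x. \<integral>\<^sup>+tau. indicator {p. 0 \<le> snd p \<and> snd p \<le> fst p} (fst x, tau) * ennreal (exp (- (fst x - tau) * (norm (snd x))\<^sup>2)) * F tau (snd x) \<partial>lborel) = case_prod (heat_duhamel F)"
    by (auto simp: fun_eq_iff heat_duhamel_def indicator_def intro!: nn_integral_cong)
  finally show ?thesis .
qed

lemma bilin_jmeas: assumes f: "jmeas f" and g: "jmeas g" shows "jmeas (bilin f g)"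
proof -
  note [measurable (raw)] = measurable_curried[OF convol_jmeas[OF f g]]
  show ?thesis unfolding bilin_def by (intro heat_duhamel_jmeas) measurable
qed

lemma wnorm_mono: "(\<And>xi. f xi \<le> g xi) \<Longrightarrow> wnorm a f \<le> wnorm a g"
  unfolding wnorm_def by (intro nn_integral_mono mult_left_mono) auto

lemma wnorm_mono_AE: "AE xi in lborel. f xi \<le> g xi \<Longrightarrow> wnorm a f \<le> wnorm a g"
  unfolding wnorm_def by (intro nn_integral_mono_AE) (auto elim!: eventually_mono intro: mult_left_mono)

lemma wnorm_cong_AE: "AE xi in lborel. f xi = g xi \<Longrightarrow> wnorm a f = wnorm a g"
  unfolding wnorm_def by (intro nn_integral_cong_AE) (auto elim!: eventually_mono)

lemma wnorm_add: "f \<in> borel_measurable borel \<Longrightarrow> g \<in> borel_measurable borel \<Longrightarrow> wnorm a (\<lambda>xi. f xi + g xi) = wnorm a f + wnorm a g"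
  unfolding wnorm_def distrib_left by (subst nn_integral_add) auto

lemma wnorm_wt: "wnorm a (\<lambda>xi. wt b xi * f xi) = wnorm (a + b) f"
  by (simp add: wnorm_def mult.assoc[symmetric] wt_mult)

lemma wnorm_eq_0: "f \<in> borel_measurable borel \<Longrightarrow> wnorm a f = 0 \<Longrightarrow> AE xi in lborel. f xi = 0"
proof -
  assume [measurable]: "f \<in> borel_measurable borel" and "wnorm a f = 0"
  then have "AE xi in lborel. wt a xi * f xi = 0" unfolding wnorm_def by (subst (asm) nn_integral_0_iff_AE) auto
  with AE_nonzero3 show ?thesis by eventually_elim (auto simp: wt_def)
qed

lemma wnorm_finite_AE: assumes [measurable]: "f \<in> borel_measurable borel" and fin: "wnorm a f < \<infinity>" shows "AE xi in lborel. f xi < \<infinity>"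
proof -
  have "AE xi in lborel. wt a xi * f xi \<noteq> \<infinity>"
    using fin unfolding wnorm_def by (intro nn_integral_PInf_AE) auto
  with AE_nonzero3 show ?thesis
    by eventually_elim (auto simp: wt_def ennreal_mult_eq_top_iff less_top)
qed

lemma wnorm_convol:
  assumes [measurable]: "f \<in> borel_measurable borel" "g \<in> borel_measurable borel"
  shows "wnorm a (convol f g) = (\<integral>\<^sup>+\<eta>. \<integral>\<^sup>+\<zeta>. wt a (\<zeta> + \<eta>) * f \<zeta> * g \<eta> \<partial>lborel \<partial>lborel)"
proof -
  have "wnorm a (convol f g) = (\<integral>\<^sup>+xi. \<integral>\<^sup>+\<eta>. wt a xi * (f (xi - \<eta>) * g \<eta>) \<partial>lborel \<partial>lborel)"
    unfolding wnorm_def convol_def by (simp add: nn_integral_cmult)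
  also have "... = (\<integral>\<^sup>+\<eta>. \<integral>\<^sup>+xi. wt a xi * (f (xi - \<eta>) * g \<eta>) \<partial>lborel \<partial>lborel)"
    by (rule lborel_pair.Fubini') simp
  also have "... = (\<integral>\<^sup>+\<eta>. \<integral>\<^sup>+\<zeta>. wt a (\<zeta> + \<eta>) * f \<zeta> * g \<eta> \<partial>lborel \<partial>lborel)"
  proof (rule nn_integral_cong)
    fix \<eta> :: "real^3"
    show "(\<integral>\<^sup>+xi. wt a xi * (f (xi - \<eta>) * g \<eta>) \<partial>lborel) = (\<integral>\<^sup>+\<zeta>. wt a (\<zeta> + \<eta>) * f \<zeta> * g \<eta> \<partial>lborel)"
      by (subst nn_integral_affine3[where c=1 and t=\<eta>]) (auto simp: add.commute mult.assoc)
  qed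
  finally show ?thesis .
qed

lemma wt_triangle:
  assumes "\<kappa> \<ge> 0" "\<zeta> \<noteq> 0" "\<eta> \<noteq> 0"
  shows "wt \<kappa> (\<zeta> + \<eta>) \<le> ennreal (2 powr \<kappa>) * (wt \<kappa> \<zeta> * wt 0 \<eta> + wt 0 \<zeta> * wt \<kappa> \<eta>)"
proof -
  have "norm (\<zeta> + \<eta>) \<le> 2 * max (norm \<zeta>) (norm \<eta>)" using norm_triangle_ineq[of \<zeta> \<eta>] by (simp add: max_def)
  then have "norm (\<zeta> + \<eta>) powr \<kappa> \<le> (2 * max (norm \<zeta>) (norm \<eta>)) powr \<kappa>" using assms(1) by (intro powr_mono2) auto
  also have "... = 2 powr \<kappa> * max (norm \<zeta>) (norm \<eta>) powr \<kappa>" by (simp add: powr_mult)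
  also have "... \<le> 2 powr \<kappa> * (norm \<zeta> powr \<kappa> + norm \<eta> powr \<kappa>)" by (intro mult_left_mono) (auto simp: max_def)
  finally show ?thesis using assms by (simp add: wt_0, simp add: wt_def ennreal_mult[symmetric] ennreal_plus[symmetric] ennreal_leI del: ennreal_plus)
qed

lemma wnorm_prod:
  assumes [measurable]: "f \<in> borel_measurable borel" "g \<in> borel_measurable borel"
  shows "(\<integral>\<^sup>+\<eta>. \<integral>\<^sup>+\<zeta>. (wt a \<zeta> * wt b \<eta>) * f \<zeta> * g \<eta> \<partial>lborel \<partial>lborel) = wnorm a f * wnorm b g"
proof -
  have "(\<integral>\<^sup>+\<eta>. \<integral>\<^sup>+\<zeta>. (wt a \<zeta> * wt b \<eta>) * f \<zeta> * g \<eta> \<partial>lborel \<partial>lborel) = (\<integral>\<^sup>+\<eta>. \<integral>\<^sup>+\<zeta>. (wt a \<zeta> * f \<zeta>) * (wt b \<eta> * g \<eta>) \<partial>lborel \<partial>lborel)"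
    by (simp add: mult_ac)
  also have "... = wnorm a f * wnorm b g" unfolding wnorm_def by (simp add: nn_integral_cmult nn_integral_multc)
  finally show ?thesis .
qed

text \<open>The weight \<open>|xi|\<^sup>\<kappa>\<close> is distributed over \<open>xi = \<zeta> +
  \<eta>\<close> by \<open>wt_triangle\<close>, at the price of the factor \<open>2\<^sup>\<kappa>\<close>,
  and the double integral then factorises.\<close>
lemma wnorm_convol_le:
  assumes [measurable]: "f \<in> borel_measurable borel" "g \<in> borel_measurable borel" and "\<kappa> \<ge> 0"
  shows "wnorm \<kappa> (convol f g) \<le> ennreal (2 powr \<kappa>) * (wnorm \<kappa> f * wnorm 0 g + wnorm 0 f * wnorm \<kappa> g)"
proof -
  have "wnorm \<kappa> (convol f g) \<le> (\<integral>\<^sup>+\<eta>. \<integral>\<^sup>+\<zeta>. ennreal (2 powr \<kappa>) * ((wt \<kappa> \<zeta> * wt 0 \<eta>) * f \<zeta> * g \<eta> + (wt 0 \<zeta> * wt \<kappa> \<eta>) * f \<zeta> * g \<eta>) \<partial>lborel \<partial>lborel)"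
    unfolding wnorm_convol[OF assms(1,2)]
  proof (rule nn_integral_mono_AE, use AE_nonzero3 in eventually_elim)
    fix \<eta> :: "real^3" assume \<eta>: "\<eta> \<noteq> 0"
    show "(\<integral>\<^sup>+\<zeta>. wt \<kappa> (\<zeta> + \<eta>) * f \<zeta> * g \<eta> \<partial>lborel) \<le> (\<integral>\<^sup>+\<zeta>. ennreal (2 powr \<kappa>) * ((wt \<kappa> \<zeta> * wt 0 \<eta>) * f \<zeta> * g \<eta> + (wt 0 \<zeta> * wt \<kappa> \<eta>) * f \<zeta> * g \<eta>) \<partial>lborel)"
    proof (rule nn_integral_mono_AE, use AE_nonzero3 in eventually_elim)
      fix \<zeta> :: "real^3" assume \<zeta>: "\<zeta> \<noteq> 0"
      have "wt \<kappa> (\<zeta> + \<eta>) * f \<zeta> * g \<eta> \<le> (ennreal (2 powr \<kappa>) * (wt \<kappa> \<zeta> * wt 0 \<eta> + wt 0 \<zeta> * wt \<kappa> \<eta>)) * f \<zeta> * g \<eta>"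
        by (intro mult_right_mono wt_triangle assms \<eta> \<zeta>) auto
      then show "wt \<kappa> (\<zeta> + \<eta>) * f \<zeta> * g \<eta> \<le> ennreal (2 powr \<kappa>) * ((wt \<kappa> \<zeta> * wt 0 \<eta>) * f \<zeta> * g \<eta> + (wt 0 \<zeta> * wt \<kappa> \<eta>) * f \<zeta> * g \<eta>)"
        by (simp add: distrib_left distrib_right mult.assoc)
    qed
  qed
  also have "... = ennreal (2 powr \<kappa>) * (wnorm \<kappa> f * wnorm 0 g + wnorm 0 f * wnorm \<kappa> g)"
    by (simp add: nn_integral_cmult nn_integral_add wnorm_prod)
  finally show ?thesis .
qed

text \<open>With \<open>x = \<delta> |\<zeta>| / |\<eta>|\<close> this is \<open>1 \<le> x + 1 /
  x\<close>.\<close>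
lemma wt_amgm:
  assumes "\<delta> > 0"
  shows "wt \<kappa> \<zeta> * wt 0 \<eta> \<le> ennreal \<delta> * (wt (\<kappa> + 1) \<zeta> * wt (-1) \<eta>) + ennreal (1 / \<delta>) * (wt (\<kappa> - 1) \<zeta> * wt 1 \<eta>)"
proof (cases "\<zeta> = 0 \<or> \<eta> = 0")
  case False
  define p q where "p = norm \<zeta>" and "q = norm \<eta>"
  have pq: "p > 0" "q > 0" using False by (auto simp: p_def q_def)
  have "1 \<le> \<delta> * (p / q) + 1 / \<delta> * (q / p)"
  proof -
    define x where "x = \<delta> * (p / q)"
    have x: "x > 0" using pq assms by (simp add: x_def)
    have "1 / \<delta> * (q / p) = 1 / x" by (simp add: x_def)
    moreover have "1 \<le> x + 1 / x" using x by (cases "x \<ge> 1") (auto simp: add_increasing2 add_increasing)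
    ultimately show ?thesis by (simp add: x_def)
  qed
  then have "p powr \<kappa> * 1 \<le> p powr \<kappa> * (\<delta> * (p / q) + 1 / \<delta> * (q / p))" by (intro mult_left_mono) auto
  also have "... = \<delta> * (p powr (\<kappa> + 1) * q powr (-1)) + (1 / \<delta>) * (p powr (\<kappa> - 1) * q powr 1)"
    using pq by (simp add: powr_add powr_diff powr_minus field_simps)
  finally show ?thesis using False assms pq
    by (simp add: wt_0, simp add: wt_def p_def[symmetric] q_def[symmetric] ennreal_mult[symmetric] ennreal_plus[symmetric] ennreal_leI del: ennreal_plus)
qed auto

text \<open>Interpolation in product form. The norms of order \<open>\<kappa>\<close> and 0 on the left are
  exactly those which the nonlinearity produces, and each product on the right pairs a norm that is bounded in
  time with one that is integrable in time. The parameter \<open>\<delta>\<close> is needed for absorption in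
  the uniqueness proof.\<close>
lemma wnorm_amgm:
  assumes [measurable]: "f \<in> borel_measurable borel" "g \<in> borel_measurable borel" and "\<delta> > 0"
  shows "wnorm \<kappa> f * wnorm 0 g \<le> ennreal \<delta> * (wnorm (\<kappa> + 1) f * wnorm (-1) g) + ennreal (1 / \<delta>) * (wnorm (\<kappa> - 1) f * wnorm 1 g)"
proof -
  have "wnorm \<kappa> f * wnorm 0 g = (\<integral>\<^sup>+\<eta>. \<integral>\<^sup>+\<zeta>. (wt \<kappa> \<zeta> * wt 0 \<eta>) * f \<zeta> * g \<eta> \<partial>lborel \<partial>lborel)" by (simp add: wnorm_prod)
  also have "... \<le> (\<integral>\<^sup>+\<eta>. \<integral>\<^sup>+\<zeta>. ennreal \<delta> * ((wt (\<kappa> + 1) \<zeta> * wt (-1) \<eta>) * f \<zeta> * g \<eta>) + ennreal (1 / \<delta>) * ((wt (\<kappa> - 1) \<zeta> * wt 1 \<eta>) * f \<zeta> * g \<eta>) \<partial>lborel \<partial>lborel)"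
  proof (intro nn_integral_mono)
    fix \<eta> \<zeta> :: "real^3"
    have "(wt \<kappa> \<zeta> * wt 0 \<eta>) * f \<zeta> * g \<eta> \<le> (ennreal \<delta> * (wt (\<kappa> + 1) \<zeta> * wt (-1) \<eta>) + ennreal (1 / \<delta>) * (wt (\<kappa> - 1) \<zeta> * wt 1 \<eta>)) * f \<zeta> * g \<eta>"
      by (intro mult_right_mono wt_amgm assms) auto
    then show "(wt \<kappa> \<zeta> * wt 0 \<eta>) * f \<zeta> * g \<eta> \<le> ennreal \<delta> * ((wt (\<kappa> + 1) \<zeta> * wt (-1) \<eta>) * f \<zeta> * g \<eta>) + ennreal (1 / \<delta>) * ((wt (\<kappa> - 1) \<zeta> * wt 1 \<eta>) * f \<zeta> * g \<eta>)"
      by (simp add: distrib_right mult.assoc)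
  qed
  also have "... = ennreal \<delta> * (wnorm (\<kappa> + 1) f * wnorm (-1) g) + ennreal (1 / \<delta>) * (wnorm (\<kappa> - 1) f * wnorm 1 g)"
    by (simp add: nn_integral_cmult nn_integral_add wnorm_prod)
  finally show ?thesis .
qed

lemma wnorm_heat_duhamel:
  assumes F: "jmeas F"
  shows "wnorm a (heat_duhamel F t) \<le> (\<integral>\<^sup>+tau. indicator {0..t} tau * wnorm a (F tau) \<partial>lborel)"
proof -
  note [measurable (raw)] = measurable_curried[OF F]
  have "wnorm a (heat_duhamel F t) = (\<integral>\<^sup>+xi. \<integral>\<^sup>+tau. wt a xi * (indicator {0..t} tau * ennreal (heat_ker (t - tau) xi) * F tau xi) \<partial>lborel \<partial>lborel)"
    unfolding wnorm_def heat_duhamel_def by (subst nn_integral_cmult) auto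
  also have "... = (\<integral>\<^sup>+tau. \<integral>\<^sup>+xi. wt a xi * (indicator {0..t} tau * ennreal (heat_ker (t - tau) xi) * F tau xi) \<partial>lborel \<partial>lborel)"
    by (rule lborel_pair.Fubini') simp
  also have "... \<le> (\<integral>\<^sup>+tau. \<integral>\<^sup>+xi. indicator {0..t} tau * (wt a xi * F tau xi) \<partial>lborel \<partial>lborel)"
  proof (intro nn_integral_mono)
    fix tau :: real and xi :: "real^3"
    have "indicator {0..t} tau * ennreal (heat_ker (t - tau) xi) \<le> indicator {0..t} tau * 1"
      by (cases "tau \<in> {0..t}") (simp_all add: mult_nonpos_nonneg)
    then have "wt a xi * ((indicator {0..t} tau * ennreal (heat_ker (t - tau) xi)) * F tau xi) \<le> wt a xi * ((indicator {0..t} tau * 1) * F tau xi)"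
      by (rule mult_left_mono[OF mult_right_mono]) auto
    then show "wt a xi * (indicator {0..t} tau * ennreal (heat_ker (t - tau) xi) * F tau xi) \<le> indicator {0..t} tau * (wt a xi * F tau xi)"
      by (simp add: mult_ac)
  qed
  also have "... = (\<integral>\<^sup>+tau. indicator {0..t} tau * wnorm a (F tau) \<partial>lborel)"
    unfolding wnorm_def by (simp add: nn_integral_cmult)
  finally show ?thesis .
qed

lemma nn_integral_exp_decay:
  assumes "c > 0"
  shows "(\<integral>\<^sup>+t. indicator {tau..} t * ennreal (exp (- (t - tau) * c)) \<partial>lborel) = ennreal (1 / c)"
proof -
  have "(\<integral>\<^sup>+t. ennreal (exp (- (t - tau) * c)) * indicator {tau..} t \<partial>lborel) = ennreal (0 - (- exp (- (tau - tau) * c) / c))"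
  proof (rule nn_integral_FTC_atLeast[where F="\<lambda>t. - exp (- (t - tau) * c) / c" and T=0])
    show "((\<lambda>t. - exp (- (t - tau) * c) / c) has_real_derivative exp (- (x - tau) * c)) (at x)" for x
      using assms by (auto intro!: derivative_eq_intros)
    show "((\<lambda>t. - exp (- (t - tau) * c) / c) \<longlongrightarrow> 0) at_top" using assms by real_asymp
  qed auto
  then show ?thesis by (simp add: mult.commute)
qed

lemma nn_integral_heat_le:
  "wt (a + 2) xi * (\<integral>\<^sup>+t. indicator {tau..} t * ennreal (heat_ker (t - tau) xi) \<partial>lborel) \<le> wt a xi"
proof (cases "xi = 0")
  case False
  have "norm xi powr (a + 2) * (1 / (norm xi)\<^sup>2) = norm xi powr a" using False by (simp add: powr_add)
  then show ?thesis using False by (subst nn_integral_exp_decay) (auto simp: wt_def ennreal_mult[symmetric])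
qed simp

text \<open>Integrating the heat kernel \<open>exp (-(t - tau) |xi|\<^sup>2)\<close> over \<open>t\<close>
  gives at most \<open>|xi|\<^sup>-\<^sup>2\<close>: this is the gain of two derivatives that closes the
  estimates.\<close>
lemma wnorm_heat_duhamel_time_integral_le:
  assumes F: "jmeas F" and S: "down_closed S"
  shows "(\<integral>\<^sup>+t. indicator S t * wnorm (a + 2) (heat_duhamel F t) \<partial>lborel) \<le> (\<integral>\<^sup>+tau. indicator S tau * wnorm a (F tau) \<partial>lborel)"
proof -
  note [measurable (raw)] = measurable_curried[OF F]
  have [measurable]: "S \<in> sets borel" using S by (simp add: down_closed_def)
  define K where "K t tau xi = indicator {p. 0 \<le> snd p \<and> snd p \<le> fst p} (t, tau) * ennreal (heat_ker (t - tau) xi)" for t tau :: real and xi :: "real^3"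
  have K: "heat_duhamel F t xi = (\<integral>\<^sup>+tau. K t tau xi * F tau xi \<partial>lborel)" for t xi
    by (auto simp: heat_duhamel_def K_def indicator_def intro!: nn_integral_cong)
  have [measurable]: "(\<lambda>x. K (f x) (g x) (h x)) \<in> borel_measurable M" if [measurable]: "f \<in> borel_measurable M" "g \<in> borel_measurable M" "h \<in> borel_measurable M" for f g h and M :: "'z measure"
    unfolding K_def by measurable
  have "(\<integral>\<^sup>+t. indicator S t * wnorm (a + 2) (heat_duhamel F t) \<partial>lborel) = (\<integral>\<^sup>+t. \<integral>\<^sup>+xi. \<integral>\<^sup>+tau. indicator S t * (wt (a + 2) xi * (K t tau xi * F tau xi)) \<partial>lborel \<partial>lborel \<partial>lborel)"
    unfolding wnorm_def K by (simp add: nn_integral_cmult)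
  also have "... = (\<integral>\<^sup>+xi. \<integral>\<^sup>+t. \<integral>\<^sup>+tau. indicator S t * (wt (a + 2) xi * (K t tau xi * F tau xi)) \<partial>lborel \<partial>lborel \<partial>lborel)"
    by (rule lborel_pair.Fubini') simp
  also have "... = (\<integral>\<^sup>+xi. \<integral>\<^sup>+tau. \<integral>\<^sup>+t. indicator S t * (wt (a + 2) xi * (K t tau xi * F tau xi)) \<partial>lborel \<partial>lborel \<partial>lborel)"
    by (intro nn_integral_cong lborel_pair.Fubini') measurable
  also have "... \<le> (\<integral>\<^sup>+xi. \<integral>\<^sup>+tau. indicator S tau * (wt a xi * F tau xi) \<partial>lborel \<partial>lborel)"
  proof (intro nn_integral_mono)
    fix xi :: "real^3" and tau :: real
    have "(\<integral>\<^sup>+t. indicator S t * (wt (a + 2) xi * (K t tau xi * F tau xi)) \<partial>lborel)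
      \<le> (\<integral>\<^sup>+t. (indicator S tau * F tau xi * wt (a + 2) xi) * (indicator {tau..} t * ennreal (heat_ker (t - tau) xi)) \<partial>lborel)"
    proof (intro nn_integral_mono)
      fix t
      show "indicator S t * (wt (a + 2) xi * (K t tau xi * F tau xi)) \<le> (indicator S tau * F tau xi * wt (a + 2) xi) * (indicator {tau..} t * ennreal (heat_ker (t - tau) xi))"
      proof (cases "t \<in> S \<and> 0 \<le> tau \<and> tau \<le> t")
        case True
        then have "tau \<in> S" using S unfolding down_closed_def by (meson atLeastAtMost_iff subsetD)
        then show ?thesis using True by (simp add: K_def mult_ac)
      next
        case False then show ?thesis by (auto simp: K_def indicator_def)
      qed
    qed
    also have "... = (indicator S tau * F tau xi) * (wt (a + 2) xi * (\<integral>\<^sup>+t. indicator {tau..} t * ennreal (heat_ker (t - tau) xi) \<partial>lborel))"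
      by (subst nn_integral_cmult) (auto simp: mult.assoc)
    also have "... \<le> (indicator S tau * F tau xi) * wt a xi" by (intro mult_left_mono nn_integral_heat_le) auto
    finally show "(\<integral>\<^sup>+t. indicator S t * (wt (a + 2) xi * (K t tau xi * F tau xi)) \<partial>lborel) \<le> indicator S tau * (wt a xi * F tau xi)"
      by (simp add: mult_ac)
  qed
  also have "... = (\<integral>\<^sup>+tau. \<integral>\<^sup>+xi. indicator S tau * (wt a xi * F tau xi) \<partial>lborel \<partial>lborel)"
    by (rule lborel_pair.Fubini') simp
  also have "... = (\<integral>\<^sup>+tau. indicator S tau * wnorm a (F tau) \<partial>lborel)"
    unfolding wnorm_def by (simp add: nn_integral_cmult)
  finally show ?thesis .
qed

lemma heat_evnorm:
  fixes h :: "real^3 \<Rightarrow> ennreal"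
  assumes [measurable]: "h \<in> borel_measurable borel" and S: "down_closed S"
  shows "evnorm S \<kappa> (\<lambda>t xi. ennreal (heat_ker t xi) * h xi) \<le> 2 * wnorm (\<kappa> - 1) h"
proof -
  have [measurable]: "S \<in> sets borel" using S by (simp add: down_closed_def)
  have "(SUP t\<in>S. wnorm (\<kappa> - 1) (\<lambda>xi. ennreal (heat_ker t xi) * h xi)) \<le> wnorm (\<kappa> - 1) h"
  proof (intro SUP_least wnorm_mono)
    fix t and xi :: "real^3" assume "t \<in> S"
    then have "heat_ker t xi \<le> 1" using S by (auto simp: down_closed_def)
    then have "ennreal (heat_ker t xi) * h xi \<le> 1 * h xi" by (intro mult_right_mono) (auto simp flip: ennreal_1 intro: ennreal_leI)
    then show "ennreal (heat_ker t xi) * h xi \<le> h xi" by simp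
  qed
  moreover have "(\<integral>\<^sup>+t. indicator S t * wnorm (\<kappa> + 1) (\<lambda>xi. ennreal (heat_ker t xi) * h xi) \<partial>lborel) \<le> wnorm (\<kappa> - 1) h"
  proof -
    have "(\<integral>\<^sup>+t. indicator S t * wnorm (\<kappa> + 1) (\<lambda>xi. ennreal (heat_ker t xi) * h xi) \<partial>lborel)
      = (\<integral>\<^sup>+t. \<integral>\<^sup>+xi. indicator S t * (wt (\<kappa> + 1) xi * (ennreal (heat_ker t xi) * h xi)) \<partial>lborel \<partial>lborel)"
      unfolding wnorm_def by (simp add: nn_integral_cmult)
    also have "... = (\<integral>\<^sup>+xi. \<integral>\<^sup>+t. indicator S t * (wt (\<kappa> + 1) xi * (ennreal (heat_ker t xi) * h xi)) \<partial>lborel \<partial>lborel)"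
      by (rule lborel_pair.Fubini') simp
    also have "... \<le> wnorm (\<kappa> - 1) h" unfolding wnorm_def
    proof (intro nn_integral_mono)
      fix xi :: "real^3"
      have "(\<integral>\<^sup>+t. indicator S t * (wt (\<kappa> + 1) xi * (ennreal (heat_ker t xi) * h xi)) \<partial>lborel)
        \<le> (\<integral>\<^sup>+t. (wt (\<kappa> - 1 + 2) xi * h xi) * (indicator {0..} t * ennreal (heat_ker (t - 0) xi)) \<partial>lborel)"
      proof (intro nn_integral_mono)
        fix t
        have "indicator S t \<le> (indicator {0..} t :: ennreal)" using S by (auto simp: down_closed_def indicator_def)
        then have "indicator S t * (wt (\<kappa> + 1) xi * (ennreal (heat_ker t xi) * h xi)) \<le> indicator {0..} t * (wt (\<kappa> + 1) xi * (ennreal (heat_ker t xi) * h xi))"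
          by (intro mult_right_mono) auto
        moreover have e: "\<kappa> - 1 + 2 = \<kappa> + 1" by simp
        ultimately show "indicator S t * (wt (\<kappa> + 1) xi * (ennreal (heat_ker t xi) * h xi)) \<le> (wt (\<kappa> - 1 + 2) xi * h xi) * (indicator {0..} t * ennreal (heat_ker (t - 0) xi))"
          unfolding e by (simp add: mult_ac)
      qed
      also have "... = (wt (\<kappa> - 1 + 2) xi * (\<integral>\<^sup>+t. indicator {0..} t * ennreal (heat_ker (t - 0) xi) \<partial>lborel)) * h xi"
        by (subst nn_integral_cmult) (auto simp: mult_ac)
      also have "... \<le> wt (\<kappa> - 1) xi * h xi" by (intro mult_right_mono nn_integral_heat_le) auto
      finally show "(\<integral>\<^sup>+t. indicator S t * (wt (\<kappa> + 1) xi * (ennreal (heat_ker t xi) * h xi)) \<partial>lborel) \<le> wt (\<kappa> - 1) xi * h xi" .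
    qed
    finally show ?thesis .
  qed
  ultimately show ?thesis unfolding evnorm_def mult_2 by (rule add_mono)
qed

lemma evnorm_wnorm: "t \<in> S \<Longrightarrow> wnorm (\<kappa> - 1) (f t) \<le> evnorm S \<kappa> f"
  unfolding evnorm_def by (intro order_trans[OF SUP_upper[of t S "\<lambda>t. wnorm (\<kappa> - 1) (f t)"] add_increasing2]) auto

lemma evnorm_int: "(\<integral>\<^sup>+t. indicator S t * wnorm (\<kappa> + 1) (f t) \<partial>lborel) \<le> evnorm S \<kappa> f"
  unfolding evnorm_def by (rule add_increasing) auto

text \<open>After interpolation each product has one factor that is bounded in time and one that is integrable
  in time; the mixed terms in the product of the two norms absorb them.\<close>
lemma wnorm_mult_time_integral_le:
  assumes f: "jmeas f" and g: "jmeas g" and S: "S \<in> sets borel"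
  shows "(\<integral>\<^sup>+tau. indicator S tau * (wnorm \<kappa> (f tau) * wnorm 0 (g tau)) \<partial>lborel) \<le> evnorm S \<kappa> f * evnorm S 0 g"
proof -
  note [measurable] = wnorm_jmeas[OF f] wnorm_jmeas[OF g] S
  let ?A = "SUP t\<in>S. wnorm (\<kappa> - 1) (f t)" and ?L = "\<integral>\<^sup>+t. indicator S t * wnorm (\<kappa> + 1) (f t) \<partial>lborel"
  let ?B = "SUP t\<in>S. wnorm (0 - 1) (g t)" and ?M = "\<integral>\<^sup>+t. indicator S t * wnorm (0 + 1) (g t) \<partial>lborel"
  have "(\<integral>\<^sup>+tau. indicator S tau * (wnorm \<kappa> (f tau) * wnorm 0 (g tau)) \<partial>lborel)
     \<le> (\<integral>\<^sup>+tau. (indicator S tau * wnorm (\<kappa> + 1) (f tau)) * ?B + ?A * (indicator S tau * wnorm 1 (g tau)) \<partial>lborel)"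
  proof (intro nn_integral_mono)
    fix tau
    show "indicator S tau * (wnorm \<kappa> (f tau) * wnorm 0 (g tau)) \<le> (indicator S tau * wnorm (\<kappa> + 1) (f tau)) * ?B + ?A * (indicator S tau * wnorm 1 (g tau))"
    proof (cases "tau \<in> S")
      case True
      have "wnorm \<kappa> (f tau) * wnorm 0 (g tau) \<le> wnorm (\<kappa> + 1) (f tau) * wnorm (-1) (g tau) + wnorm (\<kappa> - 1) (f tau) * wnorm 1 (g tau)"
        using wnorm_amgm[OF jmeas_slice[OF f] jmeas_slice[OF g], of 1 \<kappa> tau tau] by simp
      also have "... \<le> wnorm (\<kappa> + 1) (f tau) * ?B + ?A * wnorm 1 (g tau)"
      proof (rule add_mono)
        show "wnorm (\<kappa> + 1) (f tau) * wnorm (-1) (g tau) \<le> wnorm (\<kappa> + 1) (f tau) * ?B"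
          using SUP_upper[OF True, of "\<lambda>t. wnorm (0 - 1) (g t)"] by (intro mult_left_mono) auto
        show "wnorm (\<kappa> - 1) (f tau) * wnorm 1 (g tau) \<le> ?A * wnorm 1 (g tau)"
          using SUP_upper[OF True, of "\<lambda>t. wnorm (\<kappa> - 1) (f t)"] by (intro mult_right_mono) auto
      qed
      finally show ?thesis using True by simp
    qed simp
  qed
  also have "... = ?L * ?B + ?A * ?M"
    by (subst nn_integral_add) (auto simp: nn_integral_cmult nn_integral_multc)
  also have "... \<le> evnorm S \<kappa> f * evnorm S 0 g"
    unfolding evnorm_def by (simp add: distrib_left distrib_right add_increasing add_increasing2 add_mono)
  finally show ?thesis .
qed

lemma convol_time_integral_le:
  assumes f: "jmeas f" and g: "jmeas g" and S: "S \<in> sets borel" and \<kappa>: "\<kappa> \<ge> 0"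
  shows "(\<integral>\<^sup>+tau. indicator S tau * wnorm \<kappa> (convol (f tau) (g tau)) \<partial>lborel) \<le> ennreal (2 powr \<kappa>) * (evnorm S \<kappa> f * evnorm S 0 g + evnorm S 0 f * evnorm S \<kappa> g)"
proof -
  note [measurable] = wnorm_jmeas[OF f] wnorm_jmeas[OF g] S
  have "(\<integral>\<^sup>+tau. indicator S tau * wnorm \<kappa> (convol (f tau) (g tau)) \<partial>lborel)
    \<le> (\<integral>\<^sup>+tau. ennreal (2 powr \<kappa>) * (indicator S tau * (wnorm \<kappa> (f tau) * wnorm 0 (g tau)) + indicator S tau * (wnorm \<kappa> (g tau) * wnorm 0 (f tau))) \<partial>lborel)"
  proof (intro nn_integral_mono)
    fix tau
    show "indicator S tau * wnorm \<kappa> (convol (f tau) (g tau)) \<le> ennreal (2 powr \<kappa>) * (indicator S tau * (wnorm \<kappa> (f tau) * wnorm 0 (g tau)) + indicator S tau * (wnorm \<kappa> (g tau) * wnorm 0 (f tau)))"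
      using wnorm_convol_le[OF jmeas_slice[OF f] jmeas_slice[OF g] \<kappa>, of tau tau] by (auto simp: indicator_def mult.commute)
  qed
  also have "... = ennreal (2 powr \<kappa>) * ((\<integral>\<^sup>+tau. indicator S tau * (wnorm \<kappa> (f tau) * wnorm 0 (g tau)) \<partial>lborel) + (\<integral>\<^sup>+tau. indicator S tau * (wnorm \<kappa> (g tau) * wnorm 0 (f tau)) \<partial>lborel))"
    by (subst nn_integral_cmult, measurable, subst nn_integral_add) auto
  also have "... \<le> ennreal (2 powr \<kappa>) * (evnorm S \<kappa> f * evnorm S 0 g + evnorm S \<kappa> g * evnorm S 0 f)"
    by (intro mult_left_mono add_mono wnorm_mult_time_integral_le f g S) auto
  finally show ?thesis by (simp add: mult.commute)
qed

text \<open>The central bilinear estimate. Both parts of the norm on the left are at most the time integral of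
  the norms of order \<open>\<kappa>\<close> of the convolutions: the first because the heat kernel is at most
  1, the second by the gain of two derivatives.\<close>
lemma bilin_evnorm:
  assumes f: "jmeas f" and g: "jmeas g" and S: "down_closed S" and \<kappa>: "\<kappa> \<ge> 0"
  shows "evnorm S \<kappa> (bilin f g) \<le> 2 * ennreal (2 powr \<kappa>) * (evnorm S \<kappa> f * evnorm S 0 g + evnorm S 0 f * evnorm S \<kappa> g)"
proof -
  have Sb: "S \<in> sets borel" using S by (simp add: down_closed_def)
  define F where "F = (\<lambda>tau xi. wt 1 xi * convol (f tau) (g tau) xi)"
  note [measurable (raw)] = measurable_curried[OF convol_jmeas[OF f g]]
  have F: "jmeas F" unfolding F_def by measurable
  let ?I = "\<integral>\<^sup>+tau. indicator S tau * wnorm \<kappa> (convol (f tau) (g tau)) \<partial>lborel"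
  have XF: "wnorm (\<kappa> - 1) (F tau) = wnorm \<kappa> (convol (f tau) (g tau))" for tau by (simp add: F_def wnorm_wt)
  have "(SUP t\<in>S. wnorm (\<kappa> - 1) (heat_duhamel F t)) \<le> ?I"
  proof (rule SUP_least)
    fix t assume t: "t \<in> S"
    have "wnorm (\<kappa> - 1) (heat_duhamel F t) \<le> (\<integral>\<^sup>+tau. indicator {0..t} tau * wnorm (\<kappa> - 1) (F tau) \<partial>lborel)" by (rule wnorm_heat_duhamel[OF F])
    also have "... \<le> ?I" unfolding XF
    proof (intro nn_integral_mono mult_right_mono)
      fix tau
      have "{0..t} \<subseteq> S" using S t by (auto simp: down_closed_def)
      then show "indicator {0..t} tau \<le> (indicator S tau :: ennreal)" by (auto simp: indicator_def)
    qed auto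
    finally show "wnorm (\<kappa> - 1) (heat_duhamel F t) \<le> ?I" .
  qed
  moreover have "(\<integral>\<^sup>+t. indicator S t * wnorm (\<kappa> + 1) (heat_duhamel F t) \<partial>lborel) \<le> ?I"
    using wnorm_heat_duhamel_time_integral_le[OF F S, of "\<kappa> - 1"] unfolding XF by (simp add: add.commute)
  ultimately have "evnorm S \<kappa> (bilin f g) \<le> ?I + ?I" unfolding evnorm_def bilin_def F_def by (rule add_mono)
  also have "... = 2 * ?I" by (simp add: mult_2)
  also have "... \<le> 2 * (ennreal (2 powr \<kappa>) * (evnorm S \<kappa> f * evnorm S 0 g + evnorm S 0 f * evnorm S \<kappa> g))"
    by (intro mult_left_mono convol_time_integral_le f g Sb \<kappa>) auto
  finally show ?thesis by (simp add: mult.assoc)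
qed

section \<open>The Duhamel map on the Fourier side\<close>

text \<open>The symbol of \<open>P div (a \<otimes> b)\<close> at frequency \<open>xi\<close>. The factor
  \<open>(2 \<pi>)\<^sup>-\<^sup>3\<close> arises because the Fourier transform of a product is that multiple
  of the convolution, and it is small enough to make the constant in \<open>ns_symbol_norm\<close> equal to
  1.\<close>
definition ns_symbol :: "real^3 \<Rightarrow> complex^3 \<Rightarrow> complex^3 \<Rightarrow> complex^3" where
  "ns_symbol xi a b = (\<chi> i. \<Sum>j\<in>UNIV. complex_of_real (leray_symbol i j xi) *
      (\<Sum>l\<in>UNIV. \<i> * complex_of_real (xi $ l) * (complex_of_real (1 / (2 * pi) ^ 3) * (a $ j * b $ l))))"

lemma ns_symbol_diff_left: "ns_symbol xi (a - a') b = ns_symbol xi a b - ns_symbol xi a' b"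
  by (simp add: ns_symbol_def vec_eq_iff algebra_simps sum_subtractf)

lemma ns_symbol_diff_right: "ns_symbol xi a (b - b') = ns_symbol xi a b - ns_symbol xi a b'"
  by (simp add: ns_symbol_def vec_eq_iff algebra_simps sum_subtractf)

lemma vec_nth_measurable[measurable (raw)]:
  fixes f :: "'a \<Rightarrow> 'b::euclidean_space ^ 'n"
  assumes [measurable]: "f \<in> borel_measurable M" shows "(\<lambda>x. f x $ i) \<in> borel_measurable M"
proof -
  have "(\<lambda>v::'b^'n. v $ i) \<in> borel_measurable borel"
    by (intro borel_measurable_continuous_onI continuous_intros)
  from measurable_compose[OF assms this] show ?thesis .
qed

lemma vec_lambda_measurable:
  fixes f :: "'i::finite \<Rightarrow> 'a \<Rightarrow> complex"
  assumes [measurable]: "\<And>i. f i \<in> borel_measurable M" shows "(\<lambda>x. \<chi> i. f i x) \<in> borel_measurable M"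
proof -
  have [measurable]: "(\<lambda>z::complex. axis i z :: complex ^ 'i) \<in> borel_measurable borel" for i
  proof (intro borel_measurable_continuous_onI)
    have e: "(\<lambda>z::complex. axis i z :: complex ^ 'i) = (\<lambda>z. \<chi> j. if j = i then z else 0)" by (simp add: fun_eq_iff vec_eq_iff axis_def)
    show "continuous_on UNIV (\<lambda>z::complex. axis i z :: complex ^ 'i)" unfolding e by (intro continuous_on_vec_lambda) (case_tac "i = j", auto intro: continuous_on_id continuous_on_const)
  qed
  have "(\<lambda>x. \<Sum>i\<in>UNIV. axis i (f i x) :: complex ^ 'i) \<in> borel_measurable M" by measurable
  also have "(\<lambda>x. \<Sum>i\<in>UNIV. axis i (f i x) :: complex ^ 'i) = (\<lambda>x. \<chi> i. f i x)"
    by (simp add: fun_eq_iff vec_eq_iff axis_def if_distrib[of "\<lambda>v. _ v"] cong: if_cong)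
  finally show ?thesis .
qed

lemma leray_symbol_measurable[measurable]: "leray_symbol i j \<in> borel_measurable borel"
  unfolding leray_symbol_def[abs_def] by measurable

lemma ns_symbol_measurable[measurable (raw)]:
  assumes [measurable]: "f \<in> borel_measurable M" "a \<in> borel_measurable M" "b \<in> borel_measurable M"
  shows "(\<lambda>x. ns_symbol (f x) (a x) (b x)) \<in> borel_measurable M"
  unfolding ns_symbol_def by (intro vec_lambda_measurable) measurable

lemma leray_symbol_le: "\<bar>leray_symbol i j xi\<bar> \<le> 2"
proof -
  have "\<bar>xi $ i * xi $ j / (norm xi)\<^sup>2\<bar> \<le> 1"
  proof (cases "xi = 0")
    case False
    have "\<bar>xi $ i\<bar> * \<bar>xi $ j\<bar> \<le> norm xi * norm xi" by (intro mult_mono component_le_norm_cart) auto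
    then show ?thesis using False by (simp add: abs_mult power2_eq_square)
  qed simp
  moreover have "\<bar>leray_symbol i j xi\<bar> \<le> \<bar>if i = j then 1 else 0\<bar> + \<bar>xi $ i * xi $ j / (norm xi)\<^sup>2\<bar>"
    unfolding leray_symbol_def by (rule abs_triangle_ineq4)
  moreover have "\<bar>if i = j then 1 else 0 :: real\<bar> \<le> 1" by simp
  ultimately show ?thesis by linarith
qed

lemma two_pi_cube: "(2 * pi) ^ 3 \<ge> 54"
proof -
  have "(6::real) ^ 3 \<le> (2 * pi) ^ 3" using pi_gt3 by (intro power_mono) auto
  then show ?thesis by simp
qed

lemma ns_symbol_component: "norm (ns_symbol xi a b $ i) \<le> (1 / 3) * (norm xi * norm a * norm b)"
proof -
  let ?p = "1 / (2 * pi) ^ 3"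
  have p: "?p \<le> 1 / 54" "0 \<le> ?p" using two_pi_cube by (auto simp: divide_simps)
  have l: "norm (\<i> * complex_of_real (xi $ l) * (complex_of_real ?p * (a $ j * b $ l))) \<le> norm xi * (1/54 * (norm a * norm b))" for j l
  proof -
    have "norm (\<i> * complex_of_real (xi $ l) * (complex_of_real ?p * (a $ j * b $ l))) = \<bar>xi $ l\<bar> * (?p * (norm (a $ j) * norm (b $ l)))"
      using p(2) by (simp add: norm_mult norm_divide norm_power)
    also have "... \<le> norm xi * (1/54 * (norm a * norm b))"
      by (intro mult_mono component_le_norm_cart Finite_Cartesian_Product.norm_nth_le p) (auto intro!: mult_nonneg_nonneg)
    finally show ?thesis .
  qed
  have "norm (ns_symbol xi a b $ i) \<le> (\<Sum>j\<in>(UNIV::3 set). 2 * (\<Sum>l\<in>(UNIV::3 set). norm xi * (1/54 * (norm a * norm b))))"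
    unfolding ns_symbol_def vec_lambda_beta
  proof (rule order_trans[OF norm_sum], rule sum_mono)
    fix j :: 3
    have "norm (\<Sum>l\<in>UNIV. \<i> * complex_of_real (xi $ l) * (complex_of_real ?p * (a $ j * b $ l))) \<le> (\<Sum>l\<in>(UNIV::3 set). norm xi * (1/54 * (norm a * norm b)))"
      by (rule order_trans[OF norm_sum]) (intro sum_mono l)
    then show "norm (complex_of_real (leray_symbol i j xi) * (\<Sum>l\<in>UNIV. \<i> * complex_of_real (xi $ l) * (complex_of_real ?p * (a $ j * b $ l))))
      \<le> 2 * (\<Sum>l\<in>(UNIV::3 set). norm xi * (1/54 * (norm a * norm b)))"
      unfolding norm_mult norm_of_real by (intro mult_mono leray_symbol_le) auto
  qed
  also have "... = (1 / 3) * (norm xi * norm a * norm b)" by simp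
  finally show ?thesis .
qed

lemma ns_symbol_norm: "norm (ns_symbol xi a b) \<le> norm xi * norm a * norm b"
proof -
  have "norm (ns_symbol xi a b) \<le> (\<Sum>i\<in>UNIV. norm (ns_symbol xi a b $ i))"
    unfolding norm_vec_def by (rule L2_set_le_sum) auto
  also have "... \<le> (\<Sum>i\<in>(UNIV::3 set). (1 / 3) * (norm xi * norm a * norm b))" by (intro sum_mono ns_symbol_component)
  also have "... = norm xi * norm a * norm b" by simp
  finally show ?thesis .
qed

lemma ns_symbol_ennreal: "ennreal (norm (ns_symbol xi a b)) \<le> wt 1 xi * (ennreal (norm a) * ennreal (norm b))"
  using ns_symbol_norm[of xi a b] by (simp add: wt_def ennreal_mult[symmetric] mult.assoc ennreal_leI)

definition enorm :: "(real \<Rightarrow> real^3 \<Rightarrow> complex^3) \<Rightarrow> real \<Rightarrow> real^3 \<Rightarrow> ennreal" where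
  "enorm U t xi = ennreal (norm (U t xi))"

definition nonlin :: "(real \<Rightarrow> real^3 \<Rightarrow> complex^3) \<Rightarrow> real \<Rightarrow> real^3 \<Rightarrow> complex^3" where
  "nonlin U tau xi = (LINT \<eta>|lborel. ns_symbol xi (U tau (xi - \<eta>)) (U tau \<eta>))"

text \<open>The right hand side of the integral equation on the Fourier side. It is a total function; where
  the integral does not converge the integral is 0 by convention, and estimates are only used at frequencies
  with \<open>nonlin_total U xi < \<infinity>\<close>.\<close>
definition duhamel :: "(real^3 \<Rightarrow> complex^3) \<Rightarrow> (real \<Rightarrow> real^3 \<Rightarrow> complex^3) \<Rightarrow> real \<Rightarrow> real^3 \<Rightarrow> complex^3" where
  "duhamel f U t xi = heat_ker t xi *\<^sub>R f xi
     - (LINT tau|lborel. (indicator {0..t} tau * heat_ker (t - tau) xi) *\<^sub>R nonlin U tau xi)"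

text \<open>A majorant, uniform in time, for the Duhamel integral at a fixed frequency. Finiteness of this
  number singles out the frequencies at which all integrals in \<open>duhamel\<close> converge absolutely, for
  all times at once.\<close>
definition nonlin_total :: "(real \<Rightarrow> real^3 \<Rightarrow> complex^3) \<Rightarrow> real^3 \<Rightarrow> ennreal" where
  "nonlin_total U xi = (\<integral>\<^sup>+tau. indicator {0..} tau * (wt 1 xi * convol (enorm U tau) (enorm U tau) xi) \<partial>lborel)"

lemma enorm_jmeas: assumes U: "jmeas U" shows "jmeas (enorm U)"
proof -
  note [measurable (raw)] = measurable_curried[OF U]
  show ?thesis unfolding enorm_def by measurable
qed

lemma jmeas_diff: fixes U V :: "real \<Rightarrow> real^3 \<Rightarrow> complex^3"
  assumes U: "jmeas U" and V: "jmeas V" shows "jmeas (\<lambda>t xi. U t xi - V t xi)"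
proof -
  note [measurable (raw)] = measurable_curried[OF U] measurable_curried[OF V]
  show ?thesis by measurable
qed

lemma nonlin_jmeas: assumes U: "jmeas U" shows "jmeas (nonlin U)"
proof -
  note [measurable (raw)] = measurable_curried[OF U]
  have "(\<lambda>x. LINT \<eta>|lborel. ns_symbol (snd x) (U (fst x) (snd x - \<eta>)) (U (fst x) \<eta>)) \<in> borel_measurable (borel \<Otimes>\<^sub>M borel)" by measurable
  then show ?thesis unfolding nonlin_def by (simp add: case_prod_beta')
qed

lemma duhamel_jmeas: assumes U: "jmeas U" and [measurable]: "f \<in> borel_measurable borel" shows "jmeas (duhamel f U)"
proof -
  note [measurable (raw)] = measurable_curried[OF nonlin_jmeas[OF U]]
  have "(\<lambda>x. exp (- fst x * (norm (snd x))\<^sup>2) *\<^sub>R f (snd x)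
     - (LINT tau|lborel. (indicator {p. 0 \<le> snd p \<and> snd p \<le> fst p} (fst x, tau) * exp (- (fst x - tau) * (norm (snd x))\<^sup>2)) *\<^sub>R nonlin U tau (snd x))) \<in> borel_measurable (borel \<Otimes>\<^sub>M borel)"
    by measurable
  also have "(\<lambda>x. exp (- fst x * (norm (snd x))\<^sup>2) *\<^sub>R f (snd x)
     - (LINT tau|lborel. (indicator {p. 0 \<le> snd p \<and> snd p \<le> fst p} (fst x, tau) * exp (- (fst x - tau) * (norm (snd x))\<^sup>2)) *\<^sub>R nonlin U tau (snd x))) = case_prod (duhamel f U)"
    by (auto simp: fun_eq_iff duhamel_def indicator_def intro!: Bochner_Integration.integral_cong)
  finally show ?thesis .
qed

lemma norm_LINT_le: "ennreal (norm (LINT x|M. F x)) \<le> (\<integral>\<^sup>+x. ennreal (norm (F x)) \<partial>M)"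
proof (cases "integrable M F")
  case True then show ?thesis by (rule integral_norm_bound_ennreal)
qed (simp add: not_integrable_integral_eq)

lemma nonlin_le: assumes U: "jmeas U"
  shows "ennreal (norm (nonlin U tau xi)) \<le> wt 1 xi * convol (enorm U tau) (enorm U tau) xi"
proof -
  note [measurable (raw)] = measurable_curried[OF U]
  have "ennreal (norm (nonlin U tau xi)) \<le> (\<integral>\<^sup>+\<eta>. ennreal (norm (ns_symbol xi (U tau (xi - \<eta>)) (U tau \<eta>))) \<partial>lborel)"
    unfolding nonlin_def by (rule norm_LINT_le)
  also have "... \<le> (\<integral>\<^sup>+\<eta>. wt 1 xi * (enorm U tau (xi - \<eta>) * enorm U tau \<eta>) \<partial>lborel)"
    unfolding enorm_def by (intro nn_integral_mono ns_symbol_ennreal)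
  also have "... = wt 1 xi * convol (enorm U tau) (enorm U tau) xi"
    unfolding convol_def enorm_def by (subst nn_integral_cmult) auto
  finally show ?thesis .
qed

lemma ns_symbol_integrable:
  assumes U: "jmeas U" and fin: "convol (enorm U tau) (enorm U tau) xi < \<infinity>"
  shows "integrable lborel (\<lambda>\<eta>. ns_symbol xi (U tau (xi - \<eta>)) (U tau \<eta>))"
proof (rule integrableI_bounded)
  note [measurable (raw)] = measurable_curried[OF U]
  show "(\<lambda>\<eta>. ns_symbol xi (U tau (xi - \<eta>)) (U tau \<eta>)) \<in> borel_measurable lborel" by measurable
  have "(\<integral>\<^sup>+\<eta>. ennreal (norm (ns_symbol xi (U tau (xi - \<eta>)) (U tau \<eta>))) \<partial>lborel) \<le> (\<integral>\<^sup>+\<eta>. wt 1 xi * (enorm U tau (xi - \<eta>) * enorm U tau \<eta>) \<partial>lborel)"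
    unfolding enorm_def by (intro nn_integral_mono ns_symbol_ennreal)
  also have "... = wt 1 xi * convol (enorm U tau) (enorm U tau) xi"
    unfolding convol_def enorm_def by (subst nn_integral_cmult) auto
  also have "... < \<infinity>" using fin by (simp add: wt_def ennreal_mult_less_top)
  finally show "(\<integral>\<^sup>+\<eta>. ennreal (norm (ns_symbol xi (U tau (xi - \<eta>)) (U tau \<eta>))) \<partial>lborel) < \<infinity>" .
qed

lemma nonlin_diff_le:
  assumes U: "jmeas U" and V: "jmeas V" and finU: "convol (enorm U tau) (enorm U tau) xi < \<infinity>" and finV: "convol (enorm V tau) (enorm V tau) xi < \<infinity>"
  defines "W \<equiv> (\<lambda>t xi. U t xi - V t xi)"
  shows "ennreal (norm (nonlin U tau xi - nonlin V tau xi)) \<le> wt 1 xi * convol (enorm U tau) (enorm W tau) xi + wt 1 xi * convol (enorm W tau) (enorm V tau) xi"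
proof -
  note [measurable (raw)] = measurable_curried[OF U] measurable_curried[OF V]
  have "nonlin U tau xi - nonlin V tau xi = (LINT \<eta>|lborel. ns_symbol xi (U tau (xi - \<eta>)) (U tau \<eta>) - ns_symbol xi (V tau (xi - \<eta>)) (V tau \<eta>))"
    unfolding nonlin_def by (intro Bochner_Integration.integral_diff[symmetric] ns_symbol_integrable U V finU finV)
  also have "ennreal (norm ...) \<le> (\<integral>\<^sup>+\<eta>. ennreal (norm (ns_symbol xi (U tau (xi - \<eta>)) (U tau \<eta>) - ns_symbol xi (V tau (xi - \<eta>)) (V tau \<eta>))) \<partial>lborel)"
    by (rule norm_LINT_le)
  also have "... \<le> (\<integral>\<^sup>+\<eta>. wt 1 xi * (enorm U tau (xi - \<eta>) * enorm W tau \<eta>) + wt 1 xi * (enorm W tau (xi - \<eta>) * enorm V tau \<eta>) \<partial>lborel)"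
  proof (intro nn_integral_mono)
    fix \<eta>
    have "ns_symbol xi (U tau (xi - \<eta>)) (U tau \<eta>) - ns_symbol xi (V tau (xi - \<eta>)) (V tau \<eta>) = ns_symbol xi (U tau (xi - \<eta>)) (W tau \<eta>) + ns_symbol xi (W tau (xi - \<eta>)) (V tau \<eta>)"
      by (simp add: W_def ns_symbol_diff_left ns_symbol_diff_right)
    then have "ennreal (norm (ns_symbol xi (U tau (xi - \<eta>)) (U tau \<eta>) - ns_symbol xi (V tau (xi - \<eta>)) (V tau \<eta>))) \<le> ennreal (norm (ns_symbol xi (U tau (xi - \<eta>)) (W tau \<eta>))) + ennreal (norm (ns_symbol xi (W tau (xi - \<eta>)) (V tau \<eta>)))"
      by (simp add: ennreal_plus[symmetric] ennreal_leI norm_triangle_ineq del: ennreal_plus)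
    also have "... \<le> wt 1 xi * (enorm U tau (xi - \<eta>) * enorm W tau \<eta>) + wt 1 xi * (enorm W tau (xi - \<eta>) * enorm V tau \<eta>)"
      unfolding enorm_def by (intro add_mono ns_symbol_ennreal)
    finally show "ennreal (norm (ns_symbol xi (U tau (xi - \<eta>)) (U tau \<eta>) - ns_symbol xi (V tau (xi - \<eta>)) (V tau \<eta>))) \<le> wt 1 xi * (enorm U tau (xi - \<eta>) * enorm W tau \<eta>) + wt 1 xi * (enorm W tau (xi - \<eta>) * enorm V tau \<eta>)" .
  qed
  also have "... = wt 1 xi * convol (enorm U tau) (enorm W tau) xi + wt 1 xi * convol (enorm W tau) (enorm V tau) xi"
    unfolding convol_def enorm_def W_def by (subst nn_integral_add) (auto simp: nn_integral_cmult)
  finally show ?thesis .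
qed

lemma nonlin_total_measurable: assumes U: "jmeas U" shows "nonlin_total U \<in> borel_measurable borel"
proof -
  note [measurable (raw)] = measurable_curried[OF convol_jmeas[OF enorm_jmeas[OF U] enorm_jmeas[OF U]]]
  show ?thesis unfolding nonlin_total_def[abs_def] by measurable
qed

text \<open>In particular almost every frequency is good if \<open>U\<close> has finite norm at the scaling
  invariant level, see \<open>nonlin_total_finite_AE\<close>.\<close>
lemma nonlin_total_wnorm: assumes U: "jmeas U" shows "wnorm (-1) (nonlin_total U) \<le> 2 * (evnorm {0..} 0 (enorm U) * evnorm {0..} 0 (enorm U))"
proof -
  note [measurable (raw)] = measurable_curried[OF convol_jmeas[OF enorm_jmeas[OF U] enorm_jmeas[OF U]]]
  have "wnorm (-1) (nonlin_total U) = (\<integral>\<^sup>+xi. \<integral>\<^sup>+tau. wt (-1) xi * (indicator {0..} tau * (wt 1 xi * convol (enorm U tau) (enorm U tau) xi)) \<partial>lborel \<partial>lborel)"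
    unfolding wnorm_def nonlin_total_def by (simp add: nn_integral_cmult)
  also have "... = (\<integral>\<^sup>+tau. \<integral>\<^sup>+xi. wt (-1) xi * (indicator {0..} tau * (wt 1 xi * convol (enorm U tau) (enorm U tau) xi)) \<partial>lborel \<partial>lborel)"
    by (rule lborel_pair.Fubini') simp
  also have "... = (\<integral>\<^sup>+tau. indicator {0..} tau * wnorm (-1) (\<lambda>xi. wt 1 xi * convol (enorm U tau) (enorm U tau) xi) \<partial>lborel)"
    unfolding wnorm_def by (subst nn_integral_cmult[symmetric]) (auto simp: mult_ac)
  also have "... = (\<integral>\<^sup>+tau. indicator {0..} tau * wnorm 0 (convol (enorm U tau) (enorm U tau)) \<partial>lborel)"
    by (simp add: wnorm_wt)
  also have "... \<le> ennreal (2 powr 0) * (evnorm {0..} 0 (enorm U) * evnorm {0..} 0 (enorm U) + evnorm {0..} 0 (enorm U) * evnorm {0..} 0 (enorm U))"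
    by (intro convol_time_integral_le enorm_jmeas U) auto
  also have "... = 2 * (evnorm {0..} 0 (enorm U) * evnorm {0..} 0 (enorm U))" by (simp add: mult_2)
  finally show ?thesis .
qed

lemma nonlin_total_finite_AE: assumes U: "jmeas U" and fin: "evnorm {0..} 0 (enorm U) < \<infinity>"
  shows "AE xi in lborel. nonlin_total U xi < \<infinity>"
proof (rule wnorm_finite_AE[OF nonlin_total_measurable[OF U]])
  have "2 * (evnorm {0..} 0 (enorm U) * evnorm {0..} 0 (enorm U)) < (\<infinity>::ennreal)" using fin by (simp add: ennreal_mult_less_top)
  with nonlin_total_wnorm[OF U] show "wnorm (-1) (nonlin_total U) < \<infinity>" by (rule le_less_trans)
qed

lemma nonlin_total_convol_finite_AE:
  assumes U: "jmeas U" and good: "nonlin_total U xi < \<infinity>" and "xi \<noteq> 0"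
  shows "AE tau in lborel. 0 \<le> tau \<longrightarrow> convol (enorm U tau) (enorm U tau) xi < \<infinity>"
proof -
  note [measurable (raw)] = measurable_curried[OF convol_jmeas[OF enorm_jmeas[OF U] enorm_jmeas[OF U]]]
  have "AE tau in lborel. indicator {0..} tau * (wt 1 xi * convol (enorm U tau) (enorm U tau) xi) \<noteq> \<infinity>"
    using good unfolding nonlin_total_def by (intro nn_integral_PInf_AE) auto
  then show ?thesis by eventually_elim (use \<open>xi \<noteq> 0\<close> in \<open>auto simp: wt_def ennreal_mult_eq_top_iff less_top\<close>)
qed

lemma nonlin_int_le: assumes U: "jmeas U"
  shows "(\<integral>\<^sup>+tau. ennreal (norm (indicator {0..} tau *\<^sub>R nonlin U tau xi)) \<partial>lborel) \<le> nonlin_total U xi"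
  unfolding nonlin_total_def
proof (intro nn_integral_mono)
  fix tau show "ennreal (norm (indicator {0..} tau *\<^sub>R nonlin U tau xi)) \<le> indicator {0..} tau * (wt 1 xi * convol (enorm U tau) (enorm U tau) xi)"
    using nonlin_le[OF U, of tau xi] by (simp add: indicator_def)
qed

lemma nonlin_integrable: assumes U: "jmeas U" and good: "nonlin_total U xi < \<infinity>"
  shows "integrable lborel (\<lambda>tau. indicator {0..} tau *\<^sub>R nonlin U tau xi)"
proof (rule integrableI_bounded)
  note [measurable (raw)] = measurable_curried[OF nonlin_jmeas[OF U]]
  show "(\<lambda>tau. indicator {0..} tau *\<^sub>R nonlin U tau xi) \<in> borel_measurable lborel" by measurable
qed (rule le_less_trans[OF nonlin_int_le[OF U] good])

lemma exp_ind_le: "\<bar>indicator {0..t} tau * exp (- (t - tau) * (norm (xi::real^3))\<^sup>2)\<bar> \<le> indicator {0..} tau"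
  by (auto simp: indicator_def mult_nonpos_nonneg)

lemma duhamel_integrable: assumes U: "jmeas U" and good: "nonlin_total U xi < \<infinity>"
  shows "integrable lborel (\<lambda>tau. (indicator {0..t} tau * heat_ker (t - tau) xi) *\<^sub>R nonlin U tau xi)"
proof (rule Bochner_Integration.integrable_bound[OF nonlin_integrable[OF assms]])
  note [measurable (raw)] = measurable_curried[OF nonlin_jmeas[OF U]]
  show "(\<lambda>tau. (indicator {0..t} tau * heat_ker (t - tau) xi) *\<^sub>R nonlin U tau xi) \<in> borel_measurable lborel" by measurable
  show "AE tau in lborel. norm ((indicator {0..t} tau * heat_ker (t - tau) xi) *\<^sub>R nonlin U tau xi) \<le> norm (indicator {0..} tau *\<^sub>R nonlin U tau xi)"
  proof (intro AE_I2)
    fix tau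
    show "norm ((indicator {0..t} tau * heat_ker (t - tau) xi) *\<^sub>R nonlin U tau xi) \<le> norm (indicator {0..} tau *\<^sub>R nonlin U tau xi)"
      using mult_right_mono[OF exp_ind_le[of t tau xi], of "norm (nonlin U tau xi)"] by simp
  qed
qed

lemma kernel_le: "ennreal (norm ((indicator {0..t} tau * heat_ker (t - tau) xi) *\<^sub>R v)) = indicator {0..t} tau * ennreal (heat_ker (t - tau) xi) * ennreal (norm v)"
  by (simp add: indicator_def ennreal_mult[symmetric])

lemma duhamel_le: assumes U: "jmeas U"
  shows "enorm (duhamel f U) t xi \<le> ennreal (heat_ker t xi) * ennreal (norm (f xi)) + bilin (enorm U) (enorm U) t xi"
proof -
  let ?I = "LINT tau|lborel. (indicator {0..t} tau * heat_ker (t - tau) xi) *\<^sub>R nonlin U tau xi"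
  have "enorm (duhamel f U) t xi \<le> ennreal (norm (heat_ker t xi *\<^sub>R f xi)) + ennreal (norm ?I)"
    unfolding enorm_def duhamel_def by (simp add: ennreal_plus[symmetric] ennreal_leI norm_triangle_ineq4 del: ennreal_plus norm_scaleR)
  also have "ennreal (norm (heat_ker t xi *\<^sub>R f xi)) = ennreal (heat_ker t xi) * ennreal (norm (f xi))"
    by (simp add: ennreal_mult)
  also have "ennreal (norm ?I) \<le> bilin (enorm U) (enorm U) t xi"
    unfolding bilin_def heat_duhamel_def by (rule order_trans[OF norm_LINT_le]) (unfold kernel_le, intro nn_integral_mono mult_left_mono nonlin_le U, simp)
  finally show ?thesis by simp
qed

text \<open>Polarisation: \<open>U \<otimes> U - V \<otimes> V = U \<otimes> W + W \<otimes> V\<close> for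
  \<open>W = U - V\<close>.\<close>
lemma duhamel_diff_le: assumes U: "jmeas U" and V: "jmeas V" and gU: "nonlin_total U xi < \<infinity>" and gV: "nonlin_total V xi < \<infinity>" and xi: "xi \<noteq> 0"
  defines "W \<equiv> (\<lambda>t xi. U t xi - V t xi)"
  shows "ennreal (norm (duhamel f U t xi - duhamel f V t xi)) \<le> bilin (enorm U) (enorm W) t xi + bilin (enorm W) (enorm V) t xi"
proof -
  have W: "jmeas W" unfolding W_def by (rule jmeas_diff[OF U V])
  note [measurable (raw)] = measurable_curried[OF convol_jmeas[OF enorm_jmeas[OF U] enorm_jmeas[OF W]]] measurable_curried[OF convol_jmeas[OF enorm_jmeas[OF W] enorm_jmeas[OF V]]]
  let ?k = "\<lambda>tau. indicator {0..t} tau * heat_ker (t - tau) xi"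
  have "duhamel f U t xi - duhamel f V t xi = - ((LINT tau|lborel. ?k tau *\<^sub>R nonlin U tau xi) - (LINT tau|lborel. ?k tau *\<^sub>R nonlin V tau xi))"
    by (simp add: duhamel_def)
  also have "... = - (LINT tau|lborel. ?k tau *\<^sub>R nonlin U tau xi - ?k tau *\<^sub>R nonlin V tau xi)"
    by (subst Bochner_Integration.integral_diff[OF duhamel_integrable[OF U gU] duhamel_integrable[OF V gV]]) simp
  also have "... = - (LINT tau|lborel. ?k tau *\<^sub>R (nonlin U tau xi - nonlin V tau xi))" by (simp add: scaleR_right_diff_distrib)
  finally have d: "duhamel f U t xi - duhamel f V t xi = - (LINT tau|lborel. ?k tau *\<^sub>R (nonlin U tau xi - nonlin V tau xi))" .
  have "ennreal (norm (duhamel f U t xi - duhamel f V t xi)) \<le> (\<integral>\<^sup>+tau. ennreal (norm (?k tau *\<^sub>R (nonlin U tau xi - nonlin V tau xi))) \<partial>lborel)"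
    unfolding d norm_minus_cancel by (rule norm_LINT_le)
  also have "... \<le> (\<integral>\<^sup>+tau. indicator {0..t} tau * ennreal (heat_ker (t - tau) xi) * (wt 1 xi * convol (enorm U tau) (enorm W tau) xi)
      + indicator {0..t} tau * ennreal (heat_ker (t - tau) xi) * (wt 1 xi * convol (enorm W tau) (enorm V tau) xi) \<partial>lborel)"
  proof (rule nn_integral_mono_AE, use nonlin_total_convol_finite_AE[OF U gU xi] nonlin_total_convol_finite_AE[OF V gV xi] in eventually_elim)
    fix tau assume a: "0 \<le> tau \<longrightarrow> convol (enorm U tau) (enorm U tau) xi < \<infinity>" "0 \<le> tau \<longrightarrow> convol (enorm V tau) (enorm V tau) xi < \<infinity>"
    show "ennreal (norm (?k tau *\<^sub>R (nonlin U tau xi - nonlin V tau xi))) \<le> indicator {0..t} tau * ennreal (heat_ker (t - tau) xi) * (wt 1 xi * convol (enorm U tau) (enorm W tau) xi)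
      + indicator {0..t} tau * ennreal (heat_ker (t - tau) xi) * (wt 1 xi * convol (enorm W tau) (enorm V tau) xi)"
      unfolding kernel_le distrib_left[symmetric]
    proof (cases "0 \<le> tau")
      case True
      then show "indicator {0..t} tau * ennreal (heat_ker (t - tau) xi) * ennreal (norm (nonlin U tau xi - nonlin V tau xi)) \<le> indicator {0..t} tau * ennreal (heat_ker (t - tau) xi) *
          (wt 1 xi * (convol (enorm U tau) (enorm W tau) xi + convol (enorm W tau) (enorm V tau) xi))"
        using nonlin_diff_le[OF U V, of tau xi] a unfolding W_def by (intro mult_left_mono) (auto simp: distrib_left)
    qed simp
  qed
  also have "... = bilin (enorm U) (enorm W) t xi + bilin (enorm W) (enorm V) t xi"
    unfolding bilin_def heat_duhamel_def by (subst nn_integral_add) auto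
  finally show ?thesis .
qed

lemma nonlin_cong:
  assumes "AE xi in lborel. U tau xi = V tau xi" and U: "jmeas U" and V: "jmeas V"
  shows "nonlin U tau xi = nonlin V tau xi"
proof -
  note [measurable (raw)] = measurable_curried[OF U] measurable_curried[OF V]
  have "AE \<eta> in lborel. U tau (xi - \<eta>) = V tau (xi - \<eta>)"
    using AE_affine3[OF assms(1), of "-1" xi] by simp
  with assms(1) have "AE \<eta> in lborel. ns_symbol xi (U tau (xi - \<eta>)) (U tau \<eta>) = ns_symbol xi (V tau (xi - \<eta>)) (V tau \<eta>)"
    by eventually_elim simp
  then show ?thesis unfolding nonlin_def by (intro integral_cong_AE) auto
qed

text \<open>Since both integrations ignore null sets, \<open>duhamel f\<close> maps functions that agree
  almost everywhere to functions that agree everywhere. Applying it once more therefore turns a fixed point up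
  to null sets into an exact one.\<close>
lemma duhamel_cong:
  assumes "AE tau in lborel. 0 \<le> tau \<longrightarrow> (AE xi in lborel. U tau xi = V tau xi)" and U: "jmeas U" and V: "jmeas V"
  shows "duhamel f U t xi = duhamel f V t xi"
proof -
  note [measurable (raw)] = measurable_curried[OF nonlin_jmeas[OF U]] measurable_curried[OF nonlin_jmeas[OF V]]
  have "(LINT tau|lborel. (indicator {0..t} tau * heat_ker (t - tau) xi) *\<^sub>R nonlin U tau xi) = (LINT tau|lborel. (indicator {0..t} tau * heat_ker (t - tau) xi) *\<^sub>R nonlin V tau xi)"
  proof (intro integral_cong_AE)
    show "AE tau in lborel. (indicator {0..t} tau * heat_ker (t - tau) xi) *\<^sub>R nonlin U tau xi = (indicator {0..t} tau * heat_ker (t - tau) xi) *\<^sub>R nonlin V tau xi"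
      using assms(1) by eventually_elim (use nonlin_cong[OF _ U V] in \<open>auto simp: indicator_def\<close>)
  qed measurable
  then show ?thesis by (simp add: duhamel_def)
qed

lemma duhamel_bound: assumes U: "jmeas U" and "t \<ge> 0"
  shows "enorm (duhamel f U) t xi \<le> ennreal (norm (f xi)) + nonlin_total U xi"
proof -
  have "enorm (duhamel f U) t xi \<le> ennreal (heat_ker t xi) * ennreal (norm (f xi)) + bilin (enorm U) (enorm U) t xi" by (rule duhamel_le[OF U])
  also have "ennreal (heat_ker t xi) * ennreal (norm (f xi)) \<le> 1 * ennreal (norm (f xi))"
    using assms(2) by (intro mult_right_mono) auto
  also have "bilin (enorm U) (enorm U) t xi \<le> nonlin_total U xi"
    unfolding bilin_def heat_duhamel_def nonlin_total_def
  proof (intro nn_integral_mono mult_right_mono)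
    fix tau show "indicator {0..t} tau * ennreal (heat_ker (t - tau) xi) \<le> indicator {0..} tau"
      by (auto simp: indicator_def mult_nonpos_nonneg)
  qed simp
  finally show ?thesis by (simp add: add_mono)
qed

text \<open>Dominated convergence in time, with the majorant provided by \<open>nonlin_total\<close>.\<close>
lemma duhamel_continuous: assumes U: "jmeas U" and good: "nonlin_total U xi < \<infinity>" and s: "s \<longlonglongrightarrow> t"
  shows "(\<lambda>n. duhamel f U (s n) xi) \<longlonglongrightarrow> duhamel f U t xi"
  unfolding duhamel_def
proof (intro tendsto_diff tendsto_scaleR tendsto_const)
  note [measurable (raw)] = measurable_curried[OF nonlin_jmeas[OF U]]
  show "(\<lambda>n. exp (- s n * (norm xi)\<^sup>2)) \<longlonglongrightarrow> heat_ker t xi" by (intro tendsto_intros s)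
  show "(\<lambda>n. LINT tau|lborel. (indicator {0..s n} tau * exp (- (s n - tau) * (norm xi)\<^sup>2)) *\<^sub>R nonlin U tau xi)
    \<longlonglongrightarrow> (LINT tau|lborel. (indicator {0..t} tau * heat_ker (t - tau) xi) *\<^sub>R nonlin U tau xi)"
  proof (rule integral_dominated_convergence)
    show "integrable lborel (\<lambda>tau. norm (indicator {0..} tau *\<^sub>R nonlin U tau xi))" by (intro integrable_norm nonlin_integrable[OF U good])
    show "AE tau in lborel. norm ((indicator {0..s n} tau * exp (- (s n - tau) * (norm xi)\<^sup>2)) *\<^sub>R nonlin U tau xi) \<le> norm (indicator {0..} tau *\<^sub>R nonlin U tau xi)" for n
    proof (intro AE_I2)
      fix tau
      show "norm ((indicator {0..s n} tau * exp (- (s n - tau) * (norm xi)\<^sup>2)) *\<^sub>R nonlin U tau xi) \<le> norm (indicator {0..} tau *\<^sub>R nonlin U tau xi)"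
        using mult_right_mono[OF exp_ind_le[of "s n" tau xi], of "norm (nonlin U tau xi)"] by simp
    qed
    show "AE tau in lborel. (\<lambda>n. (indicator {0..s n} tau * exp (- (s n - tau) * (norm xi)\<^sup>2)) *\<^sub>R nonlin U tau xi) \<longlonglongrightarrow> (indicator {0..t} tau * heat_ker (t - tau) xi) *\<^sub>R nonlin U tau xi"
    proof (rule eventually_mono[OF AE_lborel_singleton[of t]])
      fix tau assume "tau \<noteq> t"
      have "(\<lambda>n. indicator {0..s n} tau :: real) \<longlonglongrightarrow> indicator {0..t} tau"
      proof (cases "tau < t")
        case True
        then have "\<forall>\<^sub>F n in sequentially. indicator {0..s n} tau = (indicator {0..t} tau :: real)"
          using order_tendstoD(1)[OF s True] by (auto elim!: eventually_mono simp: indicator_def)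
        then show ?thesis by (rule tendsto_eventually)
      next
        case False
        then have "t < tau" using \<open>tau \<noteq> t\<close> by simp
        then have "\<forall>\<^sub>F n in sequentially. indicator {0..s n} tau = (indicator {0..t} tau :: real)"
          using order_tendstoD(2)[OF s, of tau] by (auto elim!: eventually_mono simp: indicator_def)
        then show ?thesis by (rule tendsto_eventually)
      qed
      then show "(\<lambda>n. (indicator {0..s n} tau * exp (- (s n - tau) * (norm xi)\<^sup>2)) *\<^sub>R nonlin U tau xi) \<longlonglongrightarrow> (indicator {0..t} tau * heat_ker (t - tau) xi) *\<^sub>R nonlin U tau xi"
        by (intro tendsto_intros s)
    qed
  qed measurable
qed

lemma down_closed_atLeast[simp]: "down_closed {0..}" by (auto simp: down_closed_def)
lemma down_closed_atMost[simp]: "down_closed {0..T}" by (auto simp: down_closed_def)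

lemma evnorm_mono:
  assumes "\<And>t. t \<in> S \<Longrightarrow> AE xi in lborel. f t xi \<le> g t xi"
  shows "evnorm S \<kappa> f \<le> evnorm S \<kappa> g"
  unfolding evnorm_def
proof (rule add_mono)
  show "(SUP t\<in>S. wnorm (\<kappa> - 1) (f t)) \<le> (SUP t\<in>S. wnorm (\<kappa> - 1) (g t))"
    by (intro SUP_mono) (use wnorm_mono_AE[OF assms] in blast)
  show "(\<integral>\<^sup>+t. indicator S t * wnorm (\<kappa> + 1) (f t) \<partial>lborel) \<le> (\<integral>\<^sup>+t. indicator S t * wnorm (\<kappa> + 1) (g t) \<partial>lborel)"
    by (intro nn_integral_mono) (use wnorm_mono_AE[OF assms] in \<open>auto simp: indicator_def\<close>)
qed

lemma evnorm_cong:
  assumes "\<And>t. t \<in> S \<Longrightarrow> AE xi in lborel. f t xi = g t xi"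
  shows "evnorm S \<kappa> f = evnorm S \<kappa> g"
  by (intro antisym evnorm_mono) (auto elim!: eventually_mono dest!: assms)

lemma evnorm_add:
  assumes f: "jmeas f" and g: "jmeas g" and [measurable]: "S \<in> sets borel"
  shows "evnorm S \<kappa> (\<lambda>t xi. f t xi + g t xi) \<le> evnorm S \<kappa> f + evnorm S \<kappa> g"
proof -
  note [measurable] = wnorm_jmeas[OF f] wnorm_jmeas[OF g]
  have e: "wnorm a (\<lambda>xi. f t xi + g t xi) = wnorm a (f t) + wnorm a (g t)" for a t
    by (intro wnorm_add jmeas_slice f g)
  have 1: "(SUP t\<in>S. wnorm (\<kappa> - 1) (f t) + wnorm (\<kappa> - 1) (g t)) \<le> (SUP t\<in>S. wnorm (\<kappa> - 1) (f t)) + (SUP t\<in>S. wnorm (\<kappa> - 1) (g t))"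
    by (intro SUP_least add_mono SUP_upper)
  have 2: "(\<integral>\<^sup>+t. indicator S t * (wnorm (\<kappa> + 1) (f t) + wnorm (\<kappa> + 1) (g t)) \<partial>lborel) = (\<integral>\<^sup>+t. indicator S t * wnorm (\<kappa> + 1) (f t) \<partial>lborel) + (\<integral>\<^sup>+t. indicator S t * wnorm (\<kappa> + 1) (g t) \<partial>lborel)"
    unfolding distrib_left by (subst nn_integral_add) auto
  have "evnorm S \<kappa> (\<lambda>t xi. f t xi + g t xi) \<le> ((SUP t\<in>S. wnorm (\<kappa> - 1) (f t)) + (SUP t\<in>S. wnorm (\<kappa> - 1) (g t)))
     + ((\<integral>\<^sup>+t. indicator S t * wnorm (\<kappa> + 1) (f t) \<partial>lborel) + (\<integral>\<^sup>+t. indicator S t * wnorm (\<kappa> + 1) (g t) \<partial>lborel))"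
    unfolding evnorm_def e 2 by (intro add_right_mono 1)
  then show ?thesis unfolding evnorm_def by (simp add: add_ac)
qed

text \<open>Countable subadditivity, used to sum the increments of the Picard iteration.\<close>
lemma evnorm_suminf:
  assumes f: "\<And>n::nat. jmeas (f n)" and [measurable]: "S \<in> sets borel"
  shows "evnorm S \<kappa> (\<lambda>t xi. \<Sum>n. f n t xi) \<le> (\<Sum>n. evnorm S \<kappa> (f n))"
proof -
  note [measurable] = wnorm_jmeas[OF f] jmeas_slice[OF f]
  have e: "wnorm a (\<lambda>xi. \<Sum>n. f n t xi) = (\<Sum>n. wnorm a (f n t))" for a t
    unfolding wnorm_def by (simp add: nn_integral_suminf[symmetric])
  have 1: "(SUP t\<in>S. \<Sum>n. wnorm (\<kappa> - 1) (f n t)) \<le> (\<Sum>n. SUP t\<in>S. wnorm (\<kappa> - 1) (f n t))"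
    by (intro SUP_least suminf_le SUP_upper) auto
  have 2: "(\<integral>\<^sup>+t. indicator S t * (\<Sum>n. wnorm (\<kappa> + 1) (f n t)) \<partial>lborel) = (\<Sum>n. \<integral>\<^sup>+t. indicator S t * wnorm (\<kappa> + 1) (f n t) \<partial>lborel)"
    by (subst nn_integral_suminf[symmetric]) (auto intro!: nn_integral_cong)
  have "evnorm S \<kappa> (\<lambda>t xi. \<Sum>n. f n t xi) \<le> (\<Sum>n. SUP t\<in>S. wnorm (\<kappa> - 1) (f n t)) + (\<Sum>n. \<integral>\<^sup>+t. indicator S t * wnorm (\<kappa> + 1) (f n t) \<partial>lborel)"
    unfolding evnorm_def e 2 by (intro add_right_mono 1)
  also have "... = (\<Sum>n. evnorm S \<kappa> (f n))" unfolding evnorm_def by (simp add: suminf_add)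
  finally show ?thesis .
qed

lemma evnorm_0_D:
  assumes f: "jmeas f" and "evnorm S \<kappa> f = 0" "t \<in> S" shows "AE xi in lborel. f t xi = 0"
  using evnorm_wnorm[OF assms(3), of \<kappa> f] assms(2) by (intro wnorm_eq_0[OF jmeas_slice[OF f], where a="\<kappa> - 1"]) auto

lemma evnorm_finite_wnorm_AE:
  assumes f: "jmeas f" and fin: "evnorm S \<kappa> f < \<infinity>" and "t \<in> S" shows "AE xi in lborel. f t xi < \<infinity>"
  using le_less_trans[OF evnorm_wnorm[OF assms(3)] fin] by (intro wnorm_finite_AE[OF jmeas_slice[OF f], where a="\<kappa> - 1"]) auto

lemma duhamel_evnorm:
  assumes U: "jmeas U" and [measurable]: "f \<in> borel_measurable borel" and S: "down_closed S" and \<kappa>: "\<kappa> \<ge> 0"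
  shows "evnorm S \<kappa> (enorm (duhamel f U)) \<le> 2 * wnorm (\<kappa> - 1) (\<lambda>xi. ennreal (norm (f xi))) + 4 * ennreal (2 powr \<kappa>) * (evnorm S \<kappa> (enorm U) * evnorm S 0 (enorm U))"
proof -
  have Sb: "S \<in> sets borel" using S by (simp add: down_closed_def)
  have "evnorm S \<kappa> (enorm (duhamel f U)) \<le> evnorm S \<kappa> (\<lambda>t xi. ennreal (heat_ker t xi) * ennreal (norm (f xi)) + bilin (enorm U) (enorm U) t xi)"
    by (intro evnorm_mono AE_I2 duhamel_le U)
  also have "... \<le> evnorm S \<kappa> (\<lambda>t xi. ennreal (heat_ker t xi) * ennreal (norm (f xi))) + evnorm S \<kappa> (bilin (enorm U) (enorm U))"
    by (intro evnorm_add bilin_jmeas enorm_jmeas U Sb) simp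
  also have "... \<le> 2 * wnorm (\<kappa> - 1) (\<lambda>xi. ennreal (norm (f xi))) + 2 * ennreal (2 powr \<kappa>) * (evnorm S \<kappa> (enorm U) * evnorm S 0 (enorm U) + evnorm S 0 (enorm U) * evnorm S \<kappa> (enorm U))"
    by (intro add_mono heat_evnorm bilin_evnorm enorm_jmeas U S \<kappa>) simp
  also have "2 * ennreal (2 powr \<kappa>) * (evnorm S \<kappa> (enorm U) * evnorm S 0 (enorm U) + evnorm S 0 (enorm U) * evnorm S \<kappa> (enorm U)) = 4 * ennreal (2 powr \<kappa>) * (evnorm S \<kappa> (enorm U) * evnorm S 0 (enorm U))"
  proof -
    have "2 * c * (a * b + b * a) = 4 * c * (a * b)" for a b c :: ennreal
    proof -
      have "2 * c * (a * b + b * a) = 2 * c * (2 * (a * b))" by (simp only: mult_2 mult.commute[of b a])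
      also have "... = (2 * 2) * c * (a * b)" by (simp only: mult_ac)
      finally show ?thesis by simp
    qed
    then show ?thesis .
  qed
  finally show ?thesis .
qed

text \<open>The contraction estimate at the scaling invariant level.\<close>
lemma duhamel_diff_evnorm:
  assumes U: "jmeas U" and V: "jmeas V" and fU: "evnorm {0..} 0 (enorm U) < \<infinity>" and fV: "evnorm {0..} 0 (enorm V) < \<infinity>"
  defines "W \<equiv> (\<lambda>t xi. U t xi - V t xi)"
  shows "evnorm {0..} 0 (enorm (\<lambda>t xi. duhamel f U t xi - duhamel f V t xi)) \<le> 4 * (evnorm {0..} 0 (enorm U) + evnorm {0..} 0 (enorm V)) * evnorm {0..} 0 (enorm W)"
proof -
  have W: "jmeas W" unfolding W_def by (rule jmeas_diff[OF U V])
  have "evnorm {0..} 0 (enorm (\<lambda>t xi. duhamel f U t xi - duhamel f V t xi)) \<le> evnorm {0..} 0 (\<lambda>t xi. bilin (enorm U) (enorm W) t xi + bilin (enorm W) (enorm V) t xi)"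
  proof (rule evnorm_mono)
    fix t
    show "AE xi in lborel. enorm (\<lambda>t xi. duhamel f U t xi - duhamel f V t xi) t xi \<le> bilin (enorm U) (enorm W) t xi + bilin (enorm W) (enorm V) t xi"
      using nonlin_total_finite_AE[OF U fU] nonlin_total_finite_AE[OF V fV] AE_nonzero3
      by eventually_elim (unfold enorm_def[of "\<lambda>t xi. duhamel f U t xi - duhamel f V t xi"] W_def, rule duhamel_diff_le[OF U V])
  qed
  also have "... \<le> evnorm {0..} 0 (bilin (enorm U) (enorm W)) + evnorm {0..} 0 (bilin (enorm W) (enorm V))"
    by (intro evnorm_add bilin_jmeas enorm_jmeas U V W) simp
  also have "... \<le> 2 * ennreal (2 powr 0) * (evnorm {0..} 0 (enorm U) * evnorm {0..} 0 (enorm W) + evnorm {0..} 0 (enorm U) * evnorm {0..} 0 (enorm W))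
      + 2 * ennreal (2 powr 0) * (evnorm {0..} 0 (enorm W) * evnorm {0..} 0 (enorm V) + evnorm {0..} 0 (enorm W) * evnorm {0..} 0 (enorm V))"
    by (intro add_mono bilin_evnorm enorm_jmeas U V W) auto
  also have "... = 4 * (evnorm {0..} 0 (enorm U) + evnorm {0..} 0 (enorm V)) * evnorm {0..} 0 (enorm W)"
  proof -
    have "2 * 1 * (a * b + a * b) + 2 * 1 * (b * c + b * c) = 4 * (a + c) * b" for a b c :: ennreal
    proof -
      have "2 * 1 * (a * b + a * b) + 2 * 1 * (b * c + b * c) = 2 * (2 * (a * b)) + 2 * (2 * (b * c))" by (simp only: mult_2[symmetric] mult_1_right)
      also have "... = (2 * 2) * (a + c) * b" by (simp only: distrib_left distrib_right mult_ac)
      finally show ?thesis by simp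
    qed
    then show ?thesis by simp
  qed
  finally show ?thesis .
qed

section \<open>Propagation of pseudo-measure bounds\<close>

text \<open>The same gain of two derivatives as before, now for the integral over the source time
  \<open>tau\<close>.\<close>
lemma nn_integral_heat_back_le: "wt 2 xi * (\<integral>\<^sup>+tau. indicator {0..t} tau * ennreal (heat_ker (t - tau) xi) \<partial>lborel) \<le> 1"
proof (cases "xi = 0 \<or> t < 0")
  case False
  define c where "c = (norm xi)\<^sup>2"
  have c: "c > 0" using False by (simp add: c_def)
  have "(\<integral>\<^sup>+tau. ennreal (exp (- (t - tau) * c)) * indicator {0..t} tau \<partial>lborel) = ennreal (exp (- (t - t) * c) / c - exp (- (t - 0) * c) / c)"
  proof (rule nn_integral_FTC_Icc[where F="\<lambda>tau. exp (- (t - tau) * c) / c"])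
    show "((\<lambda>tau. exp (- (t - tau) * c) / c) has_real_derivative exp (- (t - x) * c)) (at x)" for x
      using c by (auto intro!: derivative_eq_intros)
  qed (use False in auto)
  also have "... \<le> ennreal (1 / c)" using c by (intro ennreal_leI) (simp add: field_simps)
  finally have "(\<integral>\<^sup>+tau. indicator {0..t} tau * ennreal (exp (- (t - tau) * c)) \<partial>lborel) \<le> ennreal (1 / c)" by (simp add: mult.commute)
  then have "wt 2 xi * (\<integral>\<^sup>+tau. indicator {0..t} tau * ennreal (exp (- (t - tau) * c)) \<partial>lborel) \<le> wt 2 xi * ennreal (1 / c)" by (intro mult_left_mono) auto
  also have "... = 1" using c by (simp add: wt_def ennreal_mult[symmetric] c_def)
  finally show ?thesis by (simp add: c_def)
qed auto

text \<open>Here \<open>x\<close>, \<open>z\<close>, \<open>e\<close> are \<open>|\<zeta> + \<eta>|\<close>,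
  \<open>|\<zeta>|\<close>, \<open>|\<eta>|\<close>, with \<open>\<eta>\<close> the lower of the two
  frequencies. For \<open>\<sigma> \<ge> 0\<close> the triangle inequality bounds \<open>z\<close> from below
  by \<open>x / 2\<close>, otherwise it bounds \<open>z\<close> from above by \<open>x + e\<close>; this is
  where \<open>\<sigma> \<in> [-1, 1]\<close> enters. The right hand side has the two terms that can be
  integrated in time: \<open>x\<^sup>2\<close> is compensated by the heat kernel, and \<open>e\<close> goes
  into the norm of order 1.\<close>
lemma pseudo_measure_powr_le:
  fixes x z e :: real
  assumes "x \<ge> 0" "z > 0" "e > 0" "x \<le> z + e" "e \<le> z" "z \<le> x + e" "\<sigma> \<in> {-1..1}"
  shows "x powr (1 + \<sigma>) * z powr (- \<sigma>) \<le> 2 * (x\<^sup>2 / e + e)"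
proof (cases "x = 0")
  case True then show ?thesis using assms by simp
next
  case False
  then have x: "x > 0" using assms by simp
  have am: "2 * x \<le> x\<^sup>2 / e + e"
  proof -
    have "0 \<le> (x - e)\<^sup>2 / e" using assms by simp
    also have "... = x\<^sup>2 / e + e - 2 * x" using assms by (simp add: power2_eq_square field_simps)
    finally show ?thesis by simp
  qed
  show ?thesis
  proof (cases "\<sigma> \<ge> 0")
    case True
    have "z powr (- \<sigma>) \<le> (x / 2) powr (- \<sigma>)" using assms x True by (intro powr_mono2') auto
    then have "x powr (1 + \<sigma>) * z powr (- \<sigma>) \<le> x powr (1 + \<sigma>) * (x / 2) powr (- \<sigma>)" by (intro mult_left_mono) auto
    also have "... = x * 2 powr \<sigma>" using x by (simp add: powr_add powr_minus powr_divide field_simps)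
    also have "... \<le> x * 2 powr 1" using assms x by (intro mult_left_mono powr_mono) auto
    also have "... \<le> 2 * (x\<^sup>2 / e + e)" using am x by simp
    finally show ?thesis .
  next
    case False
    have "x powr (1 + \<sigma>) * z powr (- \<sigma>) \<le> (x + e) powr (1 + \<sigma>) * (x + e) powr (- \<sigma>)"
      using assms x False by (intro mult_mono powr_mono2) auto
    also have "... = x + e" using assms x by (simp add: powr_add[symmetric])
    also have "... \<le> 2 * (x\<^sup>2 / e + e)"
    proof -
      have "0 \<le> x\<^sup>2 / e" using assms by simp
      then show ?thesis using am assms by (simp only: distrib_left)
    qed
    finally show ?thesis .
  qed
qed

text \<open>The high frequency factor is estimated by the pseudo-measure bound and the low frequency factor is
  kept for integration.\<close>
lemma pseudo_measure_pointwise: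
  fixes g :: "real^3 \<Rightarrow> ennreal"
  assumes s: "\<sigma> \<in> {-1..1}" and le: "norm \<eta> \<le> norm \<zeta>" and \<eta>: "\<eta> \<noteq> 0" and \<zeta>: "\<zeta> \<noteq> 0"
    and M: "wt \<sigma> \<zeta> * g \<zeta> \<le> M"
  shows "wt (1 + \<sigma>) (\<zeta> + \<eta>) * (g \<zeta> * g \<eta>) \<le> 2 * M * (wt 2 (\<zeta> + \<eta>) * (wt (-1) \<eta> * g \<eta>) + wt 1 \<eta> * g \<eta>)"
proof -
  let ?xi = "\<zeta> + \<eta>"
  have r: "norm ?xi powr (1 + \<sigma>) * norm \<zeta> powr (- \<sigma>) \<le> 2 * ((norm ?xi)\<^sup>2 / norm \<eta> + norm \<eta>)"
    by (rule pseudo_measure_powr_le) (use assms norm_triangle_ineq[of \<zeta> \<eta>] norm_triangle_ineq4[of "\<zeta> + \<eta>" \<eta>] in auto)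
  have w: "wt (1 + \<sigma>) ?xi * wt (- \<sigma>) \<zeta> \<le> 2 * (wt 2 ?xi * wt (-1) \<eta> + wt 1 \<eta>)"
  proof -
    have e: "(norm ?xi)\<^sup>2 / norm \<eta> = norm ?xi powr 2 * norm \<eta> powr (-1)" by (cases "?xi = 0") (auto simp: powr_minus divide_inverse)
    have "wt (1 + \<sigma>) ?xi * wt (- \<sigma>) \<zeta> = ennreal (norm ?xi powr (1 + \<sigma>) * norm \<zeta> powr (- \<sigma>))" by (simp add: wt_def ennreal_mult[symmetric])
    also have "... \<le> ennreal (2 * ((norm ?xi)\<^sup>2 / norm \<eta> + norm \<eta>))" by (intro ennreal_leI r)
    also have "... = 2 * (wt 2 ?xi * wt (-1) \<eta> + wt 1 \<eta>)"
    proof -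
      have a: "wt 2 ?xi * wt (-1) \<eta> = ennreal ((norm ?xi)\<^sup>2 / norm \<eta>)"
        unfolding e wt_def by (rule ennreal_mult[symmetric]) auto
      have b: "wt 1 \<eta> = ennreal (norm \<eta>)" by (simp add: wt_def)
      have c: "ennreal (2 * (x + y)) = 2 * (ennreal x + ennreal y)" if "0 \<le> x" "0 \<le> y" for x y
        using that by (subst ennreal_mult) auto
      show ?thesis unfolding a b by (rule c) auto
    qed
    finally show ?thesis .
  qed
  have one: "wt (- \<sigma>) \<zeta> * wt \<sigma> \<zeta> = 1" using \<zeta> by (simp add: wt_mult wt_0)
  have "wt (1 + \<sigma>) ?xi * (g \<zeta> * g \<eta>) = (wt (1 + \<sigma>) ?xi * wt (- \<sigma>) \<zeta>) * ((wt \<sigma> \<zeta> * g \<zeta>) * g \<eta>)"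
    using one by (metis (no_types, lifting) mult.assoc mult_1)
  also have "... \<le> (2 * (wt 2 ?xi * wt (-1) \<eta> + wt 1 \<eta>)) * (M * g \<eta>)"
    by (rule mult_mono[OF w mult_right_mono[OF M]]) auto
  also have "... = 2 * M * (wt 2 ?xi * (wt (-1) \<eta> * g \<eta>) + wt 1 \<eta> * g \<eta>)"
    by (simp only: distrib_left distrib_right mult_ac)
  finally show ?thesis .
qed

text \<open>The two regions where one frequency dominates the other are exchanged by \<open>\<eta> \<mapsto>
  xi - \<eta>\<close>.\<close>
lemma pseudo_measure_convol:
  fixes g :: "real^3 \<Rightarrow> ennreal"
  assumes [measurable]: "g \<in> borel_measurable borel" and s: "\<sigma> \<in> {-1..1}"
    and M: "AE xi in lborel. wt \<sigma> xi * g xi \<le> M"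
  shows "wt (1 + \<sigma>) xi * convol g g xi \<le> 4 * M * (wt 2 xi * wnorm (-1) g + wnorm 1 g)"
proof -
  define H where "H \<eta> = wt 2 xi * (wt (-1) \<eta> * g \<eta>) + wt 1 \<eta> * g \<eta>" for \<eta>
  have [measurable]: "H \<in> borel_measurable borel" unfolding H_def by measurable
  have intH: "(\<integral>\<^sup>+\<eta>. H \<eta> \<partial>lborel) = wt 2 xi * wnorm (-1) g + wnorm 1 g"
    unfolding H_def wnorm_def by (subst nn_integral_add) (auto simp: nn_integral_cmult)
  have intH': "(\<integral>\<^sup>+\<eta>. H (xi - \<eta>) \<partial>lborel) = (\<integral>\<^sup>+\<eta>. H \<eta> \<partial>lborel)"
    using nn_integral_affine3[of H "-1" xi] by simp
  have nz: "AE \<eta> in lborel. xi - \<eta> \<noteq> 0" using AE_affine3[OF AE_nonzero3, of "-1" xi] by simp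
  have M': "AE \<eta> in lborel. wt \<sigma> (xi - \<eta>) * g (xi - \<eta>) \<le> M" using AE_affine3[OF M, of "-1" xi] by simp
  have "wt (1 + \<sigma>) xi * convol g g xi = (\<integral>\<^sup>+\<eta>. wt (1 + \<sigma>) xi * (g (xi - \<eta>) * g \<eta>) \<partial>lborel)"
    unfolding convol_def by (subst nn_integral_cmult) auto
  also have "... \<le> (\<integral>\<^sup>+\<eta>. 2 * M * H \<eta> + 2 * M * H (xi - \<eta>) \<partial>lborel)"
  proof (rule nn_integral_mono_AE, use nz AE_nonzero3 M M' in eventually_elim)
    fix \<eta> assume a: "xi - \<eta> \<noteq> 0" "\<eta> \<noteq> 0" "wt \<sigma> \<eta> * g \<eta> \<le> M" "wt \<sigma> (xi - \<eta>) * g (xi - \<eta>) \<le> M"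
    show "wt (1 + \<sigma>) xi * (g (xi - \<eta>) * g \<eta>) \<le> 2 * M * H \<eta> + 2 * M * H (xi - \<eta>)"
    proof (cases "norm \<eta> \<le> norm (xi - \<eta>)")
      case True
      from pseudo_measure_pointwise[OF s True a(2,1), of g M, OF a(4)] have "wt (1 + \<sigma>) xi * (g (xi - \<eta>) * g \<eta>) \<le> 2 * M * H \<eta>" by (simp add: H_def)
      then show ?thesis by (rule order_trans) simp
    next
      case False
      then have "norm (xi - \<eta>) \<le> norm \<eta>" by simp
      from pseudo_measure_pointwise[OF s this a(1,2), of g M, OF a(3)] have "wt (1 + \<sigma>) xi * (g (xi - \<eta>) * g \<eta>) \<le> 2 * M * H (xi - \<eta>)" by (simp add: H_def mult.commute)
      then show ?thesis by (rule order_trans) simp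
    qed
  qed
  also have "... = 2 * M * (\<integral>\<^sup>+\<eta>. H \<eta> \<partial>lborel) + 2 * M * (\<integral>\<^sup>+\<eta>. H (xi - \<eta>) \<partial>lborel)"
    by (subst nn_integral_add) (auto simp: nn_integral_cmult)
  also have "... = (2 * 2) * M * (\<integral>\<^sup>+\<eta>. H \<eta> \<partial>lborel)" unfolding intH' by (simp only: mult_2 distrib_left distrib_right)
  finally show ?thesis unfolding intH by simp
qed

text \<open>The pseudo-measure bound enters linearly, and the other factor is the scaling invariant norm,
  which is small. Hence the bound propagates along the Picard iteration.\<close>
lemma pseudo_measure_bilin:
  assumes g: "jmeas g" and s: "\<sigma> \<in> {-1..1}" and t: "t \<ge> 0"
    and M: "\<And>tau. tau \<ge> 0 \<Longrightarrow> AE xi in lborel. wt \<sigma> xi * g tau xi \<le> M"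
  shows "wt \<sigma> xi * bilin g g t xi \<le> 4 * M * evnorm {0..} 0 g"
proof -
  note [measurable (raw)] = measurable_curried[OF convol_jmeas[OF g g]]
  note [measurable] = wnorm_jmeas[OF g]
  let ?A = "SUP t\<in>{0..}. wnorm (0 - 1) (g t)"
  let ?k = "\<lambda>tau. indicator {0..t} tau * ennreal (heat_ker (t - tau) xi)"
  have "wt \<sigma> xi * bilin g g t xi = (\<integral>\<^sup>+tau. wt \<sigma> xi * (?k tau * (wt 1 xi * convol (g tau) (g tau) xi)) \<partial>lborel)"
    unfolding bilin_def heat_duhamel_def by (subst nn_integral_cmult) auto
  also have "... \<le> (\<integral>\<^sup>+tau. 4 * M * ((wt 2 xi * ?A) * ?k tau + indicator {0..} tau * wnorm (0 + 1) (g tau)) \<partial>lborel)"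
  proof (intro nn_integral_mono)
    fix tau
    show "wt \<sigma> xi * (?k tau * (wt 1 xi * convol (g tau) (g tau) xi)) \<le> 4 * M * ((wt 2 xi * ?A) * ?k tau + indicator {0..} tau * wnorm (0 + 1) (g tau))"
    proof (cases "tau \<in> {0..t}")
      case True
      then have tau: "tau \<ge> 0" by simp
      have k1: "?k tau \<le> 1" using True by (simp add: mult_nonpos_nonneg)
      have "wt \<sigma> xi * (?k tau * (wt 1 xi * convol (g tau) (g tau) xi)) = ?k tau * (wt (1 + \<sigma>) xi * convol (g tau) (g tau) xi)"
        unfolding wt_mult[symmetric] by (simp only: mult_ac)
      also have "... \<le> ?k tau * (4 * M * (wt 2 xi * wnorm (-1) (g tau) + wnorm 1 (g tau)))"
        by (intro mult_left_mono pseudo_measure_convol[OF jmeas_slice[OF g] s M[OF tau]]) simp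
      also have "... = 4 * M * (wt 2 xi * wnorm (-1) (g tau) * ?k tau + ?k tau * wnorm 1 (g tau))"
        by (simp only: distrib_left mult_ac)
      also have "... \<le> 4 * M * (wt 2 xi * ?A * ?k tau + 1 * wnorm 1 (g tau))"
      proof (intro mult_left_mono[OF add_mono] mult_right_mono[OF mult_left_mono] mult_right_mono[OF k1])
        show "wnorm (-1) (g tau) \<le> ?A" using SUP_upper[of tau "{0..}" "\<lambda>t. wnorm (0 - 1) (g t)"] tau by simp
      qed auto
      finally show ?thesis using tau by simp
    qed auto
  qed
  also have "... = 4 * M * ((wt 2 xi * (\<integral>\<^sup>+tau. ?k tau \<partial>lborel)) * ?A + (\<integral>\<^sup>+tau. indicator {0..} tau * wnorm (0 + 1) (g tau) \<partial>lborel))"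
    by (subst nn_integral_cmult, measurable, subst nn_integral_add, measurable, subst nn_integral_cmult, measurable) (simp add: mult_ac)
  also have "... \<le> 4 * M * (1 * ?A + (\<integral>\<^sup>+tau. indicator {0..} tau * wnorm (0 + 1) (g tau) \<partial>lborel))"
    by (intro mult_left_mono[OF add_right_mono] mult_right_mono nn_integral_heat_back_le) auto
  finally show ?thesis by (simp add: evnorm_def)
qed

section \<open>Existence of a fixed point for small data\<close>

lemma telescoping_limit:
  fixes x :: "nat \<Rightarrow> 'b::banach"
  assumes fin: "(\<Sum>n. ennreal (norm (x (Suc n) - x n))) < \<infinity>"
  shows "x \<longlonglongrightarrow> lim x" and "ennreal (norm (lim x - x m)) \<le> (\<Sum>n. ennreal (norm (x (Suc (n + m)) - x (n + m))))"
proof -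
  have s: "summable (\<lambda>n. norm (x (Suc n) - x n))"
    using fin by (intro summable_suminf_not_top) auto
  then have "summable (\<lambda>n. x (Suc n) - x n)" by (rule summable_norm_cancel)
  then have "convergent (\<lambda>n. \<Sum>i<n. x (Suc i) - x i)" by (simp add: summable_iff_convergent)
  then have "convergent (\<lambda>n. x n - x 0)" by (simp add: sum_lessThan_telescope)
  then have "convergent x" by (simp add: convergent_diff_const_right_iff)
  then show l: "x \<longlonglongrightarrow> lim x" by (simp add: convergent_LIMSEQ_iff)
  have t: "(\<lambda>n. x (Suc n + m) - x (n + m)) sums (lim x - x (0 + m))"
    by (rule telescope_sums) (rule LIMSEQ_ignore_initial_segment[OF l])
  have s': "summable (\<lambda>n. norm (x (Suc n + m) - x (n + m)))" using summable_ignore_initial_segment[OF s, of m] by simp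
  have "norm (lim x - x m) \<le> (\<Sum>n. norm (x (Suc n + m) - x (n + m)))"
    using summable_norm[OF s'] sums_unique[OF t] by simp
  then have "ennreal (norm (lim x - x m)) \<le> ennreal (\<Sum>n. norm (x (Suc n + m) - x (n + m)))" by (rule ennreal_leI)
  also have "... = (\<Sum>n. ennreal (norm (x (Suc n + m) - x (n + m))))"
    by (rule suminf_ennreal2[symmetric]) (use s' in auto)
  finally show "ennreal (norm (lim x - x m)) \<le> (\<Sum>n. ennreal (norm (x (Suc (n + m)) - x (n + m))))" by simp
qed

lemma ennreal_affine_square: "0 \<le> a \<Longrightarrow> 0 \<le> b \<Longrightarrow> 0 \<le> c \<Longrightarrow> 0 \<le> d \<Longrightarrow> 2 * ennreal a + 4 * ennreal b * (ennreal c * ennreal d) = ennreal (2 * a + 4 * b * (c * d))"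
  by (subst ennreal_plus) (auto simp: ennreal_mult mult.assoc)

lemma ennreal_four_mult_four: "0 \<le> p \<Longrightarrow> 0 \<le> q \<Longrightarrow> ennreal (4 * p * (4 * q)) = 4 * ennreal p * (4 * ennreal q)"
proof -
  assume a: "0 \<le> p" "0 \<le> q"
  then have "ennreal (4 * p * (4 * q)) = ennreal (4 * p) * ennreal (4 * q)" by (intro ennreal_mult) auto
  moreover have "ennreal (4 * p) = 4 * ennreal p" "ennreal (4 * q) = 4 * ennreal q" using a by (auto simp: ennreal_mult)
  ultimately show ?thesis by (simp only:)
qed

lemma ennreal_four_sum_mult: "0 \<le> a \<Longrightarrow> 0 \<le> b \<Longrightarrow> 0 \<le> c \<Longrightarrow> 4 * (ennreal a + ennreal b) * ennreal c = ennreal (4 * (a + b) * c)"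
proof -
  assume a: "0 \<le> a" "0 \<le> b" "0 \<le> c"
  then have "ennreal (4 * (a + b) * c) = ennreal (4 * (a + b)) * ennreal c" by (intro ennreal_mult) auto
  moreover have "ennreal (4 * (a + b)) = 4 * ennreal (a + b)" using a by (subst ennreal_mult) auto
  moreover have "ennreal (a + b) = ennreal a + ennreal b" using a by (intro ennreal_plus) auto
  ultimately show ?thesis by (simp only:)
qed

text \<open>Iteration of \<open>duhamel f\<close> from 0. The iterates stay in a ball of radius \<open>4
  \<epsilon>\<close> in the scaling invariant norm, where \<open>duhamel f\<close> contracts by the factor
  1/2. The norm of level \<open>k\<close> and the pseudo-measure bound are only shown to be bounded along the
  sequence: both are linear in the large quantity, and pass to the limit by Fatou's lemma and by pointwise
  convergence. The value \<open>\<epsilon> = 1 / (64 * 2 powr k)\<close> makes all four smallness conditions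
  hold.\<close>
lemma picard:
  fixes f :: "real^3 \<Rightarrow> complex^3"
  defines "nf \<equiv> (\<lambda>xi. ennreal (norm (f xi)))"
  assumes fm[measurable]: "f \<in> borel_measurable borel" and k: "k \<ge> 0" and \<epsilon>: "\<epsilon> = 1 / (64 * 2 powr k)"
    and small: "wnorm (-1) nf \<le> ennreal \<epsilon>" and s: "\<sigma> \<in> {-1..1}" and M: "AE xi in lborel. wt \<sigma> xi * nf xi \<le> M"
  obtains U where "jmeas U" "\<And>t xi. duhamel f U t xi = U t xi" "evnorm {0..} 0 (enorm U) \<le> ennreal (8 * \<epsilon>)"
    "evnorm {0..} k (enorm U) \<le> 8 * wnorm (k - 1) nf" "\<And>t. t \<ge> 0 \<Longrightarrow> AE xi in lborel. wt \<sigma> xi * enorm U t xi \<le> 2 * M"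
proof -
  have p1: "2 powr k \<ge> 1" using k by (simp add: ge_one_powr_ge_zero)
  have \<epsilon>p: "\<epsilon> > 0" and \<epsilon>1: "\<epsilon> \<le> 1/64" and pe: "2 powr k * \<epsilon> = 1/64" using p1 by (auto simp: \<epsilon> field_simps)
  define Up where "Up n = (duhamel f ^^ n) (\<lambda>_ _. 0)" for n
  have Up0: "Up 0 = (\<lambda>_ _. 0)" and UnS: "Up (Suc n) = duhamel f (Up n)" for n by (auto simp: Up_def)
  have jU: "jmeas (Up n)" for n
    by (induction n) (auto simp: Up0 UnS intro: duhamel_jmeas)
  let ?N = "evnorm {0..}" and ?a = "wnorm (k - 1) nf"
  have N00: "?N \<kappa> (enorm (Up 0)) = 0" for \<kappa> by (simp add: Up0 enorm_def evnorm_def wnorm_def)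
  have N0: "?N 0 (enorm (Up n)) \<le> ennreal (4 * \<epsilon>)" for n
  proof (induction n)
    case 0 then show ?case by (simp add: N00)
  next
    case (Suc n)
    have "?N 0 (enorm (Up (Suc n))) \<le> 2 * wnorm (0 - 1) nf + 4 * ennreal (2 powr 0) * (?N 0 (enorm (Up n)) * ?N 0 (enorm (Up n)))"
      unfolding UnS nf_def by (rule duhamel_evnorm[OF jU fm]) auto
    also have "... \<le> 2 * ennreal \<epsilon> + 4 * ennreal (2 powr 0) * (ennreal (4 * \<epsilon>) * ennreal (4 * \<epsilon>))"
      using small Suc by (intro add_mono mult_left_mono mult_mono) auto
    also have "... = ennreal (2 * \<epsilon> + 4 * (2 powr 0) * ((4 * \<epsilon>) * (4 * \<epsilon>)))" using \<epsilon>p by (intro ennreal_affine_square) auto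
    also have "... \<le> ennreal (4 * \<epsilon>)" using \<epsilon>p \<epsilon>1 by (intro ennreal_leI) (simp add: field_simps)
    finally show ?case .
  qed
  have Nk: "?N k (enorm (Up n)) \<le> 4 * ?a" for n
  proof (induction n)
    case 0 then show ?case by (simp add: N00)
  next
    case (Suc n)
    have "?N k (enorm (Up (Suc n))) \<le> 2 * ?a + 4 * ennreal (2 powr k) * (?N k (enorm (Up n)) * ?N 0 (enorm (Up n)))"
      unfolding UnS nf_def by (rule duhamel_evnorm[OF jU fm]) (use k in auto)
    also have "... \<le> 2 * ?a + 4 * ennreal (2 powr k) * ((4 * ?a) * ennreal (4 * \<epsilon>))"
      using Suc N0 by (intro add_mono mult_left_mono mult_mono) auto
    also have "4 * ennreal (2 powr k) * ((4 * ?a) * ennreal (4 * \<epsilon>)) = ennreal (4 * 2 powr k * (4 * (4 * \<epsilon>))) * ?a"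
    proof -
      have "4 * ennreal (2 powr k) * ((4 * ?a) * ennreal (4 * \<epsilon>)) = (4 * ennreal (2 powr k) * (4 * ennreal (4 * \<epsilon>))) * ?a"
        by (simp only: mult_ac)
      then show ?thesis using \<epsilon>p by (subst ennreal_four_mult_four) auto
    qed
    also have "4 * 2 powr k * (4 * (4 * \<epsilon>)) = 1" using pe by simp
    also have "2 * ?a + ennreal 1 * ?a = 3 * ?a"
    proof -
      have "2 * ?a + ennreal 1 * ?a = (2 + 1) * ?a" by (simp only: ennreal_1 distrib_right)
      then show ?thesis by simp
    qed
    also have "3 * ?a \<le> 4 * ?a" by (intro mult_right_mono) auto
    finally show ?case .
  qed
  have Yn: "AE xi in lborel. wt \<sigma> xi * enorm (Up n) t xi \<le> 2 * M" if "t \<ge> 0" for n t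
    using that
  proof (induction n arbitrary: t)
    case 0 then show ?case by (simp add: Up0 enorm_def)
  next
    case (Suc n)
    show ?case
      using M
    proof eventually_elim
      fix xi assume M: "wt \<sigma> xi * nf xi \<le> M"
      have "wt \<sigma> xi * enorm (Up (Suc n)) t xi \<le> wt \<sigma> xi * (ennreal (heat_ker t xi) * nf xi + bilin (enorm (Up n)) (enorm (Up n)) t xi)"
        unfolding UnS nf_def by (intro mult_left_mono duhamel_le jU) auto
      also have "... = ennreal (heat_ker t xi) * (wt \<sigma> xi * nf xi) + wt \<sigma> xi * bilin (enorm (Up n)) (enorm (Up n)) t xi"
        by (simp only: distrib_left mult_ac)
      also have "... \<le> 1 * M + 4 * (2 * M) * ?N 0 (enorm (Up n))"
        using Suc.prems by (intro add_mono mult_mono M pseudo_measure_bilin[OF enorm_jmeas[OF jU] s] Suc.IH) auto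
      also have "... \<le> 1 * M + 4 * (2 * M) * ennreal (4 * \<epsilon>)" by (intro add_left_mono mult_left_mono N0) auto
      also have "4 * (2 * M) * ennreal (4 * \<epsilon>) = ennreal (32 * \<epsilon>) * M"
      proof -
        have "4 * (2 * M) * ennreal (4 * \<epsilon>) = (4 * (2 * (4 * ennreal \<epsilon>))) * M" using \<epsilon>p by (simp add: ennreal_mult mult_ac)
        also have "4 * (2 * (4 * ennreal \<epsilon>)) = ennreal (4 * (2 * (4 * \<epsilon>)))" using \<epsilon>p by (simp add: ennreal_mult)
        finally show ?thesis by simp
      qed
      also have "1 * M + ennreal (32 * \<epsilon>) * M \<le> 1 * M + ennreal 1 * M" using \<epsilon>1 by (intro add_left_mono mult_right_mono ennreal_leI) auto
      also have "... = 2 * M" by (simp add: mult_2)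
      finally show "wt \<sigma> xi * enorm (Up (Suc n)) t xi \<le> 2 * M" .
    qed
  qed
  define d where "d n t xi = ennreal (norm (Up (Suc n) t xi - Up n t xi))" for n t xi
  have d_enorm: "d n = enorm (\<lambda>t xi. Up (Suc n) t xi - Up n t xi)" for n by (simp add: d_def enorm_def fun_eq_iff)
  have jd: "jmeas (d n)" for n unfolding d_enorm by (intro enorm_jmeas jmeas_diff jU)
  have fin0: "?N 0 (enorm (Up n)) < \<infinity>" for n using N0[of n] by (rule le_less_trans) simp
  have D: "?N 0 (d n) \<le> ennreal ((1/2)^n * (4 * \<epsilon>))" for n
  proof (induction n)
    case 0
    have "d 0 = enorm (Up 1)" by (simp add: d_def enorm_def Up0 fun_eq_iff)
    then show ?case using N0[of 1] by simp
  next
    case (Suc n)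
    have "?N 0 (d (Suc n)) \<le> 4 * (?N 0 (enorm (Up (Suc n))) + ?N 0 (enorm (Up n))) * ?N 0 (d n)"
      unfolding d_enorm UnS[of "Suc n"] by (subst (2) UnS, rule duhamel_diff_evnorm[OF jU jU fin0 fin0])
    also have "... \<le> 4 * (ennreal (4 * \<epsilon>) + ennreal (4 * \<epsilon>)) * ennreal ((1/2)^n * (4 * \<epsilon>))"
      by (intro mult_mono add_mono N0 Suc) auto
    also have "... = ennreal (4 * (4 * \<epsilon> + 4 * \<epsilon>) * ((1/2)^n * (4 * \<epsilon>)))"
      using \<epsilon>p by (intro ennreal_four_sum_mult) auto
    also have "... \<le> ennreal ((1/2)^Suc n * (4 * \<epsilon>))"
    proof (rule ennreal_leI)
      have "4 * (4 * \<epsilon> + 4 * \<epsilon>) * ((1/2)^n * (4 * \<epsilon>)) \<le> (1/2) * ((1/2)^n * (4 * \<epsilon>))" using \<epsilon>p \<epsilon>1 by (intro mult_right_mono) auto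
      then show "4 * (4 * \<epsilon> + 4 * \<epsilon>) * ((1/2)^n * (4 * \<epsilon>)) \<le> (1/2)^Suc n * (4 * \<epsilon>)" by simp
    qed
    finally show ?case .
  qed
  have tail: "?N 0 (\<lambda>t xi. \<Sum>n. d (n + m) t xi) \<le> ennreal ((1/2)^m * (8 * \<epsilon>))" for m
  proof -
    have "?N 0 (\<lambda>t xi. \<Sum>n. d (n + m) t xi) \<le> (\<Sum>n. ?N 0 (d (n + m)))" by (intro evnorm_suminf jd) simp
    also have "... \<le> (\<Sum>n. ennreal ((1/2)^n * ((1/2)^m * (4 * \<epsilon>))))"
      using D[of "_ + m"] by (intro suminf_le) (auto simp: power_add mult.assoc)
    also have "... = ennreal (2 * ((1/2)^m * (4 * \<epsilon>)))"
    proof (rule suminf_ennreal_eq)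
      have "(\<lambda>n. (1/2::real)^n) sums 2" using geometric_sums[of "1/2::real"] by simp
      then show "(\<lambda>n. (1/2)^n * ((1/2)^m * (4 * \<epsilon>))) sums (2 * ((1/2)^m * (4 * \<epsilon>)))" by (rule sums_mult2)
    qed (use \<epsilon>p in simp)
    finally show ?thesis by (simp add: mult_ac)
  qed
  have jtail: "jmeas (\<lambda>t xi. \<Sum>n. d (n + m) t xi)" for m
  proof -
    note [measurable (raw)] = measurable_curried[OF jd]
    show ?thesis by measurable
  qed
  define U where "U t xi = lim (\<lambda>n. Up n t xi)" for t xi
  have jUU: "jmeas U"
  proof -
    note [measurable (raw)] = measurable_curried[OF jU]
    show ?thesis unfolding U_def by measurable
  qed
  have summ: "AE xi in lborel. (\<Sum>n. d n t xi) < \<infinity>" if "t \<ge> 0" for t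
    using evnorm_finite_wnorm_AE[OF jtail[of 0], of "{0..}" 0 t] le_less_trans[OF tail[of 0]] that by simp
  have conv: "AE xi in lborel. (\<lambda>n. Up n t xi) \<longlonglongrightarrow> U t xi" if "t \<ge> 0" for t
    using summ[OF that] unfolding U_def d_def by eventually_elim (rule telescoping_limit(1))
  define W where "W m = (\<lambda>t xi. U t xi - Up m t xi)" for m
  have jW: "jmeas (W m)" for m unfolding W_def by (intro jmeas_diff jUU jU)
  have W: "?N 0 (enorm (W m)) \<le> ennreal ((1/2)^m * (8 * \<epsilon>))" for m
  proof -
    have "?N 0 (enorm (W m)) \<le> ?N 0 (\<lambda>t xi. \<Sum>n. d (n + m) t xi)"
    proof (rule evnorm_mono)
      fix t :: real assume "t \<in> {0..}"
      then have "t \<ge> 0" by simp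
      from summ[OF this] show "AE xi in lborel. enorm (W m) t xi \<le> (\<Sum>n. d (n + m) t xi)"
        by eventually_elim (unfold enorm_def W_def U_def d_def, rule telescoping_limit(2))
    qed
    also have "... \<le> ennreal ((1/2)^m * (8 * \<epsilon>))" by (rule tail)
    finally show ?thesis .
  qed
  have N0U: "?N 0 (enorm U) \<le> ennreal (8 * \<epsilon>)"
    using W[of 0] by (simp add: W_def Up0)
  have fin0U: "?N 0 (enorm U) < \<infinity>" using N0U by (rule le_less_trans) simp
  \<comment> \<open>The limit is a fixed point: its distance to \<open>duhamel f U\<close> is at most a multiple of \<open>2\<^sup>-\<^sup>m\<close> for every \<open>m\<close>.\<close>
  define V where "V = duhamel f U"
  have jV: "jmeas V" unfolding V_def by (rule duhamel_jmeas[OF jUU fm])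
  have VU: "?N 0 (enorm (\<lambda>t xi. V t xi - U t xi)) \<le> ennreal ((1/2)^m * (16 * \<epsilon>))" for m
  proof -
    have "?N 0 (enorm (\<lambda>t xi. V t xi - U t xi)) \<le> ?N 0 (\<lambda>t xi. enorm (\<lambda>t xi. duhamel f U t xi - duhamel f (Up m) t xi) t xi + enorm (W (Suc m)) t xi)"
    proof (intro evnorm_mono AE_I2)
      fix t xi
      have "V t xi - U t xi = (duhamel f U t xi - duhamel f (Up m) t xi) - W (Suc m) t xi" by (simp add: V_def W_def UnS)
      then have "norm (V t xi - U t xi) \<le> norm (duhamel f U t xi - duhamel f (Up m) t xi) + norm (W (Suc m) t xi)"
        by (metis norm_triangle_ineq4)
      then show "enorm (\<lambda>t xi. V t xi - U t xi) t xi \<le> enorm (\<lambda>t xi. duhamel f U t xi - duhamel f (Up m) t xi) t xi + enorm (W (Suc m)) t xi"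
        unfolding enorm_def by (simp add: ennreal_plus[symmetric] ennreal_leI del: ennreal_plus)
    qed
    also have "... \<le> ?N 0 (enorm (\<lambda>t xi. duhamel f U t xi - duhamel f (Up m) t xi)) + ?N 0 (enorm (W (Suc m)))"
      by (intro evnorm_add enorm_jmeas jmeas_diff duhamel_jmeas jUU jU jW fm) simp
    also have "... \<le> 4 * (?N 0 (enorm U) + ?N 0 (enorm (Up m))) * ?N 0 (enorm (W m)) + ?N 0 (enorm (W (Suc m)))"
      unfolding W_def[of m] by (intro add_right_mono duhamel_diff_evnorm jUU jU fin0U fin0)
    also have "... \<le> 4 * (ennreal (8 * \<epsilon>) + ennreal (4 * \<epsilon>)) * ennreal ((1/2)^m * (8 * \<epsilon>)) + ennreal ((1/2)^Suc m * (8 * \<epsilon>))"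
      by (intro mult_mono add_mono N0 N0U W) auto
    also have "... = ennreal (4 * (8 * \<epsilon> + 4 * \<epsilon>) * ((1/2)^m * (8 * \<epsilon>)) + (1/2)^Suc m * (8 * \<epsilon>))"
      using \<epsilon>p by (subst ennreal_four_sum_mult, simp, simp, simp, subst ennreal_plus) auto
    also have "... \<le> ennreal ((1/2)^m * (16 * \<epsilon>))"
    proof (rule ennreal_leI)
      have "4 * (8 * \<epsilon> + 4 * \<epsilon>) * ((1/2)^m * (8 * \<epsilon>)) \<le> 1 * ((1/2)^m * (8 * \<epsilon>))" using \<epsilon>p \<epsilon>1 by (intro mult_right_mono) auto
      moreover have "(1/2)^Suc m * (8 * \<epsilon>) \<le> (1/2)^m * (8 * \<epsilon>)" using \<epsilon>p by simp
      moreover have "(1/2)^m * (8 * \<epsilon>) + (1/2)^m * (8 * \<epsilon>) = (1/2)^m * (16 * \<epsilon>)" by (simp add: algebra_simps)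
      ultimately show "4 * (8 * \<epsilon> + 4 * \<epsilon>) * ((1/2)^m * (8 * \<epsilon>)) + (1/2)^Suc m * (8 * \<epsilon>) \<le> (1/2)^m * (16 * \<epsilon>)" by linarith
    qed
    finally show ?thesis .
  qed
  have "?N 0 (enorm (\<lambda>t xi. V t xi - U t xi)) = 0"
  proof -
    have "(\<lambda>m. (1/2)^m * (16 * \<epsilon>)) \<longlonglongrightarrow> 0 * (16 * \<epsilon>)" by (intro tendsto_intros LIMSEQ_realpow_zero) auto
    then have "(\<lambda>m. ennreal ((1/2)^m * (16 * \<epsilon>))) \<longlonglongrightarrow> ennreal 0" using tendsto_ennrealI by fastforce
    then have "?N 0 (enorm (\<lambda>t xi. V t xi - U t xi)) \<le> ennreal 0" using VU by (intro LIMSEQ_le_const) auto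
    then show ?thesis by simp
  qed
  then have VeqU: "AE xi in lborel. V t xi = U t xi" if "t \<ge> 0" for t
    using evnorm_0_D[OF enorm_jmeas[OF jmeas_diff[OF jV jUU]], of "{0..}" 0 t] that by (auto simp: enorm_def elim!: eventually_mono)
  \<comment> \<open>One further application of \<open>duhamel f\<close> removes the exceptional null sets.\<close>
  have fixp: "duhamel f V t xi = V t xi" for t xi
    unfolding V_def by (rule duhamel_cong[OF _ jV[unfolded V_def] jUU]) (use VeqU in \<open>simp add: V_def\<close>)
  have liminf_le: "AE xi in lborel. enorm U t xi \<le> liminf (\<lambda>n. enorm (Up n) t xi)" if "t \<ge> 0" for t
    using conv[OF that]
  proof eventually_elim
    fix xi assume "(\<lambda>n. Up n t xi) \<longlonglongrightarrow> U t xi"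
    then have "(\<lambda>n. enorm (Up n) t xi) \<longlonglongrightarrow> enorm U t xi" unfolding enorm_def by (intro tendsto_ennrealI tendsto_norm)
    then show "enorm U t xi \<le> liminf (\<lambda>n. enorm (Up n) t xi)" by (simp add: lim_imp_Liminf)
  qed
  have Xl: "wnorm a (enorm U t) \<le> liminf (\<lambda>n. wnorm a (enorm (Up n) t))" if "t \<ge> 0" for t a
  proof -
    note [measurable] = jmeas_slice[OF enorm_jmeas[OF jU]]
    have "wnorm a (enorm U t) \<le> (\<integral>\<^sup>+xi. liminf (\<lambda>n. wt a xi * enorm (Up n) t xi) \<partial>lborel)" unfolding wnorm_def
    proof (rule nn_integral_mono_AE)
      show "AE xi in lborel. wt a xi * enorm U t xi \<le> liminf (\<lambda>n. wt a xi * enorm (Up n) t xi)"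
        using conv[OF that]
      proof eventually_elim
        fix xi assume "(\<lambda>n. Up n t xi) \<longlonglongrightarrow> U t xi"
        then have "(\<lambda>n. wt a xi * enorm (Up n) t xi) \<longlonglongrightarrow> wt a xi * enorm U t xi" unfolding enorm_def wt_def
          by (simp add: ennreal_mult[symmetric]) (intro tendsto_ennrealI tendsto_mult_left tendsto_norm)
        then show "wt a xi * enorm U t xi \<le> liminf (\<lambda>n. wt a xi * enorm (Up n) t xi)" by (simp add: lim_imp_Liminf)
      qed
    qed
    also have "... \<le> liminf (\<lambda>n. wnorm a (enorm (Up n) t))" unfolding wnorm_def by (rule nn_integral_liminf) measurable
    finally show ?thesis .
  qed
  have NkU: "?N k (enorm U) \<le> 8 * ?a"
  proof -
    note [measurable] = wnorm_jmeas[OF enorm_jmeas[OF jU]]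
    have "(SUP t\<in>{0..}. wnorm (k - 1) (enorm U t)) \<le> 4 * ?a"
    proof (rule SUP_least)
      fix t :: real assume t: "t \<in> {0..}"
      then have "wnorm (k - 1) (enorm U t) \<le> liminf (\<lambda>n. wnorm (k - 1) (enorm (Up n) t))" by (intro Xl) simp
      also have "... \<le> 4 * ?a"
        by (rule Liminf_le) (use order_trans[OF evnorm_wnorm[OF t] Nk] in auto)
      finally show "wnorm (k - 1) (enorm U t) \<le> 4 * ?a" .
    qed
    moreover have "(\<integral>\<^sup>+t. indicator {0..} t * wnorm (k + 1) (enorm U t) \<partial>lborel) \<le> 4 * ?a"
    proof -
      have "(\<integral>\<^sup>+t. indicator {0..} t * wnorm (k + 1) (enorm U t) \<partial>lborel) \<le> (\<integral>\<^sup>+t. liminf (\<lambda>n. indicator {0..} t * wnorm (k + 1) (enorm (Up n) t)) \<partial>lborel)"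
      proof (rule nn_integral_mono)
        fix t :: real
        show "indicator {0..} t * wnorm (k + 1) (enorm U t) \<le> liminf (\<lambda>n. indicator {0..} t * wnorm (k + 1) (enorm (Up n) t))"
          using Xl[of t] by (auto simp: indicator_def)
      qed
      also have "... \<le> liminf (\<lambda>n. \<integral>\<^sup>+t. indicator {0..} t * wnorm (k + 1) (enorm (Up n) t) \<partial>lborel)"
        by (rule nn_integral_liminf) measurable
      also have "... \<le> 4 * ?a"
        by (rule Liminf_le) (use order_trans[OF evnorm_int Nk] in auto)
      finally show ?thesis .
    qed
    ultimately have "?N k (enorm U) \<le> 4 * ?a + 4 * ?a" unfolding evnorm_def by (rule add_mono)
    also have "... = (4 + 4) * ?a" by (simp only: distrib_right)
    finally show ?thesis by simp
  qed
  have YU: "AE xi in lborel. wt \<sigma> xi * enorm U t xi \<le> 2 * M" if "t \<ge> 0" for t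
  proof -
    have "AE xi in lborel. \<forall>n. wt \<sigma> xi * enorm (Up n) t xi \<le> 2 * M" unfolding AE_all_countable using Yn[OF that] by blast
    with conv[OF that] show ?thesis
    proof eventually_elim
      fix xi assume "(\<lambda>n. Up n t xi) \<longlonglongrightarrow> U t xi" and b: "\<forall>n. wt \<sigma> xi * enorm (Up n) t xi \<le> 2 * M"
      then have "(\<lambda>n. wt \<sigma> xi * enorm (Up n) t xi) \<longlonglongrightarrow> wt \<sigma> xi * enorm U t xi" unfolding enorm_def wt_def
        by (simp add: ennreal_mult[symmetric]) (intro tendsto_ennrealI tendsto_mult_left tendsto_norm)
      then show "wt \<sigma> xi * enorm U t xi \<le> 2 * M" by (rule LIMSEQ_le_const2) (use b in auto)
    qed
  qed
  have eVU: "AE xi in lborel. enorm V t xi = enorm U t xi" if "t \<ge> 0" for t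
    using VeqU[OF that] by eventually_elim (simp add: enorm_def)
  have NVU: "?N \<kappa> (enorm V) = ?N \<kappa> (enorm U)" for \<kappa> by (rule evnorm_cong) (use eVU in simp)
  show thesis
  proof (rule that[OF jV fixp])
    show "?N 0 (enorm V) \<le> ennreal (8 * \<epsilon>)" unfolding NVU by (rule N0U)
    show "?N k (enorm V) \<le> 8 * ?a" unfolding NVU by (rule NkU)
    show "AE xi in lborel. wt \<sigma> xi * enorm V t xi \<le> 2 * M" if "t \<ge> 0" for t
      using YU[OF that] eVU[OF that] by eventually_elim simp
  qed
qed

section \<open>Uniqueness of fixed points\<close>

lemma nn_integral_short_interval:
  fixes a :: "real \<Rightarrow> ennreal"
  assumes [measurable]: "a \<in> borel_measurable borel" and fin: "(\<integral>\<^sup>+t. a t \<partial>lborel) < \<infinity>"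
  obtains h where "h > 0" "(\<integral>\<^sup>+t. indicator {T..T+h} t * a t \<partial>lborel) \<le> ennreal (1/2)"
proof -
  define h where "h n = inverse (real (Suc n))" for n
  have h: "0 < h n" for n by (auto simp: h_def)
  have h0: "h \<longlonglongrightarrow> 0" unfolding h_def by (rule LIMSEQ_inverse_real_of_nat)
  have "(\<lambda>n. \<integral>\<^sup>+t. indicator {T..T + h n} t * a t \<partial>lborel) \<longlonglongrightarrow> (\<integral>\<^sup>+(t::real). 0 \<partial>lborel)"
  proof (rule nn_integral_dominated_convergence[where w=a and u'="\<lambda>_. 0"])
    show "AE t in lborel. indicator {T..T + h n} t * a t \<le> a t" for n by (auto simp: indicator_def)
    show "AE t in lborel. (\<lambda>n. indicator {T..T + h n} t * a t) \<longlonglongrightarrow> 0"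
    proof (rule eventually_mono[OF AE_lborel_singleton[of T]])
      fix t assume "t \<noteq> T"
      have "\<forall>\<^sub>F n in sequentially. indicator {T..T + h n} t * a t = 0"
      proof (cases "t < T")
        case False
        then have "0 < t - T" using \<open>t \<noteq> T\<close> by simp
        from order_tendstoD(2)[OF h0 this] show ?thesis by (rule eventually_mono) (simp add: indicator_def)
      qed (simp add: indicator_def)
      then show "(\<lambda>n. indicator {T..T + h n} t * a t) \<longlonglongrightarrow> 0" by (rule tendsto_eventually)
    qed
  qed (use fin in auto)
  then have "(\<lambda>n. \<integral>\<^sup>+t. indicator {T..T + h n} t * a t \<partial>lborel) \<longlonglongrightarrow> 0" by simp
  then have "eventually (\<lambda>n. (\<integral>\<^sup>+t. indicator {T..T + h n} t * a t \<partial>lborel) < ennreal (1/2)) sequentially"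
    by (rule order_tendstoD(2)) (subst ennreal_less_zero_iff, simp)
  then obtain n where "(\<integral>\<^sup>+t. indicator {T..T + h n} t * a t \<partial>lborel) < ennreal (1/2)" by (auto simp: eventually_sequentially)
  then show thesis using that[OF h[of n]] by simp
qed

lemma ennreal_half_absorb: assumes "(G::ennreal) \<le> ennreal (1/2) * G + R" "G < \<infinity>" shows "G \<le> 2 * R"
proof (cases R)
  case (real r)
  obtain g where g: "G = ennreal g" "g \<ge> 0" using assms(2) by (cases G) auto
  have "ennreal ((1/2) * g + r) = ennreal ((1/2) * g) + ennreal r" using g real by (intro ennreal_plus) auto
  also have "ennreal ((1/2) * g) = ennreal (1/2) * ennreal g" using g by (intro ennreal_mult) auto
  finally have "ennreal g \<le> ennreal ((1/2) * g + r)" using assms(1) g real by (simp only:)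
  then have "g \<le> (1/2) * g + r" using g real by (subst (asm) ennreal_le_iff) auto
  then have "g \<le> 2 * r" by simp
  then have "ennreal g \<le> ennreal (2 * r)" by (rule ennreal_leI)
  then show ?thesis using real g by (simp add: ennreal_mult)
qed simp

text \<open>Let \<open>T\<close> be the infimum of the times where \<open>E\<close> does not vanish. On a
  short interval after \<open>T\<close> the function \<open>a\<close> has integral at most 1/2, so that the
  supremum of \<open>E\<close> there is at most half of itself.\<close>
lemma gronwall_zero:
  fixes E a :: "real \<Rightarrow> ennreal"
  assumes [measurable]: "a \<in> borel_measurable borel" and fin: "(\<integral>\<^sup>+t. a t \<partial>lborel) < \<infinity>"
    and B: "\<And>t. t \<ge> 0 \<Longrightarrow> E t \<le> B" "B < \<infinity>"
    and gr: "\<And>t. t \<ge> 0 \<Longrightarrow> E t \<le> (\<integral>\<^sup>+tau. indicator {0..t} tau * (E tau * a tau) \<partial>lborel)"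
    and "t \<ge> 0"
  shows "E t = 0"
proof (rule ccontr)
  assume "E t \<noteq> 0"
  define S where "S = {t. t \<ge> 0 \<and> E t \<noteq> 0}"
  have S: "S \<noteq> {}" "bdd_below S" using \<open>t \<ge> 0\<close> \<open>E t \<noteq> 0\<close> by (auto simp: S_def bdd_below_def)
  define T where "T = Inf S"
  have T0: "T \<ge> 0" unfolding T_def by (rule cInf_greatest[OF S(1)]) (simp add: S_def)
  have lt: "E s = 0" if "0 \<le> s" "s < T" for s
    using that cInf_lower[OF _ S(2), of s] unfolding T_def S_def by fastforce
  obtain h where h: "h > 0" "(\<integral>\<^sup>+t. indicator {T..T+h} t * a t \<partial>lborel) \<le> ennreal (1/2)"
    using nn_integral_short_interval[OF assms(1) fin] by metis
  define F where "F = (SUP s\<in>{T..T+h}. E s)"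
  have FB: "F \<le> B" unfolding F_def by (rule SUP_least) (use B T0 in auto)
  have le: "E r \<le> F * ennreal (1/2)" if r: "T \<le> r" "r \<le> T + h" for r
  proof -
    have "E r \<le> (\<integral>\<^sup>+tau. indicator {0..r} tau * (E tau * a tau) \<partial>lborel)" using gr[of r] r T0 by simp
    also have "... \<le> (\<integral>\<^sup>+tau. F * (indicator {T..T+h} tau * a tau) \<partial>lborel)"
    proof (rule nn_integral_mono)
      fix tau
      show "indicator {0..r} tau * (E tau * a tau) \<le> F * (indicator {T..T+h} tau * a tau)"
      proof (cases "T \<le> tau \<and> tau \<le> r")
        case True
        then have "E tau \<le> F" unfolding F_def using r by (intro SUP_upper) auto
        then have "E tau * a tau \<le> F * a tau" by (rule mult_right_mono) simp
        then show ?thesis using True T0 r by simp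
      next
        case False then show ?thesis using lt by (auto simp: indicator_def not_le)
      qed
    qed
    also have "... = F * (\<integral>\<^sup>+tau. indicator {T..T+h} tau * a tau \<partial>lborel)" by (rule nn_integral_cmult) measurable
    also have "... \<le> F * ennreal (1/2)" by (intro mult_left_mono h) simp
    finally show ?thesis .
  qed
  have "F \<le> F * ennreal (1/2)" unfolding F_def[of] by (rule SUP_least) (use le F_def in auto)
  then have "F \<le> ennreal (1/2) * F + 0" by (simp add: mult.commute)
  then have "F \<le> 2 * 0" by (rule ennreal_half_absorb) (rule le_less_trans[OF FB B(2)])
  then have "F = 0" by simp
  obtain r where r: "r \<in> S" "r < T + h" using cInf_less_iff[OF S, of "T + h"] h(1) by (auto simp: T_def)
  then have "T \<le> r" unfolding T_def by (intro cInf_lower S)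
  then have "E r \<le> F" unfolding F_def using r by (intro SUP_upper) auto
  then show False using \<open>F = 0\<close> r by (simp add: S_def)
qed

text \<open>Let \<open>W\<close> be the difference of the fixed points. Its norm \<open>E\<close> of order -1
  and the time integral of its norm of order 1 are both bounded by the same integral \<open>G\<close> of
  products of norms of order 0. Interpolating each product with a small \<open>\<delta>\<close> puts half of
  \<open>G\<close> on the left, and what remains is the Gronwall inequality for \<open>E\<close> with a
  coefficient that is integrable in time.\<close>
lemma uniqueness:
  assumes jU: "jmeas U" and jV: "jmeas V" and fin: "evnorm {0..} 0 (enorm U) < \<infinity>" "evnorm {0..} 0 (enorm V) < \<infinity>"
    and fU: "\<And>t. t \<ge> 0 \<Longrightarrow> AE xi in lborel. U t xi = duhamel f U t xi"
    and fV: "\<And>t. t \<ge> 0 \<Longrightarrow> AE xi in lborel. V t xi = duhamel f V t xi" and t0: "t \<ge> 0"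
  shows "AE xi in lborel. U t xi = V t xi"
proof -
  define W where "W = (\<lambda>t xi. U t xi - V t xi)"
  have jW: "jmeas W" unfolding W_def by (rule jmeas_diff[OF jU jV])
  note j = enorm_jmeas[OF jU] enorm_jmeas[OF jV] enorm_jmeas[OF jW]
  note [measurable] = wnorm_jmeas[OF j(1)] wnorm_jmeas[OF j(2)] wnorm_jmeas[OF j(3)]
  note [measurable (raw)] = measurable_curried[OF convol_jmeas[OF j(1) j(3)]] measurable_curried[OF convol_jmeas[OF j(3) j(2)]]
  obtain A where A: "A > 0" "evnorm {0..} 0 (enorm U) + evnorm {0..} 0 (enorm V) \<le> ennreal A"
  proof
    have "evnorm {0..} 0 (enorm U) + evnorm {0..} 0 (enorm V) < \<infinity>" using fin by simp
    then show "evnorm {0..} 0 (enorm U) + evnorm {0..} 0 (enorm V) \<le> ennreal (enn2real (evnorm {0..} 0 (enorm U) + evnorm {0..} 0 (enorm V)) + 1)"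
      by (cases "evnorm {0..} 0 (enorm U) + evnorm {0..} 0 (enorm V)") (auto intro: ennreal_leI simp del: ennreal_plus)
  qed (simp add: add_nonneg_pos)
  define a where "a tau = wnorm 1 (enorm U tau) + wnorm 1 (enorm V tau)" for tau
  define E where "E t = wnorm (-1) (enorm W t)" for t
  have [measurable]: "a \<in> borel_measurable borel" "E \<in> borel_measurable borel" unfolding a_def E_def by measurable
  have Wle: "AE xi in lborel. enorm W t xi \<le> bilin (enorm U) (enorm W) t xi + bilin (enorm W) (enorm V) t xi" if "t \<ge> 0" for t
    using nonlin_total_finite_AE[OF jU fin(1)] nonlin_total_finite_AE[OF jV fin(2)] AE_nonzero3 fU[OF that] fV[OF that]
  proof eventually_elim
    fix xi assume g: "nonlin_total U xi < \<infinity>" "nonlin_total V xi < \<infinity>" "xi \<noteq> 0" and e: "U t xi = duhamel f U t xi" "V t xi = duhamel f V t xi"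
    have "enorm W t xi = ennreal (norm (duhamel f U t xi - duhamel f V t xi))" unfolding enorm_def W_def using e by simp
    also have "... \<le> bilin (enorm U) (enorm W) t xi + bilin (enorm W) (enorm V) t xi"
      unfolding W_def by (rule duhamel_diff_le[OF jU jV g])
    finally show "enorm W t xi \<le> bilin (enorm U) (enorm W) t xi + bilin (enorm W) (enorm V) t xi" .
  qed
  define F where "F = (\<lambda>tau xi. wt 1 xi * (convol (enorm U tau) (enorm W tau) xi + convol (enorm W tau) (enorm V tau) xi))"
  have jF: "jmeas F" unfolding F_def by measurable
  have HF: "bilin (enorm U) (enorm W) t xi + bilin (enorm W) (enorm V) t xi = heat_duhamel F t xi" for t xi
    unfolding bilin_def heat_duhamel_def F_def distrib_left by (subst nn_integral_add[symmetric]) auto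
  have XF: "wnorm (-1) (F tau) \<le> 2 * (wnorm 0 (enorm W tau) * (wnorm 0 (enorm U tau) + wnorm 0 (enorm V tau)))" for tau
  proof -
    note [measurable] = jmeas_slice[OF j(1)] jmeas_slice[OF j(2)] jmeas_slice[OF j(3)]
    have "wnorm (-1) (F tau) = wnorm 0 (convol (enorm U tau) (enorm W tau)) + wnorm 0 (convol (enorm W tau) (enorm V tau))"
      unfolding F_def wnorm_wt by (subst wnorm_add) auto
    also have "... \<le> ennreal (2 powr 0) * (wnorm 0 (enorm U tau) * wnorm 0 (enorm W tau) + wnorm 0 (enorm U tau) * wnorm 0 (enorm W tau))
      + ennreal (2 powr 0) * (wnorm 0 (enorm W tau) * wnorm 0 (enorm V tau) + wnorm 0 (enorm W tau) * wnorm 0 (enorm V tau))"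
      by (intro add_mono wnorm_convol_le) auto
    also have "... = 2 * (wnorm 0 (enorm W tau) * (wnorm 0 (enorm U tau) + wnorm 0 (enorm V tau)))"
      unfolding mult_2[symmetric] by (simp add: distrib_left mult_ac)
    finally show ?thesis .
  qed
  define G where "G T = (\<integral>\<^sup>+tau. indicator {0..T} tau * (2 * (wnorm 0 (enorm W tau) * (wnorm 0 (enorm U tau) + wnorm 0 (enorm V tau)))) \<partial>lborel)" for T
  have EG: "E T \<le> G T" if "T \<ge> 0" for T
  proof -
    have "E T \<le> wnorm (-1) (heat_duhamel F T)" unfolding E_def using Wle[OF that] by (intro wnorm_mono_AE) (simp add: HF)
    also have "... \<le> (\<integral>\<^sup>+tau. indicator {0..T} tau * wnorm (-1) (F tau) \<partial>lborel)" by (rule wnorm_heat_duhamel[OF jF])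
    also have "... \<le> G T" unfolding G_def by (intro nn_integral_mono mult_left_mono XF) auto
    finally show ?thesis .
  qed
  have DG: "(\<integral>\<^sup>+tau. indicator {0..T} tau * wnorm 1 (enorm W tau) \<partial>lborel) \<le> G T" for T
  proof -
    have "(\<integral>\<^sup>+tau. indicator {0..T} tau * wnorm 1 (enorm W tau) \<partial>lborel) \<le> (\<integral>\<^sup>+tau. indicator {0..T} tau * wnorm (-1 + 2) (heat_duhamel F tau) \<partial>lborel)"
    proof (rule nn_integral_mono)
      fix tau
      show "indicator {0..T} tau * wnorm 1 (enorm W tau) \<le> indicator {0..T} tau * wnorm (-1 + 2) (heat_duhamel F tau)"
        using wnorm_mono_AE[OF Wle[of tau, unfolded HF], of 1] by (auto simp: indicator_def)
    qed
    also have "... \<le> (\<integral>\<^sup>+tau. indicator {0..T} tau * wnorm (-1) (F tau) \<partial>lborel)" by (rule wnorm_heat_duhamel_time_integral_le[OF jF]) simp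
    also have "... \<le> G T" unfolding G_def by (intro nn_integral_mono mult_left_mono XF) auto
    finally show ?thesis .
  qed
  have NW: "evnorm {0..} 0 (enorm W) \<le> ennreal A"
  proof -
    have "evnorm {0..} 0 (enorm W) \<le> evnorm {0..} 0 (\<lambda>t xi. enorm U t xi + enorm V t xi)"
      by (intro evnorm_mono AE_I2) (simp add: enorm_def W_def ennreal_plus[symmetric] ennreal_leI norm_triangle_ineq4 del: ennreal_plus)
    also have "... \<le> evnorm {0..} 0 (enorm U) + evnorm {0..} 0 (enorm V)" by (intro evnorm_add j) simp
    finally show ?thesis using A(2) by simp
  qed
  have Gfin: "G T < \<infinity>" for T
  proof -
    have "G T \<le> (\<integral>\<^sup>+tau. 2 * (indicator {0..} tau * (wnorm 0 (enorm W tau) * wnorm 0 (enorm U tau)) + indicator {0..} tau * (wnorm 0 (enorm W tau) * wnorm 0 (enorm V tau))) \<partial>lborel)"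
      unfolding G_def by (intro nn_integral_mono) (auto simp: indicator_def distrib_left)
    also have "... = 2 * ((\<integral>\<^sup>+tau. indicator {0..} tau * (wnorm 0 (enorm W tau) * wnorm 0 (enorm U tau)) \<partial>lborel) + (\<integral>\<^sup>+tau. indicator {0..} tau * (wnorm 0 (enorm W tau) * wnorm 0 (enorm V tau)) \<partial>lborel))"
      by (subst nn_integral_cmult, measurable, subst nn_integral_add) auto
    also have "... \<le> 2 * (evnorm {0..} 0 (enorm W) * evnorm {0..} 0 (enorm U) + evnorm {0..} 0 (enorm W) * evnorm {0..} 0 (enorm V))"
      by (intro mult_left_mono add_mono wnorm_mult_time_integral_le j) auto
    also have "... < \<infinity>" using fin le_less_trans[OF NW] by (simp add: ennreal_mult_less_top)
    finally show ?thesis .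
  qed
  \<comment> \<open>The parameter for which the term with the norm of \<open>W\<close> of order 1 gets the coefficient 1/2.\<close>
  define \<delta> where "\<delta> = 1 / (4 * A)"
  have \<delta>: "\<delta> > 0" "2 * \<delta> * A = 1/2" "1 / \<delta> = 4 * A" using A(1) by (auto simp: \<delta>_def)
  have Ga: "G T \<le> ennreal (1/2) * G T + (\<integral>\<^sup>+tau. indicator {0..T} tau * (ennreal (8 * A) * (E tau * a tau)) \<partial>lborel)" for T
  proof -
    have "G T \<le> (\<integral>\<^sup>+tau. ennreal (1/2) * (indicator {0..T} tau * wnorm 1 (enorm W tau)) + indicator {0..T} tau * (ennreal (8 * A) * (E tau * a tau)) \<partial>lborel)"
      unfolding G_def
    proof (rule nn_integral_mono)
      fix tau
      show "indicator {0..T} tau * (2 * (wnorm 0 (enorm W tau) * (wnorm 0 (enorm U tau) + wnorm 0 (enorm V tau))))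
         \<le> ennreal (1/2) * (indicator {0..T} tau * wnorm 1 (enorm W tau)) + indicator {0..T} tau * (ennreal (8 * A) * (E tau * a tau))"
      proof (cases "tau \<in> {0..T}")
        case True
        then have tau: "tau \<in> {0..}" by simp
        have am: "wnorm 0 (enorm W tau) * wnorm 0 (enorm Z tau) \<le> ennreal \<delta> * (wnorm 1 (enorm W tau) * wnorm (-1) (enorm Z tau)) + ennreal (4 * A) * (E tau * wnorm 1 (enorm Z tau))" if "jmeas Z" for Z
          using wnorm_amgm[OF jmeas_slice[OF j(3)] jmeas_slice[OF enorm_jmeas[OF that]] \<delta>(1), of 0 tau tau] unfolding E_def \<delta>(3) by simp
        have "wnorm 0 (enorm W tau) * (wnorm 0 (enorm U tau) + wnorm 0 (enorm V tau)) \<le>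
           (ennreal \<delta> * (wnorm 1 (enorm W tau) * wnorm (-1) (enorm U tau)) + ennreal (4 * A) * (E tau * wnorm 1 (enorm U tau)))
          + (ennreal \<delta> * (wnorm 1 (enorm W tau) * wnorm (-1) (enorm V tau)) + ennreal (4 * A) * (E tau * wnorm 1 (enorm V tau)))"
          unfolding distrib_left by (intro add_mono am jU jV)
        also have "... = (ennreal \<delta> * wnorm 1 (enorm W tau)) * (wnorm (-1) (enorm U tau) + wnorm (-1) (enorm V tau)) + ennreal (4 * A) * (E tau * a tau)"
          unfolding a_def by (simp only: distrib_left mult_ac add_ac)
        also have "... \<le> (ennreal \<delta> * wnorm 1 (enorm W tau)) * ennreal A + ennreal (4 * A) * (E tau * a tau)"
        proof (intro add_right_mono mult_left_mono)
          have "wnorm (-1) (enorm U tau) + wnorm (-1) (enorm V tau) \<le> evnorm {0..} 0 (enorm U) + evnorm {0..} 0 (enorm V)"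
            using evnorm_wnorm[OF tau, of 0 "enorm U"] evnorm_wnorm[OF tau, of 0 "enorm V"] by (intro add_mono) auto
          then show "wnorm (-1) (enorm U tau) + wnorm (-1) (enorm V tau) \<le> ennreal A" using A(2) by (rule order_trans)
        qed simp
        finally have "2 * (wnorm 0 (enorm W tau) * (wnorm 0 (enorm U tau) + wnorm 0 (enorm V tau))) \<le> 2 * ((ennreal \<delta> * wnorm 1 (enorm W tau)) * ennreal A + ennreal (4 * A) * (E tau * a tau))"
          by (rule mult_left_mono) simp
        also have "... = (2 * ennreal \<delta> * ennreal A) * wnorm 1 (enorm W tau) + (2 * ennreal (4 * A)) * (E tau * a tau)"
          by (simp only: distrib_left mult_ac)
        also have "2 * ennreal \<delta> * ennreal A = ennreal (1/2)"
        proof -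
          have "2 * ennreal \<delta> * ennreal A = ennreal (2 * \<delta> * A)" using \<delta>(1) A(1) by (simp add: ennreal_mult)
          then show ?thesis by (simp only: \<delta>(2))
        qed
        also have "2 * ennreal (4 * A) = ennreal (8 * A)"
        proof -
          have "2 * ennreal (4 * A) = ennreal (2 * (4 * A))" using A(1) by (subst ennreal_mult) auto
          then show ?thesis by simp
        qed
        finally show ?thesis using True by simp
      qed simp
    qed
    also have "... = ennreal (1/2) * (\<integral>\<^sup>+tau. indicator {0..T} tau * wnorm 1 (enorm W tau) \<partial>lborel) + (\<integral>\<^sup>+tau. indicator {0..T} tau * (ennreal (8 * A) * (E tau * a tau)) \<partial>lborel)"
      by (subst nn_integral_add, measurable, subst nn_integral_cmult) auto
    also have "... \<le> ennreal (1/2) * G T + (\<integral>\<^sup>+tau. indicator {0..T} tau * (ennreal (8 * A) * (E tau * a tau)) \<partial>lborel)"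
      by (intro add_right_mono mult_left_mono DG) auto
    finally show ?thesis .
  qed
  define a' where "a' tau = indicator {0..} tau * (2 * (ennreal (8 * A) * a tau))" for tau
  have "E t = 0"
  proof (rule gronwall_zero[of a', OF _ _ _ _ _ t0])
    show "a' \<in> borel_measurable borel" unfolding a'_def by measurable
    show "E t \<le> ennreal A" if "t \<ge> 0" for t
      using evnorm_wnorm[of t "{0..}" 0 "enorm W"] NW that by (simp add: E_def)
    show "E t \<le> (\<integral>\<^sup>+tau. indicator {0..t} tau * (E tau * a' tau) \<partial>lborel)" if "t \<ge> 0" for t
    proof -
      have "E t \<le> 2 * (\<integral>\<^sup>+tau. indicator {0..t} tau * (ennreal (8 * A) * (E tau * a tau)) \<partial>lborel)"
        using EG[OF that] ennreal_half_absorb[OF Ga Gfin] by (rule order_trans)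
      also have "... = (\<integral>\<^sup>+tau. 2 * (indicator {0..t} tau * (ennreal (8 * A) * (E tau * a tau))) \<partial>lborel)" by (subst nn_integral_cmult) auto
      also have "... = (\<integral>\<^sup>+tau. indicator {0..t} tau * (E tau * a' tau) \<partial>lborel)"
        by (intro nn_integral_cong) (auto simp: a'_def indicator_def mult_ac)
      finally show ?thesis .
    qed
    have "(\<integral>\<^sup>+t. a' t \<partial>lborel) = (\<integral>\<^sup>+t. 2 * (ennreal (8 * A) * (indicator {0..} t * wnorm (0 + 1) (enorm U t) + indicator {0..} t * wnorm (0 + 1) (enorm V t))) \<partial>lborel)"
      by (intro nn_integral_cong) (auto simp: a'_def a_def indicator_def)
    also have "... = 2 * (ennreal (8 * A) * ((\<integral>\<^sup>+t. indicator {0..} t * wnorm (0 + 1) (enorm U t) \<partial>lborel) + (\<integral>\<^sup>+t. indicator {0..} t * wnorm (0 + 1) (enorm V t) \<partial>lborel)))"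
      by (subst nn_integral_cmult, simp, subst nn_integral_cmult, simp, subst nn_integral_add) auto
    also have "... \<le> 2 * (ennreal (8 * A) * (evnorm {0..} 0 (enorm U) + evnorm {0..} 0 (enorm V)))"
      by (intro mult_left_mono add_mono evnorm_int) auto
    also have "... < \<infinity>" using fin by (simp add: ennreal_mult_less_top)
    finally show "(\<integral>\<^sup>+t. a' t \<partial>lborel) < \<infinity>" .
  qed simp
  then have "AE xi in lborel. enorm W t xi = 0" unfolding E_def by (rule wnorm_eq_0[OF jmeas_slice[OF j(3)]])
  then show ?thesis by eventually_elim (simp add: enorm_def W_def)
qed

section \<open>Time decay\<close>

lemma jmeas_shift: assumes U: "jmeas U" shows "jmeas (\<lambda>t. U (s + t))"
proof -
  note [measurable (raw)] = measurable_curried[OF U]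
  show ?thesis by measurable
qed

lemma nn_integral_shift1:
  fixes s :: real
  assumes [measurable]: "f \<in> borel_measurable borel"
  shows "(\<integral>\<^sup>+x. f x \<partial>lborel) = (\<integral>\<^sup>+x. f (s + x) \<partial>lborel)"
  using nn_integral_real_affine[of f 1 s] by simp

text \<open>A fixed point solves the integral equation from any later time \<open>s\<close> as well: the
  Duhamel integral up to \<open>s + t\<close> is split at \<open>s\<close>, and its first part is the heat
  flow of the one up to \<open>s\<close>.\<close>
lemma restart_le:
  assumes U: "jmeas U" and fixp: "\<And>t xi. duhamel f U t xi = U t xi" and good: "nonlin_total U xi < \<infinity>" and s: "s \<ge> 0" and t: "t \<ge> 0"
  shows "enorm U (s + t) xi \<le> ennreal (heat_ker t xi) * enorm U s xi + bilin (enorm (\<lambda>t. U (s + t))) (enorm (\<lambda>t. U (s + t))) t xi"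
proof -
  note [measurable (raw)] = measurable_curried[OF nonlin_jmeas[OF U]] measurable_curried[OF convol_jmeas[OF enorm_jmeas[OF U] enorm_jmeas[OF U]]]
  let ?c = "(norm xi)\<^sup>2"
  define I1 where "I1 = (\<lambda>tau. (indicator {0..s} tau * exp (- (s - tau) * ?c)) *\<^sub>R nonlin U tau xi)"
  define I2 where "I2 = (\<lambda>tau. (indicator {s<..s + t} tau * exp (- (s + t - tau) * ?c)) *\<^sub>R nonlin U tau xi)"
  define I where "I = (\<lambda>tau. (indicator {0..s + t} tau * exp (- (s + t - tau) * ?c)) *\<^sub>R nonlin U tau xi)"
  have i1: "integrable lborel I1" unfolding I1_def by (rule duhamel_integrable[OF U good])
  have i: "integrable lborel I" unfolding I_def by (rule duhamel_integrable[OF U good])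
  have ex: "exp (- (s + t - tau) * ?c) = exp (- t * ?c) * exp (- (s - tau) * ?c)" for tau
    by (simp add: exp_add[symmetric] algebra_simps)
  have split: "I2 tau = I tau - exp (- t * ?c) *\<^sub>R I1 tau" for tau
    using s t unfolding I_def I1_def I2_def ex by (auto simp: indicator_def)
  have "(LINT tau|lborel. I2 tau) = (LINT tau|lborel. I tau) - (LINT tau|lborel. exp (- t * ?c) *\<^sub>R I1 tau)"
    unfolding split by (intro Bochner_Integration.integral_diff i integrable_scaleR_right i1)
  also have "(LINT tau|lborel. exp (- t * ?c) *\<^sub>R I1 tau) = exp (- t * ?c) *\<^sub>R (LINT tau|lborel. I1 tau)" by simp
  finally have e2: "(LINT tau|lborel. I tau) = exp (- t * ?c) *\<^sub>R (LINT tau|lborel. I1 tau) + (LINT tau|lborel. I2 tau)" by simp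
  have "U (s + t) xi = exp (- (s + t) * ?c) *\<^sub>R f xi - (LINT tau|lborel. I tau)"
    unfolding fixp[symmetric, of "s + t"] duhamel_def I_def ..
  also have "... = exp (- t * ?c) *\<^sub>R (exp (- s * ?c) *\<^sub>R f xi - (LINT tau|lborel. I1 tau)) - (LINT tau|lborel. I2 tau)"
    unfolding e2 by (simp add: scaleR_right_diff_distrib exp_add[symmetric] algebra_simps)
  also have "exp (- s * ?c) *\<^sub>R f xi - (LINT tau|lborel. I1 tau) = U s xi"
    unfolding fixp[symmetric, of s] duhamel_def I1_def ..
  finally have "enorm U (s + t) xi \<le> ennreal (norm (exp (- t * ?c) *\<^sub>R U s xi)) + ennreal (norm (LINT tau|lborel. I2 tau))"
    unfolding enorm_def by (simp add: ennreal_plus[symmetric] ennreal_leI norm_triangle_ineq4 del: ennreal_plus norm_scaleR)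
  also have "ennreal (norm (exp (- t * ?c) *\<^sub>R U s xi)) = ennreal (exp (- t * ?c)) * enorm U s xi" by (simp add: enorm_def ennreal_mult)
  also have "ennreal (norm (LINT tau|lborel. I2 tau)) \<le> (\<integral>\<^sup>+tau. indicator {s..s + t} tau * ennreal (exp (- (s + t - tau) * ?c)) * (wt 1 xi * convol (enorm U tau) (enorm U tau) xi) \<partial>lborel)"
  proof (rule order_trans[OF norm_LINT_le], rule nn_integral_mono)
    fix tau
    show "ennreal (norm (I2 tau)) \<le> indicator {s..s + t} tau * ennreal (exp (- (s + t - tau) * ?c)) * (wt 1 xi * convol (enorm U tau) (enorm U tau) xi)"
      using nonlin_le[OF U, of tau xi] by (auto simp: I2_def indicator_def ennreal_mult mult_left_mono)
  qed
  also have "... = (\<integral>\<^sup>+tau. indicator {s..s + t} (s + tau) * ennreal (exp (- (s + t - (s + tau)) * ?c)) * (wt 1 xi * convol (enorm U (s + tau)) (enorm U (s + tau)) xi) \<partial>lborel)"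
    by (rule nn_integral_shift1) measurable
  also have "... = bilin (enorm (\<lambda>t. U (s + t))) (enorm (\<lambda>t. U (s + t))) t xi"
    unfolding bilin_def heat_duhamel_def by (intro nn_integral_cong) (auto simp: indicator_def enorm_def[abs_def])
  finally show ?thesis by (simp add: add_left_mono)
qed

lemma evnorm_shift_le:
  assumes f: "jmeas f" and s: "s \<ge> 0" shows "evnorm {0..} \<kappa> (\<lambda>t. f (s + t)) \<le> evnorm {0..} \<kappa> f"
  unfolding evnorm_def
proof (rule add_mono)
  note [measurable] = wnorm_jmeas[OF f]
  show "(SUP t\<in>{0..}. wnorm (\<kappa> - 1) (f (s + t))) \<le> (SUP t\<in>{0..}. wnorm (\<kappa> - 1) (f t))"
    using s by (intro SUP_least SUP_upper) auto
  have "(\<integral>\<^sup>+t. indicator {0..} t * wnorm (\<kappa> + 1) (f (s + t)) \<partial>lborel) \<le> (\<integral>\<^sup>+t. indicator {0..} (s + t) * wnorm (\<kappa> + 1) (f (s + t)) \<partial>lborel)"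
    using s by (intro nn_integral_mono mult_right_mono) (auto simp: indicator_def)
  also have "... = (\<integral>\<^sup>+t. indicator {0..} t * wnorm (\<kappa> + 1) (f t) \<partial>lborel)"
    by (rule nn_integral_shift1[symmetric]) measurable
  finally show "(\<integral>\<^sup>+t. indicator {0..} t * wnorm (\<kappa> + 1) (f (s + t)) \<partial>lborel) \<le> (\<integral>\<^sup>+t. indicator {0..} t * wnorm (\<kappa> + 1) (f t) \<partial>lborel)" .
qed

text \<open>The quadratic term is absorbed because the scaling invariant norm is small; the bound at level
  \<open>k\<close> after time \<open>s\<close> is therefore linear in the state at time
  \<open>s\<close>.\<close>
lemma restart_evnorm:
  assumes U: "jmeas U" and fixp: "\<And>t xi. duhamel f U t xi = U t xi" and k: "k \<ge> 0" and \<epsilon>: "\<epsilon> = 1 / (64 * 2 powr k)"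
    and N0: "evnorm {0..} 0 (enorm U) \<le> ennreal (8 * \<epsilon>)" and Nk: "evnorm {0..} k (enorm U) < \<infinity>" and s: "s \<ge> 0"
  shows "evnorm {0..} k (enorm (\<lambda>t. U (s + t))) \<le> 4 * wnorm (k - 1) (enorm U s)"
proof -
  have p1: "2 powr k > 0" by simp
  have \<epsilon>p: "\<epsilon> > 0" and pe: "4 * 2 powr k * (8 * \<epsilon>) = 1/2" by (auto simp: \<epsilon>)
  let ?V = "\<lambda>t. U (s + t)"
  have V: "jmeas ?V" by (rule jmeas_shift[OF U])
  have [measurable]: "enorm U s \<in> borel_measurable borel" by (rule jmeas_slice[OF enorm_jmeas[OF U]])
  have sh: "enorm ?V = (\<lambda>t. enorm U (s + t))" by (simp add: enorm_def fun_eq_iff)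
  have fin0: "evnorm {0..} 0 (enorm U) < \<infinity>" using N0 by (rule le_less_trans) simp
  let ?D = "evnorm {0..} k (enorm ?V)"
  have "?D \<le> evnorm {0..} k (\<lambda>t xi. ennreal (heat_ker t xi) * enorm U s xi + bilin (enorm ?V) (enorm ?V) t xi)"
  proof (rule evnorm_mono)
    fix t :: real assume "t \<in> {0..}"
    then have t: "t \<ge> 0" by simp
    show "AE xi in lborel. enorm ?V t xi \<le> ennreal (heat_ker t xi) * enorm U s xi + bilin (enorm ?V) (enorm ?V) t xi"
      using nonlin_total_finite_AE[OF U fin0]
    proof eventually_elim
      fix xi assume g: "nonlin_total U xi < \<infinity>"
      have "enorm ?V t xi = enorm U (s + t) xi" by (simp add: enorm_def)
      with restart_le[OF U fixp g s t] show "enorm ?V t xi \<le> ennreal (heat_ker t xi) * enorm U s xi + bilin (enorm ?V) (enorm ?V) t xi" by simp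
    qed
  qed
  also have "... \<le> evnorm {0..} k (\<lambda>t xi. ennreal (heat_ker t xi) * enorm U s xi) + evnorm {0..} k (bilin (enorm ?V) (enorm ?V))"
    by (intro evnorm_add bilin_jmeas enorm_jmeas V) simp_all
  also have "... \<le> 2 * wnorm (k - 1) (enorm U s) + 2 * ennreal (2 powr k) * (?D * evnorm {0..} 0 (enorm ?V) + evnorm {0..} 0 (enorm ?V) * ?D)"
    by (intro add_mono heat_evnorm bilin_evnorm enorm_jmeas V k) simp_all
  also have "... = 2 * wnorm (k - 1) (enorm U s) + (2 * ennreal (2 powr k) * 2) * (?D * evnorm {0..} 0 (enorm ?V))"
  proof -
    have "?D * evnorm {0..} 0 (enorm ?V) + evnorm {0..} 0 (enorm ?V) * ?D = 2 * (?D * evnorm {0..} 0 (enorm ?V))" by (simp only: mult_2 mult.commute[of _ ?D])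
    then show ?thesis by (simp only: mult.assoc)
  qed
  also have "... \<le> 2 * wnorm (k - 1) (enorm U s) + (2 * ennreal (2 powr k) * 2) * (?D * ennreal (8 * \<epsilon>))"
    using order_trans[OF evnorm_shift_le[OF enorm_jmeas[OF U] s, of 0] N0] unfolding sh by (intro add_left_mono mult_left_mono) auto
  also have "(2 * ennreal (2 powr k) * 2) * (?D * ennreal (8 * \<epsilon>)) = ennreal (1/2) * ?D"
  proof -
    have "(2 * ennreal (2 powr k) * 2) * (?D * ennreal (8 * \<epsilon>)) = (2 * 2 * ennreal (2 powr k) * ennreal (8 * \<epsilon>)) * ?D" by (simp only: mult_ac)
    also have "2 * 2 * ennreal (2 powr k) = ennreal (4 * 2 powr k)" by (simp add: ennreal_mult)
    also have "ennreal (4 * 2 powr k) * ennreal (8 * \<epsilon>) = ennreal (4 * 2 powr k * (8 * \<epsilon>))" using \<epsilon>p by (intro ennreal_mult[symmetric]) auto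
    also have "4 * 2 powr k * (8 * \<epsilon>) = 1/2" by (rule pe)
    finally show ?thesis .
  qed
  finally have "?D \<le> ennreal (1/2) * ?D + 2 * wnorm (k - 1) (enorm U s)" by (simp only: add.commute)
  moreover have "?D < \<infinity>" unfolding sh by (rule le_less_trans[OF evnorm_shift_le[OF enorm_jmeas[OF U] s] Nk])
  ultimately have "?D \<le> 2 * (2 * wnorm (k - 1) (enorm U s))" by (rule ennreal_half_absorb)
  also have "... = (2 * 2) * wnorm (k - 1) (enorm U s)" by (simp only: mult.assoc)
  finally show ?thesis by simp
qed

lemma cball_borel[measurable]: "cball (x::real^3) r \<in> sets borel" by simp

text \<open>Local integrability of \<open>|xi|\<^sup>-\<^sup>2\<close> in three dimensions. Polar coordinates
  are replaced by the identity \<open>|xi|\<^sup>-\<^sup>2 = \<integral> exp (-t |xi|\<^sup>2) dt\<close> and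
  the Gaussian integral, which decays like \<open>t\<^sup>-\<^sup>3\<^sup>/\<^sup>2\<close>.\<close>
lemma ball_weight_minus_two: "(\<integral>\<^sup>+xi. indicator (cball (0::real^3) 1) xi * wt (-2) xi \<partial>lborel) < \<infinity>"
proof -
  let ?e = "\<lambda>t xi. ennreal (exp (- (t - 0) * (norm (xi::real^3))\<^sup>2))"
  have w: "wt (-2) xi = (\<integral>\<^sup>+t. indicator {0..} t * ?e t xi \<partial>lborel)" if "xi \<noteq> 0" for xi
    using nn_integral_exp_decay[of "(norm xi)\<^sup>2" 0] that by (simp add: wt_def powr_minus divide_inverse)
  have "(\<integral>\<^sup>+xi. indicator (cball (0::real^3) 1) xi * wt (-2) xi \<partial>lborel) \<le> (\<integral>\<^sup>+xi. \<integral>\<^sup>+t. indicator (cball (0::real^3) 1) xi * (indicator {0..} t * ?e t xi) \<partial>lborel \<partial>lborel)"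
  proof (rule nn_integral_mono)
    fix xi :: "real^3"
    show "indicator (cball (0::real^3) 1) xi * wt (-2) xi \<le> (\<integral>\<^sup>+t. indicator (cball (0::real^3) 1) xi * (indicator {0..} t * ?e t xi) \<partial>lborel)"
      by (cases "xi = 0") (auto simp: w nn_integral_cmult)
  qed
  also have "... = (\<integral>\<^sup>+t. \<integral>\<^sup>+xi. indicator (cball (0::real^3) 1) xi * (indicator {0..} t * ?e t xi) \<partial>lborel \<partial>lborel)"
    by (rule lborel_pair.Fubini') simp
  also have "... \<le> (\<integral>\<^sup>+t. indicator {0..1} t * emeasure lborel (cball (0::real^3) 1) + ennreal gauss_mass * (ennreal (t powr (-3/2)) * indicator {1..} t) \<partial>lborel)"
  proof (rule nn_integral_mono)
    fix t :: real
    show "(\<integral>\<^sup>+xi. indicator (cball (0::real^3) 1) xi * (indicator {0..} t * ?e t xi) \<partial>lborel) \<le> indicator {0..1} t * emeasure lborel (cball (0::real^3) 1) + ennreal gauss_mass * (ennreal (t powr (-3/2)) * indicator {1..} t)"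
    proof (cases "t < 1")
      case True
      have "(\<integral>\<^sup>+xi. indicator (cball (0::real^3) 1) xi * (indicator {0..} t * ?e t xi) \<partial>lborel) \<le> (\<integral>\<^sup>+xi. indicator {0..1} t * indicator (cball (0::real^3) 1) xi \<partial>lborel)"
        using True by (intro nn_integral_mono) (auto simp: indicator_def)
      also have "... = indicator {0..1} t * emeasure lborel (cball (0::real^3) 1)" by (simp add: nn_integral_cmult)
      finally show ?thesis by (rule order_trans) simp
    next
      case False
      then have t: "t \<ge> 1" by simp
      define c where "c = sqrt (2 * t)"
      have c: "c > 0" "c\<^sup>2 = 2 * t" using t by (auto simp: c_def)
      have "(\<integral>\<^sup>+xi. indicator (cball (0::real^3) 1) xi * (indicator {0..} t * ?e t xi) \<partial>lborel) \<le> (\<integral>\<^sup>+xi. ennreal (gauss (c *\<^sub>R xi)) \<partial>lborel)"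
        by (intro nn_integral_mono) (auto simp: indicator_def gauss_def power_mult_distrib c)
      also have "... \<le> ennreal (t powr (-3/2)) * (ennreal (c^3) * (\<integral>\<^sup>+xi. ennreal (gauss (c *\<^sub>R xi)) \<partial>lborel))"
      proof -
        have "c^3 = (2 * t) powr (3/2)" unfolding c_def using t
          by (simp add: powr_half_sqrt[symmetric] powr_powr powr_realpow[symmetric])
        then have "t powr (-3/2) * c^3 = 2 powr (3/2)" using t by (simp add: powr_mult powr_minus)
        then have "1 \<le> t powr (-3/2) * c^3" by (simp add: ge_one_powr_ge_zero)
        then have "1 \<le> ennreal (t powr (-3/2) * c^3)" by simp
        then have "1 * (\<integral>\<^sup>+xi. ennreal (gauss (c *\<^sub>R xi)) \<partial>lborel) \<le> ennreal (t powr (-3/2) * c^3) * (\<integral>\<^sup>+xi. ennreal (gauss (c *\<^sub>R xi)) \<partial>lborel)" by (rule mult_right_mono) simp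
        then show ?thesis using c by (simp add: ennreal_mult mult.assoc)
      qed
      also have "ennreal (c^3) * (\<integral>\<^sup>+xi. ennreal (gauss (c *\<^sub>R xi)) \<partial>lborel) = (\<integral>\<^sup>+xi. ennreal (gauss xi) \<partial>lborel)"
        using nn_integral_affine3[of "\<lambda>xi. ennreal (gauss xi)" c 0] c by simp
      also have "... = ennreal gauss_mass"
        using gauss_integral gauss_pos by (subst nn_integral_eq_integral) (auto simp: less_imp_le)
      finally show ?thesis using t by (simp add: mult.commute add_increasing)
    qed
  qed
  also have "... = emeasure lborel {0..1::real} * emeasure lborel (cball (0::real^3) 1) + ennreal gauss_mass * (\<integral>\<^sup>+t. ennreal (t powr (-3/2)) * indicator {1..} t \<partial>lborel)"
    by (subst nn_integral_add, simp, simp, subst nn_integral_cmult, simp) (simp add: nn_integral_multc)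
  also have "(\<integral>\<^sup>+t. ennreal (t powr (-3/2)) * indicator {1..} t \<partial>lborel) = ennreal (0 - (- 2 * 1 powr (-1/2)))"
  proof (rule nn_integral_FTC_atLeast[where F="\<lambda>t. - 2 * t powr (-1/2)"])
    show "((\<lambda>t. - 2 * t powr (-1/2)) has_real_derivative x powr (-3/2)) (at x)" if "1 \<le> x" for x :: real
      using that by (auto intro!: derivative_eq_intros)
    show "((\<lambda>t::real. - 2 * t powr (-1/2)) \<longlongrightarrow> 0) at_top" by real_asymp
  qed auto
  also have "emeasure lborel {0..1::real} * emeasure lborel (cball (0::real^3) 1) + ennreal gauss_mass * ennreal (0 - (- 2 * 1 powr (-1/2))) < \<infinity>"
    using emeasure_bounded_finite[OF bounded_cball, of "0::real^3" 1] by (simp add: ennreal_mult_less_top)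
  finally show ?thesis .
qed

text \<open>Scaling reduces to the unit ball, and there \<open>|xi|\<^sup>b \<le>
  |xi|\<^sup>-\<^sup>2\<close>.\<close>
lemma ball_weight:
  assumes b: "b \<ge> -2"
  obtains K where "K \<ge> 0" "\<And>R. R > 0 \<Longrightarrow> (\<integral>\<^sup>+xi. indicator (cball (0::real^3) R) xi * wt b xi \<partial>lborel) \<le> ennreal (K * R powr (b + 3))"
proof -
  let ?K = "\<integral>\<^sup>+xi. indicator (cball (0::real^3) 1) xi * wt b xi \<partial>lborel"
  have "?K \<le> (\<integral>\<^sup>+xi. indicator (cball (0::real^3) 1) xi * wt (-2) xi \<partial>lborel)"
  proof (rule nn_integral_mono)
    fix xi :: "real^3"
    show "indicator (cball (0::real^3) 1) xi * wt b xi \<le> indicator (cball (0::real^3) 1) xi * wt (-2) xi"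
      using b by (cases "xi = 0") (auto simp: indicator_def wt_def intro!: ennreal_leI powr_mono')
  qed
  then have fin: "?K < \<infinity>" using ball_weight_minus_two by (rule le_less_trans)
  define K where "K = enn2real ?K"
  have K: "?K = ennreal K" "K \<ge> 0" using fin by (auto simp: K_def)
  have "(\<integral>\<^sup>+xi. indicator (cball (0::real^3) R) xi * wt b xi \<partial>lborel) \<le> ennreal (K * R powr (b + 3))" if R: "R > 0" for R
  proof -
    have "(\<integral>\<^sup>+xi. indicator (cball (0::real^3) R) xi * wt b xi \<partial>lborel) = ennreal (R^3) * (\<integral>\<^sup>+xi. indicator (cball (0::real^3) R) (R *\<^sub>R xi) * wt b (R *\<^sub>R xi) \<partial>lborel)"
      using R nn_integral_affine3[of "\<lambda>xi. indicator (cball (0::real^3) R) xi * wt b xi" R 0] by simp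
    also have "(\<integral>\<^sup>+xi. indicator (cball (0::real^3) R) (R *\<^sub>R xi) * wt b (R *\<^sub>R xi) \<partial>lborel) = (\<integral>\<^sup>+xi. ennreal (R powr b) * (indicator (cball (0::real^3) 1) xi * wt b xi) \<partial>lborel)"
      using R by (intro nn_integral_cong) (auto simp: indicator_def wt_def powr_mult ennreal_mult)
    also have "... = ennreal (R powr b) * ?K" by (rule nn_integral_cmult) measurable
    also have "ennreal (R^3) * (ennreal (R powr b) * ?K) = ennreal (R^3 * (R powr b * K))" using R K by (simp add: ennreal_mult)
    also have "R^3 * (R powr b * K) = K * R powr (b + 3)" using R by (simp add: powr_add powr_realpow)
    finally show ?thesis by simp
  qed
  then show thesis using that K(2) by blast
qed

text \<open>Frequencies below \<open>R\<close> are controlled by the pseudo-measure bound, those above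
  \<open>R\<close> by the norm with two more derivatives.\<close>
lemma low_high:
  fixes g :: "real^3 \<Rightarrow> ennreal"
  assumes [measurable]: "g \<in> borel_measurable borel" and M: "AE xi in lborel. wt \<sigma> xi * g xi \<le> M" and R: "R > 0"
    and K: "(\<integral>\<^sup>+xi. indicator (cball (0::real^3) R) xi * wt (k - 1 - \<sigma>) xi \<partial>lborel) \<le> K"
  shows "wnorm (k - 1) g \<le> M * K + ennreal (1 / R\<^sup>2) * wnorm (k + 1) g"
proof -
  have "wnorm (k - 1) g \<le> (\<integral>\<^sup>+xi. M * (indicator (cball (0::real^3) R) xi * wt (k - 1 - \<sigma>) xi) + ennreal (1 / R\<^sup>2) * (wt (k + 1) xi * g xi) \<partial>lborel)"
    unfolding wnorm_def
  proof (rule nn_integral_mono_AE, use M in eventually_elim)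
    fix xi assume M: "wt \<sigma> xi * g xi \<le> M"
    show "wt (k - 1) xi * g xi \<le> M * (indicator (cball (0::real^3) R) xi * wt (k - 1 - \<sigma>) xi) + ennreal (1 / R\<^sup>2) * (wt (k + 1) xi * g xi)"
    proof (cases "norm xi \<le> R")
      case True
      have "wt (k - 1) xi * g xi = (wt \<sigma> xi * g xi) * wt (k - 1 - \<sigma>) xi"
        using wt_mult[of "k - 1 - \<sigma>" xi \<sigma>] by (simp add: mult_ac)
      also have "... \<le> M * wt (k - 1 - \<sigma>) xi" by (intro mult_right_mono M) simp
      finally show ?thesis using True by (simp add: add_increasing2)
    next
      case False
      have "norm xi powr (k - 1) \<le> (1 / R\<^sup>2) * norm xi powr (k + 1)"
      proof -
        have n: "norm xi > 0" "R\<^sup>2 \<le> (norm xi)\<^sup>2" using False R by (auto intro!: power_mono)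
        have "norm xi powr (k + 1) = norm xi powr (k - 1) * (norm xi)\<^sup>2"
          using n powr_add[of "norm xi" "k - 1" 2] by (simp add: add.commute)
        then have "R\<^sup>2 * norm xi powr (k - 1) \<le> norm xi powr (k + 1)" using n by (simp add: mult.commute mult_left_mono)
        then show ?thesis using R by (simp add: field_simps)
      qed
      then have "wt (k - 1) xi \<le> ennreal (1 / R\<^sup>2) * wt (k + 1) xi" by (simp add: wt_def ennreal_mult[symmetric] ennreal_leI)
      then have "wt (k - 1) xi * g xi \<le> ennreal (1 / R\<^sup>2) * wt (k + 1) xi * g xi" by (rule mult_right_mono) simp
      then show ?thesis by (simp add: mult.assoc add_increasing)
    qed
  qed
  also have "... = M * (\<integral>\<^sup>+xi. indicator (cball (0::real^3) R) xi * wt (k - 1 - \<sigma>) xi \<partial>lborel) + ennreal (1 / R\<^sup>2) * wnorm (k + 1) g"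
    unfolding wnorm_def by (subst nn_integral_add) (auto simp: nn_integral_cmult)
  also have "... \<le> M * K + ennreal (1 / R\<^sup>2) * wnorm (k + 1) g" by (intro add_right_mono mult_left_mono K) simp
  finally show ?thesis .
qed

text \<open>Halving the time costs the factor \<open>2\<^sup>\<alpha>\<close> in the claimed rate, and the
  hypothesis on \<open>q\<close> says that \<open>q\<close> beats it. After \<open>n\<close> halvings the a
  priori bound \<open>B\<close> only contributes \<open>2\<^sup>-\<^sup>n B\<close>.\<close>
lemma decay_iteration:
  fixes y :: "real \<Rightarrow> real"
  assumes B: "\<And>t. t > 0 \<Longrightarrow> y t \<le> B" and B0: "B \<ge> 0" and \<alpha>: "\<alpha> \<ge> 0" and C0: "C \<ge> 0" and q: "q \<ge> 0" "q * 2 powr \<alpha> \<le> 1/2"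
    and step: "\<And>t. t > 0 \<Longrightarrow> y t \<le> C * t powr (-\<alpha>) + q * y (t / 2)" and t: "t > 0"
  shows "y t \<le> 2 * C * t powr (-\<alpha>)"
proof -
  have "2 powr \<alpha> \<ge> 1" using \<alpha> by (simp add: ge_one_powr_ge_zero)
  then have "q * 1 \<le> q * 2 powr \<alpha>" using q by (intro mult_left_mono) auto
  then have q2: "q \<le> 1/2" using q by linarith
  have P: "\<forall>t>0. y t \<le> 2 * C * t powr (-\<alpha>) + (1/2)^n * B" for n
  proof (induction n)
    case 0
    show ?case
    proof (intro allI impI)
      fix t :: real assume "t > 0"
      then have "y t \<le> B" by (rule B)
      moreover have "0 \<le> 2 * C * t powr (-\<alpha>)" using C0 by simp
      ultimately show "y t \<le> 2 * C * t powr (-\<alpha>) + (1/2)^0 * B" by simp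
    qed
  next
    case (Suc n)
    show ?case
    proof (intro allI impI)
      fix t :: real assume t: "t > 0"
      have h: "(t/2) powr (-\<alpha>) = 2 powr \<alpha> * t powr (-\<alpha>)" using t by (simp add: powr_divide powr_minus field_simps)
      have "y (t/2) \<le> 2 * C * (t/2) powr (-\<alpha>) + (1/2)^n * B" using Suc t by simp
      then have "q * y (t/2) \<le> q * (2 * C * (2 powr \<alpha> * t powr (-\<alpha>)) + (1/2)^n * B)" unfolding h using q(1) by (rule mult_left_mono)
      also have "... = (q * 2 powr \<alpha>) * (2 * C * t powr (-\<alpha>)) + q * ((1/2)^n * B)" by (simp add: algebra_simps)
      also have "... \<le> (1/2) * (2 * C * t powr (-\<alpha>)) + (1/2) * ((1/2)^n * B)"
        using q q2 C0 B0 by (intro add_mono mult_right_mono) auto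
      finally have "q * y (t/2) \<le> C * t powr (-\<alpha>) + (1/2)^Suc n * B" by simp
      with step[OF t] show "y t \<le> 2 * C * t powr (-\<alpha>) + (1/2)^Suc n * B" by simp
    qed
  qed
  have "(\<lambda>n. 2 * C * t powr (-\<alpha>) + (1/2)^n * B) \<longlonglongrightarrow> 2 * C * t powr (-\<alpha>) + 0 * B"
    by (intro tendsto_intros LIMSEQ_realpow_zero) auto
  then show ?thesis using P t by (intro LIMSEQ_le_const[where X="\<lambda>n. 2 * C * t powr (-\<alpha>) + (1/2)^n * B"]) auto
qed

lemma ennreal_mult_add_mult: "0 \<le> a \<Longrightarrow> 0 \<le> b \<Longrightarrow> 0 \<le> c \<Longrightarrow> 0 \<le> d \<Longrightarrow> ennreal a * ennreal b + ennreal c * ennreal d = ennreal (a * b + c * d)"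
  by (simp add: ennreal_mult)

text \<open>Write \<open>y t\<close> for the norm of order \<open>k - 1\<close>. Restarting at \<open>t /
  2\<close> bounds the integral of the norm of order \<open>k + 1\<close> over \<open>[t / 2, t]\<close> by
  \<open>4 y (t / 2)\<close>, so at some time \<open>s\<close> in this interval that norm is at most \<open>16
  y (t / 2) / t\<close>. At this time the frequencies are split at \<open>R = sqrt (\<Lambda> / t)\<close>:
  the low ones contribute a multiple of \<open>t\<^sup>-\<^sup>\<alpha>\<close>, the high ones \<open>(16 /
  \<Lambda>) y (t / 2)\<close>. Since \<open>y t \<le> 4 y s\<close>, a large \<open>\<Lambda>\<close> yields
  the hypothesis of \<open>decay_iteration\<close>. The constant depends on \<open>k\<close> and
  \<open>\<sigma>\<close> only.\<close>
lemma decay: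
  assumes k: "k \<ge> 0" and \<sigma>: "\<sigma> \<in> {-1..1}" and \<epsilon>: "\<epsilon> = 1 / (64 * 2 powr k)"
  defines "\<alpha> \<equiv> (k + 2 - \<sigma>) / 2"
  obtains C0 where "C0 \<ge> 0" "\<And>f U M y0 t. jmeas U \<Longrightarrow> (\<And>t xi. duhamel f U t xi = U t xi) \<Longrightarrow> evnorm {0..} 0 (enorm U) \<le> ennreal (8 * \<epsilon>)
     \<Longrightarrow> evnorm {0..} k (enorm U) < \<infinity> \<Longrightarrow> M \<ge> 0 \<Longrightarrow> (\<And>t. t \<ge> 0 \<Longrightarrow> AE xi in lborel. wt \<sigma> xi * enorm U t xi \<le> ennreal M)
     \<Longrightarrow> wnorm (k - 1) (enorm U 0) \<le> ennreal y0 \<Longrightarrow> y0 \<ge> 0 \<Longrightarrow> t > 0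
     \<Longrightarrow> wnorm (k - 1) (enorm U t) \<le> ennreal (C0 * (M + y0) * (1 + t) powr (- \<alpha>))"
proof -
  have \<alpha>0: "\<alpha> > 0" using k \<sigma> by (simp add: \<alpha>_def)
  obtain K where K: "K \<ge> 0" "\<And>R. R > 0 \<Longrightarrow> (\<integral>\<^sup>+xi. indicator (cball (0::real^3) R) xi * wt (k - 1 - \<sigma>) xi \<partial>lborel) \<le> ennreal (K * R powr (k - 1 - \<sigma> + 3))"
    using ball_weight[of "k - 1 - \<sigma>"] k \<sigma> by auto
  \<comment> \<open>Chosen such that \<open>(64 / \<Lambda>) 2\<^sup>\<alpha> = 1 / 2\<close>.\<close>
  define \<Lambda> where "\<Lambda> = 128 * 2 powr \<alpha>"
  have \<Lambda>: "\<Lambda> > 0" by (simp add: \<Lambda>_def)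
  define C1 where "C1 = 4 * K * \<Lambda> powr \<alpha>"
  define C0 where "C0 = 2 powr \<alpha> * (2 * C1 + 4)"
  have C1: "C1 \<ge> 0" using K by (simp add: C1_def)
  have C0: "C0 \<ge> 0" using C1 by (simp add: C0_def)
  have main: "wnorm (k - 1) (enorm U t) \<le> ennreal (C0 * (M + y0) * (1 + t) powr (- \<alpha>))"
    if U: "jmeas U" and fixp: "\<And>t xi. duhamel f U t xi = U t xi" and N0: "evnorm {0..} 0 (enorm U) \<le> ennreal (8 * \<epsilon>)"
      and Nk: "evnorm {0..} k (enorm U) < \<infinity>" and M0: "M \<ge> 0" and M: "\<And>t. t \<ge> 0 \<Longrightarrow> AE xi in lborel. wt \<sigma> xi * enorm U t xi \<le> ennreal M"
      and y0: "wnorm (k - 1) (enorm U 0) \<le> ennreal y0" "y0 \<ge> 0" and t: "t > 0" for f U M y0 t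
  proof -
    define y where "y t = enn2real (wnorm (k - 1) (enorm U t))" for t
    have yf: "wnorm (k - 1) (enorm U t) = ennreal (y t)" if "t \<ge> 0" for t
      using le_less_trans[OF evnorm_wnorm[of t "{0..}" k "enorm U"] Nk] that by (simp add: y_def)
    have ynn: "y t \<ge> 0" for t by (simp add: y_def)
    note rs = restart_evnorm[OF U fixp k \<epsilon> N0 Nk]
    have ymon: "y (s + r) \<le> 4 * y s" if "s \<ge> 0" "r \<ge> 0" for s r
    proof -
      have "wnorm (k - 1) (enorm (\<lambda>t. U (s + t)) r) \<le> 4 * wnorm (k - 1) (enorm U s)"
        using that by (intro order_trans[OF evnorm_wnorm rs]) auto
      then have "ennreal (y (s + r)) \<le> 4 * ennreal (y s)" using that yf[of "s + r"] yf[of s] by (simp add: enorm_def[abs_def])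
      also have "... = ennreal (4 * y s)" using ynn by (simp add: ennreal_mult)
      finally show ?thesis using ynn by (subst (asm) ennreal_le_iff) auto
    qed
    have yB: "y t \<le> 4 * y0" if "t > 0" for t
    proof -
      have "y 0 \<le> y0" using y0 yf[of 0] by simp
      then show ?thesis using ymon[of 0 t] that by simp
    qed
    have step: "y t \<le> (C1 * M) * t powr (-\<alpha>) + (64 / \<Lambda>) * y (t / 2)" if t: "t > 0" for t
    proof (cases "y (t / 2) = 0")
      case True
      then have "y t \<le> 0" using ymon[of "t/2" "t/2"] t by simp
      also have "0 \<le> (C1 * M) * t powr (-\<alpha>) + (64 / \<Lambda>) * y (t / 2)" using C1 M0 True by simp
      finally show ?thesis .
    next
      case False
      then have yp: "y (t / 2) > 0" using ynn[of "t/2"] by simp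
      \<comment> \<open>If the norm of order \<open>k + 1\<close> exceeded \<open>c\<close> on all of \<open>[t / 2, t]\<close>, its integral would be at least \<open>8 y (t / 2)\<close>, but restarting bounds it by \<open>4 y (t / 2)\<close>.\<close>
      define c where "c = 16 * y (t / 2) / t"
      have c: "c > 0" using yp t by (simp add: c_def)
      have "\<exists>tau\<in>{0..t/2}. wnorm (k + 1) (enorm U (t / 2 + tau)) \<le> ennreal c"
      proof (rule ccontr)
        assume "\<not> ?thesis"
        then have z: "ennreal c \<le> wnorm (k + 1) (enorm U (t / 2 + tau))" if "tau \<in> {0..t/2}" for tau
          using that by (meson linear)
        have "ennreal (8 * y (t/2)) = ennreal (c * (t / 2))" using t by (simp add: c_def)
        also have "... = (\<integral>\<^sup>+tau. ennreal c * indicator {0..t/2} tau \<partial>lborel)" using t c by (subst ennreal_mult) (simp_all add: nn_integral_cmult)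
        also have "... \<le> (\<integral>\<^sup>+tau. indicator {0..} tau * wnorm (k + 1) (enorm (\<lambda>tau. U (t / 2 + tau)) tau) \<partial>lborel)"
          using z by (intro nn_integral_mono) (auto simp: indicator_def enorm_def[abs_def])
        also have "... \<le> evnorm {0..} k (enorm (\<lambda>tau. U (t / 2 + tau)))" by (rule evnorm_int)
        also have "... \<le> 4 * wnorm (k - 1) (enorm U (t / 2))" using t by (intro rs) simp
        also have "... = ennreal (4 * y (t/2))" using t ynn by (simp add: yf ennreal_mult)
        finally have "8 * y (t/2) \<le> 4 * y (t/2)" using yp by (subst (asm) ennreal_le_iff) auto
        then show False using yp by simp
      qed
      then obtain tau where tau: "0 \<le> tau" "tau \<le> t/2" "wnorm (k + 1) (enorm U (t / 2 + tau)) \<le> ennreal c" by auto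
      define s where "s = t / 2 + tau"
      define R where "R = sqrt (\<Lambda> / t)"
      have R: "R > 0" "R\<^sup>2 = \<Lambda> / t" using t \<Lambda> by (auto simp: R_def)
      have s: "s > 0" "s \<le> t" using t tau by (auto simp: s_def)
      have "ennreal (y s) \<le> ennreal M * ennreal (K * R powr (k - 1 - \<sigma> + 3)) + ennreal (1 / R\<^sup>2) * wnorm (k + 1) (enorm U s)"
        using low_high[OF jmeas_slice[OF enorm_jmeas[OF U]] M R(1) K(2)[OF R(1)], of s] s yf[of s] by simp
      also have "... \<le> ennreal M * ennreal (K * R powr (k - 1 - \<sigma> + 3)) + ennreal (1 / R\<^sup>2) * ennreal c"
        using tau(3) unfolding s_def by (intro add_left_mono mult_left_mono) auto
      also have "... = ennreal (M * (K * R powr (k - 1 - \<sigma> + 3)) + (1 / R\<^sup>2) * c)"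
        using M0 K(1) c R t \<Lambda> by (intro ennreal_mult_add_mult) auto
      finally have ys: "y s \<le> M * (K * R powr (k - 1 - \<sigma> + 3)) + (1 / R\<^sup>2) * c"
        using M0 K(1) c R t \<Lambda> by (subst (asm) ennreal_le_iff) (auto intro!: add_nonneg_nonneg)
      also have "R powr (k - 1 - \<sigma> + 3) = \<Lambda> powr \<alpha> * t powr (-\<alpha>)"
      proof -
        have "R powr (k - 1 - \<sigma> + 3) = (R\<^sup>2) powr \<alpha>"
        proof -
          have "(R\<^sup>2) powr \<alpha> = (R powr 2) powr \<alpha>" using R(1) by simp
          also have "... = R powr (2 * \<alpha>)" by (rule powr_powr)
          also have "2 * \<alpha> = k - 1 - \<sigma> + 3" by (simp add: \<alpha>_def)
          finally show ?thesis by simp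
        qed
        also have "... = \<Lambda> powr \<alpha> * t powr (-\<alpha>)" unfolding R(2) using \<Lambda> t by (simp add: powr_divide powr_minus_divide)
        finally show ?thesis .
      qed
      also have "(1 / R\<^sup>2) * c = (16 / \<Lambda>) * y (t / 2)" unfolding R(2) c_def using t \<Lambda> by simp
      finally have ys: "y s \<le> M * (K * (\<Lambda> powr \<alpha> * t powr (-\<alpha>))) + (16 / \<Lambda>) * y (t / 2)" .
      have e4: "4 * (M * (K * (\<Lambda> powr \<alpha> * t powr (-\<alpha>))) + (16 / \<Lambda>) * y (t / 2)) = (C1 * M) * t powr (-\<alpha>) + (64 / \<Lambda>) * y (t / 2)"
        by (simp add: C1_def algebra_simps)
      from ys have "4 * y s \<le> 4 * (M * (K * (\<Lambda> powr \<alpha> * t powr (-\<alpha>))) + (16 / \<Lambda>) * y (t / 2))" by (rule mult_left_mono) simp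
      then have "4 * y s \<le> (C1 * M) * t powr (-\<alpha>) + (64 / \<Lambda>) * y (t / 2)" unfolding e4 .
      moreover have "y t \<le> 4 * y s" using ymon[of s "t - s"] s by simp
      ultimately show ?thesis by simp
    qed
    have dec: "y t \<le> 2 * (C1 * M) * t powr (-\<alpha>)"
    proof (rule decay_iteration[where B="4 * y0" and q="64 / \<Lambda>"])
      show "64 / \<Lambda> * 2 powr \<alpha> \<le> 1 / 2" by (simp add: \<Lambda>_def)
    qed (use yB y0 \<alpha>0 C1 M0 \<Lambda> step t in auto)
    have "y t \<le> C0 * (M + y0) * (1 + t) powr (- \<alpha>)"
    \<comment> \<open>For small times \<open>t\<^sup>-\<^sup>\<alpha>\<close> is no bound of the required form, and boundedness of \<open>y\<close> is used instead.\<close>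
    proof (cases "t \<ge> 1")
      case True
      have "t powr (-\<alpha>) \<le> ((1 + t) / 2) powr (-\<alpha>)" using True \<alpha>0 by (intro powr_mono2') auto
      also have "... = 2 powr \<alpha> * (1 + t) powr (-\<alpha>)" using True by (simp add: powr_divide powr_minus field_simps)
      finally have "2 * (C1 * M) * t powr (-\<alpha>) \<le> 2 * (C1 * M) * (2 powr \<alpha> * (1 + t) powr (-\<alpha>))" using C1 M0 by (intro mult_left_mono) auto
      also have "... \<le> C0 * (M + y0) * (1 + t) powr (- \<alpha>)"
      proof -
        have "2 * (C1 * M) * 2 powr \<alpha> = (2 powr \<alpha> * (2 * C1)) * M" by simp
        also have "... \<le> C0 * (M + y0)" unfolding C0_def using C1 M0 y0 by (intro mult_mono) auto
        finally have "2 * (C1 * M) * 2 powr \<alpha> * (1 + t) powr (-\<alpha>) \<le> C0 * (M + y0) * (1 + t) powr (-\<alpha>)" by (rule mult_right_mono) simp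
        then show ?thesis by (simp add: mult.assoc)
      qed
      finally show ?thesis using dec by simp
    next
      case False
      have "1 = 2 powr \<alpha> * 2 powr (-\<alpha>)" by (simp add: powr_minus)
      also have "... \<le> 2 powr \<alpha> * (1 + t) powr (-\<alpha>)" using False t \<alpha>0 by (intro mult_left_mono powr_mono2') auto
      finally have "4 * y0 * 1 \<le> 4 * y0 * (2 powr \<alpha> * (1 + t) powr (-\<alpha>))" using y0 by (intro mult_left_mono) auto
      also have "... \<le> C0 * (M + y0) * (1 + t) powr (- \<alpha>)"
      proof -
        have "4 * y0 * 2 powr \<alpha> = (2 powr \<alpha> * 4) * y0" by simp
        also have "... \<le> C0 * (M + y0)" unfolding C0_def using C1 M0 y0 by (intro mult_mono) auto
        finally have "4 * y0 * 2 powr \<alpha> * (1 + t) powr (-\<alpha>) \<le> C0 * (M + y0) * (1 + t) powr (-\<alpha>)" by (rule mult_right_mono) simp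
        then show ?thesis by (simp add: mult.assoc)
      qed
      finally show ?thesis using yB[OF t] by simp
    qed
    then show ?thesis using yf[of t] t by (simp add: ennreal_leI)
  qed
  show thesis by (rule that[OF C0 main])
qed

section \<open>Distributions with a prescribed Fourier transform\<close>

text \<open>The distribution with Fourier transform \<open>G\<close>, by Parseval's formula; the pairing
  converges as soon as \<open>G\<close> is integrable against \<open>|xi|\<^sup>-\<^sup>1\<close>, see
  \<open>component_integrable\<close>.\<close>
definition dist_of :: "(real^3 \<Rightarrow> complex^3) \<Rightarrow> vdist" where
  "dist_of G = (\<lambda>i \<phi>. LINT xi|lborel. G xi $ i * inv_fourier \<phi> xi)"

definition cnorm :: "(real^3 \<Rightarrow> complex^3) \<Rightarrow> real^3 \<Rightarrow> ennreal" where
  "cnorm G xi = ennreal (norm (G xi))"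

lemma cnorm_measurable[measurable]: "G \<in> borel_measurable borel \<Longrightarrow> cnorm G \<in> borel_measurable borel"
  unfolding cnorm_def[abs_def] by measurable

lemma enorm_cnorm: "enorm U t = cnorm (U t)" by (simp add: enorm_def cnorm_def fun_eq_iff)

text \<open>The factor \<open>|xi|\<^sup>-\<^sup>1\<close> in the norm is compensated by a test function with
  bounded \<open>|xi| |\<psi>|\<close>.\<close>
lemma weighted_bound_integrable:
  fixes g \<psi> :: "real^3 \<Rightarrow> complex"
  assumes [measurable]: "g \<in> borel_measurable borel" "\<psi> \<in> borel_measurable borel"
    and fin: "wnorm (-1) (\<lambda>xi. ennreal (norm (g xi))) < \<infinity>" and b: "\<And>xi. norm xi * norm (\<psi> xi) \<le> C"
  shows "integrable lborel (\<lambda>xi. g xi * \<psi> xi)"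
    and "norm (LINT xi|lborel. g xi * \<psi> xi) \<le> C * enn2real (wnorm (-1) (\<lambda>xi. ennreal (norm (g xi))))"
proof -
  have C0: "0 \<le> C" using b[of 0] by simp
  have le: "(\<integral>\<^sup>+xi. ennreal (norm (g xi * \<psi> xi)) \<partial>lborel) \<le> ennreal C * wnorm (-1) (\<lambda>xi. ennreal (norm (g xi)))"
  proof -
    have "(\<integral>\<^sup>+xi. ennreal (norm (g xi * \<psi> xi)) \<partial>lborel) \<le> (\<integral>\<^sup>+xi. ennreal C * (wt (-1) xi * ennreal (norm (g xi))) \<partial>lborel)"
    proof (rule nn_integral_mono_AE, use AE_nonzero3 in eventually_elim)
      fix xi :: "real^3" assume nz: "xi \<noteq> 0"
      have "norm (g xi * \<psi> xi) \<le> norm (g xi) * (C / norm xi)" unfolding norm_mult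
        using b[of xi] nz by (intro mult_left_mono) (auto simp: field_simps)
      also have "... = C * (norm xi powr (-1) * norm (g xi))" using nz by (simp add: powr_minus divide_inverse)
      finally have "ennreal (norm (g xi * \<psi> xi)) \<le> ennreal (C * (norm xi powr (-1) * norm (g xi)))" by (rule ennreal_leI)
      also have "ennreal (C * (norm xi powr (-1) * norm (g xi))) = ennreal C * (wt (-1) xi * ennreal (norm (g xi)))"
        unfolding wt_def using C0 by (subst ennreal_mult, simp, simp, subst ennreal_mult, simp, simp) (rule refl)
      finally show "ennreal (norm (g xi * \<psi> xi)) \<le> ennreal C * (wt (-1) xi * ennreal (norm (g xi)))" .
    qed
    then show ?thesis unfolding wnorm_def by (simp add: nn_integral_cmult)
  qed
  also have "... < \<infinity>" using fin by (simp add: ennreal_mult_less_top)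
  finally show i: "integrable lborel (\<lambda>xi. g xi * \<psi> xi)" by (intro integrableI_bounded) auto
  have "ennreal (norm (LINT xi|lborel. g xi * \<psi> xi)) \<le> ennreal C * wnorm (-1) (\<lambda>xi. ennreal (norm (g xi)))"
    using norm_LINT_le le by (rule order_trans)
  also have "... = ennreal (C * enn2real (wnorm (-1) (\<lambda>xi. ennreal (norm (g xi)))))"
    using fin C0 by (simp add: ennreal_mult)
  finally show "norm (LINT xi|lborel. g xi * \<psi> xi) \<le> C * enn2real (wnorm (-1) (\<lambda>xi. ennreal (norm (g xi))))"
    using C0 by (subst (asm) ennreal_le_iff) auto
qed

lemma schwartz_norm_mult_bound: assumes "\<psi> \<in> schwartz" obtains C where "C \<ge> 0" "\<And>xi. norm xi * norm (\<psi> xi) \<le> C" "\<And>xi. norm (\<psi> xi) \<le> C"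
proof -
  obtain C where C: "C \<ge> 0" "\<And>x. (1 + norm x) ^ 1 * norm (\<psi> x) \<le> C" using rapidE[OF schwartz_rapid[OF assms]] by metis
  have "norm xi * norm (\<psi> xi) \<le> C" "norm (\<psi> xi) \<le> C" for xi
  proof -
    have "norm (\<psi> xi) + norm xi * norm (\<psi> xi) \<le> C" using C(2)[of xi] by (simp add: distrib_right)
    moreover have "0 \<le> norm xi * norm (\<psi> xi)" by simp
    ultimately show "norm xi * norm (\<psi> xi) \<le> C" "norm (\<psi> xi) \<le> C" using norm_ge_zero[of "\<psi> xi"] by linarith+
  qed
  then show thesis using that C(1) by blast
qed

lemma wnorm_component: "wnorm a (\<lambda>xi. ennreal (norm (G xi $ i))) \<le> wnorm a (cnorm G)"
  by (intro wnorm_mono) (simp add: cnorm_def ennreal_leI Finite_Cartesian_Product.norm_nth_le)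

lemma component_integrable:
  assumes [measurable]: "G \<in> borel_measurable borel" and fin: "wnorm (-1) (cnorm G) < \<infinity>" and \<psi>: "\<psi> \<in> schwartz"
  shows "integrable lborel (\<lambda>xi. G xi $ i * \<psi> xi)"
proof -
  obtain C where "\<And>xi. norm xi * norm (\<psi> xi) \<le> C" using schwartz_norm_mult_bound[OF \<psi>] by metis
  then show ?thesis
    by (intro weighted_bound_integrable(1)[where C=C] schwartz_measurable[OF \<psi>] le_less_trans[OF wnorm_component fin]) auto
qed

lemma dist_of_represents:
  assumes [measurable]: "G \<in> borel_measurable borel" and fin: "wnorm (-1) (cnorm G) < \<infinity>"
  shows "represents (\<lambda>xi. G xi $ i) (fourier_dist (dist_of G i))"
  unfolding represents_def fourier_dist_def dist_of_def
  using component_integrable[OF assms] by (auto simp: fourier_inversion)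

lemma schwartz_seminorm_upper:
  assumes "\<phi> \<in> schwartz" "length js \<le> N"
  shows "(1 + norm x) ^ N * norm (pderivs js \<phi> x) \<le> schwartz_seminorm N \<phi>"
proof -
  have fin: "finite {js :: 3 list. length js \<le> N}" using finite_lists_length_le[of "UNIV :: 3 set" N] by simp
  have b: "bdd_above (range (\<lambda>x. (1 + norm x) ^ N * norm (pderivs js \<phi> x)))" for js
    using assms(1) unfolding schwartz_def by simp
  have "bdd_above (\<Union>js\<in>{js. length js \<le> N}. range (\<lambda>x. (1 + norm x) ^ N * norm (pderivs js \<phi> x)))"
    by (intro bdd_above_UN[OF fin, THEN iffD2] ballI b)
  then have "bdd_above ((\<lambda>(js, x). (1 + norm x) ^ N * norm (pderivs js \<phi> x)) ` ({js. length js \<le> N} \<times> UNIV))"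
    by (rule bdd_above_mono) auto
  from cSUP_upper[OF _ this, of "(js, x)"] show ?thesis
    unfolding schwartz_seminorm_def using assms(2) by (simp add: case_prod_beta')
qed

text \<open>The pairing in \<open>dist_of\<close> is continuous in a fixed Schwartz seminorm: one derivative
  produces the factor \<open>|xi|\<close>, and the weight of power 6 makes the derivative integrable.\<close>
lemma inv_fourier_norm_bound:
  obtains D where "D \<ge> 0" "\<And>\<phi> xi. \<phi> \<in> schwartz \<Longrightarrow> norm xi * norm (inv_fourier \<phi> xi) \<le> D * schwartz_seminorm 6 \<phi>"
proof -
  define w where "w = (LINT x::real^3|lborel. 1 / (1 + norm x) ^ 6)"
  have w: "w \<ge> 0" unfolding w_def by (intro Bochner_Integration.integral_nonneg) simp
  define D where "D = 1 / (2 * pi) ^ 3 * (3 * w)"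
  have "norm xi * norm (inv_fourier \<phi> xi) \<le> D * schwartz_seminorm 6 \<phi>" if \<phi>: "\<phi> \<in> schwartz" for \<phi> xi
  proof -
    have j: "\<bar>xi $ j\<bar> * norm (fourier \<phi> (- xi)) \<le> w * schwartz_seminorm 6 \<phi>" for j
    proof -
      have pd: "pderiv_dir j \<phi> \<in> schwartz" by (rule schwartz_pderiv[OF \<phi>])
      have "\<bar>xi $ j\<bar> * norm (fourier \<phi> (- xi)) = norm (fourier (pderiv_dir j \<phi>) (- xi))"
        by (simp add: fourier_of_pderiv[OF \<phi>] norm_mult)
      also have "... \<le> (LINT x|lborel. norm (pderiv_dir j \<phi> x))" by (intro fourier_norm_le schwartz_integrable pd)
      also have "... \<le> (LINT x::real^3|lborel. schwartz_seminorm 6 \<phi> * (1 / (1 + norm x) ^ 6))"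
      proof (rule integral_mono)
        show "integrable lborel (\<lambda>x. norm (pderiv_dir j \<phi> x))" by (intro integrable_norm schwartz_integrable pd)
        show "integrable lborel (\<lambda>x::real^3. schwartz_seminorm 6 \<phi> * (1 / (1 + norm x) ^ 6))" by (intro integrable_mult_right integrable_weight)
        fix x :: "real^3"
        have "(1 + norm x) ^ 6 * norm (pderiv_dir j \<phi> x) \<le> schwartz_seminorm 6 \<phi>"
          using schwartz_seminorm_upper[OF \<phi>, of "[j]" 6 x] by (simp add: pderivs_def)
        moreover have "(1 + norm x) ^ 6 > 0" by (intro zero_less_power add_pos_nonneg) auto
        ultimately have "norm (pderiv_dir j \<phi> x) \<le> schwartz_seminorm 6 \<phi> / (1 + norm x) ^ 6" by (metis pos_le_divide_eq mult.commute)
        then show "norm (pderiv_dir j \<phi> x) \<le> schwartz_seminorm 6 \<phi> * (1 / (1 + norm x) ^ 6)" by simp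
      qed
      also have "... = w * schwartz_seminorm 6 \<phi>" by (simp only: integral_mult_right_zero w_def mult.commute)
      finally show ?thesis .
    qed
    have "norm xi * norm (inv_fourier \<phi> xi) = 1 / (2 * pi) ^ 3 * (norm xi * norm (fourier \<phi> (- xi)))"
      by (simp add: inv_fourier_conv norm_mult norm_divide norm_power)
    also have "norm xi * norm (fourier \<phi> (- xi)) \<le> (\<Sum>j\<in>UNIV. \<bar>xi $ j\<bar>) * norm (fourier \<phi> (- xi))"
      by (intro mult_right_mono norm_le_sum_coord3) auto
    also have "... \<le> (\<Sum>j\<in>(UNIV::3 set). w * schwartz_seminorm 6 \<phi>)" unfolding sum_distrib_right by (intro sum_mono j)
    also have "... = 3 * w * schwartz_seminorm 6 \<phi>" by simp
    finally show ?thesis by (simp add: D_def divide_right_mono)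
  qed
  moreover have "D \<ge> 0" using w by (simp add: D_def)
  ultimately show thesis using that by blast
qed

lemma inv_fourier_lin:
  assumes "\<phi> \<in> schwartz" "\<psi> \<in> schwartz"
  shows "inv_fourier (\<lambda>x. a * \<phi> x + b * \<psi> x) xi = a * inv_fourier \<phi> xi + b * inv_fourier \<psi> xi"
proof -
  have i: "integrable lborel (\<lambda>x. cis (xi \<bullet> x) * \<phi> x)" "integrable lborel (\<lambda>x. cis (xi \<bullet> x) * \<psi> x)"
    by (intro integrable_cis_mult schwartz_integrable assms, simp)+
  have "(LINT x|lborel. cis (xi \<bullet> x) * (a * \<phi> x + b * \<psi> x)) = (LINT x|lborel. a * (cis (xi \<bullet> x) * \<phi> x) + b * (cis (xi \<bullet> x) * \<psi> x))"
    by (intro Bochner_Integration.integral_cong refl) (simp add: algebra_simps)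
  also have "... = a * (LINT x|lborel. cis (xi \<bullet> x) * \<phi> x) + b * (LINT x|lborel. cis (xi \<bullet> x) * \<psi> x)"
    by (subst Bochner_Integration.integral_add) (auto intro!: integrable_mult_right i)
  finally show ?thesis unfolding inv_fourier_def by (simp add: algebra_simps)
qed

lemma dist_of_tempered:
  assumes [measurable]: "G \<in> borel_measurable borel" and fin: "wnorm (-1) (cnorm G) < \<infinity>"
  shows "tempered (dist_of G i)"
  unfolding tempered_def
proof (intro conjI ballI allI)
  fix \<phi> \<psi> a b assume s: "\<phi> \<in> schwartz" "\<psi> \<in> schwartz"
  note i = component_integrable[OF assms inv_fourier_schwartz[OF s(1)], of i] component_integrable[OF assms inv_fourier_schwartz[OF s(2)], of i]
  have "(LINT xi|lborel. G xi $ i * inv_fourier (\<lambda>x. a * \<phi> x + b * \<psi> x) xi) = (LINT xi|lborel. a * (G xi $ i * inv_fourier \<phi> xi) + b * (G xi $ i * inv_fourier \<psi> xi))"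
    by (intro Bochner_Integration.integral_cong refl) (simp add: inv_fourier_lin[OF s] algebra_simps)
  also have "... = a * (LINT xi|lborel. G xi $ i * inv_fourier \<phi> xi) + b * (LINT xi|lborel. G xi $ i * inv_fourier \<psi> xi)"
    by (subst Bochner_Integration.integral_add) (auto intro!: integrable_mult_right i)
  finally show "dist_of G i (\<lambda>x. a * \<phi> x + b * \<psi> x) = a * dist_of G i \<phi> + b * dist_of G i \<psi>" by (simp add: dist_of_def)
next
  obtain D where D: "D \<ge> 0" "\<And>\<phi> xi. \<phi> \<in> schwartz \<Longrightarrow> norm xi * norm (inv_fourier \<phi> xi) \<le> D * schwartz_seminorm 6 \<phi>"
    using inv_fourier_norm_bound by metis
  let ?x = "enn2real (wnorm (-1) (\<lambda>xi. ennreal (norm (G xi $ i))))"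
  have "norm (dist_of G i \<phi>) \<le> (D * ?x) * schwartz_seminorm 6 \<phi>" if \<phi>: "\<phi> \<in> schwartz" for \<phi>
  proof -
    have "norm (dist_of G i \<phi>) \<le> (D * schwartz_seminorm 6 \<phi>) * ?x" unfolding dist_of_def
      by (rule weighted_bound_integrable(2)[OF _ schwartz_measurable[OF inv_fourier_schwartz[OF \<phi>]] le_less_trans[OF wnorm_component fin] D(2)[OF \<phi>]]) measurable
    then show ?thesis by (simp add: mult_ac)
  qed
  then show "\<exists>C N. \<forall>\<phi>\<in>schwartz. norm (dist_of G i \<phi>) \<le> C * schwartz_seminorm N \<phi>" by blast
qed

lemma represents_fhat: "fourier_is_fun T \<Longrightarrow> represents (fhat T) (fourier_dist T)"
  unfolding fourier_is_fun_def fhat_def using represents_dist_fun by blast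

lemma fhat_AE: "represents g (fourier_dist T) \<Longrightarrow> AE xi in lborel. fhat T xi = g xi"
  unfolding fhat_def by (rule dist_fun_AE)

lemma fhat_measurable: "fourier_is_fun T \<Longrightarrow> fhat T \<in> borel_measurable borel"
  using represents_fhat unfolding represents_def by blast

lemma vfhat_measurable: "(\<And>i. fourier_is_fun (f i)) \<Longrightarrow> vfhat f \<in> borel_measurable borel"
  unfolding vfhat_def[abs_def] by (intro vec_lambda_measurable fhat_measurable)

text \<open>By Fourier inversion the Fourier transform determines the distribution on all test
  functions.\<close>
lemma apply_via_fhat:
  assumes "fourier_is_fun T" "\<phi> \<in> schwartz"
  shows "T \<phi> = (LINT xi|lborel. fhat T xi * inv_fourier \<phi> xi)"
proof -
  have "T \<phi> = fourier_dist T (inv_fourier \<phi>)" by (simp add: fourier_dist_def fourier_inversion'[OF assms(2)])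
  then show ?thesis using represents_fhat[OF assms(1)] inv_fourier_schwartz[OF assms(2)] unfolding represents_def by simp
qed

lemma X_norm_wnorm: "X_norm s f = wnorm s (cnorm (vfhat f))"
  unfolding X_norm_def wnorm_def cnorm_def wt_def by (simp add: ennreal_mult)

lemma vfhat_AE_components: "(\<And>i. AE xi in lborel. fhat (f i) xi = G xi $ i) \<Longrightarrow> AE xi in lborel. vfhat f xi = G xi"
proof -
  assume "\<And>i. AE xi in lborel. fhat (f i) xi = G xi $ i"
  then have "AE xi in lborel. \<forall>i. fhat (f i) xi = G xi $ i" by (rule eventually_all_finite)
  then show ?thesis by eventually_elim (simp add: vfhat_def vec_eq_iff)
qed

lemma vfhat_dist_of:
  assumes "G \<in> borel_measurable borel" and "wnorm (-1) (cnorm G) < \<infinity>"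
  shows "AE xi in lborel. vfhat (dist_of G) xi = G xi"
  by (rule vfhat_AE_components, rule fhat_AE, rule dist_of_represents[OF assms])

lemma X_norm_cong: "AE xi in lborel. vfhat f xi = G xi \<Longrightarrow> X_norm s f = wnorm s (cnorm G)"
  unfolding X_norm_wnorm by (rule wnorm_cong_AE) (auto elim!: eventually_mono simp: cnorm_def)

lemma Y_norm_AE: "AE xi in lborel. wt \<sigma> xi * cnorm (vfhat f) xi \<le> Y_norm \<sigma> f"
  using esssup_AE[where M=lborel and f="\<lambda>xi. ennreal (norm xi powr \<sigma> * norm (vfhat f xi))"]
  unfolding Y_norm_def wt_def cnorm_def by (simp add: ennreal_mult)

lemma Y_norm_le:
  assumes [measurable]: "vfhat f \<in> borel_measurable borel" and "AE xi in lborel. wt \<sigma> xi * cnorm (vfhat f) xi \<le> M"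
  shows "Y_norm \<sigma> f \<le> M"
  unfolding Y_norm_def by (rule esssup_I) (use assms(2) in \<open>auto simp: wt_def cnorm_def ennreal_mult\<close>)

lemma dist_of_X_space:
  assumes "G \<in> borel_measurable borel" and "wnorm (-1) (cnorm G) < \<infinity>" and "wnorm s (cnorm G) < \<infinity>"
  shows "dist_of G \<in> X_space s"
  unfolding X_space_def fourier_is_fun_def
  using dist_of_tempered[OF assms(1,2)] dist_of_represents[OF assms(1,2)] X_norm_cong[OF vfhat_dist_of[OF assms(1,2)], of s] assms(3)
  by auto

lemma vfhat_dist_of_measurable:
  assumes "G \<in> borel_measurable borel" and "wnorm (-1) (cnorm G) < \<infinity>"
  shows "vfhat (dist_of G) \<in> borel_measurable borel"
  by (rule vfhat_measurable) (use dist_of_represents[OF assms] in \<open>auto simp: fourier_is_fun_def\<close>)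

lemma dist_of_Y_norm:
  assumes "G \<in> borel_measurable borel" and "wnorm (-1) (cnorm G) < \<infinity>" and M: "AE xi in lborel. wt \<sigma> xi * cnorm G xi \<le> M"
  shows "Y_norm \<sigma> (dist_of G) \<le> M" and "M < \<infinity> \<Longrightarrow> dist_of G \<in> Y_space \<sigma>"
proof -
  show le: "Y_norm \<sigma> (dist_of G) \<le> M"
    by (rule Y_norm_le[OF vfhat_dist_of_measurable[OF assms(1,2)]])
      (use M vfhat_dist_of[OF assms(1,2)] in eventually_elim, simp add: cnorm_def)
  assume "M < \<infinity>"
  then show "dist_of G \<in> Y_space \<sigma>" unfolding Y_space_def fourier_is_fun_def
    using dist_of_tempered[OF assms(1,2)] dist_of_represents[OF assms(1,2)] le_less_trans[OF le] by auto
qed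

section \<open>The quadratic term as a distribution\<close>

abbreviation conv_factor :: complex where "conv_factor \<equiv> complex_of_real (1 / (2 * pi) ^ 3)"

lemma inv_fourier_measurable[measurable]:
  assumes [measurable]: "g \<in> borel_measurable borel" shows "inv_fourier g \<in> borel_measurable borel"
  unfolding inv_fourier_def by measurable

lemma cnj_measurable[measurable]: "cnj \<in> borel_measurable borel"
  by (intro borel_measurable_continuous_onI continuous_intros)

lemma inv_fourier_bound: assumes "integrable lborel g" shows "norm (inv_fourier g x) \<le> (LINT xi|lborel. norm (g xi)) / (2 * pi) ^ 3"
proof -
  have "norm (inv_fourier g x) = norm (fourier g (- x)) / (2 * pi) ^ 3"
    by (simp add: inv_fourier_conv norm_mult norm_divide norm_power)
  then show ?thesis using fourier_norm_le[OF assms] by (simp add: divide_right_mono)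
qed

lemma inv_fourier_pairing:
  assumes g: "integrable lborel g" and p: "integrable lborel \<phi>"
  shows "(LINT xi|lborel. g xi * inv_fourier \<phi> xi) = (LINT x|lborel. inv_fourier g x * \<phi> x)"
proof -
  have [measurable]: "g \<in> borel_measurable borel" "\<phi> \<in> borel_measurable borel" using g p by auto
  define F where "F = (\<lambda>(xi, x). g xi * (conv_factor * (cis (xi \<bullet> x) * \<phi> x)))"
  have "integrable (lborel \<Otimes>\<^sub>M lborel) F"
  proof (rule integrable_pair_bound[where g=g and h="\<lambda>x. conv_factor * \<phi> x"])
    show "F \<in> borel_measurable (lborel \<Otimes>\<^sub>M lborel)" unfolding F_def by measurable
    show "integrable lborel (\<lambda>x. conv_factor * \<phi> x)" by (intro integrable_mult_right p)
    show "norm (F (x, y)) \<le> norm (g x) * norm (conv_factor * \<phi> y)" for x y by (simp add: F_def norm_mult norm_divide)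
  qed (rule g)
  then have "(LINT x|lborel. LINT xi|lborel. F (xi, x)) = (LINT xi|lborel. LINT x|lborel. F (xi, x))"
    using lborel_pair.Fubini_integral[of "\<lambda>x y. F (x, y)"] by simp
  moreover have "(LINT x|lborel. F (xi, x)) = g xi * inv_fourier \<phi> xi" for xi
    unfolding F_def inv_fourier_def by simp
  moreover have "(LINT xi|lborel. F (xi, x)) = inv_fourier g x * \<phi> x" for x
  proof -
    have "(LINT xi|lborel. F (xi, x)) = (LINT xi|lborel. (conv_factor * (cis (x \<bullet> xi) * g xi)) * \<phi> x)"
      unfolding F_def by (intro Bochner_Integration.integral_cong refl) (simp add: mult_ac inner_commute)
    then show ?thesis unfolding inv_fourier_def by simp
  qed
  ultimately show ?thesis by simp
qed

lemma integrable_bdd_mult: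
  fixes f g :: "real^3 \<Rightarrow> complex"
  assumes "integrable lborel f" and "g \<in> borel_measurable borel" and "\<And>x. norm (g x) \<le> B"
  shows "integrable lborel (\<lambda>x. g x * f x)"
  using integrable_bounded_mult[OF assms(1) _ assms(3)] assms(2) by (simp add: mult.commute)

text \<open>If the Fourier transform is integrable, the distribution is a bounded continuous function. This
  applies at almost every time, when the norm of order 0 is finite, and gives a meaning to the product
  \<open>u \<otimes> u\<close>.\<close>
lemma represents_physical:
  assumes T: "fourier_is_fun T" and g: "integrable lborel g" and e: "AE xi in lborel. fhat T xi = g xi"
  shows "represents (inv_fourier g) T"
  unfolding represents_def
proof (intro conjI ballI)
  have [measurable]: "g \<in> borel_measurable borel" "fhat T \<in> borel_measurable borel" using g fhat_measurable[OF T] by auto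
  show "inv_fourier g \<in> borel_measurable borel" by measurable
  fix \<phi> assume \<phi>: "\<phi> \<in> schwartz"
  note [measurable] = schwartz_measurable[OF \<phi>]
  show "integrable lborel (\<lambda>x. inv_fourier g x * \<phi> x)"
    by (rule integrable_bdd_mult[OF schwartz_integrable[OF \<phi>] _ inv_fourier_bound[OF g]]) measurable
  have "T \<phi> = (LINT xi|lborel. fhat T xi * inv_fourier \<phi> xi)" by (rule apply_via_fhat[OF T \<phi>])
  also have "... = (LINT xi|lborel. g xi * inv_fourier \<phi> xi)"
    by (rule integral_cong_AE) (use e in \<open>auto elim!: eventually_mono\<close>)
  also have "... = (LINT x|lborel. inv_fourier g x * \<phi> x)" by (rule inv_fourier_pairing[OF g schwartz_integrable[OF \<phi>]])
  finally show "T \<phi> = (LINT x|lborel. inv_fourier g x * \<phi> x)" .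
qed

definition cconv :: "(real^3 \<Rightarrow> complex) \<Rightarrow> (real^3 \<Rightarrow> complex) \<Rightarrow> real^3 \<Rightarrow> complex" where
  "cconv a b xi = (LINT \<eta>|lborel. a (xi - \<eta>) * b \<eta>)"

lemma cconv_pair_integrable:
  fixes a b :: "real^3 \<Rightarrow> complex"
  assumes a: "integrable lborel a" and b: "integrable lborel b"
  shows "integrable (lborel \<Otimes>\<^sub>M lborel) (\<lambda>(xi, \<eta>). (a (xi - \<eta>) * b \<eta> :: complex))"
proof (rule integrable_pairI)
  have [measurable]: "a \<in> borel_measurable borel" "b \<in> borel_measurable borel" using a b by auto
  show "(\<lambda>(xi, \<eta>). a (xi - \<eta>) * b \<eta>) \<in> borel_measurable (lborel \<Otimes>\<^sub>M lborel)" by measurable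
  have "(\<integral>\<^sup>+xi. \<integral>\<^sup>+\<eta>. ennreal (norm (case (xi, \<eta>) of (xi, \<eta>) \<Rightarrow> a (xi - \<eta>) * b \<eta>)) \<partial>lborel \<partial>lborel)
    = (\<integral>\<^sup>+xi. \<integral>\<^sup>+\<eta>. ennreal (norm (a (xi - \<eta>))) * ennreal (norm (b \<eta>)) \<partial>lborel \<partial>lborel)"
    by (simp add: norm_mult ennreal_mult)
  also have "... = (\<integral>\<^sup>+\<eta>. \<integral>\<^sup>+xi. ennreal (norm (a (xi - \<eta>))) * ennreal (norm (b \<eta>)) \<partial>lborel \<partial>lborel)"
    by (rule lborel_pair.Fubini') simp
  also have "... = (\<integral>\<^sup>+\<eta>. (\<integral>\<^sup>+xi. ennreal (norm (a xi)) \<partial>lborel) * ennreal (norm (b \<eta>)) \<partial>lborel)"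
  proof (rule nn_integral_cong)
    fix \<eta> :: "real^3"
    show "(\<integral>\<^sup>+xi. ennreal (norm (a (xi - \<eta>))) * ennreal (norm (b \<eta>)) \<partial>lborel) = (\<integral>\<^sup>+xi. ennreal (norm (a xi)) \<partial>lborel) * ennreal (norm (b \<eta>))"
      using nn_integral_affine3[of "\<lambda>xi. ennreal (norm (a xi))" 1 "- \<eta>"] by (simp add: nn_integral_multc)
  qed
  also have "... = (\<integral>\<^sup>+xi. ennreal (norm (a xi)) \<partial>lborel) * (\<integral>\<^sup>+\<eta>. ennreal (norm (b \<eta>)) \<partial>lborel)"
    by (simp add: nn_integral_cmult)
  also have "... < \<infinity>" using integrable_nn_norm[OF a] integrable_nn_norm[OF b] by (simp add: ennreal_mult_less_top)
  finally show "(\<integral>\<^sup>+xi. \<integral>\<^sup>+\<eta>. ennreal (norm (case (xi, \<eta>) of (xi, \<eta>) \<Rightarrow> a (xi - \<eta>) * b \<eta>)) \<partial>lborel \<partial>lborel) < \<infinity>" .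
qed

lemma cconv_integrable:
  assumes "integrable lborel a" "integrable lborel b" shows "integrable lborel (cconv a b)"
proof -
  have "integrable lborel (\<lambda>xi. LINT \<eta>|lborel. (case (xi, \<eta>) of (xi, \<eta>) \<Rightarrow> a (xi - \<eta>) * b \<eta>))"
    by (rule lborel_pair.integrable_fst'[OF cconv_pair_integrable[OF assms]])
  then show ?thesis by (simp add: cconv_def[abs_def])
qed

text \<open>The convolution theorem for the inverse transform of integrable functions.\<close>
lemma inv_fourier_cconv:
  assumes a: "integrable lborel a" and b: "integrable lborel b"
  shows "inv_fourier a x * inv_fourier b x = conv_factor * inv_fourier (cconv a b) x"
proof -
  have [measurable]: "a \<in> borel_measurable borel" "b \<in> borel_measurable borel" using a b by auto
  define F where "F = (\<lambda>(xi, \<eta>). cis (x \<bullet> xi) * (a (xi - \<eta>) * b \<eta>))"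
  have F: "integrable (lborel \<Otimes>\<^sub>M lborel) F"
  proof (rule Bochner_Integration.integrable_bound[OF cconv_pair_integrable[OF a b]])
    show "F \<in> borel_measurable (lborel \<Otimes>\<^sub>M lborel)" unfolding F_def by measurable
  qed (auto simp: F_def norm_mult)
  have "(LINT xi|lborel. cis (x \<bullet> xi) * cconv a b xi) = (LINT xi|lborel. LINT \<eta>|lborel. F (xi, \<eta>))"
    unfolding cconv_def F_def by simp
  also have "... = (LINT \<eta>|lborel. LINT xi|lborel. F (xi, \<eta>))"
    using lborel_pair.Fubini_integral[of "\<lambda>x y. F (x, y)"] F by simp
  also have "... = (LINT \<eta>|lborel. (LINT \<zeta>|lborel. cis (x \<bullet> \<zeta>) * a \<zeta>) * (cis (x \<bullet> \<eta>) * b \<eta>))"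
  proof (intro Bochner_Integration.integral_cong refl)
    fix \<eta> :: "real^3"
    have "(LINT xi|lborel. F (xi, \<eta>)) = (LINT \<zeta>|lborel. F (\<eta> + 1 *\<^sub>R \<zeta>, \<eta>))"
      unfolding F_def by (subst lborel_integral_affine3[where c=1 and t=\<eta>]) auto
    also have "... = (LINT \<zeta>|lborel. (cis (x \<bullet> \<zeta>) * a \<zeta>) * (cis (x \<bullet> \<eta>) * b \<eta>))"
    proof (intro Bochner_Integration.integral_cong refl)
      fix \<zeta> :: "real^3"
      have "cis (x \<bullet> (\<eta> + \<zeta>)) = cis (x \<bullet> \<eta>) * cis (x \<bullet> \<zeta>)" by (simp add: cis_mult inner_add_right)
      then show "F (\<eta> + 1 *\<^sub>R \<zeta>, \<eta>) = (cis (x \<bullet> \<zeta>) * a \<zeta>) * (cis (x \<bullet> \<eta>) * b \<eta>)" by (simp add: F_def mult_ac)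
    qed
    finally show "(LINT xi|lborel. F (xi, \<eta>)) = (LINT \<zeta>|lborel. cis (x \<bullet> \<zeta>) * a \<zeta>) * (cis (x \<bullet> \<eta>) * b \<eta>)" by simp
  qed
  also have "... = (LINT \<zeta>|lborel. cis (x \<bullet> \<zeta>) * a \<zeta>) * (LINT \<eta>|lborel. cis (x \<bullet> \<eta>) * b \<eta>)" by simp
  finally show ?thesis unfolding inv_fourier_def by (simp only: mult_ac)
qed

text \<open>The Fourier transform of \<open>div (u \<otimes> u)\<close>, before the Leray projection is
  applied.\<close>
definition quad_hat :: "(real^3 \<Rightarrow> complex^3) \<Rightarrow> 3 \<Rightarrow> real^3 \<Rightarrow> complex" where
  "quad_hat G j xi = (\<Sum>l\<in>UNIV. \<i> * complex_of_real (xi $ l) * (conv_factor * cconv (\<lambda>xi. G xi $ j) (\<lambda>xi. G xi $ l) xi))"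

lemma coord_mult_integrable:
  assumes g: "integrable lborel g" and \<psi>: "\<psi> \<in> schwartz"
  shows "integrable lborel (\<lambda>xi. \<i> * complex_of_real (xi $ l) * (conv_factor * g xi) * \<psi> xi)"
proof -
  have s: "(\<lambda>xi. (\<i> * conv_factor) * (complex_of_real (xi $ l) * \<psi> xi)) \<in> schwartz" by (intro schwartz_cmult schwartz_coord \<psi>)
  obtain C where C: "\<And>xi. norm ((\<i> * conv_factor) * (complex_of_real (xi $ l) * \<psi> xi)) \<le> C" using schwartz_norm_mult_bound[OF s] by metis
  have "integrable lborel (\<lambda>xi. g xi * ((\<i> * conv_factor) * (complex_of_real (xi $ l) * \<psi> xi)))"
    by (rule integrable_bounded_mult[OF g _ C]) (use schwartz_measurable[OF s] in simp)
  then show ?thesis by (simp add: mult_ac)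
qed

text \<open>The derivative is moved to the test function, where it becomes multiplication by
  \<open>xi\<close>, and the product is turned into a convolution by \<open>inv_fourier_cconv\<close>.\<close>
lemma tensor_div_represents:
  assumes f: "\<And>i. fourier_is_fun (f i)" and G: "\<And>i. integrable lborel (\<lambda>xi. G xi $ i)" and e: "\<And>i. AE xi in lborel. fhat (f i) xi = G xi $ i"
  shows "represents (quad_hat G i) (fourier_dist (tensor_div (tensor f f) i))"
  unfolding represents_def
proof (intro conjI ballI)
  have ci: "integrable lborel (cconv (\<lambda>xi. G xi $ i) (\<lambda>xi. G xi $ l))" for l by (intro cconv_integrable G)
  then have [measurable]: "cconv (\<lambda>xi. G xi $ i) (\<lambda>xi. G xi $ l) \<in> borel_measurable borel" for l by auto
  show "quad_hat G i \<in> borel_measurable borel" unfolding quad_hat_def[abs_def] by measurable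
  fix \<psi> assume \<psi>: "\<psi> \<in> schwartz"
  have qi: "integrable lborel (\<lambda>xi. \<i> * complex_of_real (xi $ l) * (conv_factor * cconv (\<lambda>xi. G xi $ i) (\<lambda>xi. G xi $ l) xi) * \<psi> xi)" for l
    by (rule coord_mult_integrable[OF ci \<psi>])
  then show "integrable lborel (\<lambda>xi. quad_hat G i xi * \<psi> xi)"
    unfolding quad_hat_def sum_distrib_right by (intro Bochner_Integration.integrable_sum)
  have rep: "represents (inv_fourier (\<lambda>xi. G xi $ j)) (f j)" for j by (rule represents_physical[OF f G e])
  have trm: "dist_deriv l (tensor f f i l) (fourier \<psi>) = (LINT xi|lborel. \<i> * complex_of_real (xi $ l) * (conv_factor * cconv (\<lambda>xi. G xi $ i) (\<lambda>xi. G xi $ l) xi) * \<psi> xi)" for l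
  proof -
    define \<theta> where "\<theta> = (\<lambda>x. - \<i> * (complex_of_real (x $ l) * \<psi> x))"
    have \<theta>: "\<theta> \<in> schwartz" unfolding \<theta>_def by (intro schwartz_cmult schwartz_coord \<psi>)
    note F\<theta> = fourier_schwartz[OF \<theta>]
    have mdf: "dist_fun (f j) \<in> borel_measurable borel" for j using represents_dist_fun[OF rep] by (simp add: represents_def)
    have mG: "(\<lambda>xi. G xi $ j) \<in> borel_measurable borel" for j using G[of j] by auto
    note [measurable] = mdf mG schwartz_measurable[OF F\<theta>]
    have "dist_deriv l (tensor f f i l) (fourier \<psi>) = - (LINT x|lborel. dist_fun (f i) x * dist_fun (f l) x * fourier \<theta> x)"
      by (simp add: dist_deriv_def tensor_def dist_mult_def fourier_pderiv[OF \<psi>] \<theta>_def)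
    also have "(LINT x|lborel. dist_fun (f i) x * dist_fun (f l) x * fourier \<theta> x) = (LINT x|lborel. inv_fourier (\<lambda>xi. G xi $ i) x * inv_fourier (\<lambda>xi. G xi $ l) x * fourier \<theta> x)"
    proof (rule integral_cong_AE)
      show "AE x in lborel. dist_fun (f i) x * dist_fun (f l) x * fourier \<theta> x = inv_fourier (\<lambda>xi. G xi $ i) x * inv_fourier (\<lambda>xi. G xi $ l) x * fourier \<theta> x"
        using dist_fun_AE[OF rep[of i]] dist_fun_AE[OF rep[of l]] by eventually_elim simp
    qed measurable
    also have "... = (LINT x|lborel. conv_factor * (inv_fourier (cconv (\<lambda>xi. G xi $ i) (\<lambda>xi. G xi $ l)) x * fourier \<theta> x))"
      unfolding inv_fourier_cconv[OF G G] by (simp only: mult.assoc)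
    also have "... = conv_factor * (LINT x|lborel. inv_fourier (cconv (\<lambda>xi. G xi $ i) (\<lambda>xi. G xi $ l)) x * fourier \<theta> x)" by (rule integral_mult_right_zero)
    also have "(LINT x|lborel. inv_fourier (cconv (\<lambda>xi. G xi $ i) (\<lambda>xi. G xi $ l)) x * fourier \<theta> x) = (LINT xi|lborel. cconv (\<lambda>xi. G xi $ i) (\<lambda>xi. G xi $ l) xi * inv_fourier (fourier \<theta>) xi)"
      by (rule inv_fourier_pairing[OF ci schwartz_integrable[OF F\<theta>], symmetric])
    also have "inv_fourier (fourier \<theta>) = \<theta>" by (rule fourier_inversion[OF \<theta>])
    also have "- (conv_factor * (LINT xi|lborel. cconv (\<lambda>xi. G xi $ i) (\<lambda>xi. G xi $ l) xi * \<theta> xi)) = (LINT xi|lborel. - (conv_factor * (cconv (\<lambda>xi. G xi $ i) (\<lambda>xi. G xi $ l) xi * \<theta> xi)))"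
      by (simp only: integral_mult_right_zero Bochner_Integration.integral_minus)
    also have "... = (LINT xi|lborel. \<i> * complex_of_real (xi $ l) * (conv_factor * cconv (\<lambda>xi. G xi $ i) (\<lambda>xi. G xi $ l) xi) * \<psi> xi)"
      by (intro Bochner_Integration.integral_cong refl) (simp add: \<theta>_def mult_ac)
    finally show ?thesis .
  qed
  show "fourier_dist (tensor_div (tensor f f) i) \<psi> = (LINT xi|lborel. quad_hat G i xi * \<psi> xi)"
    unfolding fourier_dist_def tensor_div_def trm quad_hat_def sum_distrib_right
    by (rule Bochner_Integration.integral_sum[symmetric]) (rule qi)
qed

lemma leray_represents:
  assumes rep: "\<And>j. represents (g j) (fourier_dist (F j))"
  shows "represents (\<lambda>xi. \<Sum>j\<in>UNIV. complex_of_real (leray_symbol i j xi) * g j xi) (fourier_dist (leray F i))"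
  unfolding represents_def
proof (intro conjI ballI)
  have [measurable]: "g j \<in> borel_measurable borel" for j using rep[of j] by (simp add: represents_def)
  have [measurable]: "fhat (F j) \<in> borel_measurable borel" for j using rep[of j] by (intro fhat_measurable) (auto simp: fourier_is_fun_def)
  show "(\<lambda>xi. \<Sum>j\<in>UNIV. complex_of_real (leray_symbol i j xi) * g j xi) \<in> borel_measurable borel" by measurable
  fix \<psi> assume \<psi>: "\<psi> \<in> schwartz"
  note [measurable] = schwartz_measurable[OF \<psi>]
  have i: "integrable lborel (\<lambda>xi. complex_of_real (leray_symbol i j xi) * (g j xi * \<psi> xi))" for j
    by (rule integrable_bdd_mult[where B=2]) (use rep[of j] \<psi> leray_symbol_le in \<open>auto simp: represents_def\<close>)
  then have i': "integrable lborel (\<lambda>xi. complex_of_real (leray_symbol i j xi) * g j xi * \<psi> xi)" for j by (simp add: mult.assoc)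
  then show "integrable lborel (\<lambda>xi. (\<Sum>j\<in>UNIV. complex_of_real (leray_symbol i j xi) * g j xi) * \<psi> xi)"
    unfolding sum_distrib_right by (intro Bochner_Integration.integrable_sum)
  have "fourier_dist (leray F i) \<psi> = (\<Sum>j\<in>UNIV. LINT xi|lborel. complex_of_real (leray_symbol i j xi) * fhat (F j) xi * \<psi> xi)"
    by (simp add: fourier_dist_def leray_def fourier_mult_def inv_fourier_dist_def fourier_inversion[OF \<psi>])
  also have "... = (\<Sum>j\<in>UNIV. LINT xi|lborel. complex_of_real (leray_symbol i j xi) * g j xi * \<psi> xi)"
  proof (intro sum.cong refl integral_cong_AE)
    fix j show "AE xi in lborel. complex_of_real (leray_symbol i j xi) * fhat (F j) xi * \<psi> xi = complex_of_real (leray_symbol i j xi) * g j xi * \<psi> xi"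
      using fhat_AE[OF rep[of j]] by eventually_elim simp
  qed measurable
  also have "... = (LINT xi|lborel. (\<Sum>j\<in>UNIV. complex_of_real (leray_symbol i j xi) * g j xi) * \<psi> xi)"
    unfolding sum_distrib_right by (rule Bochner_Integration.integral_sum[symmetric]) (rule i')
  finally show "fourier_dist (leray F i) \<psi> = (LINT xi|lborel. (\<Sum>j\<in>UNIV. complex_of_real (leray_symbol i j xi) * g j xi) * \<psi> xi)" .
qed

lemma heat_apply:
  assumes rep: "represents g (fourier_dist (F i))" and \<phi>: "\<phi> \<in> schwartz"
  shows "heat t F i \<phi> = (LINT xi|lborel. complex_of_real (heat_ker t xi) * g xi * inv_fourier \<phi> xi)"
proof -
  have [measurable]: "g \<in> borel_measurable borel" using rep by (simp add: represents_def)
  have [measurable]: "fhat (F i) \<in> borel_measurable borel" using rep by (intro fhat_measurable) (auto simp: fourier_is_fun_def)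
  note [measurable] = schwartz_measurable[OF \<phi>]
  show ?thesis unfolding heat_def fourier_mult_def inv_fourier_dist_def
    by (rule integral_cong_AE) (use fhat_AE[OF rep] in \<open>auto elim!: eventually_mono\<close>)
qed

lemma nonlin_component:
  assumes U: "jmeas U" and fin: "convol (enorm U tau) (enorm U tau) xi < \<infinity>"
  shows "nonlin U tau xi $ i = (\<Sum>j\<in>UNIV. complex_of_real (leray_symbol i j xi) * quad_hat (U tau) j xi)"
proof -
  note [measurable] = jmeas_slice[OF U]
  have pi: "integrable lborel (\<lambda>\<eta>. U tau (xi - \<eta>) $ j * U tau \<eta> $ l)" for j l
  proof (rule integrableI_bounded)
    have "(\<integral>\<^sup>+\<eta>. ennreal (norm (U tau (xi - \<eta>) $ j * U tau \<eta> $ l)) \<partial>lborel) \<le> convol (enorm U tau) (enorm U tau) xi"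
      unfolding convol_def enorm_def
      by (intro nn_integral_mono) (auto simp: norm_mult ennreal_mult[symmetric] intro!: ennreal_leI mult_mono Finite_Cartesian_Product.norm_nth_le)
    then show "(\<integral>\<^sup>+\<eta>. ennreal (norm (U tau (xi - \<eta>) $ j * U tau \<eta> $ l)) \<partial>lborel) < \<infinity>" using fin by (rule le_less_trans)
  qed measurable
  have "nonlin U tau xi $ i = (LINT \<eta>|lborel. ns_symbol xi (U tau (xi - \<eta>)) (U tau \<eta>) $ i)"
    unfolding nonlin_def using integral_bounded_linear[OF bounded_linear_vec_nth ns_symbol_integrable[OF U fin]] by metis
  also have "... = (\<Sum>j\<in>UNIV. complex_of_real (leray_symbol i j xi) * (\<Sum>l\<in>UNIV. \<i> * complex_of_real (xi $ l) * (conv_factor * (LINT \<eta>|lborel. U tau (xi - \<eta>) $ j * U tau \<eta> $ l))))"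
    unfolding ns_symbol_def vec_lambda_beta
    by (subst Bochner_Integration.integral_sum, intro integrable_mult_right Bochner_Integration.integrable_sum pi,
        simp only: integral_mult_right_zero, subst Bochner_Integration.integral_sum, intro integrable_mult_right pi,
        simp only: integral_mult_right_zero)
  finally show ?thesis by (simp add: quad_hat_def cconv_def)
qed

lemma convol_finite_AE:
  assumes U: "jmeas U" and fin: "wnorm 0 (enorm U tau) < \<infinity>" shows "AE xi in lborel. convol (enorm U tau) (enorm U tau) xi < \<infinity>"
proof (rule wnorm_finite_AE)
  note [measurable] = jmeas_slice[OF enorm_jmeas[OF U]]
  show "convol (enorm U tau) (enorm U tau) \<in> borel_measurable borel" by measurable
  have "wnorm 0 (convol (enorm U tau) (enorm U tau)) \<le> ennreal (2 powr 0) * (wnorm 0 (enorm U tau) * wnorm 0 (enorm U tau) + wnorm 0 (enorm U tau) * wnorm 0 (enorm U tau))"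
    by (intro wnorm_convol_le) auto
  also have "... < \<infinity>" using fin by (simp add: ennreal_mult_less_top)
  finally show "wnorm 0 (convol (enorm U tau) (enorm U tau)) < \<infinity>" .
qed

lemma wnorm0_integrable:
  assumes [measurable]: "G \<in> borel_measurable borel" and fin: "wnorm 0 (cnorm G) < \<infinity>"
  shows "integrable lborel (\<lambda>xi. G xi $ i)"
proof (rule integrableI_bounded)
  have "(\<integral>\<^sup>+xi. ennreal (norm (G xi $ i)) \<partial>lborel) \<le> wnorm 0 (cnorm G)" unfolding wnorm_def
  proof (rule nn_integral_mono_AE, use AE_nonzero3 in eventually_elim)
    fix xi :: "real^3" assume "xi \<noteq> 0"
    then show "ennreal (norm (G xi $ i)) \<le> wt 0 xi * cnorm G xi" by (simp add: wt_0 cnorm_def ennreal_leI Finite_Cartesian_Product.norm_nth_le)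
  qed
  then show "(\<integral>\<^sup>+xi. ennreal (norm (G xi $ i)) \<partial>lborel) < \<infinity>" using fin by (rule le_less_trans)
qed measurable

text \<open>The chain of operators in \<open>duhamel_integrand\<close> is evaluated from the inside out; each
  one acts on the representing Fourier transform of the previous one.\<close>
lemma duhamel_integrand_eq:
  assumes U: "jmeas U" and fin: "wnorm 0 (enorm U tau) < \<infinity>" and f: "\<And>i. fourier_is_fun (u tau i)"
    and e: "AE xi in lborel. vfhat (u tau) xi = U tau xi" and \<phi>: "\<phi> \<in> schwartz"
  shows "duhamel_integrand u t tau i \<phi> = (LINT xi|lborel. complex_of_real (heat_ker (t - tau) xi) * nonlin U tau xi $ i * inv_fourier \<phi> xi)"
proof -
  note [measurable] = jmeas_slice[OF U] jmeas_slice[OF nonlin_jmeas[OF U]] schwartz_measurable[OF \<phi>]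
  have G: "integrable lborel (\<lambda>xi. U tau xi $ j)" for j
    using fin by (intro wnorm0_integrable) (auto simp: enorm_cnorm)
  have e': "AE xi in lborel. fhat (u tau j) xi = U tau xi $ j" for j
    using e by eventually_elim (metis vfhat_def vec_lambda_beta)
  have [measurable]: "quad_hat (U tau) j \<in> borel_measurable borel" for j
    using tensor_div_represents[OF f G e', of j] by (simp add: represents_def)
  have rep: "represents (\<lambda>xi. \<Sum>j\<in>UNIV. complex_of_real (leray_symbol i j xi) * quad_hat (U tau) j xi) (fourier_dist (leray (tensor_div (tensor (u tau) (u tau))) i))"
    by (intro leray_represents tensor_div_represents f G e')
  show ?thesis unfolding duhamel_integrand_def heat_apply[where F="leray (tensor_div (tensor (u tau) (u tau)))" and i=i, OF rep \<phi>]
    by (rule integral_cong_AE, measurable) (use convol_finite_AE[OF U fin] in \<open>eventually_elim, simp add: nonlin_component[OF U]\<close>)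
qed

section \<open>Divergence and reality on the Fourier side\<close>

lemma inv_fourier_pderiv:
  assumes "\<phi> \<in> schwartz" shows "inv_fourier (pderiv_dir j \<phi>) xi = - (\<i> * complex_of_real (xi $ j) * inv_fourier \<phi> xi)"
  by (simp add: inv_fourier_conv fourier_of_pderiv[OF assms])

lemma inv_fourier_cnj: "inv_fourier (\<lambda>x. cnj (\<phi> x)) xi = cnj (inv_fourier \<phi> (- xi))"
proof -
  have "(LINT x|lborel. cis (xi \<bullet> x) * cnj (\<phi> x)) = (LINT x|lborel. cnj (cis (- xi \<bullet> x) * \<phi> x))"
    by (intro Bochner_Integration.integral_cong refl) (simp add: cis_cnj)
  also have "... = cnj (LINT x|lborel. cis (- xi \<bullet> x) * \<phi> x)" by (rule Bochner_Integration.integral_cnj)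
  finally show ?thesis by (simp add: inv_fourier_def)
qed

text \<open>This is the uniqueness of the function that represents the zero distribution.\<close>
lemma AE_zero_of_schwartz:
  assumes "g \<in> borel_measurable borel" "\<And>\<psi>. \<psi> \<in> schwartz \<Longrightarrow> integrable lborel (\<lambda>xi. g xi * \<psi> xi)" "\<And>\<psi>. \<psi> \<in> schwartz \<Longrightarrow> (LINT xi|lborel. g xi * \<psi> xi) = 0"
  shows "AE xi in lborel. g xi = 0"
  by (rule represents_unique[of g "\<lambda>_. 0" "\<lambda>_. 0"]) (use assms in \<open>auto simp: represents_def\<close>)

lemma dist_of_div_free:
  assumes [measurable]: "G \<in> borel_measurable borel" and fin: "wnorm (-1) (cnorm G) < \<infinity>"
    and div: "AE xi in lborel. (\<Sum>j\<in>UNIV. complex_of_real (xi $ j) * G xi $ j) = 0"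
  shows "div_free (dist_of G)"
  unfolding div_free_def
proof
  fix \<phi> assume \<phi>: "\<phi> \<in> schwartz"
  note [measurable] = schwartz_measurable[OF \<phi>]
  have i: "integrable lborel (\<lambda>xi. G xi $ j * inv_fourier (pderiv_dir j \<phi>) xi)" for j
    by (intro component_integrable fin inv_fourier_schwartz schwartz_pderiv \<phi>) measurable
  have "(\<Sum>j\<in>UNIV. dist_deriv j (dist_of G j) \<phi>) = - (LINT xi|lborel. (\<Sum>j\<in>UNIV. G xi $ j * inv_fourier (pderiv_dir j \<phi>) xi))"
    by (simp add: dist_deriv_def dist_of_def sum_negf Bochner_Integration.integral_sum[OF i])
  also have "(LINT xi|lborel. (\<Sum>j\<in>UNIV. G xi $ j * inv_fourier (pderiv_dir j \<phi>) xi)) = (LINT xi::real^3|lborel. 0)"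
  proof (rule integral_cong_AE)
    show "AE xi in lborel. (\<Sum>j\<in>UNIV. G xi $ j * inv_fourier (pderiv_dir j \<phi>) xi) = 0"
      using div
    proof eventually_elim
      fix xi assume d: "(\<Sum>j\<in>UNIV. complex_of_real (xi $ j) * G xi $ j) = 0"
      have "(\<Sum>j\<in>UNIV. G xi $ j * inv_fourier (pderiv_dir j \<phi>) xi) = (- \<i> * inv_fourier \<phi> xi) * (\<Sum>j\<in>UNIV. complex_of_real (xi $ j) * G xi $ j)"
        unfolding inv_fourier_pderiv[OF \<phi>] sum_distrib_left by (intro sum.cong refl) (simp add: mult_ac)
      then show "(\<Sum>j\<in>UNIV. G xi $ j * inv_fourier (pderiv_dir j \<phi>) xi) = 0" using d by simp
    qed
    show "(\<lambda>xi. \<Sum>j\<in>UNIV. G xi $ j * inv_fourier (pderiv_dir j \<phi>) xi) \<in> borel_measurable lborel"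
      using i by (intro borel_measurable_sum) auto
  qed simp
  finally show "(\<Sum>j\<in>UNIV. dist_deriv j (dist_of G j) \<phi>) = 0" by simp
qed

text \<open>Divergence freeness tested with \<open>\<phi>\<close> says that \<open>xi \<bullet> vfhat
  f\<close> integrates to 0 against the inverse transform of \<open>\<phi>\<close>, and every Schwartz
  function is of this form.\<close>
lemma div_free_fhat:
  assumes f: "\<And>i. fourier_is_fun (f i)" and d: "div_free f"
  shows "AE xi in lborel. (\<Sum>j\<in>UNIV. complex_of_real (xi $ j) * vfhat f xi $ j) = 0"
proof (rule AE_zero_of_schwartz)
  note [measurable] = vfhat_measurable[OF f] fhat_measurable[OF f]
  show "(\<lambda>xi. \<Sum>j\<in>UNIV. complex_of_real (xi $ j) * vfhat f xi $ j) \<in> borel_measurable borel" by measurable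
  fix \<psi> assume \<psi>: "\<psi> \<in> schwartz"
  have i: "integrable lborel (\<lambda>xi. fhat (f j) xi * (complex_of_real (xi $ j) * \<psi> xi))" for j
    using represents_fhat[OF f, of j] schwartz_coord[OF \<psi>] by (simp add: represents_def)
  have e: "(\<Sum>j\<in>UNIV. complex_of_real (xi $ j) * vfhat f xi $ j) * \<psi> xi = (\<Sum>j\<in>UNIV. fhat (f j) xi * (complex_of_real (xi $ j) * \<psi> xi))" for xi
    unfolding sum_distrib_right by (intro sum.cong refl) (simp add: vfhat_def mult_ac)
  show "integrable lborel (\<lambda>xi. (\<Sum>j\<in>UNIV. complex_of_real (xi $ j) * vfhat f xi $ j) * \<psi> xi)"
    unfolding e by (intro Bochner_Integration.integrable_sum i)
  have F\<psi>: "fourier \<psi> \<in> schwartz" by (rule fourier_schwartz[OF \<psi>])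
  have "0 = (\<Sum>j\<in>UNIV. dist_deriv j (f j) (fourier \<psi>))" using d F\<psi> by (simp add: div_free_def)
  also have "... = (\<Sum>j\<in>UNIV. - (LINT xi|lborel. fhat (f j) xi * inv_fourier (pderiv_dir j (fourier \<psi>)) xi))"
    unfolding dist_deriv_def by (intro sum.cong refl arg_cong[where f=uminus] apply_via_fhat f schwartz_pderiv F\<psi>)
  also have "... = (\<Sum>j\<in>UNIV. LINT xi|lborel. \<i> * (fhat (f j) xi * (complex_of_real (xi $ j) * \<psi> xi)))"
    unfolding inv_fourier_pderiv[OF F\<psi>] fourier_inversion[OF \<psi>] by (simp add: Bochner_Integration.integral_minus[symmetric] mult_ac del: Bochner_Integration.integral_minus)
  also have "... = \<i> * (LINT xi|lborel. (\<Sum>j\<in>UNIV. complex_of_real (xi $ j) * vfhat f xi $ j) * \<psi> xi)"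
    unfolding e Bochner_Integration.integral_sum[OF i] sum_distrib_left by (simp only: integral_mult_right_zero)
  finally show "(LINT xi|lborel. (\<Sum>j\<in>UNIV. complex_of_real (xi $ j) * vfhat f xi $ j) * \<psi> xi) = 0" by simp
qed

lemma dist_of_real_field:
  assumes [measurable]: "G \<in> borel_measurable borel"
    and re: "AE xi in lborel. \<forall>i. G (- xi) $ i = cnj (G xi $ i)"
  shows "real_field (dist_of G)"
  unfolding real_field_def
proof (intro allI ballI)
  fix i \<phi> assume \<phi>: "\<phi> \<in> schwartz"
  note [measurable] = schwartz_measurable[OF \<phi>]
  have "dist_of G i (\<lambda>x. cnj (\<phi> x)) = (LINT xi|lborel. G xi $ i * cnj (inv_fourier \<phi> (- xi)))"
    by (simp add: dist_of_def inv_fourier_cnj)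
  also have "... = (LINT xi|lborel. G (- xi) $ i * cnj (inv_fourier \<phi> xi))"
    by (subst lborel_integral_affine3[where c="-1" and t=0]) auto
  also have "... = (LINT xi|lborel. cnj (G xi $ i * inv_fourier \<phi> xi))"
    by (rule integral_cong_AE) (use re in \<open>auto elim!: eventually_mono\<close>)
  also have "... = cnj (dist_of G i \<phi>)" unfolding dist_of_def by (rule Bochner_Integration.integral_cnj)
  finally show "dist_of G i (\<lambda>x. cnj (\<phi> x)) = cnj (dist_of G i \<phi>)" .
qed

lemma real_field_fhat:
  assumes f: "\<And>i. fourier_is_fun (f i)" and r: "real_field f"
  shows "AE xi in lborel. \<forall>i. vfhat f (- xi) $ i = cnj (vfhat f xi $ i)"
proof (rule eventually_all_finite)
  fix i
  note [measurable] = fhat_measurable[OF f, of i]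
  have rep: "integrable lborel (\<lambda>xi. fhat (f i) xi * \<psi> xi)" if "\<psi> \<in> schwartz" for \<psi>
    using represents_fhat[OF f, of i] that by (simp add: represents_def)
  have "AE xi in lborel. fhat (f i) (- xi) - cnj (fhat (f i) xi) = 0"
  proof (rule AE_zero_of_schwartz)
    show "(\<lambda>xi. fhat (f i) (- xi) - cnj (fhat (f i) xi)) \<in> borel_measurable borel" by measurable
    fix \<psi> assume \<psi>: "\<psi> \<in> schwartz"
    note [measurable] = schwartz_measurable[OF \<psi>]
    define \<phi> where "\<phi> = fourier (\<lambda>x. cnj (\<psi> x))"
    have c\<psi>: "(\<lambda>x. cnj (\<psi> x)) \<in> schwartz" by (rule schwartz_cnj[OF \<psi>])
    have \<phi>: "\<phi> \<in> schwartz" unfolding \<phi>_def by (rule fourier_schwartz[OF c\<psi>])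
    have inv: "inv_fourier \<phi> = (\<lambda>x. cnj (\<psi> x))" unfolding \<phi>_def by (rule fourier_inversion[OF c\<psi>])
    have i1: "integrable lborel (\<lambda>xi. fhat (f i) (- xi) * \<psi> xi)"
      using lborel_integrable_affine3[of "-1" _ 0, OF _ rep[OF schwartz_reflect[OF \<psi>]]] by simp
    have i2: "integrable lborel (\<lambda>xi. cnj (fhat (f i) xi) * \<psi> xi)"
      using integrable_cnj[OF rep[OF c\<psi>]] by simp
    show "integrable lborel (\<lambda>xi. (fhat (f i) (- xi) - cnj (fhat (f i) xi)) * \<psi> xi)"
      unfolding left_diff_distrib by (intro Bochner_Integration.integrable_diff i1 i2)
    have "f i (\<lambda>x. cnj (\<phi> x)) = (LINT xi|lborel. fhat (f i) xi * \<psi> (- xi))"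
      unfolding apply_via_fhat[OF f schwartz_cnj[OF \<phi>]] inv_fourier_cnj inv by simp
    also have "... = (LINT xi|lborel. fhat (f i) (- xi) * \<psi> xi)"
      by (subst lborel_integral_affine3[where c="-1" and t=0]) auto
    finally have a: "f i (\<lambda>x. cnj (\<phi> x)) = (LINT xi|lborel. fhat (f i) (- xi) * \<psi> xi)" .
    have "cnj (f i \<phi>) = cnj (LINT xi|lborel. fhat (f i) xi * cnj (\<psi> xi))"
      unfolding apply_via_fhat[OF f \<phi>] inv ..
    also have "... = (LINT xi|lborel. cnj (fhat (f i) xi) * \<psi> xi)" by (simp flip: Bochner_Integration.integral_cnj)
    finally have b: "cnj (f i \<phi>) = (LINT xi|lborel. cnj (fhat (f i) xi) * \<psi> xi)" .
    show "(LINT xi|lborel. (fhat (f i) (- xi) - cnj (fhat (f i) xi)) * \<psi> xi) = 0"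
      unfolding left_diff_distrib Bochner_Integration.integral_diff[OF i1 i2] a[symmetric] b[symmetric]
      using r \<phi> by (simp add: real_field_def)
  qed
  then show "AE xi in lborel. vfhat f (- xi) $ i = cnj (vfhat f xi $ i)" by eventually_elim (simp add: vfhat_def)
qed

section \<open>The mild formulation on the Fourier side\<close>

text \<open>From \<open>1 \<le> 1 / |xi| + |xi|\<close>: a function with finite norms of order -1 and 1 is
  integrable.\<close>
lemma wnorm0_le:
  assumes [measurable]: "g \<in> borel_measurable borel" shows "wnorm 0 g \<le> wnorm (-1) g + wnorm 1 g"
proof -
  have "wnorm 0 g \<le> (\<integral>\<^sup>+xi. wt (-1) xi * g xi + wt 1 xi * g xi \<partial>lborel)" unfolding wnorm_def
  proof (rule nn_integral_mono)
    fix xi :: "real^3"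
    have "wt 0 xi \<le> wt (-1) xi + wt 1 xi"
    proof (cases "xi = 0")
      case False
      define r where "r = norm xi"
      have r: "r > 0" using False by (simp add: r_def)
      have "1 \<le> r powr (-1) + r powr 1"
      proof (cases "r \<ge> 1")
        case True then show ?thesis by (simp add: add_increasing)
      next
        case False then have "1 \<le> r powr (-1)" using r by (simp add: powr_minus one_le_inverse)
        moreover have "0 \<le> r powr 1" by simp
        ultimately show ?thesis by linarith
      qed
      then have "ennreal 1 \<le> ennreal (r powr (-1) + r powr 1)" by (rule ennreal_leI)
      then show ?thesis using False by (simp add: wt_0, simp add: wt_def r_def)
    qed simp
    then have "wt 0 xi * g xi \<le> (wt (-1) xi + wt 1 xi) * g xi" by (rule mult_right_mono) simp
    then show "wt 0 xi * g xi \<le> wt (-1) xi * g xi + wt 1 xi * g xi" by (simp add: distrib_right)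
  qed
  also have "... = wnorm (-1) g + wnorm 1 g" unfolding wnorm_def by (rule nn_integral_add) measurable
  finally show ?thesis .
qed

lemma wnorm0_finite_AE:
  assumes U: "jmeas U" and fin: "evnorm {0..} 0 (enorm U) < \<infinity>"
  shows "AE tau in lborel. 0 \<le> tau \<longrightarrow> wnorm 0 (enorm U tau) < \<infinity>"
proof -
  note [measurable] = wnorm_jmeas[OF enorm_jmeas[OF U]]
  have "AE tau in lborel. indicator {0..} tau * wnorm (0 + 1) (enorm U tau) \<noteq> \<infinity>"
    by (rule nn_integral_PInf_AE) (use le_less_trans[OF evnorm_int fin] in auto)
  then show ?thesis
  proof eventually_elim
    fix tau assume a: "indicator {0..} tau * wnorm (0 + 1) (enorm U tau) \<noteq> \<infinity>"
    show "0 \<le> tau \<longrightarrow> wnorm 0 (enorm U tau) < \<infinity>"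
    proof
      assume "0 \<le> tau"
      then have "wnorm (-1) (enorm U tau) < \<infinity>" "wnorm 1 (enorm U tau) < \<infinity>"
        using a le_less_trans[OF evnorm_wnorm[of tau "{0..}" 0 "enorm U"] fin] by (auto simp: less_top)
      then show "wnorm 0 (enorm U tau) < \<infinity>" using le_less_trans[OF wnorm0_le[OF jmeas_slice[OF enorm_jmeas[OF U]]]] by simp
    qed
  qed
qed

text \<open>Fubini's theorem for the time integral and the pairing with a test function, with
  \<open>nonlin_total\<close> as the majorant.\<close>
lemma duhamel_pairing:
  fixes t :: real and i :: 3
  assumes U: "jmeas U" and fin: "evnorm {0..} 0 (enorm U) < \<infinity>" and \<phi>: "\<phi> \<in> schwartz"
  defines "D \<equiv> \<lambda>tau. LINT xi|lborel. complex_of_real (heat_ker (t - tau) xi) * nonlin U tau xi $ i * inv_fourier \<phi> xi"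
  shows "integrable lborel (\<lambda>tau. indicator {0..t} tau *\<^sub>R D tau)"
    and "(LINT tau|lborel. indicator {0..t} tau *\<^sub>R D tau)
      = (LINT xi|lborel. (LINT tau|lborel. (indicator {0..t} tau * heat_ker (t - tau) xi) *\<^sub>R nonlin U tau xi) $ i * inv_fourier \<phi> xi)"
    and "integrable lborel (\<lambda>xi. (LINT tau|lborel. (indicator {0..t} tau * heat_ker (t - tau) xi) *\<^sub>R nonlin U tau xi) $ i * inv_fourier \<phi> xi)"
proof -
  have sI: "inv_fourier \<phi> \<in> schwartz" by (rule inv_fourier_schwartz[OF \<phi>])
  note [measurable] = schwartz_measurable[OF sI] nonlin_total_measurable[OF U]
  note [measurable (raw)] = measurable_curried[OF nonlin_jmeas[OF U]] measurable_curried[OF convol_jmeas[OF enorm_jmeas[OF U] enorm_jmeas[OF U]]]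
  define F where "F = (\<lambda>(tau, xi). (indicator {0..t} tau * heat_ker (t - tau) xi) *\<^sub>R (nonlin U tau xi $ i * inv_fourier \<phi> xi))"
  obtain C where C: "C \<ge> 0" "\<And>xi. norm xi * norm (inv_fourier \<phi> xi) \<le> C" using schwartz_norm_mult_bound[OF sI] by metis
  have Fm: "F \<in> borel_measurable (lborel \<Otimes>\<^sub>M lborel)" unfolding F_def by measurable
  have Fi: "integrable (lborel \<Otimes>\<^sub>M lborel) F"
  proof (rule integrable_pairI[OF Fm])
    have "(\<integral>\<^sup>+tau. \<integral>\<^sup>+xi. ennreal (norm (F (tau, xi))) \<partial>lborel \<partial>lborel)
      \<le> (\<integral>\<^sup>+tau. \<integral>\<^sup>+xi. indicator {0..} tau * (wt 1 xi * convol (enorm U tau) (enorm U tau) xi) * ennreal (norm (inv_fourier \<phi> xi)) \<partial>lborel \<partial>lborel)"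
    proof (intro nn_integral_mono)
      fix tau :: real and xi :: "real^3"
      have "norm (F (tau, xi)) \<le> indicator {0..} tau * (norm (nonlin U tau xi) * norm (inv_fourier \<phi> xi))"
        unfolding F_def using exp_ind_le[of t tau xi]
        by (auto simp: norm_mult intro!: mult_mono Finite_Cartesian_Product.norm_nth_le)
      then have "ennreal (norm (F (tau, xi))) \<le> ennreal (indicator {0..} tau * (norm (nonlin U tau xi) * norm (inv_fourier \<phi> xi)))" by (rule ennreal_leI)
      also have "... = indicator {0..} tau * ennreal (norm (nonlin U tau xi)) * ennreal (norm (inv_fourier \<phi> xi))"
        by (simp add: indicator_def ennreal_mult)
      also have "... \<le> indicator {0..} tau * (wt 1 xi * convol (enorm U tau) (enorm U tau) xi) * ennreal (norm (inv_fourier \<phi> xi))"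
        by (intro mult_right_mono mult_left_mono nonlin_le U) auto
      finally show "ennreal (norm (F (tau, xi))) \<le> indicator {0..} tau * (wt 1 xi * convol (enorm U tau) (enorm U tau) xi) * ennreal (norm (inv_fourier \<phi> xi))" .
    qed
    also have "... = (\<integral>\<^sup>+xi. \<integral>\<^sup>+tau. indicator {0..} tau * (wt 1 xi * convol (enorm U tau) (enorm U tau) xi) * ennreal (norm (inv_fourier \<phi> xi)) \<partial>lborel \<partial>lborel)"
      by (rule lborel_pair.Fubini'[symmetric]) measurable
    also have "... = (\<integral>\<^sup>+xi. nonlin_total U xi * ennreal (norm (inv_fourier \<phi> xi)) \<partial>lborel)"
      unfolding nonlin_total_def by (simp add: nn_integral_multc)
    also have "... \<le> (\<integral>\<^sup>+xi. ennreal C * (wt (-1) xi * nonlin_total U xi) \<partial>lborel)"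
    proof (rule nn_integral_mono_AE, use AE_nonzero3 in eventually_elim)
      fix xi :: "real^3" assume nz: "xi \<noteq> 0"
      have "norm (inv_fourier \<phi> xi) \<le> C * norm xi powr (-1)" using C(2)[of xi] nz by (simp add: powr_minus field_simps)
      then have "ennreal (norm (inv_fourier \<phi> xi)) \<le> ennreal C * wt (-1) xi" using C(1) by (simp add: wt_def ennreal_mult[symmetric] ennreal_leI)
      then have "nonlin_total U xi * ennreal (norm (inv_fourier \<phi> xi)) \<le> nonlin_total U xi * (ennreal C * wt (-1) xi)" by (rule mult_left_mono) simp
      then show "nonlin_total U xi * ennreal (norm (inv_fourier \<phi> xi)) \<le> ennreal C * (wt (-1) xi * nonlin_total U xi)" by (simp add: mult_ac)
    qed
    also have "... = ennreal C * wnorm (-1) (nonlin_total U)" unfolding wnorm_def by (rule nn_integral_cmult) measurable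
    also have "... \<le> ennreal C * (2 * (evnorm {0..} 0 (enorm U) * evnorm {0..} 0 (enorm U)))" by (intro mult_left_mono nonlin_total_wnorm U) simp
    also have "... < \<infinity>" using fin by (simp add: ennreal_mult_less_top)
    finally show "(\<integral>\<^sup>+tau. \<integral>\<^sup>+xi. ennreal (norm (F (tau, xi))) \<partial>lborel \<partial>lborel) < \<infinity>" .
  qed
  have in1: "(LINT xi|lborel. F (tau, xi)) = indicator {0..t} tau *\<^sub>R D tau" for tau
  proof -
    have "(LINT xi|lborel. F (tau, xi)) = (LINT xi|lborel. indicator {0..t} tau *\<^sub>R (complex_of_real (heat_ker (t - tau) xi) * nonlin U tau xi $ i * inv_fourier \<phi> xi))"
      unfolding F_def by (intro Bochner_Integration.integral_cong refl) (simp add: scaleR_conv_of_real mult.assoc)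
    then show ?thesis unfolding D_def by simp
  qed
  have in2: "AE xi in lborel. (LINT tau|lborel. F (tau, xi)) = (LINT tau|lborel. (indicator {0..t} tau * heat_ker (t - tau) xi) *\<^sub>R nonlin U tau xi) $ i * inv_fourier \<phi> xi"
    using nonlin_total_finite_AE[OF U fin]
  proof eventually_elim
    fix xi assume g: "nonlin_total U xi < \<infinity>"
    let ?k = "\<lambda>tau. indicator {0..t} tau * heat_ker (t - tau) xi"
    have "(LINT tau|lborel. ?k tau *\<^sub>R nonlin U tau xi) $ i = (LINT tau|lborel. (?k tau *\<^sub>R nonlin U tau xi) $ i)"
      using integral_bounded_linear[OF bounded_linear_vec_nth duhamel_integrable[OF U g]] by metis
    also have "... * inv_fourier \<phi> xi = (LINT tau|lborel. (?k tau *\<^sub>R nonlin U tau xi) $ i * inv_fourier \<phi> xi)"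
      by (rule integral_mult_left_zero[symmetric])
    also have "... = (LINT tau|lborel. F (tau, xi))" unfolding F_def by (intro Bochner_Integration.integral_cong refl) simp
    finally show "(LINT tau|lborel. F (tau, xi)) = (LINT tau|lborel. ?k tau *\<^sub>R nonlin U tau xi) $ i * inv_fourier \<phi> xi" by simp
  qed
  show "integrable lborel (\<lambda>tau. indicator {0..t} tau *\<^sub>R D tau)"
    using lborel_pair.integrable_fst'[OF Fi] unfolding in1 .
  have m1: "(\<lambda>xi. LINT tau|lborel. F (tau, xi)) \<in> borel_measurable lborel" unfolding F_def by measurable
  have m2: "(\<lambda>xi. (LINT tau|lborel. (indicator {0..t} tau * heat_ker (t - tau) xi) *\<^sub>R nonlin U tau xi) $ i * inv_fourier \<phi> xi) \<in> borel_measurable lborel" by measurable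
  have i2: "integrable lborel (\<lambda>xi. LINT tau|lborel. F (tau, xi))"
    using lborel_pair.integrable_fst'[OF lborel_pair.integrable_product_swap[OF Fi]] by simp
  then show "integrable lborel (\<lambda>xi. (LINT tau|lborel. (indicator {0..t} tau * heat_ker (t - tau) xi) *\<^sub>R nonlin U tau xi) $ i * inv_fourier \<phi> xi)"
    by (subst integrable_cong_AE[OF m2 m1]) (use in2 in \<open>auto elim!: eventually_mono\<close>)
  have "(LINT tau|lborel. indicator {0..t} tau *\<^sub>R D tau) = (LINT tau|lborel. LINT xi|lborel. F (tau, xi))" by (simp add: in1)
  also have "... = (LINT xi|lborel. LINT tau|lborel. F (tau, xi))"
    using lborel_pair.Fubini_integral[of "\<lambda>x y. F (x, y)"] Fi by simp
  also have "... = (LINT xi|lborel. (LINT tau|lborel. (indicator {0..t} tau * heat_ker (t - tau) xi) *\<^sub>R nonlin U tau xi) $ i * inv_fourier \<phi> xi)"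
    by (rule integral_cong_AE[OF m1 m2 in2])
  finally show "(LINT tau|lborel. indicator {0..t} tau *\<^sub>R D tau)
      = (LINT xi|lborel. (LINT tau|lborel. (indicator {0..t} tau * heat_ker (t - tau) xi) *\<^sub>R nonlin U tau xi) $ i * inv_fourier \<phi> xi)" .
qed

lemma lebesgue_integral_AE_eq:
  fixes g h :: "real \<Rightarrow> complex"
  assumes g: "integrable lborel (\<lambda>tau. indicator S tau *\<^sub>R g tau)" and e: "AE tau in lborel. tau \<in> S \<longrightarrow> h tau = g tau"
  shows "set_integrable lebesgue S h" and "(LINT tau:S|lebesgue. h tau) = (LINT tau|lborel. indicator S tau *\<^sub>R g tau)"
proof -
  have gm: "(\<lambda>tau. indicator S tau *\<^sub>R g tau) \<in> borel_measurable lborel" using g by auto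
  have gl: "integrable lebesgue (\<lambda>tau. indicator S tau *\<^sub>R g tau)" using g integrable_completion[OF gm] by simp
  obtain N where N: "N \<in> null_sets lborel" "{tau \<in> space lborel. \<not> (tau \<in> S \<longrightarrow> h tau = g tau)} \<subseteq> N"
    using e unfolding eventually_ae_filter by blast
  have neg: "negligible N" using N(1) null_sets_completionI by (auto simp: negligible_iff_null_sets)
  have eq: "h tau = g tau" if "tau \<in> S - N" for tau using N(2) that by auto
  show hi: "set_integrable lebesgue S h"
    by (rule absolutely_integrable_spike[where f=g, OF _ neg]) (use gl eq in \<open>auto simp: set_integrable_def\<close>)
  have "(LINT tau:S|lebesgue. h tau) = (LINT tau|lebesgue. indicator S tau *\<^sub>R g tau)" unfolding set_lebesgue_integral_def
  proof (rule integral_cong_AE)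
    show "(\<lambda>tau. indicator S tau *\<^sub>R h tau) \<in> borel_measurable lebesgue" using hi by (auto simp: set_integrable_def)
    show "(\<lambda>tau. indicator S tau *\<^sub>R g tau) \<in> borel_measurable lebesgue" using gl by auto
    show "AE tau in lebesgue. indicator S tau *\<^sub>R h tau = indicator S tau *\<^sub>R g tau"
      using AE_completion[OF e] by eventually_elim (auto simp: indicator_def)
  qed
  also have "... = (LINT tau|lborel. indicator S tau *\<^sub>R g tau)" by (rule integral_completion[OF gm])
  finally show "(LINT tau:S|lebesgue. h tau) = (LINT tau|lborel. indicator S tau *\<^sub>R g tau)" .
qed

text \<open>The bridge between the two formulations: for a curve of distributions whose Fourier transforms are
  given by \<open>U\<close> at almost every time, the right hand side of the integral equation is the
  distribution with Fourier transform \<open>duhamel (vfhat u0) U t\<close>. Almost every time suffices,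
  because the right hand side only sees the time integral.\<close>
lemma mild_formula:
  assumes U: "jmeas U" and fin: "evnorm {0..} 0 (enorm U) < \<infinity>" and f: "\<And>tau i. tau \<ge> 0 \<Longrightarrow> fourier_is_fun (u tau i)"
    and e: "AE tau in lborel. 0 \<le> tau \<longrightarrow> (AE xi in lborel. vfhat (u tau) xi = U tau xi)"
    and u0: "u0 \<in> X_space (-1)" and \<phi>: "\<phi> \<in> schwartz" and t: "t \<ge> 0"
  shows "set_integrable lebesgue {0..t} (\<lambda>tau. duhamel_integrand u t tau i \<phi>)"
    and "heat t u0 i \<phi> - (LINT tau:{0..t}|lebesgue. duhamel_integrand u t tau i \<phi>) = (LINT xi|lborel. duhamel (vfhat u0) U t xi $ i * inv_fourier \<phi> xi)"
proof -
  let ?D = "\<lambda>tau. LINT xi|lborel. complex_of_real (heat_ker (t - tau) xi) * nonlin U tau xi $ i * inv_fourier \<phi> xi"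
  have ae: "AE tau in lborel. tau \<in> {0..t} \<longrightarrow> duhamel_integrand u t tau i \<phi> = ?D tau"
    using wnorm0_finite_AE[OF U fin] e
  proof eventually_elim
    fix tau assume a: "0 \<le> tau \<longrightarrow> wnorm 0 (enorm U tau) < \<infinity>" "0 \<le> tau \<longrightarrow> (AE xi in lborel. vfhat (u tau) xi = U tau xi)"
    show "tau \<in> {0..t} \<longrightarrow> duhamel_integrand u t tau i \<phi> = ?D tau"
    proof
      assume "tau \<in> {0..t}"
      then have "0 \<le> tau" by simp
      then show "duhamel_integrand u t tau i \<phi> = ?D tau" using a f by (intro duhamel_integrand_eq[OF U _ _ _ \<phi>]) auto
    qed
  qed
  note dp = duhamel_pairing[OF U fin \<phi>, of t i]
  show "set_integrable lebesgue {0..t} (\<lambda>tau. duhamel_integrand u t tau i \<phi>)"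
    by (rule lebesgue_integral_AE_eq(1)[OF dp(1) ae])
  have I: "(LINT tau:{0..t}|lebesgue. duhamel_integrand u t tau i \<phi>) = (LINT xi|lborel. (LINT tau|lborel. (indicator {0..t} tau * heat_ker (t - tau) xi) *\<^sub>R nonlin U tau xi) $ i * inv_fourier \<phi> xi)"
    unfolding lebesgue_integral_AE_eq(2)[OF dp(1) ae] by (rule dp(2))
  have uf: "fourier_is_fun (u0 i)" for i using u0 by (simp add: X_space_def)
  have Xf: "wnorm (-1) (cnorm (vfhat u0)) < \<infinity>" using u0 by (simp add: X_space_def X_norm_wnorm)
  have H: "heat t u0 i \<phi> = (LINT xi|lborel. (heat_ker t xi *\<^sub>R vfhat u0 xi) $ i * inv_fourier \<phi> xi)"
    unfolding heat_apply[where F=u0 and i=i, OF represents_fhat[OF uf] \<phi>]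
    unfolding vector_scaleR_component unfolding scaleR_conv_of_real vfhat_def vec_lambda_beta by (rule refl)
  note [measurable] = vfhat_measurable[OF uf]
  have iH: "integrable lborel (\<lambda>xi. (heat_ker t xi *\<^sub>R vfhat u0 xi) $ i * inv_fourier \<phi> xi)"
  proof (rule component_integrable[OF _ _ inv_fourier_schwartz[OF \<phi>]])
    have "wnorm (-1) (cnorm (\<lambda>xi. heat_ker t xi *\<^sub>R vfhat u0 xi)) \<le> wnorm (-1) (cnorm (vfhat u0))"
      using t by (intro wnorm_mono) (auto simp: cnorm_def intro!: ennreal_leI mult_left_le_one_le)
    then show "wnorm (-1) (cnorm (\<lambda>xi. heat_ker t xi *\<^sub>R vfhat u0 xi)) < \<infinity>" using Xf by (rule le_less_trans)
  qed measurable
  show "heat t u0 i \<phi> - (LINT tau:{0..t}|lebesgue. duhamel_integrand u t tau i \<phi>) = (LINT xi|lborel. duhamel (vfhat u0) U t xi $ i * inv_fourier \<phi> xi)"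
    unfolding I H duhamel_def vector_minus_component left_diff_distrib
    by (rule Bochner_Integration.integral_diff[OF iH dp(3), symmetric])
qed

section \<open>Jointly measurable Fourier transforms\<close>

lemma vdist_diff_represents:
  assumes "\<And>i. fourier_is_fun (f i)" "\<And>i. fourier_is_fun (g i)"
  shows "represents (\<lambda>xi. fhat (f i) xi - fhat (g i) xi) (fourier_dist (vdist_diff f g i))"
proof -
  have i: "integrable lborel (\<lambda>xi. fhat (f i) xi * \<psi> xi)" "integrable lborel (\<lambda>xi. fhat (g i) xi * \<psi> xi)" if "\<psi> \<in> schwartz" for \<psi>
    using represents_fhat[OF assms(1), of i] represents_fhat[OF assms(2), of i] that by (auto simp: represents_def)
  show ?thesis
    using represents_fhat[OF assms(1), of i] represents_fhat[OF assms(2), of i]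
    unfolding represents_def fourier_dist_def vdist_diff_def left_diff_distrib by auto
qed

lemma vfhat_vdist_diff:
  assumes "\<And>i. fourier_is_fun (f i)" "\<And>i. fourier_is_fun (g i)"
  shows "AE xi in lborel. vfhat (vdist_diff f g) xi = vfhat f xi - vfhat g xi"
proof (rule vfhat_AE_components)
  fix i
  show "AE xi in lborel. fhat (vdist_diff f g i) xi = (vfhat f xi - vfhat g xi) $ i"
    using fhat_AE[OF vdist_diff_represents[OF assms]] by eventually_elim (simp add: vfhat_def)
qed

lemma X_norm_vdist_diff:
  assumes "\<And>i. fourier_is_fun (f i)" "\<And>i. fourier_is_fun (g i)"
  shows "X_norm s (vdist_diff f g) = wnorm s (cnorm (\<lambda>xi. vfhat f xi - vfhat g xi))"
  by (rule X_norm_cong[OF vfhat_vdist_diff[OF assms]])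

lemma AE_lebesgue_on_pos: "(AE t in lebesgue_on {0<..}. P t) \<longleftrightarrow> (AE t in lborel. (0::real) < t \<longrightarrow> P t)"
  by (subst AE_restrict_space_iff) (auto simp: AE_completion_iff)

text \<open>The level sets of \<open>w\<close> are only Lebesgue measurable; up to a null set they may be
  replaced by Borel sets, as is needed for measurability with respect to the product of Borel
  algebras.\<close>
lemma simple_function_borel_pieces:
  fixes w :: "real \<Rightarrow> 'b"
  assumes w: "simple_function (lebesgue_on {0<..}) w"
  obtains C where "\<And>x. x \<in> w ` {0<..} \<Longrightarrow> C x \<in> sets borel" "\<And>x. x \<in> w ` {0<..} \<Longrightarrow> C x \<subseteq> w -` {x}"
    "AE t in lborel. 0 < t \<longrightarrow> t \<in> C (w t)"
proof -
  have fin: "finite (w ` {0<..})" using simple_functionD(1)[OF w] by simp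
  have "\<exists>S N. S \<in> sets borel \<and> S \<subseteq> w -` {x} \<and> N \<in> null_sets lborel \<and> w -` {x} \<inter> {0<..} \<subseteq> S \<union> N" for x
  proof -
    have "w -` {x} \<inter> {0<..} \<in> sets (lebesgue_on {0<..})" using simple_functionD(2)[OF w, of "{x}"] by simp
    then have "w -` {x} \<inter> {0<..} \<in> sets lebesgue" by (subst (asm) sets_restrict_space_iff) auto
    then obtain S N N' where SN: "w -` {x} \<inter> {0<..} = S \<union> N" "N \<subseteq> N'" "N' \<in> null_sets lborel" "S \<in> sets lborel" by (rule sets_completionE)
    show ?thesis by (rule exI[of _ S], rule exI[of _ N']) (use SN in auto)
  qed
  then obtain C N where CN: "\<And>x. C x \<in> sets borel" "\<And>x. C x \<subseteq> w -` {x}" "\<And>x. N x \<in> null_sets lborel" "\<And>x. w -` {x} \<inter> {0<..} \<subseteq> C x \<union> N x"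
    by metis
  have "AE t in lborel. \<forall>x\<in>w ` {0<..}. t \<notin> N x"
    using CN(3) fin by (intro AE_finite_allI AE_not_in) auto
  then have "AE t in lborel. 0 < t \<longrightarrow> t \<in> C (w t)"
  proof eventually_elim
    fix t assume a: "\<forall>x\<in>w ` {0<..}. t \<notin> N x"
    show "0 < t \<longrightarrow> t \<in> C (w t)"
    proof
      assume t: "0 < t"
      then have "t \<in> w -` {w t} \<inter> {0<..}" by simp
      then have "t \<in> C (w t) \<union> N (w t)" using CN(4) by blast
      then show "t \<in> C (w t)" using a t by auto
    qed
  qed
  then show thesis using that CN(1,2) by blast
qed

text \<open>The Fourier transforms of a curve are chosen at each time separately, so that nothing is known
  about their measurability in time. Strong measurability repairs this. A simple curve has an evidently
  jointly measurable version \<open>g n\<close>. At each time choose the first index \<open>\<nu> j t\<close>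
  from which on the sequence moves by at most \<open>2\<^sup>-\<^sup>j\<close> in norm: this index is
  measurable in \<open>t\<close>, and along it the convergence is fast enough to hold almost everywhere in
  \<open>xi\<close>.\<close>
lemma joint_version:
  assumes L1: "L1_in (X_space (k + 1) \<inter> X_space 1) (\<lambda>f. X_norm (k + 1) f + X_norm 1 f) v"
  obtains V where "jmeas V" "AE t in lborel. 0 < t \<longrightarrow> (AE xi in lborel. vfhat (v t) xi = V t xi)"
proof -
  let ?B = "X_space (k + 1) \<inter> X_space 1" and ?N = "\<lambda>f. X_norm (k + 1) f + X_norm 1 f"
  obtain w where w: "\<And>n. simple_function (lebesgue_on {0<..}) (w n)" "\<And>n t. t > 0 \<Longrightarrow> w n t \<in> ?B"
    and wl: "AE t in lebesgue_on {0<..}. (\<lambda>n. ?N (vdist_diff (w n t) (v t))) \<longlonglongrightarrow> 0"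
    and vB: "AE t in lebesgue_on {0<..}. v t \<in> ?B"
    using L1 unfolding L1_in_def by blast
  have Bf: "fourier_is_fun (f i)" if "f \<in> ?B" for f i using that by (simp add: X_space_def)
  define split where "split n C \<longleftrightarrow> (\<forall>x\<in>w n ` {0<..}. C x \<in> sets borel) \<and> (\<forall>x\<in>w n ` {0<..}. C x \<subseteq> w n -` {x}) \<and> (AE t in lborel. 0 < t \<longrightarrow> t \<in> C (w n t))" for n C
  have "\<exists>C. split n C" for n
    by (rule simple_function_borel_pieces[OF w(1)[of n]]) (unfold split_def, blast)
  then have "\<exists>C. \<forall>n. split n (C n)" by (intro choice allI)
  then obtain C where sC': "\<forall>n. split n (C n)" by (rule exE)
  have sC: "split n (C n)" for n using sC' by (rule spec)
  have C: "C n x \<in> sets borel" "C n x \<subseteq> w n -` {x}" if "x \<in> w n ` {0<..}" for n x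
    using sC[of n] that unfolding split_def by blast+
  have C3: "AE t in lborel. 0 < t \<longrightarrow> t \<in> C n (w n t)" for n
    using sC[of n] unfolding split_def by blast
  define g where "g n t xi = (\<Sum>x\<in>w n ` {0<..}. indicator (C n x) t *\<^sub>R vfhat x xi)" for n t xi
  have fin: "finite (w n ` {0<..})" for n using simple_functionD(1)[OF w(1)[of n]] by simp
  have vm: "vfhat x \<in> borel_measurable borel" if "x \<in> w n ` {0<..}" for n x
    using that w(2) Bf by (intro vfhat_measurable) auto
  have jg: "jmeas (g n)" for n
  proof -
    have "(\<lambda>p. \<Sum>x\<in>w n ` {0<..}. indicator (C n x) (fst p) *\<^sub>R vfhat x (snd p)) \<in> borel_measurable (borel \<Otimes>\<^sub>M borel)"
    proof (rule borel_measurable_sum)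
      fix x assume x: "x \<in> w n ` {0<..}"
      note [measurable] = C(1)[OF x] vm[OF x]
      show "(\<lambda>p. indicator (C n x) (fst p) *\<^sub>R vfhat x (snd p)) \<in> borel_measurable (borel \<Otimes>\<^sub>M borel)" by measurable
    qed
    then show ?thesis by (simp add: g_def case_prod_beta')
  qed
  have g_eq: "g n t xi = vfhat (w n t) xi" if t: "0 < t" "t \<in> C n (w n t)" for n t xi
  proof -
    have "g n t xi = (\<Sum>x\<in>w n ` {0<..}. if x = w n t then vfhat x xi else 0)" unfolding g_def
    proof (rule sum.cong[OF refl])
      fix x assume x: "x \<in> w n ` {0<..}"
      show "indicator (C n x) t *\<^sub>R vfhat x xi = (if x = w n t then vfhat x xi else 0)"
        using C(2)[OF x] t(2) by (auto simp: indicator_def)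
    qed
    also have "... = vfhat (w n t) xi" using fin t(1) by (simp add: sum.delta')
    finally show ?thesis .
  qed
  define e where "e m n t = wnorm 1 (cnorm (\<lambda>xi. g m t xi - g n t xi))" for m n t
  have em[measurable]: "e m n \<in> borel_measurable borel" for m n
  proof -
    have "e m n = (\<lambda>t. wnorm 1 (enorm (\<lambda>t xi. g m t xi - g n t xi) t))" by (simp add: e_def fun_eq_iff enorm_cnorm)
    then show ?thesis using wnorm_jmeas[OF enorm_jmeas[OF jmeas_diff[OF jg jg]]] by simp
  qed
  define d where "d n t = wnorm 1 (cnorm (\<lambda>xi. g n t xi - vfhat (v t) xi))" for n t
  define good where "good t \<longleftrightarrow> (\<forall>n. t \<in> C n (w n t)) \<and> v t \<in> ?B \<and> (\<lambda>n. ?N (vdist_diff (w n t) (v t))) \<longlonglongrightarrow> 0" for t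
  have nonlin_total_finite_AE: "AE t in lborel. 0 < t \<longrightarrow> good t"
  proof -
    have "AE t in lborel. \<forall>n. 0 < t \<longrightarrow> t \<in> C n (w n t)" unfolding AE_all_countable using C3 by blast
    with wl[unfolded AE_lebesgue_on_pos] vB[unfolded AE_lebesgue_on_pos] show ?thesis
      by eventually_elim (simp add: good_def)
  qed
  have d0: "(\<lambda>n. d n t) \<longlonglongrightarrow> 0" if t: "0 < t" "good t" for t
  proof (rule tendsto_sandwich[OF _ _ tendsto_const])
    show "(\<lambda>n. ?N (vdist_diff (w n t) (v t))) \<longlonglongrightarrow> 0" using t by (simp add: good_def)
    show "\<forall>\<^sub>F n in sequentially. d n t \<le> ?N (vdist_diff (w n t) (v t))"
    proof (intro always_eventually allI)
      fix n
      have "d n t = X_norm 1 (vdist_diff (w n t) (v t))"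
        unfolding d_def using t g_eq[of t n] by (subst X_norm_vdist_diff) (use Bf[OF w(2)[OF t(1)]] in \<open>auto simp: good_def intro: Bf\<close>)
      then show "d n t \<le> ?N (vdist_diff (w n t) (v t))" by (simp add: add_increasing)
    qed
  qed simp
  have vmt: "vfhat (v t) \<in> borel_measurable borel" if "good t" for t
    using that by (intro vfhat_measurable Bf) (simp add: good_def)
  have tri: "wnorm 1 (cnorm (\<lambda>xi. a xi - b xi)) \<le> wnorm 1 (cnorm (\<lambda>xi. a xi - c xi)) + wnorm 1 (cnorm (\<lambda>xi. c xi - b xi))"
    if [measurable]: "a \<in> borel_measurable borel" "b \<in> borel_measurable borel" "c \<in> borel_measurable borel" for a b c :: "real^3 \<Rightarrow> complex^3"
  proof -
    have "wnorm 1 (cnorm (\<lambda>xi. a xi - b xi)) \<le> wnorm 1 (\<lambda>xi. cnorm (\<lambda>xi. a xi - c xi) xi + cnorm (\<lambda>xi. c xi - b xi) xi)"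
    proof (rule wnorm_mono)
      fix xi
      have "norm (a xi - b xi) \<le> norm (a xi - c xi) + norm (c xi - b xi)" using norm_triangle_ineq[of "a xi - c xi" "c xi - b xi"] by simp
      then show "cnorm (\<lambda>xi. a xi - b xi) xi \<le> cnorm (\<lambda>xi. a xi - c xi) xi + cnorm (\<lambda>xi. c xi - b xi) xi"
        unfolding cnorm_def by (simp add: ennreal_plus[symmetric] ennreal_leI del: ennreal_plus)
    qed
    also have "... = wnorm 1 (cnorm (\<lambda>xi. a xi - c xi)) + wnorm 1 (cnorm (\<lambda>xi. c xi - b xi))" by (rule wnorm_add) measurable
    finally show ?thesis .
  qed
  have sym: "wnorm 1 (cnorm (\<lambda>xi. a xi - b xi)) = wnorm 1 (cnorm (\<lambda>xi. b xi - a xi))" for a b :: "real^3 \<Rightarrow> complex^3"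
    by (simp add: cnorm_def[abs_def] norm_minus_commute)
  have gs: "g n t \<in> borel_measurable borel" for n t by (rule jmeas_slice[OF jg])
  define P where "P j n t \<longleftrightarrow> (\<forall>m. n \<le> m \<longrightarrow> e m n t \<le> ennreal ((1/2)^j))" for j n t
  have Pm: "Measurable.pred borel (P j n)" for j n unfolding P_def by measurable
  define \<nu> where "\<nu> j t = (LEAST n. P j n t)" for j t
  have \<nu>m: "\<nu> j \<in> measurable borel (count_space UNIV)" for j
    unfolding \<nu>_def using Pm by (intro measurable_Least) (simp add: pred_def)
  define G where "G j t xi = g (\<nu> j t) t xi" for j t xi
  have jG: "jmeas (G j)" for j
  proof -
    have "(\<lambda>p. g (\<nu> j (fst p)) (fst p) (snd p)) \<in> borel_measurable (borel \<Otimes>\<^sub>M borel)"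
    proof (rule measurable_compose_countable'[where I="UNIV::nat set" and g="\<lambda>p. \<nu> j (fst p)"])
      show "(\<lambda>p. g n (fst p) (snd p)) \<in> borel_measurable (borel \<Otimes>\<^sub>M borel)" for n using jg[of n] by (simp add: case_prod_beta')
      show "(\<lambda>p. \<nu> j (fst p)) \<in> measurable (borel \<Otimes>\<^sub>M borel) (count_space UNIV)" by (rule measurable_compose[OF measurable_fst \<nu>m])
    qed simp
    then show ?thesis by (simp add: G_def case_prod_beta')
  qed
  define V where "V t xi = lim (\<lambda>j. G j t xi)" for t xi
  have jV: "jmeas V"
  proof -
    note [measurable (raw)] = measurable_curried[OF jG]
    show ?thesis unfolding V_def by measurable
  qed
  have conv: "AE xi in lborel. vfhat (v t) xi = V t xi" if t: "0 < t" "good t" for t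
  proof -
    note [measurable] = vmt[OF t(2)] gs jmeas_slice[OF jG]
    have ex: "\<exists>n. P j n t" for j
    proof -
      have "\<forall>\<^sub>F n in sequentially. d n t < ennreal ((1/2)^Suc j)"
        by (rule order_tendstoD(2)[OF d0[OF t]]) (subst ennreal_less_zero_iff, simp)
      then obtain n where n: "\<And>m. n \<le> m \<Longrightarrow> d m t < ennreal ((1/2)^Suc j)" by (auto simp: eventually_sequentially)
      have "e m n t \<le> ennreal ((1/2)^j)" if "n \<le> m" for m
      proof -
        have "e m n t \<le> d m t + wnorm 1 (cnorm (\<lambda>xi. vfhat (v t) xi - g n t xi))" unfolding e_def d_def by (rule tri) measurable
        also have "wnorm 1 (cnorm (\<lambda>xi. vfhat (v t) xi - g n t xi)) = d n t" unfolding d_def by (rule sym)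
        also have "d m t + d n t \<le> ennreal ((1/2)^Suc j) + ennreal ((1/2)^Suc j)"
          using n[OF that] n[of n] by (intro add_mono) (auto intro: less_imp_le)
        also have "... = ennreal ((1/2)^Suc j + (1/2)^Suc j)" by (rule ennreal_plus[symmetric]) auto
        also have "(1/2)^Suc j + (1/2)^Suc j = (1/2::real)^j" by simp
        finally show ?thesis .
      qed
      then show ?thesis unfolding P_def by blast
    qed
    have Gd: "wnorm 1 (cnorm (\<lambda>xi. G j t xi - vfhat (v t) xi)) \<le> ennreal ((1/2)^j)" for j
    proof -
      define n where "n = \<nu> j t"
      have Pn: "P j n t" unfolding n_def \<nu>_def using ex by (rule LeastI_ex)
      have le: "d n t \<le> ennreal ((1/2)^j) + d m t" if "n \<le> m" for m
      proof -
        have "d n t \<le> wnorm 1 (cnorm (\<lambda>xi. g n t xi - g m t xi)) + d m t" unfolding d_def by (rule tri) measurable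
        also have "wnorm 1 (cnorm (\<lambda>xi. g n t xi - g m t xi)) = e m n t" unfolding e_def by (rule sym)
        also have "e m n t + d m t \<le> ennreal ((1/2)^j) + d m t" using Pn that unfolding P_def by (intro add_right_mono) auto
        finally show ?thesis .
      qed
      have "(\<lambda>m. ennreal ((1/2)^j) + d m t) \<longlonglongrightarrow> ennreal ((1/2)^j) + 0" by (intro tendsto_add tendsto_const d0[OF t])
      then have "d n t \<le> ennreal ((1/2)^j) + 0" by (rule LIMSEQ_le_const) (use le in blast)
      then show ?thesis by (simp add: d_def G_def n_def)
    qed
    have "wnorm 1 (\<lambda>xi. \<Sum>j. cnorm (\<lambda>xi. G j t xi - vfhat (v t) xi) xi) < \<infinity>"
    proof -
      have "wnorm 1 (\<lambda>xi. \<Sum>j. cnorm (\<lambda>xi. G j t xi - vfhat (v t) xi) xi) = (\<Sum>j. wnorm 1 (cnorm (\<lambda>xi. G j t xi - vfhat (v t) xi)))"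
        unfolding wnorm_def by (simp add: nn_integral_suminf[symmetric])
      also have "... \<le> (\<Sum>j. ennreal ((1/2)^j))" by (intro suminf_le Gd) auto
      also have "... = ennreal 2"
        by (rule suminf_ennreal_eq) (use geometric_sums[of "1/2::real"] in auto)
      also have "... < \<infinity>" by simp
      finally show ?thesis .
    qed
    then have "AE xi in lborel. (\<Sum>j. cnorm (\<lambda>xi. G j t xi - vfhat (v t) xi) xi) < \<infinity>" by (rule wnorm_finite_AE[rotated]) measurable
    then show ?thesis
    proof eventually_elim
      fix xi assume "(\<Sum>j. cnorm (\<lambda>xi. G j t xi - vfhat (v t) xi) xi) < \<infinity>"
      then have "summable (\<lambda>j. norm (G j t xi - vfhat (v t) xi))" unfolding cnorm_def by (intro summable_suminf_not_top) auto
      then have "(\<lambda>j. norm (G j t xi - vfhat (v t) xi)) \<longlonglongrightarrow> 0" by (rule summable_LIMSEQ_zero)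
      then have "(\<lambda>j. G j t xi) \<longlonglongrightarrow> vfhat (v t) xi" by (metis LIM_zero_cancel tendsto_norm_zero_iff)
      then show "vfhat (v t) xi = V t xi" unfolding V_def by (rule limI[symmetric])
    qed
  qed
  have "AE t in lborel. 0 < t \<longrightarrow> (AE xi in lborel. vfhat (v t) xi = V t xi)"
    using nonlin_total_finite_AE by eventually_elim (use conv in blast)
  then show thesis using that jV by blast
qed

section \<open>Strong measurability in time\<close>

text \<open>Pointwise continuity in time at the good frequencies and the majorant \<open>|f| + nonlin_total
  U\<close> make the distance of two time slices a continuous function on a compact square.\<close>
lemma fixed_point_uniformly_continuous:
  assumes U: "jmeas U" and fp: "\<And>t xi. duhamel f U t xi = U t xi" and f[measurable]: "f \<in> borel_measurable borel"
    and f1: "wnorm (-1) (cnorm f) < \<infinity>" and fin: "evnorm {0..} 0 (enorm U) < \<infinity>" and \<eta>: "\<eta> > 0"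
  obtains \<delta> where "\<delta> > 0" "\<And>s t. s \<in> {0..T} \<Longrightarrow> t \<in> {0..T} \<Longrightarrow> \<bar>s - t\<bar> < \<delta> \<Longrightarrow> wnorm (-1) (cnorm (\<lambda>xi. U s xi - U t xi)) \<le> ennreal \<eta>"
proof -
  note [measurable] = jmeas_slice[OF U] nonlin_total_measurable[OF U]
  define w where "w xi = 2 * (cnorm f xi + nonlin_total U xi)" for xi
  have wm[measurable]: "w \<in> borel_measurable borel" unfolding w_def[abs_def] by measurable
  have b: "cnorm (U t) xi \<le> cnorm f xi + nonlin_total U xi" if "t \<ge> 0" for t xi
    using duhamel_bound[OF U that, of f xi] by (simp add: enorm_def cnorm_def fp)
  have bd: "cnorm (\<lambda>xi. U s xi - U t xi) xi \<le> w xi" if "s \<ge> 0" "t \<ge> 0" for s t xi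
  proof -
    have "cnorm (\<lambda>xi. U s xi - U t xi) xi \<le> cnorm (U s) xi + cnorm (U t) xi"
      unfolding cnorm_def by (simp add: ennreal_plus[symmetric] ennreal_leI norm_triangle_ineq4 del: ennreal_plus)
    also have "... \<le> w xi" unfolding w_def mult_2 by (intro add_mono b that)
    finally show ?thesis .
  qed
  have wfin: "wnorm (-1) w < \<infinity>"
  proof -
    have "evnorm {0..} 0 (enorm U) * evnorm {0..} 0 (enorm U) < \<infinity>" using fin by (simp add: ennreal_mult_less_top)
    then have bN: "wnorm (-1) (nonlin_total U) < \<infinity>" by (intro le_less_trans[OF nonlin_total_wnorm[OF U]]) (simp add: ennreal_mult_less_top)
    have "wnorm (-1) w = wnorm (-1) (\<lambda>xi. cnorm f xi + nonlin_total U xi) + wnorm (-1) (\<lambda>xi. cnorm f xi + nonlin_total U xi)"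
      unfolding w_def mult_2 by (rule wnorm_add) measurable
    also have "wnorm (-1) (\<lambda>xi. cnorm f xi + nonlin_total U xi) = wnorm (-1) (cnorm f) + wnorm (-1) (nonlin_total U)" by (rule wnorm_add) measurable
    finally show ?thesis using bN f1 by simp
  qed
  define F where "F p = wnorm (-1) (cnorm (\<lambda>xi. U (fst p) xi - U (snd p) xi))" for p :: "real \<times> real"
  have Ffin: "F p < \<infinity>" if "fst p \<ge> 0" "snd p \<ge> 0" for p
    unfolding F_def by (rule le_less_trans[OF wnorm_mono wfin]) (rule bd[OF that])
  have Fc: "(\<lambda>n. F (x n)) \<longlonglongrightarrow> F p" if x: "x \<longlonglongrightarrow> p" "\<And>n. x n \<in> {0..T} \<times> {0..T}" and p: "p \<in> {0..T} \<times> {0..T}" for x p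
    unfolding F_def wnorm_def
  proof (rule nn_integral_dominated_convergence[where w="\<lambda>xi. wt (-1) xi * w xi"])
    show "AE xi in lborel. wt (-1) xi * cnorm (\<lambda>xi. U (fst (x j)) xi - U (snd (x j)) xi) xi \<le> wt (-1) xi * w xi" for j
    proof (rule AE_I2, rule mult_left_mono)
      fix xi
      show "cnorm (\<lambda>xi. U (fst (x j)) xi - U (snd (x j)) xi) xi \<le> w xi" using x(2)[of j] by (intro bd) (auto simp: mem_Times_iff)
    qed simp
    show "(\<integral>\<^sup>+xi. wt (-1) xi * w xi \<partial>lborel) < \<infinity>" using wfin by (simp add: wnorm_def)
    show "AE xi in lborel. (\<lambda>n. wt (-1) xi * cnorm (\<lambda>xi. U (fst (x n)) xi - U (snd (x n)) xi) xi) \<longlonglongrightarrow> wt (-1) xi * cnorm (\<lambda>xi. U (fst p) xi - U (snd p) xi) xi"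
      using nonlin_total_finite_AE[OF U fin]
    proof eventually_elim
      fix xi assume g: "nonlin_total U xi < \<infinity>"
      have "(\<lambda>n. U (s n) xi) \<longlonglongrightarrow> U t xi" if "s \<longlonglongrightarrow> t" for s t
        using duhamel_continuous[OF U g that, of f] by (simp add: fp)
      then have "(\<lambda>n. U (fst (x n)) xi - U (snd (x n)) xi) \<longlonglongrightarrow> U (fst p) xi - U (snd p) xi"
        by (intro tendsto_diff) (use x(1) in \<open>auto intro: tendsto_fst tendsto_snd\<close>)
      then show "(\<lambda>n. wt (-1) xi * cnorm (\<lambda>xi. U (fst (x n)) xi - U (snd (x n)) xi) xi) \<longlonglongrightarrow> wt (-1) xi * cnorm (\<lambda>xi. U (fst p) xi - U (snd p) xi) xi"
        unfolding cnorm_def wt_def by (intro tendsto_mult_ennreal tendsto_const tendsto_ennrealI tendsto_norm) auto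
    qed
  qed measurable
  have "continuous_on ({0..T} \<times> {0..T}) (\<lambda>p. enn2real (F p))"
    unfolding continuous_on_sequentially o_def
  proof (intro allI impI ballI)
    fix x p assume x: "(\<forall>n. x n \<in> {0..T} \<times> {0..T}) \<and> x \<longlonglongrightarrow> p" and p: "p \<in> {0..T} \<times> {0..T}"
    have "F p = ennreal (enn2real (F p))" using Ffin[of p] p by (simp add: mem_Times_iff)
    moreover have "(\<lambda>n. F (x n)) \<longlonglongrightarrow> F p" using x p by (intro Fc) auto
    ultimately show "(\<lambda>n. enn2real (F (x n))) \<longlonglongrightarrow> enn2real (F p)"
      using tendsto_enn2real[of "\<lambda>n. F (x n)" "enn2real (F p)"] by simp
  qed
  then have "uniformly_continuous_on ({0..T} \<times> {0..T}) (\<lambda>p. enn2real (F p))"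
    by (rule compact_uniformly_continuous) (intro compact_Times compact_Icc)
  then obtain \<delta> where \<delta>: "\<delta> > 0" "\<And>p q. p \<in> {0..T} \<times> {0..T} \<Longrightarrow> q \<in> {0..T} \<times> {0..T} \<Longrightarrow> dist q p < \<delta> \<Longrightarrow> dist (enn2real (F q)) (enn2real (F p)) < \<eta>"
    unfolding uniformly_continuous_on_def using \<eta> by meson
  show thesis
  proof (rule that[OF \<delta>(1)])
    fix s t assume st: "s \<in> {0..T}" "t \<in> {0..T}" "\<bar>s - t\<bar> < \<delta>"
    have "F (t, t) = 0" by (simp add: F_def cnorm_def wnorm_def)
    moreover have "dist (enn2real (F (s, t))) (enn2real (F (t, t))) < \<eta>"
      using st by (intro \<delta>(2)) (auto simp: dist_Pair_Pair dist_real_def)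
    ultimately have "enn2real (F (s, t)) \<le> \<eta>" by (simp add: dist_real_def)
    then have "ennreal (enn2real (F (s, t))) \<le> ennreal \<eta>" by (rule ennreal_leI)
    moreover have "F (s, t) < \<infinity>" using st by (intro Ffin) auto
    ultimately show "wnorm (-1) (cnorm (\<lambda>xi. U s xi - U t xi)) \<le> ennreal \<eta>" by (simp add: F_def)
  qed
qed

lemma wnorm_truncated_le:
  assumes [measurable]: "g \<in> borel_measurable borel" and a: "a \<ge> -1" and R: "R \<ge> 0"
  shows "wnorm a (\<lambda>xi. indicator (cball 0 R) xi * g xi) \<le> ennreal (R powr (a + 1)) * wnorm (-1) g"
proof -
  have "wt a xi * (indicator (cball 0 R) xi * g xi) \<le> ennreal (R powr (a + 1)) * (wt (-1) xi * g xi)" for xi :: "real^3"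
  proof (cases "norm xi \<le> R")
    case True
    have "wt a xi = wt (a + 1) xi * wt (-1) xi" by (simp add: wt_mult)
    also have "... \<le> ennreal (R powr (a + 1)) * wt (-1) xi"
      using True a by (intro mult_right_mono) (auto simp: wt_def intro!: ennreal_leI powr_mono2)
    finally show ?thesis using True by (simp add: mult.assoc[symmetric] mult_right_mono)
  qed simp
  then have "wnorm a (\<lambda>xi. indicator (cball 0 R) xi * g xi) \<le> (\<integral>\<^sup>+xi. ennreal (R powr (a + 1)) * (wt (-1) xi * g xi) \<partial>lborel)"
    unfolding wnorm_def by (rule nn_integral_mono)
  also have "... = ennreal (R powr (a + 1)) * wnorm (-1) g" unfolding wnorm_def by (rule nn_integral_cmult) measurable
  finally show ?thesis .
qed

lemma wnorm_tail_tendsto: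
  assumes [measurable]: "g \<in> borel_measurable borel" and fin: "wnorm a g < \<infinity>"
  shows "(\<lambda>n. wnorm a (\<lambda>xi. indicator (- cball 0 (real (Suc n))) xi * g xi)) \<longlonglongrightarrow> 0"
proof -
  have "(\<lambda>n. \<integral>\<^sup>+xi. wt a xi * (indicator (- cball 0 (real (Suc n))) xi * g xi) \<partial>lborel) \<longlonglongrightarrow> (\<integral>\<^sup>+(xi::real^3). 0 \<partial>lborel)"
  proof (rule nn_integral_dominated_convergence[where w="\<lambda>xi. wt a xi * g xi"])
    show "AE xi in lborel. wt a xi * (indicator (- cball 0 (real (Suc n))) xi * g xi) \<le> wt a xi * g xi" for n
      by (auto simp: indicator_def)
    show "AE xi in lborel. (\<lambda>n. wt a xi * (indicator (- cball 0 (real (Suc n))) xi * g xi)) \<longlonglongrightarrow> 0"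
    proof (rule AE_I2, rule tendsto_eventually)
      fix xi :: "real^3"
      obtain N :: nat where N: "norm xi \<le> N" using real_arch_simple by blast
      then show "\<forall>\<^sub>F n in sequentially. wt a xi * (indicator (- cball 0 (real (Suc n))) xi * g xi) = 0"
        by (intro eventually_sequentiallyI[of N]) (auto simp: indicator_def)
    qed
  qed (use fin in \<open>auto simp: wnorm_def\<close>)
  then show ?thesis by (simp add: wnorm_def)
qed

text \<open>The approximating simple curves sample \<open>U\<close> on a time grid and cut off the frequencies
  above \<open>n + 1\<close>. The cutoff makes the values regular enough, but comparing norms of order
  \<open>k + 1\<close> with the norm of order -1 costs the factor \<open>(n + 1) powr (k + 2)\<close>; the
  grid is so fine that the modulus of continuity \<open>\<eta> n\<close> compensates it.\<close>
lemma fixed_point_L1_in: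
  assumes U: "jmeas U" and fp: "\<And>t xi. duhamel f U t xi = U t xi" and f: "f \<in> borel_measurable borel"
    and f1: "wnorm (-1) (cnorm f) < \<infinity>" and fin: "evnorm {0..} 0 (enorm U) < \<infinity>" and fink: "evnorm {0..} k (enorm U) < \<infinity>" and k: "k \<ge> 0"
  shows "L1_in (X_space (k + 1) \<inter> X_space 1) (\<lambda>f. X_norm (k + 1) f + X_norm 1 f) (\<lambda>t. dist_of (U t))"
proof -
  note m = jmeas_slice[OF U]
  note [measurable] = m
  have U1: "wnorm (-1) (cnorm (U t)) < \<infinity>" if "t \<ge> 0" for t
    using le_less_trans[OF evnorm_wnorm[of t "{0..}" 0 "enorm U"] fin] that by (simp add: enorm_cnorm)
  \<comment> \<open>The last factor is the loss from the frequency cutoff at \<open>n + 1\<close>, the first makes the product tend to 0.\<close>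
  define \<eta> where "\<eta> n = 1 / (real (Suc n) * real (Suc n) powr (k + 2))" for n
  have \<eta>: "\<eta> n > 0" for n by (simp add: \<eta>_def)
  have "\<exists>\<delta>>0. \<forall>s\<in>{0..real n}. \<forall>t\<in>{0..real n}. \<bar>s - t\<bar> < \<delta> \<longrightarrow> wnorm (-1) (cnorm (\<lambda>xi. U s xi - U t xi)) \<le> ennreal (\<eta> n)" for n
    by (rule fixed_point_uniformly_continuous[OF U fp f f1 fin \<eta>]) blast
  then obtain \<delta> where \<delta>: "\<And>n. \<delta> n > 0"
    "\<And>n s t. s \<in> {0..real n} \<Longrightarrow> t \<in> {0..real n} \<Longrightarrow> \<bar>s - t\<bar> < \<delta> n \<Longrightarrow> wnorm (-1) (cnorm (\<lambda>xi. U s xi - U t xi)) \<le> ennreal (\<eta> n)"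
    by metis
  define G where "G n s xi = indicator (cball 0 (real (Suc n))) xi *\<^sub>R U s xi" for n s xi
  have Gm[measurable]: "G n s \<in> borel_measurable borel" for n s unfolding G_def[abs_def] by measurable
  have GX: "wnorm a (cnorm (G n s)) < \<infinity>" if "a \<ge> -1" "s \<ge> 0" for a n s
  proof -
    have "cnorm (G n s) = (\<lambda>xi. indicator (cball 0 (real (Suc n))) xi * cnorm (U s) xi)"
      by (auto simp: G_def cnorm_def fun_eq_iff indicator_def)
    then have "wnorm a (cnorm (G n s)) \<le> ennreal (real (Suc n) powr (a + 1)) * wnorm (-1) (cnorm (U s))"
      using wnorm_truncated_le[of "cnorm (U s)" a "real (Suc n)"] that by simp
    also have "... < \<infinity>" using U1[OF that(2)] by (simp add: ennreal_mult_less_top)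
    finally show ?thesis .
  qed
  have GB: "dist_of (G n s) \<in> X_space (k + 1) \<inter> X_space 1" if "s \<ge> 0" for n s
    using k that by (intro IntI dist_of_X_space GX Gm) auto
  \<comment> \<open>Clamping at \<open>n\<close> keeps the range of the grid index finite.\<close>
  define h where "h n t = \<lfloor>min t (real n) / \<delta> n\<rfloor>" for n and t :: real
  define w where "w n t = dist_of (G n (\<delta> n * of_int (h n t)))" for n t
  have h0: "0 \<le> h n t" if "t > 0" for n t using that \<delta>(1)[of n] by (simp add: h_def)
  have h1: "h n t \<le> \<lfloor>real n / \<delta> n\<rfloor>" for n t using \<delta>(1)[of n] by (auto simp: h_def intro!: floor_mono divide_right_mono)
  have sg: "0 \<le> \<delta> n * of_int (h n t)" if "t > 0" for n t using h0[OF that, of n] \<delta>(1)[of n] by simp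
  have near: "\<delta> n * of_int (h n t) \<in> {0..real n}" "\<bar>\<delta> n * of_int (h n t) - t\<bar> < \<delta> n" if "t > 0" "t \<le> real n" for n t
  proof -
    have "of_int (h n t) \<le> t / \<delta> n" "t / \<delta> n < of_int (h n t) + 1" using that by (auto simp: h_def)
    then have a: "\<delta> n * of_int (h n t) \<le> t" "t < \<delta> n * of_int (h n t) + \<delta> n" using \<delta>(1)[of n] by (auto simp: field_simps)
    then show "\<delta> n * of_int (h n t) \<in> {0..real n}" "\<bar>\<delta> n * of_int (h n t) - t\<bar> < \<delta> n" using sg[OF that(1), of n] that by auto
  qed
  have sf: "simple_function (lebesgue_on {0<..}) (w n)" for n
  proof -
    have "simple_function (lebesgue_on {0<..}) (h n)" unfolding simple_function_eq_measurable
    proof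
      have "h n ` space (lebesgue_on {0<..}) \<subseteq> {0..\<lfloor>real n / \<delta> n\<rfloor>}" using h0 h1 by auto
      then show "finite (h n ` space (lebesgue_on {0<..}))" by (rule finite_subset) simp
      have "h n \<in> measurable borel (count_space UNIV)" unfolding h_def by measurable
      then show "h n \<in> measurable (lebesgue_on {0<..}) (count_space UNIV)"
        by (intro measurable_restrict_space1 measurable_completion) simp
    qed
    then show ?thesis unfolding w_def by (rule simple_function_compose1)
  qed
  have ffun: "fourier_is_fun (dist_of V i)" if "V \<in> borel_measurable borel" "wnorm (-1) (cnorm V) < \<infinity>" for V i
    using dist_of_represents[OF that] unfolding fourier_is_fun_def by blast
  have diff: "X_norm a (vdist_diff (w n t) (dist_of (U t))) = wnorm a (cnorm (\<lambda>xi. G n (\<delta> n * of_int (h n t)) xi - U t xi))" if "t > 0" for a n t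
  proof (rule X_norm_cong)
    have t0: "t \<ge> 0" using that by simp
    note g = GX[OF order_refl sg[OF that], of n n] and u = U1[OF t0]
    have "AE xi in lborel. vfhat (vdist_diff (dist_of (G n (\<delta> n * of_int (h n t)))) (dist_of (U t))) xi
        = vfhat (dist_of (G n (\<delta> n * of_int (h n t)))) xi - vfhat (dist_of (U t)) xi"
      by (intro vfhat_vdist_diff ffun Gm g m u)
    with vfhat_dist_of[OF Gm g] vfhat_dist_of[OF m u]
    show "AE xi in lborel. vfhat (vdist_diff (w n t) (dist_of (U t))) xi = G n (\<delta> n * of_int (h n t)) xi - U t xi"
      unfolding w_def by eventually_elim simp
  qed
  have lim: "(\<lambda>n. X_norm a (vdist_diff (w n t) (dist_of (U t)))) \<longlonglongrightarrow> 0"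
    if t: "t > 0" and a: "a \<ge> -1" "a \<le> k + 1" and Xa: "wnorm a (cnorm (U t)) < \<infinity>" for t a
  proof (rule tendsto_sandwich[OF _ _ tendsto_const])
    let ?tail = "\<lambda>n. wnorm a (\<lambda>xi. indicator (- cball 0 (real (Suc n))) xi * cnorm (U t) xi)"
    have "(\<lambda>n. 1 / real (Suc n)) \<longlonglongrightarrow> 0" using LIMSEQ_inverse_real_of_nat by (simp add: inverse_eq_divide)
    from tendsto_ennrealI[OF this] have "(\<lambda>n. ennreal (1 / real (Suc n)) + ?tail n) \<longlonglongrightarrow> ennreal 0 + 0"
      by (rule tendsto_add[OF _ wnorm_tail_tendsto[OF _ Xa]]) measurable
    then show "(\<lambda>n. ennreal (1 / real (Suc n)) + ?tail n) \<longlonglongrightarrow> 0" by simp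
    obtain N :: nat where N: "t \<le> real N" using real_arch_simple by blast
    show "\<forall>\<^sub>F n in sequentially. X_norm a (vdist_diff (w n t) (dist_of (U t))) \<le> ennreal (1 / real (Suc n)) + ?tail n"
    proof (rule eventually_sequentiallyI[of N])
      fix n assume "N \<le> n"
      then have tn: "t \<le> real n" using N by linarith
      define s where "s = \<delta> n * of_int (h n t)"
      define D where "D = cnorm (\<lambda>xi. U s xi - U t xi)"
      have [measurable]: "D \<in> borel_measurable borel" unfolding D_def by measurable
      have D1: "wnorm (-1) D \<le> ennreal (\<eta> n)" unfolding D_def s_def using near[OF t tn] t tn by (intro \<delta>(2)) auto
      have "X_norm a (vdist_diff (w n t) (dist_of (U t))) = wnorm a (cnorm (\<lambda>xi. G n s xi - U t xi))" unfolding s_def by (rule diff[OF t])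
      also have "... = wnorm a (\<lambda>xi. indicator (cball 0 (real (Suc n))) xi * D xi + indicator (- cball 0 (real (Suc n))) xi * cnorm (U t) xi)"
        by (rule arg_cong[where f="wnorm a"]) (auto simp: G_def D_def cnorm_def fun_eq_iff indicator_def)
      also have "... = wnorm a (\<lambda>xi. indicator (cball 0 (real (Suc n))) xi * D xi) + ?tail n" by (rule wnorm_add) measurable
      also have "wnorm a (\<lambda>xi. indicator (cball 0 (real (Suc n))) xi * D xi) \<le> ennreal (real (Suc n) powr (a + 1)) * wnorm (-1) D"
        using a by (intro wnorm_truncated_le) auto
      also have "... \<le> ennreal (real (Suc n) powr (k + 2)) * ennreal (\<eta> n)"
        using a by (intro mult_mono D1 ennreal_leI powr_mono) auto
      also have "... = ennreal (1 / real (Suc n))" by (simp add: \<eta>_def ennreal_mult[symmetric] del: of_nat_Suc)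
      finally show "X_norm a (vdist_diff (w n t) (dist_of (U t))) \<le> ennreal (1 / real (Suc n)) + ?tail n" by (simp add: add_right_mono)
    qed
  qed simp
  have norm_u: "X_norm a (dist_of (U t)) = wnorm a (enorm U t)" if "t > 0" for a t
    using X_norm_cong[OF vfhat_dist_of[OF m U1]] that by (simp add: enorm_cnorm)
  have Xfin: "AE t in lborel. 0 < t \<longrightarrow> wnorm (\<kappa> + 1) (enorm U t) < \<infinity>" if "evnorm {0..} \<kappa> (enorm U) < \<infinity>" for \<kappa>
  proof -
    note [measurable] = wnorm_jmeas[OF enorm_jmeas[OF U]]
    have "AE t in lborel. indicator {0..} t * wnorm (\<kappa> + 1) (enorm U t) \<noteq> \<infinity>"
      by (rule nn_integral_PInf_AE) (use le_less_trans[OF evnorm_int that] in auto)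
    then show ?thesis by eventually_elim (auto simp: less_top)
  qed
  have Xk: "AE t in lborel. 0 < t \<longrightarrow> wnorm (k + 1) (cnorm (U t)) < \<infinity> \<and> wnorm 1 (cnorm (U t)) < \<infinity>"
    using Xfin[OF fink] Xfin[OF fin] by eventually_elim (simp add: enorm_cnorm)
  show ?thesis unfolding L1_in_def
  proof (intro conjI exI[of _ w] allI impI)
    show "AE t in lebesgue_on {0<..}. dist_of (U t) \<in> X_space (k + 1) \<inter> X_space 1"
      unfolding AE_lebesgue_on_pos using Xk by eventually_elim (auto intro!: dist_of_X_space m U1)
    show "AE t in lebesgue_on {0<..}. (\<lambda>n. X_norm (k + 1) (vdist_diff (w n t) (dist_of (U t))) + X_norm 1 (vdist_diff (w n t) (dist_of (U t)))) \<longlonglongrightarrow> 0"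
      unfolding AE_lebesgue_on_pos using Xk
    proof eventually_elim
      fix t assume X: "0 < t \<longrightarrow> wnorm (k + 1) (cnorm (U t)) < \<infinity> \<and> wnorm 1 (cnorm (U t)) < \<infinity>"
      show "0 < t \<longrightarrow> (\<lambda>n. X_norm (k + 1) (vdist_diff (w n t) (dist_of (U t))) + X_norm 1 (vdist_diff (w n t) (dist_of (U t)))) \<longlonglongrightarrow> 0"
        using tendsto_add[OF lim[of t "k + 1"] lim[of t 1]] X k by auto
    qed
    show "simple_function (lebesgue_on {0<..}) (w n)" for n by (rule sf)
    show "w n t \<in> X_space (k + 1) \<inter> X_space 1" if "t > 0" for n t unfolding w_def by (rule GB[OF sg[OF that]])
    note [measurable] = wnorm_jmeas[OF enorm_jmeas[OF U]]
    have "(\<integral>\<^sup>+ t. X_norm (k + 1) (dist_of (U t)) + X_norm 1 (dist_of (U t)) \<partial>lebesgue_on {0<..})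
        = (\<integral>\<^sup>+ t. (wnorm (k + 1) (enorm U t) + wnorm 1 (enorm U t)) * indicator {0<..} t \<partial>lebesgue)"
      by (subst nn_integral_restrict_space) (auto intro!: nn_integral_cong simp: norm_u indicator_def)
    also have "... = (\<integral>\<^sup>+ t. (wnorm (k + 1) (enorm U t) + wnorm 1 (enorm U t)) * indicator {0<..} t \<partial>lborel)"
      by (rule nn_integral_completion)
    also have "... \<le> (\<integral>\<^sup>+ t. indicator {0..} t * wnorm (k + 1) (enorm U t) + indicator {0..} t * wnorm (0 + 1) (enorm U t) \<partial>lborel)"
      by (intro nn_integral_mono) (auto simp: indicator_def)
    also have "... = (\<integral>\<^sup>+ t. indicator {0..} t * wnorm (k + 1) (enorm U t) \<partial>lborel) + (\<integral>\<^sup>+ t. indicator {0..} t * wnorm (0 + 1) (enorm U t) \<partial>lborel)"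
      by (rule nn_integral_add) measurable
    also have "... \<le> evnorm {0..} k (enorm U) + evnorm {0..} 0 (enorm U)" by (intro add_mono evnorm_int)
    also have "... < \<infinity>" using fin fink by simp
    finally show "(\<integral>\<^sup>+ t. X_norm (k + 1) (dist_of (U t)) + X_norm 1 (dist_of (U t)) \<partial>lebesgue_on {0<..}) < \<infinity>" .
  qed
qed

section \<open>Symmetries of the fixed point\<close>

text \<open>If the integral diverges, it is 0 by convention, and \<open>L\<close> maps it to 0 as
  well.\<close>
lemma bounded_linear_LINT_zero:
  fixes L :: "'a::{banach,second_countable_topology} \<Rightarrow> 'b::{banach,second_countable_topology}"
  assumes L: "bounded_linear L" and z: "\<And>x. L (F x) = 0"
  shows "L (LINT x|M. F x) = 0"
proof (cases "integrable M F")
  case True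
  have "L (LINT x|M. F x) = (LINT x|M. L (F x))" by (rule integral_bounded_linear[OF L True, symmetric])
  then show ?thesis by (simp add: z)
qed (simp add: not_integrable_integral_eq linear_0[OF bounded_linear.linear[OF L]])

text \<open>The divergence on the Fourier side, without the factor \<open>\<i>\<close>.\<close>
definition div_symbol :: "real^3 \<Rightarrow> complex^3 \<Rightarrow> complex" where
  "div_symbol xi a = (\<Sum>j\<in>UNIV. complex_of_real (xi $ j) * a $ j)"

lemma bounded_linear_div_symbol: "bounded_linear (div_symbol xi)"
  unfolding div_symbol_def[abs_def] by (intro bounded_linear_sum bounded_linear_const_mult bounded_linear_vec_nth)

text \<open>The Leray projection maps onto the vectors orthogonal to \<open>xi\<close>.\<close>
lemma div_symbol_ns_symbol: "div_symbol xi (ns_symbol xi a b) = 0"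
proof (cases "xi = 0")
  case True then show ?thesis by (simp add: div_symbol_def)
next
  case False
  have n: "(norm xi)\<^sup>2 = (\<Sum>i\<in>UNIV. xi $ i * xi $ i)" by (simp add: power2_norm_eq_inner inner_vec_def)
  have s: "(\<Sum>i\<in>UNIV. xi $ i * leray_symbol i j xi) = 0" for j
  proof -
    have "(\<Sum>i\<in>UNIV. xi $ i * leray_symbol i j xi) = (\<Sum>i\<in>UNIV. (if i = j then xi $ i else 0) - (xi $ i * xi $ i) * (xi $ j / (norm xi)\<^sup>2))"
      by (rule sum.cong) (auto simp: leray_symbol_def algebra_simps)
    also have "... = xi $ j - (norm xi)\<^sup>2 * (xi $ j / (norm xi)\<^sup>2)" unfolding n sum_subtractf sum_distrib_right[symmetric] by simp
    finally show ?thesis using False by simp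
  qed
  define c where "c j = (\<Sum>l\<in>UNIV. \<i> * complex_of_real (xi $ l) * (complex_of_real (1 / (2 * pi) ^ 3) * (a $ j * b $ l)))" for j
  have "div_symbol xi (ns_symbol xi a b) = (\<Sum>i\<in>UNIV. \<Sum>j\<in>UNIV. complex_of_real (xi $ i * leray_symbol i j xi) * c j)"
    unfolding div_symbol_def ns_symbol_def by (simp add: c_def sum_distrib_left mult.assoc)
  also have "... = (\<Sum>j\<in>UNIV. complex_of_real (\<Sum>i\<in>UNIV. xi $ i * leray_symbol i j xi) * c j)"
    by (subst sum.swap) (simp add: sum_distrib_right)
  also have "... = 0" by (simp only: s) simp
  finally show ?thesis .
qed

lemma div_symbol_duhamel: "div_symbol xi (duhamel f U t xi) = heat_ker t xi *\<^sub>R div_symbol xi (f xi)"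
proof -
  interpret div_symbol: bounded_linear "div_symbol xi" by (rule bounded_linear_div_symbol)
  have "div_symbol xi (nonlin U tau xi) = 0" for tau unfolding nonlin_def by (rule bounded_linear_LINT_zero[OF bounded_linear_div_symbol div_symbol_ns_symbol])
  then have "div_symbol xi (LINT tau|lborel. (indicator {0..t} tau * heat_ker (t - tau) xi) *\<^sub>R nonlin U tau xi) = 0"
    by (intro bounded_linear_LINT_zero[OF bounded_linear_div_symbol]) (simp add: div_symbol.scaleR)
  then show ?thesis by (simp add: duhamel_def div_symbol.diff div_symbol.scaleR)
qed

definition conj_vec :: "complex^3 \<Rightarrow> complex^3" where "conj_vec a = (\<chi> i. cnj (a $ i))"

lemma conj_vec_conj_vec[simp]: "conj_vec (conj_vec a) = a" by (simp add: conj_vec_def vec_eq_iff)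
lemma norm_conj_vec[simp]: "norm (conj_vec a) = norm a" by (simp add: conj_vec_def norm_vec_def)
lemma bounded_linear_conj_vec: "bounded_linear conj_vec"
  by (rule bounded_linear_intro[where K=1]) (auto simp: conj_vec_def vec_eq_iff norm_vec_def)
lemma conj_vec_measurable[measurable]: "conj_vec \<in> borel_measurable borel"
  by (intro borel_measurable_continuous_onI linear_continuous_on bounded_linear_conj_vec)

lemma conj_vec_LINT: "(LINT x|M. conj_vec (F x)) = conj_vec (LINT x|M. F x)"
  by (rule integral_bounded_linear'[OF bounded_linear_conj_vec bounded_linear_conj_vec]) simp

lemma ns_symbol_conj_vec: "ns_symbol xi (conj_vec a) (conj_vec b) = conj_vec (ns_symbol (- xi) a b)"
  by (simp add: ns_symbol_def conj_vec_def vec_eq_iff leray_symbol_def sum_negf)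

text \<open>A field is real if and only if its Fourier transform is invariant under this reflection.\<close>
definition conj_reflect :: "(real^3 \<Rightarrow> complex^3) \<Rightarrow> real^3 \<Rightarrow> complex^3" where "conj_reflect f xi = conj_vec (f (- xi))"

lemma jmeas_conj_reflect: assumes U: "jmeas U" shows "jmeas (\<lambda>t. conj_reflect (U t))"
proof -
  note [measurable (raw)] = measurable_curried[OF U]
  show ?thesis unfolding conj_reflect_def by measurable
qed

lemma nonlin_conj_reflect: assumes U: "jmeas U" shows "nonlin (\<lambda>t. conj_reflect (U t)) tau xi = conj_vec (nonlin U tau (- xi))"
proof -
  note [measurable] = jmeas_slice[OF U, of tau]
  have "nonlin (\<lambda>t. conj_reflect (U t)) tau xi = (LINT \<eta>|lborel. conj_vec (ns_symbol (- xi) (U tau (- xi + \<eta>)) (U tau (- \<eta>))))"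
    unfolding nonlin_def conj_reflect_def ns_symbol_conj_vec by simp
  also have "... = conj_vec (LINT \<eta>|lborel. ns_symbol (- xi) (U tau (- xi + \<eta>)) (U tau (- \<eta>)))" by (rule conj_vec_LINT)
  also have "(LINT \<eta>|lborel. ns_symbol (- xi) (U tau (- xi + \<eta>)) (U tau (- \<eta>))) = nonlin U tau (- xi)"
    unfolding nonlin_def using lborel_integral_affine3[of "\<lambda>\<eta>. ns_symbol (- xi) (U tau (- xi + \<eta>)) (U tau (- \<eta>))" "-1" 0] by simp
  finally show ?thesis .
qed

lemma duhamel_conj_reflect: assumes U: "jmeas U" shows "duhamel (conj_reflect f) (\<lambda>t. conj_reflect (U t)) t xi = conj_vec (duhamel f U t (- xi))"
proof -
  interpret c: bounded_linear conj_vec by (rule bounded_linear_conj_vec)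
  show ?thesis unfolding duhamel_def nonlin_conj_reflect[OF U]
    by (simp add: c.diff c.scaleR conj_reflect_def conj_vec_LINT[symmetric])
qed

lemma wnorm_reflect: assumes [measurable]: "g \<in> borel_measurable borel" shows "wnorm a (\<lambda>xi. g (- xi)) = wnorm a g"
  unfolding wnorm_def using nn_integral_affine3[of "\<lambda>xi. wt a xi * g xi" "-1" 0] by simp

text \<open>The reflected fixed point is a fixed point for the reflected datum, which is the same datum; hence
  uniqueness identifies it with the original one.\<close>
lemma fixed_point_real:
  assumes U: "jmeas U" and fin: "evnorm {0..} 0 (enorm U) < \<infinity>" and fp: "\<And>t xi. duhamel f U t xi = U t xi"
    and re: "AE xi in lborel. conj_reflect f xi = f xi" and t: "t \<ge> 0"
  shows "AE xi in lborel. conj_reflect (U t) xi = U t xi"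
proof (rule uniqueness[OF jmeas_conj_reflect[OF U] U _ fin _ _ t])
  have "enorm (\<lambda>t. conj_reflect (U t)) t = (\<lambda>xi. enorm U t (- xi))" for t by (simp add: fun_eq_iff enorm_def conj_reflect_def)
  then show "evnorm {0..} 0 (enorm (\<lambda>t. conj_reflect (U t))) < \<infinity>"
    using fin by (simp add: evnorm_def wnorm_reflect[OF jmeas_slice[OF enorm_jmeas[OF U]]])
  show "AE xi in lborel. U t xi = duhamel f U t xi" for t by (simp add: fp)
  show "AE xi in lborel. conj_reflect (U t) xi = duhamel f (\<lambda>t. conj_reflect (U t)) t xi" for t
    using re
  proof eventually_elim
    fix xi assume "conj_reflect f xi = f xi"
    then have "duhamel f (\<lambda>t. conj_reflect (U t)) t xi = duhamel (conj_reflect f) (\<lambda>t. conj_reflect (U t)) t xi" by (simp add: duhamel_def)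
    then show "conj_reflect (U t) xi = duhamel f (\<lambda>t. conj_reflect (U t)) t xi" by (simp add: duhamel_conj_reflect[OF U] fp conj_reflect_def)
  qed
qed

lemma duhamel_0: "duhamel f U 0 xi = f xi"
proof -
  have "(indicator {0..0} tau * heat_ker (0 - tau) xi) *\<^sub>R nonlin U tau xi = indicator {0} tau *\<^sub>R nonlin U 0 xi" for tau :: real
    by (simp add: indicator_def)
  then show ?thesis by (simp add: duhamel_def)
qed

section \<open>Uniqueness of mild solutions, and the theorem\<close>

text \<open>The norm \<open>evnorm\<close> has a supremum over all times, whereas the version from
  \<open>joint_version\<close> is meaningful at almost every time only. It is therefore set to 0 at the times
  where its norm exceeds the bound for \<open>v\<close>; this set of times is measurable and null.\<close>
lemma solution_transform:
  fixes v :: "real \<Rightarrow> vdist"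
  assumes v: "v \<in> solution_class k \<sigma>"
  obtains V where "jmeas V" "evnorm {0..} 0 (enorm V) < \<infinity>" "AE t in lborel. 0 \<le> t \<longrightarrow> (AE xi in lborel. vfhat (v t) xi = V t xi)"
proof -
  let ?N = "\<lambda>f. X_norm (k + 1) f + X_norm 1 f"
  have Li: "Linf_in (data_space k \<sigma>) (\<lambda>f. X_norm (k - 1) f + X_norm (-1) f + Y_norm \<sigma> f) v"
    and L1: "L1_in (X_space (k + 1) \<inter> X_space 1) ?N v" using v by (auto simp: solution_class_def)
  define B where "B = (SUP t\<in>{0..}. X_norm (k - 1) (v t) + X_norm (-1) (v t) + Y_norm \<sigma> (v t))"
  have B: "B < \<infinity>" using Li by (simp add: Linf_in_def B_def)
  have vB: "X_norm (-1) (v t) \<le> B" if "t \<ge> 0" for t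
  proof -
    have "X_norm (-1) (v t) \<le> X_norm (k - 1) (v t) + X_norm (-1) (v t) + Y_norm \<sigma> (v t)" by (simp add: add_increasing add_increasing2)
    also have "... \<le> B" unfolding B_def using that by (intro SUP_upper) auto
    finally show ?thesis .
  qed
  obtain V' where jV': "jmeas V'" and V': "AE t in lborel. 0 < t \<longrightarrow> (AE xi in lborel. vfhat (v t) xi = V' t xi)"
    by (rule joint_version[OF L1])
  define A where "A = {t. wnorm (-1) (enorm V' t) \<le> B}"
  have [measurable]: "A \<in> sets borel" unfolding A_def using wnorm_jmeas[OF enorm_jmeas[OF jV'], of "-1"] by measurable
  define V where "V t xi = indicator A t *\<^sub>R V' t xi" for t xi
  note [measurable (raw)] = measurable_curried[OF jV']
  have jV: "jmeas V" unfolding V_def by measurable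
  have V: "AE t in lborel. 0 \<le> t \<longrightarrow> 0 < t \<and> (AE xi in lborel. vfhat (v t) xi = V t xi)"
    using V' AE_lborel_singleton[of 0]
  proof eventually_elim
    fix t assume a: "0 < t \<longrightarrow> (AE xi in lborel. vfhat (v t) xi = V' t xi)" "t \<noteq> 0"
    show "0 \<le> t \<longrightarrow> 0 < t \<and> (AE xi in lborel. vfhat (v t) xi = V t xi)"
    proof
      assume t0: "0 \<le> t"
      then have e: "AE xi in lborel. vfhat (v t) xi = V' t xi" using a by simp
      have "wnorm (-1) (enorm V' t) = X_norm (-1) (v t)" unfolding enorm_cnorm by (rule X_norm_cong[OF e, symmetric])
      then have "t \<in> A" using vB[OF t0] by (simp add: A_def)
      then show "0 < t \<and> (AE xi in lborel. vfhat (v t) xi = V t xi)" using e t0 a(2) by (simp add: V_def)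
    qed
  qed
  have s: "wnorm (0 - 1) (enorm V t) \<le> B" for t
  proof (cases "t \<in> A")
    case True
    then have "enorm V t = enorm V' t" by (simp add: enorm_def V_def fun_eq_iff)
    then show ?thesis using True by (simp add: A_def)
  next
    case False
    then have "enorm V t = (\<lambda>_. 0)" by (simp add: enorm_def V_def fun_eq_iff)
    then show ?thesis by (simp add: wnorm_def)
  qed
  have "(\<integral>\<^sup>+t. indicator {0..} t * wnorm (0 + 1) (enorm V t) \<partial>lborel) = (\<integral>\<^sup>+t. indicator {0..} t * wnorm (0 + 1) (enorm V t) \<partial>lebesgue)"
    by (rule nn_integral_completion[symmetric])
  also have "... \<le> (\<integral>\<^sup>+t. ?N (v t) * indicator {0<..} t \<partial>lebesgue)"
  proof (rule nn_integral_mono_AE)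
    show "AE t in lebesgue. indicator {0..} t * wnorm (0 + 1) (enorm V t) \<le> ?N (v t) * indicator {0<..} t"
      unfolding AE_completion_iff using V
    proof eventually_elim
      fix t assume a: "0 \<le> t \<longrightarrow> 0 < t \<and> (AE xi in lborel. vfhat (v t) xi = V t xi)"
      show "indicator {0..} t * wnorm (0 + 1) (enorm V t) \<le> ?N (v t) * indicator {0<..} t"
        using a by (auto simp: indicator_def enorm_cnorm X_norm_cong[of "v t" "V t" 1] intro: add_increasing)
    qed
  qed
  also have "... = (\<integral>\<^sup>+t. ?N (v t) \<partial>lebesgue_on {0<..})" by (rule nn_integral_restrict_space[symmetric]) simp
  also have "... < \<infinity>" using L1 by (simp add: L1_in_def)
  finally have i: "(\<integral>\<^sup>+t. indicator {0..} t * wnorm (0 + 1) (enorm V t) \<partial>lborel) < \<infinity>" .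
  have "(SUP t\<in>{0..}. wnorm (0 - 1) (enorm V t)) \<le> B" by (rule SUP_least) (rule s)
  then have "(SUP t\<in>{0..}. wnorm (0 - 1) (enorm V t)) < \<infinity>" using B by (rule le_less_trans)
  then have "evnorm {0..} 0 (enorm V) < \<infinity>" unfolding evnorm_def using i by simp
  moreover have "AE t in lborel. 0 \<le> t \<longrightarrow> (AE xi in lborel. vfhat (v t) xi = V t xi)" using V by eventually_elim blast
  ultimately show thesis by (rule that[OF jV])
qed

lemma vfhat_of_dist_of_eq:
  assumes [measurable]: "G \<in> borel_measurable borel" and fin: "wnorm (-1) (cnorm G) < \<infinity>"
    and e: "\<And>i \<phi>. \<phi> \<in> schwartz \<Longrightarrow> f i \<phi> = dist_of G i \<phi>"
  shows "AE xi in lborel. vfhat f xi = G xi"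
proof (rule vfhat_AE_components)
  fix i
  have "represents (\<lambda>xi. G xi $ i) (fourier_dist (f i))"
    using dist_of_represents[OF assms(1) fin, of i] by (simp add: represents_def fourier_dist_def e fourier_schwartz)
  then show "AE xi in lborel. fhat (f i) xi = G xi $ i" by (rule fhat_AE)
qed

text \<open>The version \<open>V\<close> of the Fourier transform of \<open>v\<close> is replaced by \<open>W
  = duhamel (vfhat u0) V\<close>, which by the integral equation is the Fourier transform of \<open>v
  t\<close> at every time \<open>t \<ge> 0\<close>, and is an exact fixed point.\<close>
lemma solution_unique:
  assumes u0: "u0 \<in> X_space (-1)" and v: "v \<in> solution_class k \<sigma>" and mv: "mild_solution u0 v"
    and U: "jmeas U" "evnorm {0..} 0 (enorm U) < \<infinity>" "\<And>t xi. duhamel (vfhat u0) U t xi = U t xi" and t: "t \<ge> 0"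
  shows "dist_eq (v t) (dist_of (U t))"
proof -
  obtain V where jV: "jmeas V" and fV: "evnorm {0..} 0 (enorm V) < \<infinity>"
    and V: "AE t in lborel. 0 \<le> t \<longrightarrow> (AE xi in lborel. vfhat (v t) xi = V t xi)" by (rule solution_transform[OF v])
  have ffun: "fourier_is_fun (v tau i)" if "tau \<ge> 0" for tau i
    using v that by (auto simp: solution_class_def Linf_in_def data_space_def X_space_def)
  have fm[measurable]: "vfhat u0 \<in> borel_measurable borel" using u0 by (intro vfhat_measurable) (auto simp: X_space_def)
  define W where "W = duhamel (vfhat u0) V"
  have jW: "jmeas W" unfolding W_def by (rule duhamel_jmeas[OF jV fm])
  have X0: "wnorm (-1) (cnorm (vfhat u0)) < \<infinity>" using u0 by (simp add: X_space_def X_norm_wnorm)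
  have fW: "evnorm {0..} 0 (enorm W) < \<infinity>"
    unfolding W_def using X0 fV
    by (intro le_less_trans[OF duhamel_evnorm[OF jV fm down_closed_atLeast order_refl]]) (simp add: cnorm_def[abs_def] ennreal_mult_less_top)
  have W1: "wnorm (-1) (cnorm (W t)) < \<infinity>" if "t \<ge> 0" for t
    using le_less_trans[OF evnorm_wnorm[of t "{0..}" 0 "enorm W"] fW] that by (simp add: enorm_cnorm)
  have eq: "v t i \<phi> = dist_of (W t) i \<phi>" if "t \<ge> 0" "\<phi> \<in> schwartz" for t i \<phi>
    using mv that mild_formula(2)[OF jV fV ffun V u0 that(2,1), of i] by (simp add: mild_solution_def dist_of_def W_def)
  have vW: "AE xi in lborel. vfhat (v t) xi = W t xi" if "t \<ge> 0" for t
    by (rule vfhat_of_dist_of_eq[OF jmeas_slice[OF jW] W1[OF that] eq[OF that]])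
  have VW: "AE tau in lborel. 0 \<le> tau \<longrightarrow> (AE xi in lborel. V tau xi = W tau xi)"
    using V
  proof eventually_elim
    fix tau assume a: "0 \<le> tau \<longrightarrow> (AE xi in lborel. vfhat (v tau) xi = V tau xi)"
    show "0 \<le> tau \<longrightarrow> (AE xi in lborel. V tau xi = W tau xi)"
    proof
      assume t: "0 \<le> tau"
      from mp[OF a t] vW[OF t] show "AE xi in lborel. V tau xi = W tau xi" by eventually_elim simp
    qed
  qed
  have "W t xi = duhamel (vfhat u0) W t xi" for t xi unfolding W_def
    by (rule duhamel_cong[OF VW[unfolded W_def] jV jW[unfolded W_def]])
  then have WU: "AE xi in lborel. W t xi = U t xi"
    using U by (intro uniqueness[OF jW U(1) fW U(2) _ _ t]) auto
  note [measurable] = jmeas_slice[OF jW] jmeas_slice[OF U(1)] inv_fourier_schwartz[THEN schwartz_measurable]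
  show ?thesis unfolding dist_eq_def
  proof (intro allI ballI)
    fix i \<phi> assume \<phi>: "\<phi> \<in> schwartz"
    note [measurable] = schwartz_measurable[OF \<phi>]
    have "dist_of (W t) i \<phi> = dist_of (U t) i \<phi>" unfolding dist_of_def
      by (rule integral_cong_AE) (use WU in \<open>measurable, eventually_elim, simp\<close>)
    then show "v t i \<phi> = dist_of (U t) i \<phi>" using eq[OF t \<phi>] by simp
  qed
qed

theorem theorem1p2:
  fixes k \<sigma> :: real
  assumes "k \<ge> 0" and "\<sigma> \<in> {-1..1}"
  shows "\<exists>\<epsilon>>0. \<exists>C :: ennreal \<Rightarrow> ennreal \<Rightarrow> ennreal \<Rightarrow> real.
    \<forall>u0. u0 \<in> data_space k \<sigma> \<and> real_field u0 \<and> div_free u0 \<and> X_norm (-1) u0 \<le> ennreal \<epsilon> \<longrightarrow>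
      (\<exists>u. u \<in> solution_class k \<sigma> \<and> mild_solution u0 u \<and>
         (\<forall>v. v \<in> solution_class k \<sigma> \<and> mild_solution u0 v \<longrightarrow> (\<forall>t\<ge>0. dist_eq (v t) (u t))) \<and>
         (\<forall>t>0. X_norm (k - 1) (u t) \<le>
            ennreal (C (X_norm (k - 1) u0) (X_norm (-1) u0) (Y_norm \<sigma> u0)
                     * (1 + t) powr (-1 + \<sigma> / 2 - k / 2))))"
proof -
  define \<epsilon> where "\<epsilon> = 1 / (64 * 2 powr k)"
  obtain C0 where C0: "C0 \<ge> 0" "\<And>f U M y0 t. jmeas U \<Longrightarrow> (\<And>t xi. duhamel f U t xi = U t xi) \<Longrightarrow> evnorm {0..} 0 (enorm U) \<le> ennreal (8 * \<epsilon>)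
     \<Longrightarrow> evnorm {0..} k (enorm U) < \<infinity> \<Longrightarrow> M \<ge> 0 \<Longrightarrow> (\<And>t. t \<ge> 0 \<Longrightarrow> AE xi in lborel. wt \<sigma> xi * enorm U t xi \<le> ennreal M)
     \<Longrightarrow> wnorm (k - 1) (enorm U 0) \<le> ennreal y0 \<Longrightarrow> y0 \<ge> 0 \<Longrightarrow> t > 0
     \<Longrightarrow> wnorm (k - 1) (enorm U t) \<le> ennreal (C0 * (M + y0) * (1 + t) powr (- ((k + 2 - \<sigma>) / 2)))"
    using decay[OF assms \<epsilon>_def] by blast
  show ?thesis
  \<comment> \<open>The pseudo-measure norm is at most doubled by the flow, whence the factor 2.\<close>
  proof (rule exI[of _ \<epsilon>], intro conjI exI[of _ "\<lambda>a b c. C0 * (2 * enn2real c + enn2real a)"] allI impI)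
    show "\<epsilon> > 0" by (simp add: \<epsilon>_def)
    fix u0 assume a: "u0 \<in> data_space k \<sigma> \<and> real_field u0 \<and> div_free u0 \<and> X_norm (-1) u0 \<le> ennreal \<epsilon>"
    define f where "f = vfhat u0"
    have u0: "u0 \<in> X_space (-1)" and Xk: "wnorm (k - 1) (cnorm f) < \<infinity>" and Y: "Y_norm \<sigma> u0 < \<infinity>"
      and f1: "wnorm (-1) (cnorm f) \<le> ennreal \<epsilon>"
      using a by (auto simp: data_space_def X_space_def Y_space_def X_norm_wnorm f_def)
    have ff: "fourier_is_fun (u0 i)" for i using u0 by (simp add: X_space_def)
    have fm: "f \<in> borel_measurable borel" unfolding f_def by (rule vfhat_measurable[OF ff])
    have f1': "wnorm (-1) (cnorm f) < \<infinity>" using f1 by (rule le_less_trans) simp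
    obtain U where U: "jmeas U" "\<And>t xi. duhamel f U t xi = U t xi" "evnorm {0..} 0 (enorm U) \<le> ennreal (8 * \<epsilon>)"
        "evnorm {0..} k (enorm U) \<le> 8 * wnorm (k - 1) (cnorm f)" "\<And>t. t \<ge> 0 \<Longrightarrow> AE xi in lborel. wt \<sigma> xi * enorm U t xi \<le> 2 * Y_norm \<sigma> u0"
      using picard[OF fm assms(1) \<epsilon>_def f1[unfolded cnorm_def[abs_def]] assms(2) Y_norm_AE[of \<sigma> u0, folded f_def, unfolded cnorm_def]]
      unfolding cnorm_def[abs_def] by blast
    have fin: "evnorm {0..} 0 (enorm U) < \<infinity>" using U(3) by (rule le_less_trans) simp
    have fink: "evnorm {0..} k (enorm U) < \<infinity>" using U(4) by (rule le_less_trans) (use Xk in \<open>simp add: ennreal_mult_less_top\<close>)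
    note m = jmeas_slice[OF U(1)]
    have n1: "wnorm (-1) (cnorm (U t)) \<le> evnorm {0..} 0 (enorm U)" and nk: "wnorm (k - 1) (cnorm (U t)) \<le> evnorm {0..} k (enorm U)" if "t \<ge> 0" for t
      using evnorm_wnorm[of t "{0..}" 0 "enorm U"] evnorm_wnorm[of t "{0..}" k "enorm U"] that by (simp_all add: enorm_cnorm)
    have U1: "wnorm (-1) (cnorm (U t)) < \<infinity>" if "t \<ge> 0" for t using n1[OF that] fin by (rule le_less_trans)
    define u where "u t = dist_of (U t)" for t
    have vu: "AE xi in lborel. vfhat (u t) xi = U t xi" if "t \<ge> 0" for t unfolding u_def by (rule vfhat_dist_of[OF m U1[OF that]])
    have Xu: "X_norm s (u t) = wnorm s (cnorm (U t))" if "t \<ge> 0" for s t by (rule X_norm_cong[OF vu[OF that]])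
    have M: "2 * Y_norm \<sigma> u0 < \<infinity>" using Y by (simp add: ennreal_mult_less_top)
    have Yu: "Y_norm \<sigma> (u t) \<le> 2 * Y_norm \<sigma> u0" "u t \<in> Y_space \<sigma>" if "t \<ge> 0" for t
      unfolding u_def using dist_of_Y_norm[OF m U1[OF that] U(5)[OF that, unfolded enorm_cnorm]] M by auto
    have "Linf_in (data_space k \<sigma>) (\<lambda>f. X_norm (k - 1) f + X_norm (-1) f + Y_norm \<sigma> f) u" unfolding Linf_in_def
    proof (intro conjI allI impI)
      show "u t \<in> data_space k \<sigma>" if "t \<ge> 0" for t
        unfolding data_space_def using Yu(2)[OF that] le_less_trans[OF nk[OF that] fink] U1[OF that]
        by (auto simp: u_def intro!: dist_of_X_space m)
      have "(SUP t\<in>{0..}. X_norm (k - 1) (u t) + X_norm (-1) (u t) + Y_norm \<sigma> (u t)) \<le> evnorm {0..} k (enorm U) + evnorm {0..} 0 (enorm U) + 2 * Y_norm \<sigma> u0"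
        by (rule SUP_least) (auto simp: Xu intro!: add_mono n1 nk Yu)
      also have "... < \<infinity>" using fin fink M by simp
      finally show "(SUP t\<in>{0..}. X_norm (k - 1) (u t) + X_norm (-1) (u t) + Y_norm \<sigma> (u t)) < \<infinity>" .
    qed
    moreover have "L1_in (X_space (k + 1) \<inter> X_space 1) (\<lambda>f. X_norm (k + 1) f + X_norm 1 f) u"
      unfolding u_def[abs_def] by (rule fixed_point_L1_in[OF U(1,2) fm f1' fin fink assms(1)])
    ultimately have sol: "u \<in> solution_class k \<sigma>" by (simp add: solution_class_def)
    have ffu: "fourier_is_fun (u t i)" if "t \<ge> 0" for t i
      using Yu(2)[OF that] by (simp add: Y_space_def)
    have fr: "AE xi in lborel. conj_reflect f xi = f xi"
    proof -
      have "AE xi in lborel. \<forall>i. vfhat u0 (- xi) $ i = cnj (vfhat u0 xi $ i)" using a by (intro real_field_fhat ff) auto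
      then show ?thesis by eventually_elim (simp add: f_def conj_reflect_def conj_vec_def vec_eq_iff)
    qed
    have fd: "AE xi in lborel. div_symbol xi (f xi) = 0" unfolding div_symbol_def f_def using a by (intro div_free_fhat ff) auto
    have vuAE: "AE tau in lborel. 0 \<le> tau \<longrightarrow> (AE xi in lborel. vfhat (u tau) xi = U tau xi)" using vu by simp
    have mild: "mild_solution u0 u" unfolding mild_solution_def
    proof (intro conjI allI impI ballI)
      fix t :: real assume t: "t \<ge> 0"
      show "real_field (u t)" unfolding u_def
      proof (rule dist_of_real_field[OF m])
        show "AE xi in lborel. \<forall>i. U t (- xi) $ i = cnj (U t xi $ i)"
          using fixed_point_real[OF U(1) fin U(2) fr t]
        proof eventually_elim
          fix xi assume "conj_reflect (U t) xi = U t xi"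
          then have "U t xi = conj_vec (U t (- xi))" by (simp add: conj_reflect_def)
          then show "\<forall>i. U t (- xi) $ i = cnj (U t xi $ i)" by (simp add: conj_vec_def)
        qed
      qed
      show "div_free (u t)" unfolding u_def
      proof (rule dist_of_div_free[OF m U1[OF t]])
        show "AE xi in lborel. (\<Sum>j\<in>UNIV. complex_of_real (xi $ j) * U t xi $ j) = 0"
          using fd
        proof eventually_elim
          fix xi assume "div_symbol xi (f xi) = 0"
          then show "(\<Sum>j\<in>UNIV. complex_of_real (xi $ j) * U t xi $ j) = 0" using div_symbol_duhamel[of xi f U t] by (simp add: U(2) div_symbol_def)
        qed
      qed
      fix i and \<phi> :: "real^3 \<Rightarrow> complex" assume \<phi>: "\<phi> \<in> schwartz"
      show "set_integrable lebesgue {0..t} (\<lambda>tau. duhamel_integrand u t tau i \<phi>)"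
        by (rule mild_formula(1)[OF U(1) fin ffu vuAE u0 \<phi> t])
      show "u t i \<phi> = heat t u0 i \<phi> - (LINT tau:{0..t}|lebesgue. duhamel_integrand u t tau i \<phi>)"
      proof -
        have "u t i \<phi> = (LINT xi|lborel. duhamel (vfhat u0) U t xi $ i * inv_fourier \<phi> xi)"
          by (simp add: u_def dist_of_def f_def[symmetric] U(2))
        with mild_formula(2)[OF U(1) fin ffu vuAE u0 \<phi> t, of i] show ?thesis by (rule trans[OF _ sym, rotated])
      qed
    qed
    have uniq: "dist_eq (v t) (u t)" if "v \<in> solution_class k \<sigma> \<and> mild_solution u0 v" "t \<ge> 0" for v t
      unfolding u_def using that by (intro solution_unique[OF u0 _ _ U(1) fin U(2)[unfolded f_def]]) auto
    \<comment> \<open>At time 0 the fixed point equals the datum everywhere, so the initial norm is that of the datum.\<close>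
    have U0: "U 0 = f" using U(2)[of 0] by (simp add: fun_eq_iff duhamel_0)
    have dec: "X_norm (k - 1) (u t) \<le> ennreal (C0 * (2 * enn2real (Y_norm \<sigma> u0) + enn2real (X_norm (k - 1) u0)) * (1 + t) powr (-1 + \<sigma> / 2 - k / 2))"
      if t: "t > 0" for t
    proof -
      have e: "-1 + \<sigma> / 2 - k / 2 = - ((k + 2 - \<sigma>) / 2)" by (simp add: field_simps)
      have Yr: "ennreal (2 * enn2real (Y_norm \<sigma> u0)) = 2 * Y_norm \<sigma> u0" using Y by (simp add: ennreal_mult)
      have Xr: "wnorm (k - 1) (enorm U 0) \<le> ennreal (enn2real (X_norm (k - 1) u0))" using Xk by (simp add: enorm_cnorm U0 X_norm_wnorm f_def)
      have "wnorm (k - 1) (enorm U t) \<le> ennreal (C0 * (2 * enn2real (Y_norm \<sigma> u0) + enn2real (X_norm (k - 1) u0)) * (1 + t) powr (- ((k + 2 - \<sigma>) / 2)))"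
        by (rule C0(2)[OF U(1,2,3) fink _ _ Xr _ t]) (auto simp only: Yr intro!: U(5), auto)
      then show ?thesis unfolding e using Xu[of t] t by (simp add: enorm_cnorm)
    qed
    show "\<exists>u. u \<in> solution_class k \<sigma> \<and> mild_solution u0 u \<and>
         (\<forall>v. v \<in> solution_class k \<sigma> \<and> mild_solution u0 v \<longrightarrow> (\<forall>t\<ge>0. dist_eq (v t) (u t))) \<and>
         (\<forall>t>0. X_norm (k - 1) (u t) \<le> ennreal (C0 * (2 * enn2real (Y_norm \<sigma> u0) + enn2real (X_norm (k - 1) u0)) * (1 + t) powr (-1 + \<sigma> / 2 - k / 2)))"
      using sol mild uniq dec by (intro exI[of _ u]) blast
  qed
qed

end
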